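(* Let $(M^n,g)$ be a closed, orientable $n$-dimensional Riemannian manifold equipped with a smooth vector field $X$ such that $(M,g,X)$ has positive weighted sectional curvature. If $F$ is an isometry of $M$ with no fixed point, then $F$ reverses orientation if $n$ is even and preserves it if $n$ is odd.
   Context: Manifolds are connected; closed means compact without boundary. Let $(M,g)$ be a Riemannian manifold and $X$ a smooth vector field on $M$. For an orthonormal pair $(U,V)$ in $T_pM$, let $\sec(U,V)$ be the sectional curvature of the plane spanned by $U,V$, and set $$\sec_X^V(U)=\sec(U,V)+\tfrac12 (L_Xg)(V,V).$$ If $X=\nabla f$ for a smooth function $f$, set $$\overline{\sec}_f^V(U)=\sec(U,V)+\mathrm{Hess}\, f(V,V)+df(V)^2.$$ Write $\sec_X>0$ (resp. $\overline{\sec}_f>0$) if $\sec_X^V(U)>0$ (resp. $\overline{\sec}_f^V(U)>0$) for every point $p$ and every orthonormal pair $(U,V)$ in $T_pM$. The triple $(M,g,X)$ has positive weighted sectional curvature if either $\sec_X>0$, or $X=\nabla f$ and $\overline{\sec}_f>0$ for some smooth function $f$. *)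

theory Defs
  imports "HOL-Analysis.Analysis"
begin

section \<open>Smooth maps between Euclidean spaces\<close>

text \<open>
  Intended for open sets \<open>S\<close> and finite-dimensional spaces, where this is the usual notion of
  a \<open>C\<^sup>k\<close> map, since the map of derivatives is \<open>C\<^bsup>k-1\<^esup>\<close> as soon as all directional
  derivatives are.
\<close>

primrec Ck_on :: "nat \<Rightarrow> 'b::real_normed_vector set \<Rightarrow> ('b \<Rightarrow> 'c::real_normed_vector) \<Rightarrow> bool"
  where
    "Ck_on 0 S f \<longleftrightarrow> continuous_on S f"
  | "Ck_on (Suc k) S f \<longleftrightarrow>
       (\<forall>x\<in>S. f differentiable (at x)) \<and>
       (\<forall>v. Ck_on k S (\<lambda>x. frechet_derivative f (at x) v))"

definition smooth_on :: "'b::real_normed_vector set \<Rightarrow> ('b \<Rightarrow> 'c::real_normed_vector) \<Rightarrow> bool"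
  where "smooth_on S f \<longleftrightarrow> (\<forall>k. Ck_on k S f)"

definition pd :: "'n::finite \<Rightarrow> (real^'n \<Rightarrow> real) \<Rightarrow> real^'n \<Rightarrow> real"
  where "pd i f x = frechet_derivative f (at x) (axis i 1)"


section \<open>Smooth manifolds\<close>

text \<open>
  A chart is a pair of a domain and a coordinate map; the values of the coordinate map outside
  the domain are irrelevant.
\<close>

type_synonym ('a, 'n) chart = "'a set \<times> ('a \<Rightarrow> real^'n)"

abbreviation dom_c :: "('a, 'n) chart \<Rightarrow> 'a set"
  where "dom_c c \<equiv> fst c"

abbreviation map_c :: "('a, 'n) chart \<Rightarrow> 'a \<Rightarrow> real^'n"
  where "map_c c \<equiv> snd c"

definition inv_c :: "('a, 'n) chart \<Rightarrow> real^'n \<Rightarrow> 'a"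
  where "inv_c c = inv_into (dom_c c) (map_c c)"

definition is_chart :: "'a topology \<Rightarrow> ('a, 'n::finite) chart \<Rightarrow> bool"
  where "is_chart T c \<longleftrightarrow>
    openin T (dom_c c) \<and> open (map_c c ` dom_c c) \<and>
    homeomorphic_map (subtopology T (dom_c c)) (top_of_set (map_c c ` dom_c c)) (map_c c)"

text \<open>
  The atlas need not be maximal; it represents the smooth structure it generates.
\<close>

definition smooth_atlas :: "'a topology \<Rightarrow> ('a, 'n::finite) chart set \<Rightarrow> bool"
  where "smooth_atlas T A \<longleftrightarrow>
    (\<forall>c\<in>A. is_chart T c) \<and>
    (\<Union>c\<in>A. dom_c c) = topspace T \<and>
    (\<forall>c\<in>A. \<forall>d\<in>A. smooth_on (map_c c ` (dom_c c \<inter> dom_c d)) (map_c d \<circ> inv_c c))"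

text \<open>
  Manifolds are connected (and nonempty), and the dimension is \<open>CARD('n)\<close>.
\<close>

definition smooth_manifold :: "'a topology \<Rightarrow> ('a, 'n::finite) chart set \<Rightarrow> bool"
  where "smooth_manifold T A \<longleftrightarrow>
    topspace T \<noteq> {} \<and> connected_space T \<and> Hausdorff_space T \<and>
    (\<exists>\<B>. countable \<B> \<and> openin T = arbitrary union_of (\<lambda>W. W \<in> \<B>)) \<and>
    smooth_atlas T A"

text \<open>Charts have open images in \<open>real^'n\<close>, so there is no boundary.\<close>

definition closed_manifold :: "'a topology \<Rightarrow> ('a, 'n::finite) chart set \<Rightarrow> bool"
  where "closed_manifold T A \<longleftrightarrow> smooth_manifold T A \<and> compact_space T"

definition smooth_fun :: "('a, 'n::finite) chart set \<Rightarrow> ('a \<Rightarrow> real) \<Rightarrow> bool"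
  where "smooth_fun A f \<longleftrightarrow> (\<forall>c\<in>A. smooth_on (map_c c ` dom_c c) (f \<circ> inv_c c))"

definition smooth_map :: "'a topology \<Rightarrow> ('a, 'n::finite) chart set \<Rightarrow> ('a \<Rightarrow> 'a) \<Rightarrow> bool"
  where "smooth_map T A F \<longleftrightarrow>
    continuous_map T T F \<and>
    (\<forall>c\<in>A. \<forall>d\<in>A.
       smooth_on (map_c c ` {p \<in> dom_c c. F p \<in> dom_c d}) (map_c d \<circ> F \<circ> inv_c c))"

definition diffeomorphism :: "'a topology \<Rightarrow> ('a, 'n::finite) chart set \<Rightarrow> ('a \<Rightarrow> 'a) \<Rightarrow> bool"
  where "diffeomorphism T A F \<longleftrightarrow>
    bij_betw F (topspace T) (topspace T) \<and>
    smooth_map T A F \<and> smooth_map T A (inv_into (topspace T) F)"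


section \<open>Tangent vectors and vector fields\<close>

text \<open>
  A tangent vector at \<open>p\<close> is the family of its component vectors in all charts around \<open>p\<close>,
  which transform by the differentials of the coordinate changes. Families are set to \<open>0\<close> at
  all other indices, so that equal tangent vectors are equal functions.
\<close>

type_synonym ('a, 'n) tvec = "('a, 'n) chart \<Rightarrow> real^'n"

definition tangent_space :: "('a, 'n::finite) chart set \<Rightarrow> 'a \<Rightarrow> ('a, 'n) tvec set"
  where "tangent_space A p = {v.
    (\<forall>c\<in>A. \<forall>d\<in>A. p \<in> dom_c c \<inter> dom_c d \<longrightarrow>
       v d = frechet_derivative (map_c d \<circ> inv_c c) (at (map_c c p)) (v c)) \<and>
    (\<forall>c. \<not> (c \<in> A \<and> p \<in> dom_c c) \<longrightarrow> v c = 0)}"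

text \<open>The tangent vector at \<open>p\<close> whose component vector in the chart \<open>c\<close> around \<open>p\<close> is \<open>u\<close>.\<close>

definition vec_at ::
    "('a, 'n::finite) chart set \<Rightarrow> ('a, 'n) chart \<Rightarrow> 'a \<Rightarrow> real^'n \<Rightarrow> ('a, 'n) tvec"
  where "vec_at A c p u = (\<lambda>d.
    if d \<in> A \<and> p \<in> dom_c d
    then frechet_derivative (map_c d \<circ> inv_c c) (at (map_c c p)) u else 0)"

definition vf_coord :: "('a \<Rightarrow> ('a, 'n) tvec) \<Rightarrow> ('a, 'n) chart \<Rightarrow> real^'n \<Rightarrow> real^'n"
  where "vf_coord X c x = X (inv_c c x) c"

definition smooth_vector_field ::
    "'a topology \<Rightarrow> ('a, 'n::finite) chart set \<Rightarrow> ('a \<Rightarrow> ('a, 'n) tvec) \<Rightarrow> bool"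
  where "smooth_vector_field T A X \<longleftrightarrow>
    (\<forall>p\<in>topspace T. X p \<in> tangent_space A p) \<and>
    (\<forall>c\<in>A. smooth_on (map_c c ` dom_c c) (vf_coord X c))"

definition dfun :: "('a, 'n::finite) chart \<Rightarrow> ('a \<Rightarrow> real) \<Rightarrow> 'a \<Rightarrow> ('a, 'n) tvec \<Rightarrow> real"
  where "dfun c f p v = frechet_derivative (f \<circ> inv_c c) (at (map_c c p)) (v c)"

definition dmap ::
    "('a, 'n::finite) chart set \<Rightarrow> ('a \<Rightarrow> 'a) \<Rightarrow> 'a \<Rightarrow> ('a, 'n) tvec \<Rightarrow> ('a, 'n) tvec \<Rightarrow> bool"
  where "dmap A F p v w \<longleftrightarrow>
    w \<in> tangent_space A (F p) \<and>
    (\<forall>c\<in>A. \<forall>d\<in>A. p \<in> dom_c c \<and> F p \<in> dom_c d \<longrightarrow>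
       w d = frechet_derivative (map_c d \<circ> F \<circ> inv_c c) (at (map_c c p)) (v c))"


section \<open>Riemannian metrics and isometries\<close>

type_synonym ('a, 'n) metric = "'a \<Rightarrow> ('a, 'n) tvec \<Rightarrow> ('a, 'n) tvec \<Rightarrow> real"

definition metric_coord ::
    "('a, 'n::finite) chart set \<Rightarrow> ('a, 'n) metric \<Rightarrow> ('a, 'n) chart \<Rightarrow> real^'n \<Rightarrow> real^'n^'n"
  where "metric_coord A g c x = (\<chi> i j.
    g (inv_c c x) (vec_at A c (inv_c c x) (axis i 1)) (vec_at A c (inv_c c x) (axis j 1)))"

definition riemannian_metric ::
    "'a topology \<Rightarrow> ('a, 'n::finite) chart set \<Rightarrow> ('a, 'n) metric \<Rightarrow> bool"
  where "riemannian_metric T A g \<longleftrightarrow>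
    (\<forall>p\<in>topspace T. \<forall>u\<in>tangent_space A p. \<forall>v\<in>tangent_space A p.
       g p u v = g p v u \<and>
       (\<forall>w\<in>tangent_space A p. g p (\<lambda>c. u c + v c) w = g p u w + g p v w) \<and>
       (\<forall>r. g p (\<lambda>c. r *\<^sub>R u c) v = r * g p u v) \<and>
       (u \<noteq> (\<lambda>c. 0) \<longrightarrow> g p u u > 0)) \<and>
    (\<forall>c\<in>A. smooth_on (map_c c ` dom_c c) (metric_coord A g c))"

definition orthonormal_pair ::
    "('a, 'n::finite) chart set \<Rightarrow> ('a, 'n) metric \<Rightarrow> 'a \<Rightarrow> ('a, 'n) tvec \<Rightarrow> ('a, 'n) tvec \<Rightarrow> bool"
  where "orthonormal_pair A g p U V \<longleftrightarrow>
    U \<in> tangent_space A p \<and> V \<in> tangent_space A p \<and>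
    g p U U = 1 \<and> g p V V = 1 \<and> g p U V = 0"

definition riem_isometry ::
    "'a topology \<Rightarrow> ('a, 'n::finite) chart set \<Rightarrow> ('a, 'n) metric \<Rightarrow> ('a \<Rightarrow> 'a) \<Rightarrow> bool"
  where "riem_isometry T A g F \<longleftrightarrow>
    diffeomorphism T A F \<and>
    (\<forall>p\<in>topspace T. \<forall>u\<in>tangent_space A p. \<forall>v\<in>tangent_space A p. \<forall>u' v'.
       dmap A F p u u' \<and> dmap A F p v v' \<longrightarrow> g (F p) u' v' = g p u v)"

text \<open>\<open>X\<close> is the gradient of \<open>f\<close>: \<open>g(X, v) = df(v)\<close> for all tangent vectors \<open>v\<close>.\<close>

definition is_gradient ::
    "'a topology \<Rightarrow> ('a, 'n::finite) chart set \<Rightarrow> ('a, 'n) metric \<Rightarrow> ('a \<Rightarrow> ('a, 'n) tvec)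
      \<Rightarrow> ('a \<Rightarrow> real) \<Rightarrow> bool"
  where "is_gradient T A g X f \<longleftrightarrow>
    (\<forall>p\<in>topspace T. \<forall>c\<in>A. p \<in> dom_c c \<longrightarrow>
       (\<forall>v\<in>tangent_space A p. g p (X p) v = dfun c f p v))"


section \<open>Orientation\<close>

text \<open>
  The charts of an oriented atlas belong to the given smooth structure but not necessarily
  to the atlas \<open>A\<close>.
\<close>

definition oriented_atlas ::
    "'a topology \<Rightarrow> ('a, 'n::finite) chart set \<Rightarrow> ('a, 'n) chart set \<Rightarrow> bool"
  where "oriented_atlas T A B \<longleftrightarrow>
    smooth_atlas T B \<and> smooth_atlas T (A \<union> B) \<and>
    (\<forall>c\<in>B. \<forall>d\<in>B. \<forall>p\<in>dom_c c \<inter> dom_c d.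
       det (jacobian (map_c d \<circ> inv_c c) (at (map_c c p))) > 0)"

definition orientable :: "'a topology \<Rightarrow> ('a, 'n::finite) chart set \<Rightarrow> bool"
  where "orientable T A \<longleftrightarrow> (\<exists>B. oriented_atlas T A B)"

text \<open>
  On a connected orientable manifold the following two notions do not depend on the
  orientation \<open>B\<close> (used on both sides); they are only meant for orientable manifolds.
\<close>

definition preserves_orientation ::
    "'a topology \<Rightarrow> ('a, 'n::finite) chart set \<Rightarrow> ('a \<Rightarrow> 'a) \<Rightarrow> bool"
  where "preserves_orientation T A F \<longleftrightarrow>
    (\<forall>B. oriented_atlas T A B \<longrightarrow>
       (\<forall>c\<in>B. \<forall>d\<in>B. \<forall>p\<in>dom_c c. F p \<in> dom_c d \<longrightarrow>
          det (jacobian (map_c d \<circ> F \<circ> inv_c c) (at (map_c c p))) > 0))"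

definition reverses_orientation ::
    "'a topology \<Rightarrow> ('a, 'n::finite) chart set \<Rightarrow> ('a \<Rightarrow> 'a) \<Rightarrow> bool"
  where "reverses_orientation T A F \<longleftrightarrow>
    (\<forall>B. oriented_atlas T A B \<longrightarrow>
       (\<forall>c\<in>B. \<forall>d\<in>B. \<forall>p\<in>dom_c c. F p \<in> dom_c d \<longrightarrow>
          det (jacobian (map_c d \<circ> F \<circ> inv_c c) (at (map_c c p))) < 0))"


section \<open>Curvature, Hessian and Lie derivative\<close>

text \<open>
  Here \<open>G\<close> is the matrix field of the metric in some coordinates. \<open>christoffel G k i j\<close> has upper
  index \<open>k\<close>, and \<open>riem G l i j k\<close> is the \<open>l\<close>-th component of \<open>R(\<partial>\<^sub>i, \<partial>\<^sub>j) \<partial>\<^sub>k\<close>, where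
  \<open>R(X, Y) Z = \<nabla>\<^sub>X \<nabla>\<^sub>Y Z - \<nabla>\<^sub>Y \<nabla>\<^sub>X Z - \<nabla>\<^bsub>[X, Y]\<^esub> Z\<close> for the Levi-Civita connection.
\<close>

definition christoffel ::
    "(real^'n \<Rightarrow> real^'n^'n) \<Rightarrow> 'n::finite \<Rightarrow> 'n \<Rightarrow> 'n \<Rightarrow> real^'n \<Rightarrow> real"
  where "christoffel G k i j x =
    (1/2) * (\<Sum>l\<in>UNIV. matrix_inv (G x) $ k $ l *
      (pd i (\<lambda>y. G y $ j $ l) x + pd j (\<lambda>y. G y $ i $ l) x - pd l (\<lambda>y. G y $ i $ j) x))"

definition riem ::
    "(real^'n \<Rightarrow> real^'n^'n) \<Rightarrow> 'n::finite \<Rightarrow> 'n \<Rightarrow> 'n \<Rightarrow> 'n \<Rightarrow> real^'n \<Rightarrow> real"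
  where "riem G l i j k x =
    pd i (christoffel G l j k) x - pd j (christoffel G l i k) x +
    (\<Sum>m\<in>UNIV. christoffel G l i m x * christoffel G m j k x
              - christoffel G l j m x * christoffel G m i k x)"

text \<open>
  The following quantities at \<open>p\<close> are computed in a chart \<open>c\<close> around \<open>p\<close>, on whose choice they
  do not depend.

  Sectional curvature \<open>g(R(U, V) V, U) / (g(U, U) g(V, V) - g(U, V)\<^sup>2)\<close> of the plane spanned by
  \<open>U\<close>, \<open>V\<close>; it is positive for round spheres.
\<close>

definition sec ::
    "('a, 'n::finite) chart set \<Rightarrow> ('a, 'n) metric \<Rightarrow> ('a, 'n) chart \<Rightarrow> 'a
      \<Rightarrow> ('a, 'n) tvec \<Rightarrow> ('a, 'n) tvec \<Rightarrow> real"
  where "sec A g c p U V =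
    (let G = metric_coord A g c; x = map_c c p in
      (\<Sum>i\<in>UNIV. \<Sum>j\<in>UNIV. \<Sum>k\<in>UNIV. \<Sum>l\<in>UNIV. \<Sum>m\<in>UNIV.
         G x $ l $ m * riem G l i j k x * U c $ i * V c $ j * V c $ k * U c $ m)
      / (g p U U * g p V V - (g p U V)\<^sup>2))"

text \<open>\<open>(L\<^sub>X g)\<^sub>i\<^sub>j = X\<^sup>k \<partial>\<^sub>k g\<^sub>i\<^sub>j + g\<^sub>k\<^sub>j \<partial>\<^sub>i X\<^sup>k + g\<^sub>i\<^sub>k \<partial>\<^sub>j X\<^sup>k\<close>\<close>

definition lie_metric ::
    "('a, 'n::finite) chart set \<Rightarrow> ('a, 'n) metric \<Rightarrow> ('a \<Rightarrow> ('a, 'n) tvec) \<Rightarrow> ('a, 'n) chart \<Rightarrow> 'a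
      \<Rightarrow> ('a, 'n) tvec \<Rightarrow> ('a, 'n) tvec \<Rightarrow> real"
  where "lie_metric A g X c p U V =
    (let G = metric_coord A g c; Y = vf_coord X c; x = map_c c p in
      \<Sum>i\<in>UNIV. \<Sum>j\<in>UNIV. (\<Sum>k\<in>UNIV.
         Y x $ k * pd k (\<lambda>y. G y $ i $ j) x
         + G x $ k $ j * pd i (\<lambda>y. Y y $ k) x
         + G x $ i $ k * pd j (\<lambda>y. Y y $ k) x) * U c $ i * V c $ j)"

text \<open>\<open>(Hess f)\<^sub>i\<^sub>j = \<partial>\<^sub>i \<partial>\<^sub>j f - \<Gamma>\<^sup>k\<^sub>i\<^sub>j \<partial>\<^sub>k f\<close>\<close>

definition hess ::
    "('a, 'n::finite) chart set \<Rightarrow> ('a, 'n) metric \<Rightarrow> ('a \<Rightarrow> real) \<Rightarrow> ('a, 'n) chart \<Rightarrow> 'a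
      \<Rightarrow> ('a, 'n) tvec \<Rightarrow> ('a, 'n) tvec \<Rightarrow> real"
  where "hess A g f c p U V =
    (let G = metric_coord A g c; h = f \<circ> inv_c c; x = map_c c p in
      \<Sum>i\<in>UNIV. \<Sum>j\<in>UNIV.
        (pd i (pd j h) x - (\<Sum>k\<in>UNIV. christoffel G k i j x * pd k h x)) * U c $ i * V c $ j)"


section \<open>Positive weighted sectional curvature\<close>

definition sec_X ::
    "('a, 'n::finite) chart set \<Rightarrow> ('a, 'n) metric \<Rightarrow> ('a \<Rightarrow> ('a, 'n) tvec) \<Rightarrow> ('a, 'n) chart \<Rightarrow> 'a
      \<Rightarrow> ('a, 'n) tvec \<Rightarrow> ('a, 'n) tvec \<Rightarrow> real"
  where "sec_X A g X c p V U = sec A g c p U V + (1/2) * lie_metric A g X c p V V"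

definition sec_bar ::
    "('a, 'n::finite) chart set \<Rightarrow> ('a, 'n) metric \<Rightarrow> ('a \<Rightarrow> real) \<Rightarrow> ('a, 'n) chart \<Rightarrow> 'a
      \<Rightarrow> ('a, 'n) tvec \<Rightarrow> ('a, 'n) tvec \<Rightarrow> real"
  where "sec_bar A g f c p V U = sec A g c p U V + hess A g f c p V V + (dfun c f p V)\<^sup>2"

definition sec_X_positive ::
    "'a topology \<Rightarrow> ('a, 'n::finite) chart set \<Rightarrow> ('a, 'n) metric \<Rightarrow> ('a \<Rightarrow> ('a, 'n) tvec) \<Rightarrow> bool"
  where "sec_X_positive T A g X \<longleftrightarrow>
    (\<forall>p\<in>topspace T. \<forall>c\<in>A. p \<in> dom_c c \<longrightarrow>
       (\<forall>U V. orthonormal_pair A g p U V \<longrightarrow> sec_X A g X c p V U > 0))"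

definition sec_bar_positive ::
    "'a topology \<Rightarrow> ('a, 'n::finite) chart set \<Rightarrow> ('a, 'n) metric \<Rightarrow> ('a \<Rightarrow> real) \<Rightarrow> bool"
  where "sec_bar_positive T A g f \<longleftrightarrow>
    (\<forall>p\<in>topspace T. \<forall>c\<in>A. p \<in> dom_c c \<longrightarrow>
       (\<forall>U V. orthonormal_pair A g p U V \<longrightarrow> sec_bar A g f c p V U > 0))"

definition positive_weighted_sec ::
    "'a topology \<Rightarrow> ('a, 'n::finite) chart set \<Rightarrow> ('a, 'n) metric \<Rightarrow> ('a \<Rightarrow> ('a, 'n) tvec) \<Rightarrow> bool"
  where "positive_weighted_sec T A g X \<longleftrightarrow>
    sec_X_positive T A g X \<or>
    (\<exists>f. smooth_fun A f \<and> is_gradient T A g X f \<and> sec_bar_positive T A g f)"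

end

theory Submission
  imports Defs
begin

text \<open>
  Suppose the differential of \<open>F\<close> has the wrong determinant sign. By compactness and connectedness,
  the total energy of chains of short minimal geodesic segments from a point \<open>p\<close> to \<open>F p\<close> has a
  minimum; since \<open>F\<close> has no fixed point, a minimal chain is a nonconstant geodesic \<open>\<gamma>\<close> that \<open>F\<close>
  continues smoothly. Parallel transport along \<open>\<gamma>\<close>, closed up by \<open>F\<close>, is an isometry of a tangent
  space fixing the velocity, and its determinant forces a second fixed direction: there is a unit
  parallel field \<open>P\<close> normal to \<open>\<gamma>\<close> and compatible with \<open>F\<close>. With \<open>K\<close> the curvature term of \<open>P\<close> and \<open>\<gamma>'\<close>,
  the second variation along \<open>\<phi> P\<close> gives \<open>0 \<le> \<integral> \<phi>'\<^sup>2 - \<phi>\<^sup>2 K\<close> whenever \<open>\<phi>\<close> closes up.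

  The images \<open>F\<^sup>k \<gamma>\<close> form a complete geodesic with the same \<open>K\<close> on each piece, although neither \<open>X\<close>
  nor \<open>f\<close> is invariant under \<open>F\<close>. If \<open>sec\<^sub>X > 0\<close>, then \<open>h = g(X, \<gamma>')\<close> is bounded on it while
  \<open>h' \<ge> \<delta> - K\<close>, contradicting \<open>\<integral> K \<le> 0\<close> (take \<open>\<phi> = 1\<close>). In the gradient case \<open>u = exp f\<close> satisfies
  \<open>u'' \<ge> (\<delta> - K) u\<close> with \<open>u\<close>, \<open>1/u\<close> and \<open>u'\<close> bounded; the mean of \<open>u\<close> over many periods satisfies
  the same inequality and almost closes up, so after a small correction it is a \<open>\<phi>\<close> with negative
  second variation.
\<close>

section \<open>Calculus of smooth maps\<close>

text \<open>Existence of a minimum wants closed balls, while varying it wants an interior point;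
  this tension shapes the middle of the proof. A path cut into N pieces, each run through in unit
  time, has total energy of order 1/N, so chains of arbitrarily small energy exist. With the number
  of pieces fixed from such a chain, a minimum consists of very short segments, and each can be
  transferred to a ball in which it lies well inside. Only junction points vary, so compactness of a
  finite product suffices.

  The second fixed direction comes from a single determinant identity for a matrix built from the
  holonomy.

  Since f and X may change under F, a test function made from them does not close up after one
  period. Averaging repairs this, but f'' + (f')^2 >= \<delta> - K is not linear in f and need not
  survive a mean; for exp f the inequality is linear. The mean over n periods keeps its bounds while
  its closing defect is O(1/n), so \<delta> and all bounds must hold for every iterate at once.
  Compactness gives them because isometries keep the speed.\<close>

lemma Ck_on_cong:
  assumes "open S" "\<And>x. x \<in> S \<Longrightarrow> f x = g x"
  shows "Ck_on k S f = Ck_on k S g"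
  using assms(2)
proof (induction k arbitrary: f g)
  case 0
  then show ?case by (simp cong: continuous_on_cong)
next
  case (Suc k)
  have diff: "f differentiable (at x) \<longleftrightarrow> g differentiable (at x)" if "x \<in> S" for x
    using that Suc.prems assms(1)
    by (metis differentiable_def has_derivative_transform_within_open)
  show ?case
  proof (cases "\<forall>x\<in>S. f differentiable (at x)")
    case True
    have "frechet_derivative f (at x) = frechet_derivative g (at x)" if "x \<in> S" for x
      using frechet_derivative_transform_within_open[OF _ assms(1) that, of f g] True Suc.prems that
      by auto
    then have "Ck_on k S (\<lambda>x. frechet_derivative f (at x) v) = Ck_on k S (\<lambda>x. frechet_derivative g (at x) v)" for v
      by (intro Suc.IH) simp
    then show ?thesis using diff by auto
  next
    case False
    then show ?thesis using diff by auto
  qed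
qed

text \<open>Any explicit derivative may stand in for the chosen \<open>frechet_derivative\<close>;
  the closure properties below rest on this.\<close>

lemma Ck_on_SucI:
  assumes "open S" "\<And>x. x \<in> S \<Longrightarrow> (f has_derivative f' x) (at x)" "\<And>v. Ck_on k S (\<lambda>x. f' x v)"
  shows "Ck_on (Suc k) S f"
proof -
  have "frechet_derivative f (at x) = f' x" if "x \<in> S" for x
    using frechet_derivative_at[OF assms(2)[OF that]] by simp
  then have "Ck_on k S (\<lambda>x. frechet_derivative f (at x) v) = Ck_on k S (\<lambda>x. f' x v)" for v
    by (intro Ck_on_cong assms) auto
  then show ?thesis using assms by (auto simp: differentiable_def)
qed

lemma Ck_on_SucD:
  assumes "Ck_on (Suc k) S f"
  shows "x \<in> S \<Longrightarrow> (f has_derivative frechet_derivative f (at x)) (at x)"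
    and "Ck_on k S (\<lambda>x. frechet_derivative f (at x) v)"
  using assms by (auto simp: frechet_derivative_works[symmetric])

lemma Ck_on_Suc_imp: "Ck_on (Suc k) S f \<Longrightarrow> Ck_on k S f"
proof (induction k arbitrary: f)
  case 0
  then show ?case
    by (auto intro!: continuous_at_imp_continuous_on differentiable_imp_continuous_within)
next
  case (Suc k)
  then show ?case by auto
qed

lemma Ck_on_const: "open S \<Longrightarrow> Ck_on k S (\<lambda>x. c)"
  by (induction k arbitrary: c) (auto intro!: Ck_on_SucI derivative_eq_intros simp del: Ck_on.simps(2))

lemma Ck_on_add:
  assumes "open S" "Ck_on k S f" "Ck_on k S g"
  shows "Ck_on k S (\<lambda>x. f x + g x)"
  using assms(2,3)
proof (induction k arbitrary: f g)
  case 0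
  then show ?case by (auto intro: continuous_intros)
next
  case (Suc k)
  show ?case
    by (rule Ck_on_SucI[OF assms(1)],
        rule has_derivative_add[OF Ck_on_SucD(1)[OF Suc.prems(1)] Ck_on_SucD(1)[OF Suc.prems(2)]])
       (auto intro!: Suc.IH Ck_on_SucD(2)[OF Suc.prems(1)] Ck_on_SucD(2)[OF Suc.prems(2)])
qed

lemma Ck_on_linear:
  assumes "bounded_linear L" "open S" "Ck_on k S f"
  shows "Ck_on k S (\<lambda>x. L (f x))"
  using assms(3)
proof (induction k arbitrary: f)
  case 0
  then show ?case by (auto intro: bounded_linear.continuous_on[OF assms(1)])
next
  case (Suc k)
  show ?case
    by (rule Ck_on_SucI[OF assms(2)], 
        rule bounded_linear.has_derivative[OF assms(1) Ck_on_SucD(1)[OF Suc.prems]])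
       (auto intro!: Suc.IH Ck_on_SucD(2)[OF Suc.prems])
qed

lemma Ck_on_bilinear:
  assumes "bounded_bilinear B" "open S" "Ck_on k S f" "Ck_on k S g"
  shows "Ck_on k S (\<lambda>x. B (f x) (g x))"
  using assms(3,4)
proof (induction k arbitrary: f g)
  case 0
  then show ?case by (auto intro: bounded_bilinear.continuous_on[OF assms(1)])
next
  case (Suc k)
  show ?case
  proof (rule Ck_on_SucI[OF assms(2)], 
        rule bounded_bilinear.FDERIV[OF assms(1) Ck_on_SucD(1)[OF Suc.prems(1)] Ck_on_SucD(1)[OF Suc.prems(2)]])
    fix v
    show "Ck_on k S (\<lambda>x. B (f x) (frechet_derivative g (at x) v) + B (frechet_derivative f (at x) v) (g x))"
      by (rule Ck_on_add[OF assms(2)]; rule Suc.IH)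
         (rule Ck_on_SucD(2)[OF Suc.prems(1)] Ck_on_SucD(2)[OF Suc.prems(2)]
           Ck_on_Suc_imp[OF Suc.prems(1)] Ck_on_Suc_imp[OF Suc.prems(2)])+
  qed
qed

text \<open>The derivative of 1/f contains 1/f again, but only its smoothness of order k is asked
  for, so induction on k closes.\<close>

lemma Ck_on_inverse:
  fixes f :: "'b::real_normed_vector \<Rightarrow> real"
  assumes "open S" "Ck_on k S f" "\<And>x. x \<in> S \<Longrightarrow> f x \<noteq> 0"
  shows "Ck_on k S (\<lambda>x. inverse (f x))"
  using assms(2)
proof (induction k)
  case 0
  then show ?case using assms by (auto intro: continuous_intros)
next
  case (Suc k)
  have 1: "((\<lambda>x. inverse (f x)) has_derivative (\<lambda>v. - (inverse (f x) * frechet_derivative f (at x) v * inverse (f x)))) (at x)"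
    if "x \<in> S" for x
    using Ck_on_SucD(1)[OF Suc.prems that] assms(3)[OF that]
    by (auto intro!: derivative_eq_intros)
  show ?case
  proof (rule Ck_on_SucI[OF assms(1) 1])
    fix v
    show "Ck_on k S (\<lambda>x. - (inverse (f x) * frechet_derivative f (at x) v * inverse (f x)))"
      by (intro Ck_on_linear[OF bounded_linear_minus[OF bounded_linear_ident] assms(1)] 
           Ck_on_bilinear[OF bounded_bilinear_mult assms(1)] Suc.IH Ck_on_SucD(2)[OF Suc.prems]
           Ck_on_Suc_imp[OF Suc.prems])
  qed simp
qed

lemma smooth_on_cong: "open S \<Longrightarrow> (\<And>x. x \<in> S \<Longrightarrow> f x = g x) \<Longrightarrow> smooth_on S f = smooth_on S g"
  using Ck_on_cong[of S f g] by (auto simp: smooth_on_def)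

lemma smooth_on_const: "open S \<Longrightarrow> smooth_on S (\<lambda>x. c)"
  unfolding smooth_on_def by (blast intro: Ck_on_const)

lemma smooth_on_add: "open S \<Longrightarrow> smooth_on S f \<Longrightarrow> smooth_on S g \<Longrightarrow> smooth_on S (\<lambda>x. f x + g x)"
  unfolding smooth_on_def by (rule allI, rule Ck_on_add) auto

lemma smooth_on_linear: "bounded_linear L \<Longrightarrow> open S \<Longrightarrow> smooth_on S f \<Longrightarrow> smooth_on S (\<lambda>x. L (f x))"
  unfolding smooth_on_def by (rule allI, rule Ck_on_linear) auto

lemma smooth_on_bilinear:
  "bounded_bilinear B \<Longrightarrow> open S \<Longrightarrow> smooth_on S f \<Longrightarrow> smooth_on S g \<Longrightarrow> smooth_on S (\<lambda>x. B (f x) (g x))"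
  unfolding smooth_on_def by (rule allI, rule Ck_on_bilinear) auto

lemmas smooth_on_mult = smooth_on_bilinear[OF bounded_bilinear_mult]

lemma smooth_on_minus: "open S \<Longrightarrow> smooth_on S f \<Longrightarrow> smooth_on S (\<lambda>x. - f x)"
  by (rule smooth_on_linear[OF bounded_linear_minus[OF bounded_linear_ident]])

lemma smooth_on_diff: "open S \<Longrightarrow> smooth_on S f \<Longrightarrow> smooth_on S g \<Longrightarrow> smooth_on S (\<lambda>x. f x - g x)"
  using smooth_on_add[OF _ _ smooth_on_minus, of S f g] by simp

lemma smooth_on_sum: 
  "open S \<Longrightarrow> (\<And>i. i \<in> I \<Longrightarrow> smooth_on S (f i)) \<Longrightarrow> smooth_on S (\<lambda>x. \<Sum>i\<in>I. f i x)"
  by (induction I rule: infinite_finite_induct) (auto intro: smooth_on_const smooth_on_add)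

lemma smooth_on_prod: 
  fixes f :: "'i \<Rightarrow> 'b::real_normed_vector \<Rightarrow> real"
  shows "open S \<Longrightarrow> (\<And>i. i \<in> I \<Longrightarrow> smooth_on S (f i)) \<Longrightarrow> smooth_on S (\<lambda>x. \<Prod>i\<in>I. f i x)"
  by (induction I rule: infinite_finite_induct) (auto intro: smooth_on_const smooth_on_mult)

lemma smooth_on_inverse:
  fixes f :: "'b::real_normed_vector \<Rightarrow> real"
  shows "open S \<Longrightarrow> smooth_on S f \<Longrightarrow> (\<And>x. x \<in> S \<Longrightarrow> f x \<noteq> 0) \<Longrightarrow> smooth_on S (\<lambda>x. inverse (f x))"
  unfolding smooth_on_def by (rule allI, rule Ck_on_inverse) auto

lemma smooth_on_continuous: "smooth_on S f \<Longrightarrow> continuous_on S f"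
  by (auto simp: smooth_on_def dest: spec[of _ 0])

lemma smooth_on_frechet: "smooth_on S f \<Longrightarrow> smooth_on S (\<lambda>x. frechet_derivative f (at x) v)"
  unfolding smooth_on_def by (rule allI, rule Ck_on_SucD(2)) (erule spec)

lemma smooth_on_has_frechet: 
  "smooth_on S f \<Longrightarrow> x \<in> S \<Longrightarrow> (f has_derivative frechet_derivative f (at x)) (at x)"
  using Ck_on_SucD(1)[of 0 S f x] by (auto simp: smooth_on_def simp del: Ck_on.simps)

lemma smooth_on_det:
  fixes M :: "'b::real_normed_vector \<Rightarrow> real^'n^'n"
  assumes "open S" "\<And>i j. smooth_on S (\<lambda>x. M x $ i $ j)"
  shows "smooth_on S (\<lambda>x. det (M x))"
  unfolding det_def
  by (auto intro!: smooth_on_sum smooth_on_mult smooth_on_const smooth_on_prod assms)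

lemma matrix_inv_works: "invertible (A::real^'n^'n) \<Longrightarrow> A ** matrix_inv A = mat 1 \<and> matrix_inv A ** A = mat 1"
  unfolding invertible_def matrix_inv_def by (rule someI_ex)

text \<open>Cramer's rule writes each entry of the inverse as a quotient of determinants, hence of
  polynomials in the entries; smoothness of the inverse matrix follows from that of
  \<open>det\<close>.\<close>

lemma matrix_inv_nth:
  fixes M :: "real^'n^'n"
  assumes "det M \<noteq> 0"
  shows "matrix_inv M $ k $ l = det (\<chi> i j. if j = k then axis l 1 $ i else M $ i $ j) * inverse (det M)"
proof -
  have "invertible M" using assms by (simp add: invertible_det_nz)
  then have "M ** matrix_inv M = mat 1" by (rule conjunct1[OF matrix_inv_works])
  then have "M *v (matrix_inv M *v axis l 1) = axis l 1"
    by (simp add: matrix_vector_mul_assoc)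
  then have "matrix_inv M *v axis l 1 = (\<chi> k. det (\<chi> i j. if j = k then axis l 1 $ i else M $ i $ j) / det M)"
    using cramer[OF assms] by blast
  moreover have "(matrix_inv M *v axis l 1) $ k = matrix_inv M $ k $ l"
    by (simp add: matrix_vector_mult_basis column_def)
  ultimately show ?thesis by (simp add: divide_inverse)
qed

lemma smooth_on_matrix_inv:
  fixes M :: "'b::real_normed_vector \<Rightarrow> real^'n^'n"
  assumes "open S" "\<And>i j. smooth_on S (\<lambda>x. M x $ i $ j)" "\<And>x. x \<in> S \<Longrightarrow> det (M x) \<noteq> 0"
  shows "smooth_on S (\<lambda>x. matrix_inv (M x) $ k $ l)"
proof -
  have "smooth_on S (\<lambda>x. det (\<chi> i j. if j = k then axis l 1 $ i else M x $ i $ j) * inverse (det (M x)))"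
  proof (intro smooth_on_mult smooth_on_det smooth_on_inverse assms)
    fix i j
    show "smooth_on S (\<lambda>x. (\<chi> i j. if j = k then axis l 1 $ i else M x $ i $ j) $ i $ j)"
      using assms(1,2) by (cases "j = k") (auto intro: smooth_on_const)
  qed auto
  then show ?thesis
    using matrix_inv_nth[OF assms(3)] smooth_on_cong[OF assms(1)] by (metis (no_types, lifting))
qed

section \<open>Vector- and operator-valued smooth maps, symmetry of second derivatives\<close>

lemma smooth_on_vecI:
  fixes f :: "'b::real_normed_vector \<Rightarrow> real^'n"
  assumes "open S" "\<And>i. smooth_on S (\<lambda>x. f x $ i)"
  shows "smooth_on S f"
proof -
  have "smooth_on S (\<lambda>x. \<Sum>i\<in>UNIV. f x $ i *\<^sub>R (axis i 1 :: real^'n))"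
    by (intro smooth_on_sum assms smooth_on_linear[OF bounded_linear_scaleR_left])
  moreover have "(\<lambda>x. \<Sum>i\<in>UNIV. f x $ i *\<^sub>R (axis i 1 :: real^'n)) = f"
    by (simp add: basis_expansion flip: scalar_mult_eq_scaleR)
  ultimately show ?thesis by (simp only:)
qed

lemma smooth_on_vec_nth: "open S \<Longrightarrow> smooth_on S f \<Longrightarrow> smooth_on S (\<lambda>x. f x $ i)"
  by (rule smooth_on_linear[OF bounded_linear_vec_nth])

text \<open>In finite dimension an operator is a finite sum of fixed bounded linear images of its
  values on a basis, so pointwise smoothness gives smoothness in the operator norm.\<close>

lemma smooth_on_blinfunI:
  fixes f :: "'b::real_normed_vector \<Rightarrow> ('d::euclidean_space \<Rightarrow>\<^sub>L 'c::real_normed_vector)"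
  assumes "open S" "\<And>v. smooth_on S (\<lambda>x. f x v)"
  shows "smooth_on S f"
proof -
  let ?L = "\<lambda>b::'d. \<lambda>c::'c. blinfun_scaleR_left c o\<^sub>L blinfun_inner_right b"
  have "smooth_on S (\<lambda>x. \<Sum>b\<in>Basis. ?L b (f x b))"
    by (rule smooth_on_sum[OF assms(1)], rule smooth_on_linear[OF _ assms],
        rule bounded_linear_compose[OF bounded_bilinear.bounded_linear_left[OF bounded_bilinear_blinfun_compose] bounded_linear_blinfun_scaleR_left])
  moreover have "(\<lambda>x. \<Sum>b\<in>Basis. ?L b (f x b)) = f"
  proof (rule ext, rule blinfun_euclidean_eqI)
    fix x and i :: 'd assume "i \<in> Basis"
    then have "(\<Sum>b\<in>Basis. (b \<bullet> i) *\<^sub>R f x b) = (\<Sum>b\<in>Basis. if b = i then f x b else 0)"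
      by (intro sum.cong) (auto simp: inner_Basis)
    then show "blinfun_apply (\<Sum>b\<in>Basis. ?L b (f x b)) i = f x i"
      using \<open>i \<in> Basis\<close> by (simp add: blinfun.sum_left)
  qed
  ultimately show ?thesis by simp
qed

text \<open>Bundling the derivative as a bounded operator lets it be differentiated again and be
  estimated in operator norm. The value is meaningful only where a derivative exists.\<close>

definition Dbl :: "('b::real_normed_vector \<Rightarrow> 'c::real_normed_vector) \<Rightarrow> 'b \<Rightarrow> ('b \<Rightarrow>\<^sub>L 'c)"
  where "Dbl f x = Blinfun (frechet_derivative f (at x))"

lemma Dbl_eq: "(f has_derivative f') (at x) \<Longrightarrow> blinfun_apply (Dbl f x) = f'"
  using frechet_derivative_at[of f f' x] by (simp add: Dbl_def bounded_linear_Blinfun_apply has_derivative_bounded_linear)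

lemma smooth_on_has_derivative: 
  "smooth_on S f \<Longrightarrow> x \<in> S \<Longrightarrow> (f has_derivative blinfun_apply (Dbl f x)) (at x)"
  using smooth_on_has_frechet[of S f x] Dbl_eq[of f _ x] by metis

lemma smooth_on_frechet_eq:
  "smooth_on S f \<Longrightarrow> x \<in> S \<Longrightarrow> frechet_derivative f (at x) = blinfun_apply (Dbl f x)"
  by (metis frechet_derivative_at smooth_on_has_derivative)

lemma smooth_on_Dbl:
  fixes f :: "'b::euclidean_space \<Rightarrow> 'c::real_normed_vector"
  assumes "open S" "smooth_on S f" shows "smooth_on S (Dbl f)"
proof (rule smooth_on_blinfunI[OF assms(1)])
  fix v
  show "smooth_on S (\<lambda>x. Dbl f x v)"
    using smooth_on_frechet[OF assms(2), of v] smooth_on_frechet_eq[OF assms(2)] 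
    by (simp add: smooth_on_cong[OF assms(1), where f="\<lambda>x. Dbl f x v" and g="\<lambda>x. frechet_derivative f (at x) v"])
qed

text \<open>The mixed second difference is the increment along \<open>h *\<^sub>R u\<close> of the
  function y -> f(y + hv) - f(y). After subtraction of the expected linear part, its derivative is a
  difference of two first-order remainders of \<open>f'\<close> at \<open>x\<close>, so the mean
  value inequality bounds it by a small multiple of \<open>h * h\<close>.\<close>

lemma second_difference_estimate:
  fixes f :: "'b::real_normed_vector \<Rightarrow> 'c::real_normed_vector" and f' :: "'b \<Rightarrow> 'b \<Rightarrow>\<^sub>L 'c"
  assumes "open S" "x \<in> S" and f': "\<And>y. y \<in> S \<Longrightarrow> (f has_derivative f' y) (at y)"
    and f'': "(f' has_derivative f'') (at x)" and "e > 0"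
  shows "\<exists>d>0. \<forall>h. 0 < h \<and> h < d \<longrightarrow>
    norm (f (x + h *\<^sub>R u + h *\<^sub>R v) - f (x + h *\<^sub>R u) - f (x + h *\<^sub>R v) + f x - (h * h) *\<^sub>R f'' v u) \<le> h * h * e"
proof -
  define K where "K = norm u + norm v + 1"
  have K: "K \<ge> 1" "norm u \<le> K" "norm v \<le> K" "norm u + norm v \<le> K" by (auto simp: K_def)
  \<comment> \<open>The mean value inequality below yields
    \<open>2 * (e' * (h * K)) * (h * K)\<close>, which is then exactly \<open>h * h * e\<close>. The
    summand 1 in \<open>K\<close> keeps the division legitimate when both vectors vanish.\<close>
  define e' where "e' = e / (2 * K * K)"
  have e': "e' > 0" using \<open>e > 0\<close> K by (simp add: e'_def)
  from f'' e' obtain d1 where d1: "d1 > 0" "\<And>y. norm (y - x) < d1 \<Longrightarrow> norm (f' y - f' x - f'' (y - x)) \<le> e' * norm (y - x)"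
    unfolding has_derivative_at_alt by blast
  interpret f'': bounded_linear f'' using f'' by (rule has_derivative_bounded_linear)
  from \<open>open S\<close> \<open>x \<in> S\<close> obtain d2 where d2: "d2 > 0" "ball x d2 \<subseteq> S" by (auto simp: open_contains_ball)
  define d where "d = min d1 d2 / K"
  have "d > 0" using d1 d2 K by (simp add: d_def)
  show ?thesis
  proof (intro exI conjI allI impI)
    show "d > 0" by fact
    fix h :: real assume h: "0 < h \<and> h < d"
    have hK: "h * K < d1" "h * K < d2" using h K by (auto simp: d_def field_simps)
    define k where "k y = f (y + h *\<^sub>R v) - f y" for y
    define S' where "S' = {y. \<exists>t\<in>{0..1}. y = x + t *\<^sub>R (h *\<^sub>R u)}"
    have near: "norm (t *\<^sub>R h *\<^sub>R u + s *\<^sub>R h *\<^sub>R v) \<le> h * K" if "t \<in> {0..1}" "s \<in> {0..1}" for t s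
    proof -
      have "norm (t *\<^sub>R h *\<^sub>R u + s *\<^sub>R h *\<^sub>R v) \<le> t * (h * norm u) + s * (h * norm v)"
        using that h by (intro norm_triangle_le) simp
      also have "\<dots> \<le> 1 * (h * norm u) + 1 * (h * norm v)"
        using that h by (intro add_mono mult_right_mono) auto
      also have "\<dots> = h * (norm u + norm v)" by (simp add: algebra_simps)
      also have "\<dots> \<le> h * K" using h K by (intro mult_left_mono) auto
      finally show ?thesis .
    qed
    have inS: "x + t *\<^sub>R h *\<^sub>R u + s *\<^sub>R h *\<^sub>R v \<in> S" if "t \<in> {0..1}" "s \<in> {0..1}" for t s
      using near[OF that] hK d2(2) by (auto simp: dist_norm subset_iff norm_minus_commute algebra_simps)
    have est: "norm (f' (x + t *\<^sub>R h *\<^sub>R u + s *\<^sub>R h *\<^sub>R v) - f' x - f'' (t *\<^sub>R h *\<^sub>R u + s *\<^sub>R h *\<^sub>R v)) \<le> e' * (h * K)"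
      if "t \<in> {0..1}" "s \<in> {0..1}" for t s
    proof -
      let ?w = "t *\<^sub>R h *\<^sub>R u + s *\<^sub>R h *\<^sub>R v"
      have "norm (f' (x + ?w) - f' x - f'' ?w) \<le> e' * norm ?w"
        using d1(2)[of "x + ?w"] near[OF that] hK by simp
      also have "\<dots> \<le> e' * (h * K)" using near[OF that] e' by (intro mult_left_mono) auto
      finally show ?thesis by (simp add: add.assoc)
    qed
    define k' where "k' y = f' (y + h *\<^sub>R v) - f' y" for y
    \<comment> \<open>Subtracting the linear map \<open>f'' (h *\<^sub>R v)\<close> leaves a
      function whose derivative is small on the whole segment \<open>S'\<close>, not merely at
      \<open>x\<close>.\<close>
    define F where "F = (\<lambda>y. f (y + h *\<^sub>R v) - f y - f'' (h *\<^sub>R v) y)"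
    define F' where "F' = (\<lambda>y w. (k' y - f'' (h *\<^sub>R v)) w)"
    have der: "(F has_derivative F' y) (at y within S')" if "y \<in> S'" for y
    proof -
      from that obtain t where t: "t \<in> {0..1}" "y = x + t *\<^sub>R h *\<^sub>R u" by (auto simp: S'_def)
      have a: "y \<in> S" "y + h *\<^sub>R v \<in> S" using inS[OF t(1), of 0] inS[OF t(1), of 1] t by auto
      have c: "((\<lambda>y. y + h *\<^sub>R v) has_derivative (\<lambda>w. w)) (at y within S')"
        by (auto intro!: derivative_eq_intros)
      have b: "((\<lambda>y. f (y + h *\<^sub>R v)) has_derivative f' (y + h *\<^sub>R v)) (at y within S')"
        using has_derivative_compose[OF c f'[OF a(2)]] .
      show ?thesis unfolding F_def F'_def k'_def
        by (rule has_derivative_eq_rhs, rule has_derivative_diff[OF has_derivative_diff[OF b has_derivative_at_withinI[OF f'[OF a(1)]]]]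
            , rule bounded_linear_imp_has_derivative, rule blinfun.bounded_linear_right)
           (auto simp: blinfun.bilinear_simps)
    qed
    have bd: "onorm (F' y - (\<lambda>w. 0)) \<le> 2 * (e' * (h * K))" if "y \<in> S'" for y
    proof -
      from that obtain t where t: "t \<in> {0..1}" "y = x + t *\<^sub>R h *\<^sub>R u" by (auto simp: S'_def)
      have "k' y - f'' (h *\<^sub>R v) = (f' (y + h *\<^sub>R v) - f' x - f'' (t *\<^sub>R h *\<^sub>R u + h *\<^sub>R v)) - (f' y - f' x - f'' (t *\<^sub>R h *\<^sub>R u))"
        by (simp add: k'_def f''.add algebra_simps)
      then have "norm (k' y - f'' (h *\<^sub>R v)) \<le> norm (f' (y + h *\<^sub>R v) - f' x - f'' (t *\<^sub>R h *\<^sub>R u + h *\<^sub>R v)) + norm (f' y - f' x - f'' (t *\<^sub>R h *\<^sub>R u))"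
        by (metis norm_triangle_ineq4)
      also have "\<dots> \<le> 2 * (e' * (h * K))"
        using est[OF t(1), of 0] est[OF t(1), of 1] t by (simp add: add.assoc)
      finally have "norm (k' y - f'' (h *\<^sub>R v)) \<le> 2 * (e' * (h * K))" .
      moreover have "F' y - (\<lambda>w. 0) = blinfun_apply (k' y - f'' (h *\<^sub>R v))" by (auto simp: F'_def)
      ultimately show ?thesis by (simp add: norm_blinfun.rep_eq)
    qed
    have conv: "convex S'"
    proof -
      have "S' = (\<lambda>t. x + t *\<^sub>R (h *\<^sub>R u)) ` {0..1}" by (auto simp: S'_def)
      also have "\<dots> = (+) x ` (\<lambda>t. t *\<^sub>R (h *\<^sub>R u)) ` {0..1}" by (auto simp: image_image)
      finally show ?thesis
        by (simp only: convex_translation convex_linear_image linear_scaleR_left convex_real_interval)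
    qed
    have "norm (F (x + h *\<^sub>R u) - F x) \<le> 2 * (e' * (h * K)) * norm ((x + h *\<^sub>R u) - x)"
    proof (rule differentiable_bound[OF conv der])
      show "onorm (F' y) \<le> 2 * (e' * (h * K))" if "y \<in> S'" for y
        using bd[OF that] by (simp add: fun_diff_def)
      show "x + h *\<^sub>R u \<in> S'" by (auto simp: S'_def intro!: bexI[of _ 1])
      show "x \<in> S'" by (auto simp: S'_def intro!: bexI[of _ 0])
    qed
    also have "\<dots> = 2 * (e' * (h * K)) * (h * norm u)" using h by simp
    also have "\<dots> \<le> 2 * (e' * (h * K)) * (h * K)"
      using h K e' by (intro mult_left_mono) auto
    also have "\<dots> = h * h * e" using K by (simp add: e'_def field_simps)
    finally show "norm (f (x + h *\<^sub>R u + h *\<^sub>R v) - f (x + h *\<^sub>R u) - f (x + h *\<^sub>R v) + f x - (h * h) *\<^sub>R f'' v u) \<le> h * h * e"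
      by (simp add: F_def blinfun.bilinear_simps f''.scaleR algebra_simps)
  qed
qed

text \<open>The second difference is unchanged when \<open>u\<close> and \<open>v\<close> are
  exchanged, yet approximates both \<open>f'' v u\<close> and \<open>f'' u v\<close>. Two errors of
  a third of their distance cannot add up to the whole distance.\<close>

lemma symmetric_second_derivative:
  fixes f :: "'b::real_normed_vector \<Rightarrow> 'c::real_normed_vector" and f' :: "'b \<Rightarrow> 'b \<Rightarrow>\<^sub>L 'c"
  assumes "open S" "x \<in> S" "\<And>y. y \<in> S \<Longrightarrow> (f has_derivative f' y) (at y)"
    and "(f' has_derivative f'') (at x)"
  shows "f'' u v = f'' v u"
proof (rule ccontr)
  assume "f'' u v \<noteq> f'' v u"
  then have e: "norm (f'' u v - f'' v u) / 3 > 0" (is "?e > 0") by simp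
  from second_difference_estimate[OF assms e, of u v] obtain d1 where d1: "d1 > 0"
    "\<And>h. 0 < h \<Longrightarrow> h < d1 \<Longrightarrow> norm (f (x + h *\<^sub>R u + h *\<^sub>R v) - f (x + h *\<^sub>R u) - f (x + h *\<^sub>R v) + f x - (h * h) *\<^sub>R f'' v u) \<le> h * h * ?e"
    by blast
  from second_difference_estimate[OF assms e, of v u] obtain d2 where d2: "d2 > 0"
    "\<And>h. 0 < h \<Longrightarrow> h < d2 \<Longrightarrow> norm (f (x + h *\<^sub>R v + h *\<^sub>R u) - f (x + h *\<^sub>R v) - f (x + h *\<^sub>R u) + f x - (h * h) *\<^sub>R f'' u v) \<le> h * h * ?e"
    by blast
  define h where "h = min d1 d2 / 2"
  have h: "0 < h" "h < d1" "h < d2" using d1(1) d2(1) by (auto simp: h_def)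
  define P where "P = f (x + h *\<^sub>R u + h *\<^sub>R v) - f (x + h *\<^sub>R u) - f (x + h *\<^sub>R v) + f x"
  have P: "norm (P - (h * h) *\<^sub>R f'' v u) \<le> h * h * ?e" "norm (P - (h * h) *\<^sub>R f'' u v) \<le> h * h * ?e"
    using d1(2)[OF h(1,2)] d2(2)[OF h(1,3)] by (simp_all add: P_def algebra_simps)
  have "(h * h) *\<^sub>R (f'' u v - f'' v u) = (P - (h * h) *\<^sub>R f'' v u) - (P - (h * h) *\<^sub>R f'' u v)"
    by (simp add: algebra_simps)
  then have "norm ((h * h) *\<^sub>R (f'' u v - f'' v u)) \<le> 2 * (h * h * ?e)"
    using P norm_triangle_ineq4[of "P - (h * h) *\<^sub>R f'' v u" "P - (h * h) *\<^sub>R f'' u v"]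
    unfolding \<open>(h * h) *\<^sub>R (f'' u v - f'' v u) = _\<close> by linarith
  then have "(h * h) * (3 * ?e) \<le> (h * h) * (2 * ?e)" using h by simp
  then show False using h e by (simp add: mult_le_cancel_left)
qed

lemma Dbl2_sym:
  fixes f :: "'b::euclidean_space \<Rightarrow> 'c::real_normed_vector"
  assumes "open S" "smooth_on S f" "x \<in> S"
  shows "Dbl (Dbl f) x u v = Dbl (Dbl f) x v u"
  using symmetric_second_derivative[OF assms(1,3) smooth_on_has_derivative[OF assms(2)]
      smooth_on_has_derivative[OF smooth_on_Dbl[OF assms(1,2)] assms(3)]] by auto

section \<open>Riemannian metrics in coordinates\<close>

text \<open>Tensors given by coordinate sums become bounded operators, so that they can be
  differentiated as wholes. Meaningful for bilinear \<open>B\<close>.\<close>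

definition bl2 :: "('a::euclidean_space \<Rightarrow> 'b::euclidean_space \<Rightarrow> 'c::real_normed_vector) \<Rightarrow> ('a \<Rightarrow>\<^sub>L 'b \<Rightarrow>\<^sub>L 'c)"
  where "bl2 B = Blinfun (\<lambda>u. Blinfun (B u))"

lemma bl2_apply:
  assumes "bilinear B"
  shows "bl2 B u v = B u v"
proof -
  have 1: "blinfun_apply (Blinfun (B u)) = B u" for u
    using assms by (intro bounded_linear_Blinfun_apply) (simp add: bilinear_def linear_conv_bounded_linear)
  have "linear (\<lambda>u. Blinfun (B u))"
    using assms by (intro linearI) (auto intro!: blinfun_eqI simp: 1 blinfun.bilinear_simps bilinear_ladd bilinear_lmul)
  then have "blinfun_apply (bl2 B) = (\<lambda>u. Blinfun (B u))"
    unfolding bl2_def by (intro bounded_linear_Blinfun_apply) (simp add: linear_conv_bounded_linear)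
  then show ?thesis by (simp add: 1)
qed

lemma blinfun_axis_expand:
  fixes f :: "(real^'n) \<Rightarrow>\<^sub>L 'c::real_normed_vector"
  shows "f u = (\<Sum>i\<in>UNIV. u $ i *\<^sub>R f (axis i 1))"
proof -
  have "f (\<Sum>i\<in>UNIV. u $ i *\<^sub>R (axis i 1 :: real^'n)) = (\<Sum>i\<in>UNIV. u $ i *\<^sub>R f (axis i 1))"
    by (simp add: blinfun.sum_right blinfun.scaleR_right)
  then show ?thesis by (simp add: basis_expansion flip: scalar_mult_eq_scaleR)
qed

lemma linear_eq_axis:
  assumes "linear f" "linear g" "\<And>i. f (axis i 1) = g (axis i (1::real))"
  shows "f (u::real^'n) = g u"
  using linear_eq_stdbasis[OF assms(1,2)] assms(3) by (auto simp: Basis_vec_def)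

definition gb :: "(real^'n \<Rightarrow> real^'n^'n) \<Rightarrow> real^'n::finite \<Rightarrow> ((real^'n) \<Rightarrow>\<^sub>L (real^'n) \<Rightarrow>\<^sub>L real)"
  where "gb G x = bl2 (\<lambda>u v. \<Sum>i\<in>UNIV. \<Sum>j\<in>UNIV. G x $ i $ j * u $ i * v $ j)"

definition chr :: "(real^'n \<Rightarrow> real^'n^'n) \<Rightarrow> real^'n::finite \<Rightarrow> ((real^'n) \<Rightarrow>\<^sub>L (real^'n) \<Rightarrow>\<^sub>L (real^'n))"
  where "chr G x = bl2 (\<lambda>u v. \<chi> k. \<Sum>i\<in>UNIV. \<Sum>j\<in>UNIV. christoffel G k i j x * u $ i * v $ j)"

lemma gb_apply: "gb G x u v = (\<Sum>i\<in>UNIV. \<Sum>j\<in>UNIV. G x $ i $ j * u $ i * v $ j)"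
  unfolding gb_def
  by (rule bl2_apply) (auto simp: bilinear_def algebra_simps sum.distrib sum_distrib_left intro!: linearI)

lemma chr_apply: "chr G x u v = (\<chi> k. \<Sum>i\<in>UNIV. \<Sum>j\<in>UNIV. christoffel G k i j x * u $ i * v $ j)"
  unfolding chr_def
  by (rule bl2_apply) (auto simp: bilinear_def algebra_simps sum.distrib sum_distrib_left vec_eq_iff intro!: linearI)

lemma gb_axis: "gb G x (axis i 1) (axis j 1) = G x $ i $ j"
  by (simp add: gb_apply axis_def if_distrib[of "\<lambda>r. _ * r"] if_distrib[of "\<lambda>r. r * _"] sum.delta cong: if_cong)

lemma chr_axis: "chr G x (axis i 1) (axis j 1) $ k = christoffel G k i j x"
  by (simp add: chr_apply axis_def if_distrib[of "\<lambda>r. _ * r"] if_distrib[of "\<lambda>r. r * _"] sum.delta cong: if_cong)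

lemma gb_matrix: "gb G x u v = u \<bullet> (G x *v v)"
  by (simp add: gb_apply inner_vec_def matrix_vector_mult_def sum_distrib_left mult_ac)

text \<open>The curvature operator R(u, v) w, computed on fields with constant coefficients: their
  brackets vanish and only the derivative and the products of the connection form remain.\<close>

definition Rm :: "(real^'n \<Rightarrow> real^'n^'n) \<Rightarrow> real^'n::finite \<Rightarrow> real^'n \<Rightarrow> real^'n \<Rightarrow> real^'n \<Rightarrow> real^'n"
  where "Rm G x u v w = Dbl (chr G) x u v w - Dbl (chr G) x v u w
     + chr G x u (chr G x v w) - chr G x v (chr G x u w)"

locale lmetric =
  fixes U :: "(real^'n::finite) set" and G :: "real^'n \<Rightarrow> real^'n^'n"
  assumes open_U: "open U" and smooth_G: "smooth_on U G"
    and sym: "x \<in> U \<Longrightarrow> gb G x u v = gb G x v u"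
    and pos: "x \<in> U \<Longrightarrow> u \<noteq> 0 \<Longrightarrow> 0 < gb G x u u"
begin

lemma smooth_G_nth: "smooth_on U (\<lambda>x. G x $ i $ j)"
  by (intro smooth_on_vec_nth open_U smooth_G)

lemma smooth_gb: "smooth_on U (gb G)"
  by (intro smooth_on_blinfunI open_U, simp add: gb_apply, intro smooth_on_sum smooth_on_mult smooth_on_const open_U smooth_G_nth)

lemma nondeg: "x \<in> U \<Longrightarrow> (\<And>w. gb G x a w = 0) \<Longrightarrow> a = 0"
  using pos[of x a] by force

lemma nondeg_eq: "x \<in> U \<Longrightarrow> (\<And>w. gb G x a w = gb G x b w) \<Longrightarrow> a = b"
  using nondeg[of x "a - b"] by (simp add: blinfun.bilinear_simps)

lemma det_G: "x \<in> U \<Longrightarrow> det (G x) \<noteq> 0"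
proof
  assume x: "x \<in> U" and "det (G x) = 0"
  then have "\<not> (\<forall>v. G x *v v = 0 \<longrightarrow> v = 0)"
    using matrix_left_invertible_ker[of "G x"] invertible_det_nz[of "G x"] invertible_left_inverse by metis
  then obtain v where v: "v \<noteq> 0" "G x *v v = 0" by blast
  then have "gb G x v v = 0" by (simp add: gb_matrix)
  then show False using pos[OF x v(1)] by simp
qed

lemma smooth_christoffel: "smooth_on U (christoffel G k i j)"
  unfolding christoffel_def pd_def
  by (intro smooth_on_mult smooth_on_const open_U smooth_on_sum smooth_on_add smooth_on_diff
      smooth_on_frechet smooth_G_nth smooth_on_matrix_inv det_G)

lemma smooth_chr: "smooth_on U (chr G)"
  by (intro smooth_on_blinfunI open_U smooth_on_vecI, simp add: chr_apply, 
      intro smooth_on_sum smooth_on_mult smooth_on_const open_U smooth_christoffel)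

lemma has_derivative_gb: "x \<in> U \<Longrightarrow> (gb G has_derivative Dbl (gb G) x) (at x)"
  by (rule smooth_on_has_derivative[OF smooth_gb])

lemma has_derivative_chr: "x \<in> U \<Longrightarrow> (chr G has_derivative Dbl (chr G) x) (at x)"
  by (rule smooth_on_has_derivative[OF smooth_chr])

lemma has_derivative_Dgb: "x \<in> U \<Longrightarrow> (Dbl (gb G) has_derivative Dbl (Dbl (gb G)) x) (at x)"
  by (rule smooth_on_has_derivative[OF smooth_on_Dbl[OF open_U smooth_gb]])

lemma has_derivative_gb_apply: "x \<in> U \<Longrightarrow> ((\<lambda>x. gb G x u v) has_derivative (\<lambda>w. Dbl (gb G) x w u v)) (at x)"
  using has_derivative_gb[of x] by (auto intro!: derivative_eq_intros)

lemma pd_G: "x \<in> U \<Longrightarrow> pd i (\<lambda>y. G y $ j $ l) x = Dbl (gb G) x (axis i 1) (axis j 1) (axis l 1)"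
  unfolding pd_def gb_axis[symmetric]
  using frechet_derivative_at[OF has_derivative_gb_apply, of x "axis j 1" "axis l 1"] by metis

lemma Dgb_sym: assumes "x \<in> U" shows "Dbl (gb G) x w u v = Dbl (gb G) x w v u"
proof -
  have "((\<lambda>x. gb G x v u) has_derivative (\<lambda>w. Dbl (gb G) x w u v)) (at x)"
    by (rule has_derivative_transform_within_open[OF has_derivative_gb_apply[OF assms] open_U assms])
       (simp add: sym)
  from has_derivative_unique[OF this has_derivative_gb_apply[OF assms]] show ?thesis by metis
qed

text \<open>Lowering the index with \<open>gb\<close> cancels the inverse matrix in the Christoffel
  symbols. This is checked on basis vectors and extended one argument at a time by linearity; from
  here on the index formula is hardly seen again.\<close>

lemma koszul:
  assumes x: "x \<in> U"
  shows "gb G x (chr G x u v) w = (Dbl (gb G) x u v w + Dbl (gb G) x v u w - Dbl (gb G) x w u v) / 2"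
proof -
  let ?D = "Dbl (gb G) x"
  have inv: "invertible (G x)" using det_G[OF x] by (simp add: invertible_det_nz)
  have ax: "gb G x (chr G x (axis i 1) (axis j 1)) (axis l 1) =
    (?D (axis i 1) (axis j 1) (axis l 1) + ?D (axis j 1) (axis i 1) (axis l 1) - ?D (axis l 1) (axis i 1) (axis j 1)) / 2"
    for i j l
  proof -
    define L :: "real^'n" where "L = (\<chi> m. (?D (axis i 1) (axis j 1) (axis m 1) + ?D (axis j 1) (axis i 1) (axis m 1) - ?D (axis m 1) (axis i 1) (axis j 1)) / 2)"
    have "chr G x (axis i 1) (axis j 1) = matrix_inv (G x) *v L"
      by (simp add: vec_eq_iff chr_axis christoffel_def pd_G[OF x] L_def matrix_vector_mult_def sum_distrib_left field_simps)
    then have "G x *v chr G x (axis i 1) (axis j 1) = L"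
      using matrix_inv_works[OF inv] by (simp add: matrix_vector_mul_assoc)
    then have "gb G x (axis l 1) (chr G x (axis i 1) (axis j 1)) = L $ l"
      by (simp add: gb_matrix inner_axis')
    then show ?thesis by (simp add: sym[OF x, of "axis l 1"] L_def)
  qed
  have 1: "gb G x (chr G x (axis i 1) (axis j 1)) w =
    (?D (axis i 1) (axis j 1) w + ?D (axis j 1) (axis i 1) w - ?D w (axis i 1) (axis j 1)) / 2" for i j w
    by (rule linear_eq_axis[of "\<lambda>w. gb G x (chr G x (axis i 1) (axis j 1)) w" "\<lambda>w. (?D (axis i 1) (axis j 1) w + ?D (axis j 1) (axis i 1) w - ?D w (axis i 1) (axis j 1)) / 2"])
       (auto intro!: linearI simp: blinfun.bilinear_simps ax field_simps)
  have 2: "gb G x (chr G x (axis i 1) v) w = (?D (axis i 1) v w + ?D v (axis i 1) w - ?D w (axis i 1) v) / 2" for i v w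
    by (rule linear_eq_axis[of "\<lambda>v. gb G x (chr G x (axis i 1) v) w" "\<lambda>v. (?D (axis i 1) v w + ?D v (axis i 1) w - ?D w (axis i 1) v) / 2"])
       (auto intro!: linearI simp: blinfun.bilinear_simps 1 field_simps)
  show ?thesis
    by (rule linear_eq_axis[of "\<lambda>u. gb G x (chr G x u v) w" "\<lambda>u. (?D u v w + ?D v u w - ?D w u v) / 2"])
       (auto intro!: linearI simp: blinfun.bilinear_simps 2 field_simps)
qed

lemma chr_sym: assumes "x \<in> U" shows "chr G x u v = chr G x v u"
  by (rule nondeg_eq[OF assms]) (simp add: koszul[OF assms] Dgb_sym[OF assms, of _ u v])

text \<open>The Levi-Civita connection makes the metric parallel: adding the Koszul formulas for (w,
  u, v) and (w, v, u) cancels all other derivatives.\<close>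

lemma metric_compat:
  assumes x: "x \<in> U"
  shows "Dbl (gb G) x w u v = gb G x (chr G x w u) v + gb G x u (chr G x w v)"
  using koszul[OF x, of w u v] koszul[OF x, of w v u] sym[OF x, of u "chr G x w v"]
    Dgb_sym[OF x, of w u v] Dgb_sym[OF x, of u w v] Dgb_sym[OF x, of v w u] by (simp add: field_simps)

lemma Dchr_sym: assumes "x \<in> U" shows "Dbl (chr G) x w u v = Dbl (chr G) x w v u"
proof -
  have d: "((\<lambda>x. chr G x u v) has_derivative (\<lambda>w. Dbl (chr G) x w u v)) (at x)" for u v
    using has_derivative_chr[OF assms] by (auto intro!: derivative_eq_intros)
  have "((\<lambda>x. chr G x v u) has_derivative (\<lambda>w. Dbl (chr G) x w u v)) (at x)"
    by (rule has_derivative_transform_within_open[OF d open_U assms]) (simp add: chr_sym)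
  from has_derivative_unique[OF this d] show ?thesis by metis
qed

text \<open>Obtained by differentiating \<open>metric_compat\<close>. It trades second derivatives
  of the metric for the connection, both in the symmetry of the curvature and in the second
  variation of the energy.\<close>

lemma D2gb:
  assumes x: "x \<in> U"
  shows "Dbl (Dbl (gb G)) x w v a b = gb G x (chr G x w (chr G x v a)) b + gb G x (chr G x v a) (chr G x w b)
     + gb G x (Dbl (chr G) x w v a) b
     + gb G x (chr G x w a) (chr G x v b) + gb G x a (chr G x w (chr G x v b)) + gb G x a (Dbl (chr G) x w v b)"
proof -
  have "((\<lambda>y. Dbl (gb G) y v a b) has_derivative (\<lambda>w. Dbl (Dbl (gb G)) x w v a b)) (at x)"
    using has_derivative_Dgb[OF x] by (auto intro!: derivative_eq_intros)
  then have 1: "((\<lambda>y. gb G y (chr G y v a) b + gb G y a (chr G y v b)) has_derivative (\<lambda>w. Dbl (Dbl (gb G)) x w v a b)) (at x)"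
    by (rule has_derivative_transform_within_open[OF _ open_U x]) (simp add: metric_compat)
  have 2: "((\<lambda>y. gb G y (chr G y v a) b + gb G y a (chr G y v b)) has_derivative
     (\<lambda>w. Dbl (gb G) x w (chr G x v a) b + gb G x (Dbl (chr G) x w v a) b
        + (Dbl (gb G) x w a (chr G x v b) + gb G x a (Dbl (chr G) x w v b)))) (at x)"
    using has_derivative_gb[OF x] has_derivative_chr[OF x]
    by (auto intro!: derivative_eq_intros simp: blinfun.bilinear_simps)
  show ?thesis
    using fun_cong[OF has_derivative_unique[OF 1 2], of w] by (simp add: metric_compat[OF x])
qed

text \<open>Second derivatives of the metric commute, so the two instances of \<open>D2gb\<close>
  with \<open>u\<close> and \<open>v\<close> exchanged agree; their difference is this
  identity.\<close>

lemma Rm_antisym: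
  assumes x: "x \<in> U"
  shows "gb G x (Rm G x u v a) b = - gb G x a (Rm G x u v b)"
  using D2gb[OF x, of u v a b] D2gb[OF x, of v u a b] Dbl2_sym[OF open_U smooth_gb x, of u v]
  by (simp add: Rm_def blinfun.bilinear_simps)

lemma pd_christoffel: assumes x: "x \<in> U" 
  shows "pd m (christoffel G k i j) x = Dbl (chr G) x (axis m 1) (axis i 1) (axis j 1) $ k"
proof -
  have "((\<lambda>x. chr G x (axis i 1) (axis j 1) $ k) has_derivative (\<lambda>w. Dbl (chr G) x w (axis i 1) (axis j 1) $ k)) (at x)"
    using has_derivative_chr[OF x] 
    by (intro bounded_linear.has_derivative[OF bounded_linear_vec_nth]) (auto intro!: derivative_eq_intros)
  then have "(christoffel G k i j has_derivative (\<lambda>w. Dbl (chr G) x w (axis i 1) (axis j 1) $ k)) (at x)"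
    by (simp add: chr_axis)
  from frechet_derivative_at[OF this] show ?thesis by (metis pd_def)
qed

lemma riem_eq: assumes x: "x \<in> U"
  shows "riem G l i j k x = Rm G x (axis i 1) (axis j 1) (axis k 1) $ l"
proof -
  have "chr G x (axis i 1) w $ l = (\<Sum>m\<in>UNIV. christoffel G l i m x * w $ m)" for w i
    using blinfun_axis_expand[of "chr G x (axis i 1)" w] by (simp add: chr_axis mult.commute)
  then show ?thesis
    by (simp add: riem_def Rm_def pd_christoffel[OF x] chr_axis sum_subtractf)
qed

lemma Rm_linear: "linear (\<lambda>u. Rm G x u v w)" "linear (\<lambda>v. Rm G x u v w)" "linear (\<lambda>w. Rm G x u v w)"
  by (auto intro!: linearI simp: Rm_def blinfun.bilinear_simps algebra_simps)

text \<open>Identifies the fivefold index sum in \<open>sec\<close> with the curvature form. The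
  vector arguments of \<open>Rm\<close> are expanded in the basis one after the other, and
  \<open>gb\<close> supplies the sums over \<open>l\<close> and \<open>m\<close>.\<close>

lemma sec_sum: assumes x: "x \<in> U"
  shows "(\<Sum>i\<in>UNIV. \<Sum>j\<in>UNIV. \<Sum>k\<in>UNIV. \<Sum>l\<in>UNIV. \<Sum>m\<in>UNIV.
         G x $ l $ m * riem G l i j k x * u $ i * v $ j * v $ k * u $ m) = gb G x (Rm G x u v v) u"
proof -
  have lin: "linear (\<lambda>u::real^'n. \<Sum>i\<in>UNIV. u $ i * c i)" for c :: "'n \<Rightarrow> real"
    by (auto intro!: linearI simp: algebra_simps sum.distrib sum_distrib_left)
  have linc: "linear (\<lambda>u. gb G x (f u) z)" if "linear f" for f :: "real^'n \<Rightarrow> real^'n" and z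
    using that by (auto intro!: linearI simp: linear_add linear_scale blinfun.bilinear_simps)
  have ax: "(\<Sum>i\<in>UNIV. (axis j 1 :: real^'n) $ i * c i) = c j" for j and c :: "'n \<Rightarrow> real"
    by (simp add: axis_def if_distrib[of "\<lambda>r. r * _"] sum.delta cong: if_cong)
  define S where "S i j k z = (\<Sum>l\<in>UNIV. \<Sum>m\<in>UNIV. G x $ l $ m * riem G l i j k x * z $ m)" for i j k and z :: "real^'n"
  have 0: "gb G x (Rm G x (axis i 1) (axis j 1) (axis k 1)) z = S i j k z" for i j k z
    by (simp add: gb_apply S_def riem_eq[OF x])
  have 1: "gb G x (Rm G x (axis i 1) (axis j 1) w) z = (\<Sum>k\<in>UNIV. w $ k * S i j k z)" for i j w z
    by (rule linear_eq_axis[OF linc[OF Rm_linear(3)] lin]) (simp add: ax 0)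
  have 2: "gb G x (Rm G x (axis i 1) v w) z = (\<Sum>j\<in>UNIV. v $ j * (\<Sum>k\<in>UNIV. w $ k * S i j k z))" for i v w z
    by (rule linear_eq_axis[OF linc[OF Rm_linear(2)] lin]) (simp add: ax 1)
  have 3: "gb G x (Rm G x u v w) z = (\<Sum>i\<in>UNIV. u $ i * (\<Sum>j\<in>UNIV. v $ j * (\<Sum>k\<in>UNIV. w $ k * S i j k z)))" for u v w z
    by (rule linear_eq_axis[OF linc[OF Rm_linear(1)] lin]) (simp add: ax 2)
  show ?thesis by (simp add: 3 S_def sum_distrib_left mult_ac)
qed

lemma continuous_on_Rm: "continuous_on U (\<lambda>x. Dbl (chr G) x)" "continuous_on U (\<lambda>x. chr G x)" "continuous_on U (\<lambda>x. gb G x)"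
  by (intro smooth_on_continuous[OF smooth_on_Dbl] smooth_on_continuous[OF smooth_chr] smooth_on_continuous[OF smooth_gb] open_U smooth_chr)+

end

text \<open>In coordinates a change of chart and an isometry of the manifold look the same, so one
  locale serves both.\<close>

locale lisom = A: lmetric U G + B: lmetric U' G'
  for U :: "(real^'n::finite) set" and G and U' :: "(real^'n::finite) set" and G' +
  fixes W :: "(real^'n) set" and \<psi> :: "real^'n \<Rightarrow> real^'n"
  assumes open_W: "open W" and W_sub: "W \<subseteq> U" and smooth_psi: "smooth_on W \<psi>" and psi_in: "x \<in> W \<Longrightarrow> \<psi> x \<in> U'"
    and isom: "x \<in> W \<Longrightarrow> gb G x u v = gb G' (\<psi> x) (Dbl \<psi> x u) (Dbl \<psi> x v)"
begin

lemma has_derivative_psi: "x \<in> W \<Longrightarrow> (\<psi> has_derivative Dbl \<psi> x) (at x)"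
  by (rule smooth_on_has_derivative[OF smooth_psi])

lemma has_derivative_Dpsi: "x \<in> W \<Longrightarrow> (Dbl \<psi> has_derivative Dbl (Dbl \<psi>) x) (at x)"
  by (rule smooth_on_has_derivative[OF smooth_on_Dbl[OF open_W smooth_psi]])

lemma has_derivative_D2psi: "x \<in> W \<Longrightarrow> (Dbl (Dbl \<psi>) has_derivative Dbl (Dbl (Dbl \<psi>)) x) (at x)"
  by (rule smooth_on_has_derivative[OF smooth_on_Dbl[OF open_W smooth_on_Dbl[OF open_W smooth_psi]]])

lemma D2psi_sym: "x \<in> W \<Longrightarrow> Dbl (Dbl \<psi>) x u v = Dbl (Dbl \<psi>) x v u"
  by (rule Dbl2_sym[OF open_W smooth_psi])

lemma D3psi_sym: "x \<in> W \<Longrightarrow> Dbl (Dbl (Dbl \<psi>)) x u v w = Dbl (Dbl (Dbl \<psi>)) x v u w"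
  using Dbl2_sym[OF open_W smooth_on_Dbl[OF open_W smooth_psi], of x u v] by simp

lemma inj_Dpsi: "x \<in> W \<Longrightarrow> Dbl \<psi> x u = 0 \<Longrightarrow> u = 0"
  using A.nondeg[of x u] W_sub isom[of x u] by auto

lemma bij_Dpsi: "x \<in> W \<Longrightarrow> bij (Dbl \<psi> x)"
proof -
  assume x: "x \<in> W"
  have lin: "linear (Dbl \<psi> x)" by (rule bounded_linear.linear[OF blinfun.bounded_linear_right])
  have "inj (Dbl \<psi> x)" using inj_Dpsi[OF x] linear_injective_0[OF lin] by blast
  then show ?thesis using linear_injective_imp_surjective[OF lin] by (simp add: bij_def)
qed

lemma has_derivative_gb_psi:
  assumes x: "x \<in> W"
  shows "Dbl (gb G) x w u v = Dbl (gb G') (\<psi> x) (Dbl \<psi> x w) (Dbl \<psi> x u) (Dbl \<psi> x v)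
     + gb G' (\<psi> x) (Dbl (Dbl \<psi>) x w u) (Dbl \<psi> x v) + gb G' (\<psi> x) (Dbl \<psi> x u) (Dbl (Dbl \<psi>) x w v)"
proof -
  have xU: "x \<in> U" using x W_sub by auto
  have 1: "((\<lambda>x. gb G' (\<psi> x) (Dbl \<psi> x u) (Dbl \<psi> x v)) has_derivative (\<lambda>w. Dbl (gb G) x w u v)) (at x)"
    by (rule has_derivative_transform_within_open[OF A.has_derivative_gb_apply[OF xU] open_W x]) (simp add: isom)
  have c: "((\<lambda>x. gb G' (\<psi> x)) has_derivative (\<lambda>w. Dbl (gb G') (\<psi> x) (Dbl \<psi> x w))) (at x)"
    using has_derivative_compose[OF has_derivative_psi[OF x] B.has_derivative_gb[OF psi_in[OF x]]] .
  have 2: "((\<lambda>x. gb G' (\<psi> x) (Dbl \<psi> x u) (Dbl \<psi> x v)) has_derivative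
     (\<lambda>w. Dbl (gb G') (\<psi> x) (Dbl \<psi> x w) (Dbl \<psi> x u) (Dbl \<psi> x v)
     + gb G' (\<psi> x) (Dbl (Dbl \<psi>) x w u) (Dbl \<psi> x v) + gb G' (\<psi> x) (Dbl \<psi> x u) (Dbl (Dbl \<psi>) x w v))) (at x)"
    using c has_derivative_Dpsi[OF x] by (auto intro!: derivative_eq_intros simp: blinfun.bilinear_simps)
  show ?thesis using fun_cong[OF has_derivative_unique[OF 1 2], of w] by simp
qed

text \<open>The defect of the transformation law is symmetric in two of its arguments and antisymmetric
  in two others, hence zero.\<close>

lemma chr_law:
  assumes x: "x \<in> W"
  shows "Dbl (Dbl \<psi>) x u v + chr G' (\<psi> x) (Dbl \<psi> x u) (Dbl \<psi> x v) = Dbl \<psi> x (chr G x u v)"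
proof -
  have xU: "x \<in> U" using x W_sub by auto
  note y = psi_in[OF x]
  define B where "B u v = Dbl (Dbl \<psi>) x u v + chr G' (\<psi> x) (Dbl \<psi> x u) (Dbl \<psi> x v) - Dbl \<psi> x (chr G x u v)" for u v
  define T where "T w u v = gb G' (\<psi> x) (B w u) (Dbl \<psi> x v)" for w u v
  have Bsym: "B u v = B v u" for u v
    by (simp add: B_def D2psi_sym[OF x, of u] A.chr_sym[OF xU, of u] B.chr_sym[OF y, of "Dbl \<psi> x u"])
  have anti: "T w u v = - T w v u" for w u v
    using has_derivative_gb_psi[OF x, of w u v] 
    by (simp add: A.metric_compat[OF xU] B.metric_compat[OF y] T_def B_def blinfun.bilinear_simps isom[OF x]
        B.sym[OF y, of "Dbl \<psi> x u"])
  have sym: "T w u v = T u w v" for w u v by (simp add: T_def Bsym)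
  have "T w u v = 0" for w u v
    using anti[of w u v] sym[of w v u] anti[of v w u] sym[of v u w] anti[of u v w] sym[of u w v] by linarith
  have "B u v = 0"
  proof (rule B.nondeg[OF y])
    fix w
    obtain z where "w = Dbl \<psi> x z" using bij_Dpsi[OF x] by (metis bij_pointE)
    then show "gb G' (\<psi> x) (B u v) w = 0" using \<open>\<And>w u v. T w u v = 0\<close> by (simp add: T_def)
  qed
  then show ?thesis by (simp add: B_def)
qed

text \<open>Differentiating \<open>chr_law\<close> gives an identity whose defect \<open>E\<close>
  is zero. Antisymmetrising it in the first two arguments removes the third derivative of the map,
  by symmetry, and what remains is the difference of the two curvatures.\<close>

lemma Rm_law:
  assumes x: "x \<in> W"
  shows "Rm G' (\<psi> x) (Dbl \<psi> x u) (Dbl \<psi> x v) (Dbl \<psi> x w) = Dbl \<psi> x (Rm G x u v w)"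
proof -
  have xU: "x \<in> U" using x W_sub by auto
  note y = psi_in[OF x]
  have c: "((\<lambda>x. chr G' (\<psi> x)) has_derivative (\<lambda>w. Dbl (chr G') (\<psi> x) (Dbl \<psi> x w))) (at x)"
    using has_derivative_compose[OF has_derivative_psi[OF x] B.has_derivative_chr[OF psi_in[OF x]]] .
  have eq: "Dbl (Dbl (Dbl \<psi>)) x z u v + (Dbl (chr G') (\<psi> x) (Dbl \<psi> x z) (Dbl \<psi> x u) (Dbl \<psi> x v)
     + chr G' (\<psi> x) (Dbl (Dbl \<psi>) x z u) (Dbl \<psi> x v) + chr G' (\<psi> x) (Dbl \<psi> x u) (Dbl (Dbl \<psi>) x z v))
     = Dbl (Dbl \<psi>) x z (chr G x u v) + Dbl \<psi> x (Dbl (chr G) x z u v)" for z u v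
  proof -
    have 1: "((\<lambda>x. Dbl (Dbl \<psi>) x u v + chr G' (\<psi> x) (Dbl \<psi> x u) (Dbl \<psi> x v)) has_derivative
      (\<lambda>z. Dbl (Dbl (Dbl \<psi>)) x z u v + (Dbl (chr G') (\<psi> x) (Dbl \<psi> x z) (Dbl \<psi> x u) (Dbl \<psi> x v)
       + chr G' (\<psi> x) (Dbl (Dbl \<psi>) x z u) (Dbl \<psi> x v) + chr G' (\<psi> x) (Dbl \<psi> x u) (Dbl (Dbl \<psi>) x z v)))) (at x)"
      using c has_derivative_Dpsi[OF x] has_derivative_D2psi[OF x]
      by (auto intro!: derivative_eq_intros simp: blinfun.bilinear_simps)
    have 2: "((\<lambda>x. Dbl \<psi> x (chr G x u v)) has_derivative
      (\<lambda>z. Dbl (Dbl \<psi>) x z (chr G x u v) + Dbl \<psi> x (Dbl (chr G) x z u v))) (at x)"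
      using has_derivative_Dpsi[OF x] A.has_derivative_chr[OF xU]
      by (auto intro!: derivative_eq_intros simp: blinfun.bilinear_simps)
    have 3: "((\<lambda>x. Dbl (Dbl \<psi>) x u v + chr G' (\<psi> x) (Dbl \<psi> x u) (Dbl \<psi> x v)) has_derivative
      (\<lambda>z. Dbl (Dbl \<psi>) x z (chr G x u v) + Dbl \<psi> x (Dbl (chr G) x z u v))) (at x)"
      by (rule has_derivative_transform_within_open[OF 2 open_W x]) (simp add: chr_law)
    show ?thesis using fun_cong[OF has_derivative_unique[OF 1 3], of z] by simp
  qed
  have D2: "Dbl (Dbl \<psi>) x u v = Dbl \<psi> x (chr G x u v) - chr G' (\<psi> x) (Dbl \<psi> x u) (Dbl \<psi> x v)" for u v
    using chr_law[OF x, of u v] by (simp add: algebra_simps)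
  define E where "E z u v = Dbl (Dbl (Dbl \<psi>)) x z u v + (Dbl (chr G') (\<psi> x) (Dbl \<psi> x z) (Dbl \<psi> x u) (Dbl \<psi> x v)
     + chr G' (\<psi> x) (Dbl (Dbl \<psi>) x z u) (Dbl \<psi> x v) + chr G' (\<psi> x) (Dbl \<psi> x u) (Dbl (Dbl \<psi>) x z v))
     - (Dbl (Dbl \<psi>) x z (chr G x u v) + Dbl \<psi> x (Dbl (chr G) x z u v))" for z u v
  have "Rm G' (\<psi> x) (Dbl \<psi> x u) (Dbl \<psi> x v) (Dbl \<psi> x w) - Dbl \<psi> x (Rm G x u v w) = E u v w - E v u w"
    using D3psi_sym[OF x, of u v w] A.chr_sym[OF xU, of u v] B.chr_sym[OF y, of "Dbl \<psi> x u" "Dbl \<psi> x v"]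
    by (simp add: Rm_def E_def blinfun.bilinear_simps D2 algebra_simps)
  then show ?thesis using eq by (simp add: E_def)
qed

lemma sec_law:
  assumes x: "x \<in> W"
  shows "gb G' (\<psi> x) (Rm G' (\<psi> x) (Dbl \<psi> x u) (Dbl \<psi> x v) (Dbl \<psi> x w)) (Dbl \<psi> x z) = gb G x (Rm G x u v w) z"
  by (simp add: Rm_law[OF x] isom[OF x])

end

section \<open>Short geodesics\<close>

text \<open>Banach's principle for continuous curves on the unit interval. The contraction
  hypothesis is stated with an arbitrary uniform bound \<open>D\<close>, so users never handle the
  sup norm.\<close>

lemma fixpoint_C01:
  fixes \<Phi> :: "(real \<Rightarrow> 'b::banach) \<Rightarrow> real \<Rightarrow> 'b" and M :: real
  defines "S \<equiv> \<lambda>v. continuous_on {0..1} v \<and> (\<forall>t\<in>{0..1}. norm (v t) \<le> M)"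
  assumes M: "M \<ge> 0" and maps: "\<And>v. S v \<Longrightarrow> S (\<Phi> v)"
    and contr: "\<And>v w D. S v \<Longrightarrow> S w \<Longrightarrow> (\<And>t. t \<in> {0..1} \<Longrightarrow> norm (v t - w t) \<le> D) \<Longrightarrow>
        (\<And>t. t \<in> {0..1} \<Longrightarrow> norm (\<Phi> v t - \<Phi> w t) \<le> D / 2)"
  shows "\<exists>v. S v \<and> (\<forall>t\<in>{0..1}. \<Phi> v t = v t)"
proof -
  \<comment> \<open>Precomposition with the clamp to [0,1] extends a curve to a bounded continuous
    function on the line, an element of the complete space in which the fixed point is
    found.\<close>
  define cl :: "real \<Rightarrow> real" where "cl t = max 0 (min 1 t)" for t
  have cl: "cl t \<in> {0..1}" "t \<in> {0..1} \<Longrightarrow> cl t = t" for t by (auto simp: cl_def)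
  have ccl: "continuous_on UNIV cl" unfolding cl_def by (intro continuous_intros)
  define C where "C = (cball 0 M :: (real \<Rightarrow>\<^sub>C 'b) set)"
  have CS: "S (apply_bcontfun f)" if "f \<in> C" for f
  proof -
    have "norm (f t) \<le> norm f" for t by (rule norm_bounded)
    then show ?thesis using that unfolding C_def S_def 
      by (auto intro: order_trans continuous_on_subset[OF continuous_on_apply_bcontfun])
  qed
  define ext where "ext v = Bcontfun (\<lambda>t. v (cl t))" for v :: "real \<Rightarrow> 'b"
  have ext: "apply_bcontfun (ext v) t = v (cl t)" "ext v \<in> C" if "S v" for v t
  proof -
    have "continuous_on UNIV (\<lambda>t. v (cl t))"
      using that cl(1) unfolding S_def by (intro continuous_on_compose2[OF _ ccl]) auto
    moreover have bd: "norm (v (cl t)) \<le> M" for t using that cl(1) unfolding S_def by blast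
    ultimately have "(\<lambda>t. v (cl t)) \<in> bcontfun" by (auto simp: bcontfun_def bounded_iff)
    then have a: "apply_bcontfun (ext v) = (\<lambda>t. v (cl t))" by (simp add: ext_def Bcontfun_inverse)
    then show "apply_bcontfun (ext v) t = v (cl t)" by simp
    show "ext v \<in> C" using norm_bound[of "ext v" M] bd by (simp add: C_def a)
  qed
  define \<Psi> where "\<Psi> f = ext (\<Phi> (apply_bcontfun f))" for f
  have "\<exists>!f\<in>C. \<Psi> f = f"
  proof (rule Banach_fix[of _ "1/2"])
    show "complete C" unfolding C_def by (intro complete_eq_closed[THEN iffD2] closed_cball)
    show "C \<noteq> {}" using M by (auto simp: C_def)
    show "\<Psi> ` C \<subseteq> C" using ext(2) maps CS by (auto simp: \<Psi>_def)
    fix f g assume fg: "f \<in> C" "g \<in> C"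
    show "dist (\<Psi> f) (\<Psi> g) \<le> 1 / 2 * dist f g"
    proof (rule dist_bound)
      fix t
      have "norm (f s - g s) \<le> dist f g" for s using dist_bounded[of f s g] by (simp add: dist_norm)
      from contr[OF CS[OF fg(1)] CS[OF fg(2)] this cl(1)[of t]]
      show "dist (apply_bcontfun (\<Psi> f) t) (apply_bcontfun (\<Psi> g) t) \<le> 1 / 2 * dist f g"
        using ext(1)[OF maps[OF CS]] fg by (simp add: \<Psi>_def dist_norm)
    qed
  qed auto
  then obtain f where f: "f \<in> C" "\<Psi> f = f" by blast
  have "\<Phi> f t = f t" if "t \<in> {0..1}" for t
  proof -
    have "f t = \<Psi> f t" by (simp add: f)
    also have "\<dots> = \<Phi> f t" using ext(1)[OF maps[OF CS[OF f(1)]], of t] cl(2)[OF that] by (simp add: \<Psi>_def)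
    finally show ?thesis by simp
  qed
  then show ?thesis using CS[OF f(1)] by blast
qed

section \<open>Integral estimates and linear differential equations on the unit interval\<close>

lemma indefinite_integral_vd:
  fixes f :: "real \<Rightarrow> 'b::banach"
  assumes "continuous_on {0..1} f" "t \<in> {0..1}"
  shows "((\<lambda>u. integral {0..u} f) has_vector_derivative f t) (at t within {0..1})"
  by (rule integral_has_vector_derivative[OF assms])

lemma indefinite_integral_cont:
  fixes f :: "real \<Rightarrow> 'b::banach"
  assumes "continuous_on {0..1} f"
  shows "continuous_on {0..1} (\<lambda>u. integral {0..u} f)"
  by (rule continuous_on_vector_derivative[OF indefinite_integral_vd[OF assms]])

lemma integral_bound01:
  fixes f :: "real \<Rightarrow> 'b::banach"
  assumes "continuous_on {0..1} f" "t \<in> {0..1}" "\<And>s. s \<in> {0..1} \<Longrightarrow> norm (f s) \<le> B"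
  shows "norm (integral {0..t} f) \<le> B"
proof -
  have "norm (integral {0..t} f) \<le> B * (t - 0)"
    using assms by (intro integral_bound) (auto intro: continuous_on_subset)
  also have "\<dots> \<le> B" using assms(2) norm_ge_zero[of "f 0"] assms(3)[of 0] mult_left_le[of t B] by (auto simp del: norm_ge_zero)
  finally show ?thesis .
qed

lemma ftc01:
  fixes f :: "real \<Rightarrow> 'b::banach"
  assumes "\<And>t. t \<in> {0..1} \<Longrightarrow> (f has_vector_derivative f' t) (at t within {0..1})" "t \<in> {0..1}"
  shows "(f' has_integral (f t - f 0)) {0..t}"
  by (rule fundamental_theorem_of_calculus)
     (use assms(2) in \<open>auto intro!: has_vector_derivative_within_subset[OF assms(1)]\<close>)

lemma continuous_on_vd:
  "(\<And>t. t \<in> S \<Longrightarrow> (f has_vector_derivative f' t) (at t within S)) \<Longrightarrow> continuous_on S f"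
  by (rule continuous_on_vector_derivative)

text \<open>With coefficients of norm at most 1/2 the integral operator halves distances on the
  whole interval, so a single fixed point is the global solution and no continuation is required.
  The ball of radius 2 is preserved because 1 + (1/2) * 2 = 2.\<close>

lemma linear_ode_fundamental:
  fixes A :: "real \<Rightarrow> ('b::banach \<Rightarrow>\<^sub>L 'b)"
  assumes A: "continuous_on {0..1} A" "\<And>t. t \<in> {0..1} \<Longrightarrow> norm (A t) \<le> 1/2"
  shows "\<exists>P. P 0 = id_blinfun \<and> (\<forall>t\<in>{0..1}. (P has_vector_derivative A t o\<^sub>L P t) (at t within {0..1}))"
proof -
  define \<Phi> where "\<Phi> P t = id_blinfun + integral {0..t} (\<lambda>s. A s o\<^sub>L P s)" for P :: "real \<Rightarrow> ('b \<Rightarrow>\<^sub>L 'b)" and t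
  have cont: "continuous_on {0..1} (\<lambda>s. A s o\<^sub>L P s)" if "continuous_on {0..1} P" for P :: "real \<Rightarrow> ('b \<Rightarrow>\<^sub>L 'b)"
    using A(1) that by (rule bounded_bilinear.continuous_on[OF bounded_bilinear_blinfun_compose])
  have le: "norm (A s o\<^sub>L P) \<le> D / 2" if "s \<in> {0..1}" "norm P \<le> D" for s D and P :: "'b \<Rightarrow>\<^sub>L 'b"
  proof -
    have "norm (A s o\<^sub>L P) \<le> norm (A s) * norm P" by (rule norm_blinfun_compose)
    also have "\<dots> \<le> (1/2) * D" using A(2)[OF that(1)] that(2) by (intro mult_mono) auto
    finally show ?thesis by simp
  qed
  have "\<exists>v. (continuous_on {0..1} v \<and> (\<forall>t\<in>{0..1}. norm (v t) \<le> 2)) \<and> (\<forall>t\<in>{0..1}. \<Phi> v t = v t)"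
  proof (rule fixpoint_C01)
    show "(0::real) \<le> 2" by simp
    fix v :: "real \<Rightarrow> ('b \<Rightarrow>\<^sub>L 'b)" assume v: "continuous_on {0..1} v \<and> (\<forall>t\<in>{0..1}. norm (v t) \<le> 2)"
    have "norm (\<Phi> v t) \<le> 2" if "t \<in> {0..1}" for t
    proof -
      have le': "norm (A s o\<^sub>L v s) \<le> 2 / 2" if "s \<in> {0..1}" for s using v that by (intro le) auto
      have "norm (\<Phi> v t) \<le> norm (id_blinfun :: 'b \<Rightarrow>\<^sub>L 'b) + norm (integral {0..t} (\<lambda>s. A s o\<^sub>L v s))"
        unfolding \<Phi>_def by (rule norm_triangle_ineq)
      also have "\<dots> \<le> 1 + 2 / 2"
        using v that by (intro add_mono norm_blinfun_id_le integral_bound01 cont le') auto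
      finally show ?thesis by simp
    qed
    moreover have "continuous_on {0..1} (\<Phi> v)"
      unfolding \<Phi>_def using v by (intro continuous_intros indefinite_integral_cont cont) auto
    ultimately show "continuous_on {0..1} (\<Phi> v) \<and> (\<forall>t\<in>{0..1}. norm (\<Phi> v t) \<le> 2)" by blast
  next
    fix v w :: "real \<Rightarrow> ('b \<Rightarrow>\<^sub>L 'b)" and D t
    assume v: "continuous_on {0..1} v \<and> (\<forall>t\<in>{0..1}. norm (v t) \<le> 2)"
      and w: "continuous_on {0..1} w \<and> (\<forall>t\<in>{0..1}. norm (w t) \<le> 2)"
      and D: "\<And>t. t \<in> {0..1} \<Longrightarrow> norm (v t - w t) \<le> D" and t: "t \<in> {0..1::real}"
    have "\<Phi> v t - \<Phi> w t = integral {0..t} (\<lambda>s. A s o\<^sub>L (v s - w s))"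
      unfolding \<Phi>_def using v w t
      by (subst bounded_bilinear.diff_right[OF bounded_bilinear_blinfun_compose], subst integral_diff)
         (auto intro!: integrable_continuous_interval continuous_on_subset[OF cont])
    moreover have "norm (integral {0..t} (\<lambda>s. A s o\<^sub>L (v s - w s))) \<le> D / 2"
      using v w by (intro integral_bound01 cont t le D) (auto intro!: continuous_intros)
    ultimately show "norm (\<Phi> v t - \<Phi> w t) \<le> D / 2" by simp
  qed
  then obtain P where P: "continuous_on {0..1} P" "\<And>t. t \<in> {0..1} \<Longrightarrow> \<Phi> P t = P t" by blast
  have "(P has_vector_derivative A t o\<^sub>L P t) (at t within {0..1})" if t: "t \<in> {0..1}" for t
  proof (rule has_vector_derivative_transform[OF t P(2)[symmetric]])
    show "(\<Phi> P has_vector_derivative A t o\<^sub>L P t) (at t within {0..1})"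
      unfolding \<Phi>_def using indefinite_integral_vd[OF cont[OF P(1)] t] by (auto intro!: derivative_eq_intros)
  qed auto
  moreover have "P 0 = id_blinfun" using P(2)[of 0] by (simp add: \<Phi>_def)
  ultimately show ?thesis by blast
qed

section \<open>Geodesics, energy and the first variation\<close>

definition geodesic01 :: "(real^'n) set \<Rightarrow> (real^'n \<Rightarrow> real^'n^'n) \<Rightarrow> (real \<Rightarrow> real^'n::finite) \<Rightarrow> (real \<Rightarrow> real^'n) \<Rightarrow> bool"
  where "geodesic01 U G x x' \<longleftrightarrow> (\<forall>t\<in>{0..1}. x t \<in> U \<and> (x has_vector_derivative x' t) (at t within {0..1}) \<and>
     (x' has_vector_derivative - chr G (x t) (x' t) (x' t)) (at t within {0..1}))"

definition C1_curve :: "(real \<Rightarrow> 'b::real_normed_vector) \<Rightarrow> (real \<Rightarrow> 'b) \<Rightarrow> bool"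
  where "C1_curve y y' \<longleftrightarrow> (\<forall>t\<in>{0..1}. (y has_vector_derivative y' t) (at t within {0..1})) \<and> continuous_on {0..1} y'"

definition energy :: "(real^'n \<Rightarrow> real^'n^'n) \<Rightarrow> (real \<Rightarrow> real^'n::finite) \<Rightarrow> (real \<Rightarrow> real^'n) \<Rightarrow> real"
  where "energy G y y' = integral {0..1} (\<lambda>t. gb G (y t) (y' t) (y' t))"

lemma C1_curve_continuous: "C1_curve y y' \<Longrightarrow> continuous_on {0..1} y" "C1_curve y y' \<Longrightarrow> continuous_on {0..1} y'"
  unfolding C1_curve_def by (rule continuous_on_vd, blast) blast

lemma geodesic01_C1: assumes "geodesic01 U G x x'" shows "C1_curve x x'"
proof -
  have "continuous_on {0..1} x'"
    by (rule continuous_on_vd[of _ _ "\<lambda>t. - chr G (x t) (x' t) (x' t)"]) (use assms in \<open>simp add: geodesic01_def\<close>)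
  then show ?thesis using assms by (simp add: C1_curve_def geodesic01_def)
qed

text \<open>Cauchy-Schwarz against the constant 1: the integral of the squared deviation from the
  mean is nonnegative.\<close>

lemma square_integral_le:
  fixes h :: "real \<Rightarrow> real"
  assumes "continuous_on {0..1} h"
  shows "(integral {0..1} h)\<^sup>2 \<le> integral {0..1} (\<lambda>t. (h t)\<^sup>2)"
proof -
  define m where "m = integral {0..1} h"
  have 1: "(h has_integral m) {0..1}" using assms unfolding m_def
    by (intro integrable_integral integrable_continuous_interval)
  have 2: "((\<lambda>t. (h t)\<^sup>2) has_integral integral {0..1} (\<lambda>t. (h t)\<^sup>2)) {0..1}" using assms
    by (intro integrable_integral integrable_continuous_interval continuous_intros)
  have 3: "((\<lambda>t::real. m\<^sup>2) has_integral m\<^sup>2) {0..1}" using has_integral_const_real[of "m\<^sup>2" 0 1] by simp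
  have "((\<lambda>t. (h t)\<^sup>2 - (2 * m) * h t + m\<^sup>2) has_integral (integral {0..1} (\<lambda>t. (h t)\<^sup>2) - (2 * m) * m + m\<^sup>2)) {0..1}"
    by (intro has_integral_add has_integral_diff has_integral_mult_right 1 2 3)
  moreover have "(h t)\<^sup>2 - (2 * m) * h t + m\<^sup>2 = (h t - m)\<^sup>2" for t by (simp add: power2_eq_square algebra_simps)
  ultimately have "0 \<le> integral {0..1} (\<lambda>t. (h t)\<^sup>2) - (2 * m) * m + m\<^sup>2"
    using has_integral_nonneg[of "\<lambda>t. (h t)\<^sup>2 - (2 * m) * h t + m\<^sup>2" _ "{0..1}"] by simp
  then show ?thesis by (simp add: m_def power2_eq_square)
qed

text \<open>A curve starting at 0 is the integral of its velocity, so its sup norm is controlled by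
  the L2 norm of the velocity. This is the link between energy and displacement used
  throughout.\<close>

lemma poincare01:
  fixes w :: "real \<Rightarrow> 'b::banach"
  assumes w: "C1_curve w w'" "w 0 = 0" "t \<in> {0..1}"
  shows "(norm (w t))\<^sup>2 \<le> integral {0..1} (\<lambda>t. (norm (w' t))\<^sup>2)"
proof -
  have c: "continuous_on {0..1} w'" using w by (simp add: C1_curve_def)
  have "(w' has_integral (w t - w 0)) {0..t}"
    using w by (intro ftc01) (auto simp: C1_curve_def)
  then have "w t = integral {0..t} w'" using w by (simp add: integral_unique)
  also have "norm \<dots> \<le> integral {0..t} (\<lambda>t. norm (w' t))"
    using c w(3) by (intro integral_norm_bound_integral integrable_continuous_interval continuous_intros)
       (auto intro: continuous_on_subset)
  also have "\<dots> \<le> integral {0..1} (\<lambda>t. norm (w' t))"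
    using c w(3) by (intro integral_subset_le integrable_continuous_interval continuous_intros)
       (auto intro: continuous_on_subset)
  finally have "(norm (w t))\<^sup>2 \<le> (integral {0..1} (\<lambda>t. norm (w' t)))\<^sup>2" by (intro power_mono) auto
  also have "\<dots> \<le> integral {0..1} (\<lambda>t. (norm (w' t))\<^sup>2)"
    using c by (intro square_integral_le continuous_intros)
  finally show ?thesis .
qed

lemma norm_blinfun2: "norm (blinfun_apply (blinfun_apply B p) q) \<le> norm B * norm p * norm q"
  by (rule order_trans[OF norm_blinfun mult_right_mono[OF norm_blinfun norm_ge_zero]])

context lmetric begin

lemma gb_vd:
  assumes "x t \<in> U" "(x has_vector_derivative x') (at t within S)"
    "(u has_vector_derivative u') (at t within S)" "(v has_vector_derivative v') (at t within S)"
  shows "((\<lambda>t. gb G (x t) (u t) (v t)) has_vector_derivative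
     Dbl (gb G) (x t) x' (u t) (v t) + gb G (x t) u' (v t) + gb G (x t) (u t) v') (at t within S)"
proof -
  have 1: "((\<lambda>t. gb G (x t)) has_derivative (\<lambda>h. Dbl (gb G) (x t) (h *\<^sub>R x'))) (at t within S)"
    using has_derivative_compose[OF assms(2)[unfolded has_vector_derivative_def] has_derivative_gb[OF assms(1)]] .
  note 2 = bounded_bilinear.FDERIV[OF bounded_bilinear_blinfun_apply 1 assms(3)[unfolded has_vector_derivative_def]]
  note 3 = bounded_bilinear.FDERIV[OF bounded_bilinear_blinfun_apply 2 assms(4)[unfolded has_vector_derivative_def]]
  show ?thesis unfolding has_vector_derivative_def
    by (rule has_derivative_eq_rhs[OF 3]) (auto simp: blinfun.bilinear_simps algebra_simps)
qed

lemma chr_vd: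
  assumes "x t \<in> U" "(x has_vector_derivative x') (at t within S)"
    "(u has_vector_derivative u') (at t within S)" "(v has_vector_derivative v') (at t within S)"
  shows "((\<lambda>t. chr G (x t) (u t) (v t)) has_vector_derivative
     Dbl (chr G) (x t) x' (u t) (v t) + chr G (x t) u' (v t) + chr G (x t) (u t) v') (at t within S)"
proof -
  have 1: "((\<lambda>t. chr G (x t)) has_derivative (\<lambda>h. Dbl (chr G) (x t) (h *\<^sub>R x'))) (at t within S)"
    using has_derivative_compose[OF assms(2)[unfolded has_vector_derivative_def] has_derivative_chr[OF assms(1)]] .
  note 2 = bounded_bilinear.FDERIV[OF bounded_bilinear_blinfun_apply 1 assms(3)[unfolded has_vector_derivative_def]]
  note 3 = bounded_bilinear.FDERIV[OF bounded_bilinear_blinfun_apply 2 assms(4)[unfolded has_vector_derivative_def]]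
  show ?thesis unfolding has_vector_derivative_def
    by (rule has_derivative_eq_rhs[OF 3]) (auto simp: blinfun.bilinear_simps algebra_simps)
qed

text \<open>By the Koszul formula and the geodesic equation, the variation of the energy density in
  the direction \<open>w\<close> is twice the derivative of g(x', w), which leaves boundary terms
  only.\<close>

lemma first_variation:
  assumes x: "geodesic01 U G x x'" and w: "C1_curve w w'"
  shows "((\<lambda>t. Dbl (gb G) (x t) (w t) (x' t) (x' t) + 2 * gb G (x t) (x' t) (w' t)) has_integral
     2 * gb G (x 1) (x' 1) (w 1) - 2 * gb G (x 0) (x' 0) (w 0)) {0..1}"
proof -
  have "((\<lambda>t. gb G (x t) (x' t) (w t)) has_vector_derivative (Dbl (gb G) (x t) (w t) (x' t) (x' t) / 2 + gb G (x t) (x' t) (w' t))) (at t within {0..1})"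
    if "t \<in> {0..1}" for t
  proof (rule has_vector_derivative_eq_rhs, rule gb_vd)
    show "x t \<in> U" using x that by (simp add: geodesic01_def)
    show "(x has_vector_derivative x' t) (at t within {0..1})" "(x' has_vector_derivative - chr G (x t) (x' t) (x' t)) (at t within {0..1})" 
       "(w has_vector_derivative w' t) (at t within {0..1})"
      using x w that by (auto simp: geodesic01_def C1_curve_def)
    show "Dbl (gb G) (x t) (x' t) (x' t) (w t) + gb G (x t) (- chr G (x t) (x' t) (x' t)) (w t) + gb G (x t) (x' t) (w' t) =
      Dbl (gb G) (x t) (w t) (x' t) (x' t) / 2 + gb G (x t) (x' t) (w' t)"
      by (simp add: koszul[OF \<open>x t \<in> U\<close>] blinfun.bilinear_simps Dgb_sym[OF \<open>x t \<in> U\<close>] field_simps)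
  qed
  from has_integral_mult_right[OF ftc01[OF this, of 1], of 2] show ?thesis by (simp add: algebra_simps)
qed

lemma energy_integrable:
  assumes "C1_curve y y'" "\<And>t. t \<in> {0..1} \<Longrightarrow> y t \<in> U"
  shows "continuous_on {0..1} (\<lambda>t. gb G (y t) (y' t) (y' t))" "(\<lambda>t. gb G (y t) (y' t) (y' t)) integrable_on {0..1}"
proof -
  show "continuous_on {0..1} (\<lambda>t. gb G (y t) (y' t) (y' t))"
    using assms C1_curve_continuous[OF assms(1)]
    by (intro continuous_intros continuous_on_compose2[OF continuous_on_Rm(3)]) auto
  then show "(\<lambda>t. gb G (y t) (y' t) (y' t)) integrable_on {0..1}" by (rule integrable_continuous_interval)
qed

text \<open>Second-order Taylor expansion of the energy density around \<open>x\<close>: the first-order term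
  integrates to \<open>0\<close>, and \<open>lam * |w'|\<^sup>2\<close> dominates the remainder by the Poincare inequality.\<close>

lemma geodesic_minimal:
  assumes x: "geodesic01 U G x x'" "\<And>t. t \<in> {0..1} \<Longrightarrow> x t \<in> K" "\<And>t. t \<in> {0..1} \<Longrightarrow> norm (x' t) \<le> e"
    and y: "C1_curve y y'" "\<And>t. t \<in> {0..1} \<Longrightarrow> y t \<in> K" "y 0 = x 0" "y 1 = x 1"
    and K: "convex K" "K \<subseteq> U"
    and lam: "\<And>p v. p \<in> K \<Longrightarrow> lam * (norm v)\<^sup>2 \<le> gb G p v v"
    and C: "\<And>p. p \<in> K \<Longrightarrow> norm (Dbl (gb G) p) \<le> C" "\<And>p. p \<in> K \<Longrightarrow> norm (Dbl (Dbl (gb G)) p) \<le> C"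
    and e: "0 \<le> e" "e \<le> 4" "6 * C * e \<le> lam"
  shows "energy G x x' \<le> energy G y y'"
proof -
  define w where "w t = y t - x t" for t
  define w' where "w' t = y' t - x' t" for t
  have w: "C1_curve w w'" 
    using y(1) geodesic01_C1[OF x(1)] unfolding C1_curve_def w_def w'_def
    by (auto intro!: derivative_intros continuous_intros)
  have w01: "w 0 = 0" "w 1 = 0" using y by (auto simp: w_def)
  have Cpos: "0 \<le> C" using order_trans[OF norm_ge_zero C(1)[OF x(2)[of 0]]] by simp
  have lip: "norm (gb G q - gb G p) \<le> C * norm (q - p)" if "p \<in> K" "q \<in> K" for p q
    using that K C(1) by (intro differentiable_bound[OF K(1)])
      (auto intro!: has_derivative_at_withinI[OF has_derivative_gb] simp: norm_blinfun.rep_eq[symmetric])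
  have lip2: "norm (Dbl (gb G) q - Dbl (gb G) p) \<le> C * norm (q - p)" if "p \<in> K" "q \<in> K" for p q
    using that K C(2) by (intro differentiable_bound[OF K(1)])
      (auto intro!: has_derivative_at_withinI[OF has_derivative_Dgb] simp: norm_blinfun.rep_eq[symmetric])
  have taylor: "norm (gb G q - gb G p - Dbl (gb G) p (q - p)) \<le> C * (norm (q - p))\<^sup>2" if pq: "p \<in> K" "q \<in> K" for p q
  proof -
    have seg: "closed_segment p q \<subseteq> K" using K(1) pq by (simp add: convex_contains_segment)
    have "norm (gb G q - gb G p - Dbl (gb G) p (q - p)) \<le> norm (q - p) * (C * norm (q - p))"
    proof (rule differentiable_bound_linearization[where S="closed_segment p q"])
      show "p + t *\<^sub>R (q - p) \<in> closed_segment p q" if "t \<in> {0..1}" for t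
        using that by (auto simp: closed_segment_def algebra_simps intro!: exI[of _ t])
      show "(gb G has_derivative Dbl (gb G) r) (at r within closed_segment p q)" if "r \<in> closed_segment p q" for r
        using that seg K(2) by (intro has_derivative_at_withinI[OF has_derivative_gb]) auto
      fix r assume r: "r \<in> closed_segment p q"
      have "onorm (Dbl (gb G) r - Dbl (gb G) p) = norm (Dbl (gb G) r - Dbl (gb G) p)"
        by (simp add: norm_blinfun.rep_eq minus_blinfun.rep_eq fun_diff_def)
      also have "\<dots> \<le> C * norm (r - p)" using r seg pq by (intro lip2) auto
      also have "\<dots> \<le> C * norm (q - p)" using segment_bound(1)[OF r] Cpos by (intro mult_left_mono) (auto simp: norm_minus_commute)
      finally show "onorm (\<lambda>a. (blinfun_apply (Dbl (gb G) r) - blinfun_apply (Dbl (gb G) p)) a) \<le> C * norm (q - p)"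
        by (simp add: blinfun.diff_left[abs_def])
    qed simp
    then show ?thesis by (simp add: power2_eq_square mult_ac)
  qed
  define L where "L t = Dbl (gb G) (x t) (w t) (x' t) (x' t) + 2 * gb G (x t) (x' t) (w' t)" for t
  define m where "m = integral {0..1} (\<lambda>t. (norm (w' t))\<^sup>2)"
  \<comment> \<open>The quadratic Taylor remainder costs at most \<open>C * m * (e * 4)\<close>,
    since \<open>d * d\<close> is at most \<open>e * 4\<close> when \<open>e\<close> is at most 4;
    the mixed term costs \<open>C * e * (m + b\<^sup>2)\<close>. Integrated, these make up
    \<open>6 * C * e * m\<close>, which the bound on \<open>6 * C * e\<close> by \<open>lam\<close>
    absorbs.\<close>
  have pt: "gb G (x t) (x' t) (x' t) + L t + lam * (norm (w' t))\<^sup>2 - 5 * C * e * m - C * e * (norm (w' t))\<^sup>2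
      \<le> gb G (y t) (y' t) (y' t)" if t: "t \<in> {0..1}" for t
  proof -
    define a where "a = norm (w t)"
    define b where "b = norm (w' t)"
    define d where "d = norm (x' t)"
    have ab: "0 \<le> a" "0 \<le> b" "0 \<le> d" "d \<le> e" using x(3)[OF t] by (auto simp: a_def b_def d_def)
    have xy: "x t \<in> K" "y t \<in> K" "y t \<in> U" "x t \<in> U" using x y K t by auto
    have y': "y' t = x' t + w' t" "y t - x t = w t" by (auto simp: w_def w'_def)
    have "\<bar>(gb G (y t) - gb G (x t) - Dbl (gb G) (x t) (w t)) (x' t) (x' t)\<bar> \<le> norm (gb G (y t) - gb G (x t) - Dbl (gb G) (x t) (w t)) * d * d"
      using norm_blinfun2[of "gb G (y t) - gb G (x t) - Dbl (gb G) (x t) (w t)" "x' t" "x' t"] by (simp add: d_def)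
    also have "\<dots> \<le> (C * a\<^sup>2) * d * d"
      using taylor[OF xy(1,2)] ab by (intro mult_right_mono) (auto simp: y' a_def)
    also have "\<dots> = C * a\<^sup>2 * d\<^sup>2" by (simp add: power2_eq_square)
    finally have 1: "gb G (x t) (x' t) (x' t) + Dbl (gb G) (x t) (w t) (x' t) (x' t) - C * a\<^sup>2 * d\<^sup>2 \<le> gb G (y t) (x' t) (x' t)"
      by (simp add: blinfun.bilinear_simps)
    have "\<bar>(gb G (y t) - gb G (x t)) (x' t) (w' t)\<bar> \<le> norm (gb G (y t) - gb G (x t)) * d * b"
      using norm_blinfun2[of "gb G (y t) - gb G (x t)" "x' t" "w' t"] by (simp add: d_def b_def)
    also have "\<dots> \<le> (C * a) * d * b"
      using lip[OF xy(1,2)] ab by (intro mult_right_mono) (auto simp: y' a_def)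
    finally have 2: "gb G (x t) (x' t) (w' t) - C * a * d * b \<le> gb G (y t) (x' t) (w' t)"
      by (simp add: blinfun.bilinear_simps)
    have 3: "lam * b\<^sup>2 \<le> gb G (y t) (w' t) (w' t)" using lam[OF xy(2)] by (simp add: b_def)
    have am: "a\<^sup>2 \<le> m" using poincare01[OF w w01(1) t] by (simp add: a_def m_def)
    have 4: "C * a\<^sup>2 * d\<^sup>2 \<le> C * m * (e * 4)"
    proof -
      have "d\<^sup>2 \<le> e * 4" unfolding power2_eq_square using ab e by (intro mult_mono) auto
      moreover have "0 \<le> m" using am zero_le_power2[of a] by linarith
      ultimately show ?thesis using am ab Cpos e by (intro mult_mono) auto
    qed
    have 5: "2 * (C * a * d * b) \<le> C * e * (m + b\<^sup>2)"
    proof -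
      have "2 * (C * a * d * b) = C * d * (2 * a * b)" by simp
      also have "\<dots> \<le> C * e * (m + b\<^sup>2)"
      proof (intro mult_mono)
        have "2 * a * b \<le> a\<^sup>2 + b\<^sup>2" by (rule sum_squares_bound)
        then show "2 * a * b \<le> m + b\<^sup>2" using am by simp
      qed (use ab Cpos e am in auto)
      finally show ?thesis .
    qed
    have 6: "gb G (y t) (y' t) (y' t) = gb G (y t) (x' t) (x' t) + 2 * gb G (y t) (x' t) (w' t) + gb G (y t) (w' t) (w' t)"
      by (simp add: y' blinfun.bilinear_simps sym[OF xy(3), of "w' t" "x' t"])
    have 7: "C * m * (e * 4) + C * e * (m + b\<^sup>2) = 5 * C * e * m + C * e * b\<^sup>2" by (simp add: algebra_simps)
    show ?thesis using 1 2 3 4 5 6 7 unfolding L_def b_def[symmetric] by linarith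
  qed
  have cw': "continuous_on {0..1} w'" using w by (simp add: C1_curve_def)
  have Ix: "((\<lambda>t. gb G (x t) (x' t) (x' t)) has_integral energy G x x') {0..1}"
    unfolding energy_def using x K by (intro integrable_integral energy_integrable geodesic01_C1[OF x(1)]) auto
  have Iy: "((\<lambda>t. gb G (y t) (y' t) (y' t)) has_integral energy G y y') {0..1}"
    unfolding energy_def using y K by (intro integrable_integral energy_integrable y) auto
  have IL: "(L has_integral 0) {0..1}" 
    using first_variation[OF x(1) w] by (simp add: w01 L_def[abs_def] blinfun.bilinear_simps)
  have Iw: "((\<lambda>t. (norm (w' t))\<^sup>2) has_integral m) {0..1}"
    unfolding m_def using cw' by (intro integrable_integral integrable_continuous_interval continuous_intros)
  have Ic: "((\<lambda>t::real. 5 * C * e * m) has_integral 5 * C * e * m) {0..1}" 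
    using has_integral_const_real[of "5 * C * e * m" 0 1] by simp
  have "energy G x x' + 0 + lam * m - 5 * C * e * m - (C * e) * m \<le> energy G y y'"
  proof (rule has_integral_le[OF _ Iy])
    show "((\<lambda>t. gb G (x t) (x' t) (x' t) + L t + lam * (norm (w' t))\<^sup>2 - 5 * C * e * m - C * e * (norm (w' t))\<^sup>2) has_integral
       energy G x x' + 0 + lam * m - 5 * C * e * m - (C * e) * m) {0..1}"
      by (intro has_integral_add has_integral_diff has_integral_mult_right Ix IL Iw Ic)
  qed (rule pt)
  moreover have "0 \<le> (lam - 6 * C * e) * m"
    using e(3) by (intro mult_nonneg_nonneg) (auto simp: m_def intro!: integral_nonneg integrable_continuous_interval continuous_intros cw')
  ultimately show ?thesis by (simp add: algebra_simps)
qed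

text \<open>The unknown is the velocity \<open>v\<close>, and the curve \<open>X v\<close> is
  recovered by integration from \<open>a\<close>. A fixed point of the integrated geodesic equation
  with the right mean solves the boundary value problem directly, and smallness of \<open>r\<close>
  makes the map contracting.\<close>

lemma geodesic_bvp:
  assumes R: "cball z (6 * r) \<subseteq> U" "0 < r" "r \<le> 1"
    and C: "\<And>p. p \<in> cball z (6 * r) \<Longrightarrow> norm (chr G p) \<le> C" "\<And>p. p \<in> cball z (6 * r) \<Longrightarrow> norm (Dbl (chr G) p) \<le> C"
    and r: "96 * C * r \<le> 1"
    and ab: "a \<in> cball z r" "b \<in> cball z r"
  shows "\<exists>x x'. geodesic01 U G x x' \<and> x 0 = a \<and> x 1 = b \<and> (\<forall>t\<in>{0..1}. x t \<in> cball z (5 * r) \<and> norm (x' t) \<le> 4 * r)"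
proof -
  have z: "z \<in> cball z (6 * r)" using R by simp
  have C0: "0 \<le> C" using C(1)[OF z] norm_ge_zero order_trans by blast
  have lip: "norm (chr G p - chr G q) \<le> C * norm (p - q)" if "p \<in> cball z (6 * r)" "q \<in> cball z (6 * r)" for p q
    using that R C(2) by (intro differentiable_bound[OF convex_cball])
      (auto intro!: has_derivative_at_withinI[OF has_derivative_chr] simp: norm_blinfun.rep_eq[symmetric])
  have nba: "norm (b - a) \<le> 2 * r" using ab dist_triangle2[of b a z] by (auto simp: dist_norm norm_minus_commute)
  define S where "S v \<longleftrightarrow> continuous_on {0..1} v \<and> (\<forall>t\<in>{0..1}. norm (v t) \<le> 4 * r)" for v :: "real \<Rightarrow> real^'n"
  define X where "X v t = a + integral {0..t} v" for v :: "real \<Rightarrow> real^'n" and t :: real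
  define Q where "Q v t = - chr G (X v t) (v t) (v t)" for v t
  define I where "I v t = integral {0..t} (Q v)" for v t
  \<comment> \<open>Removing the mean of \<open>I v\<close> forces the mean of
    \<open>\<Phi> v\<close> to be \<open>b - a\<close>; for a fixed point this says that the curve
    ends at \<open>b\<close>.\<close>
  define \<Phi> where "\<Phi> v t = (b - a) + I v t - integral {0..1} (I v)" for v t
  have X: "X v t \<in> cball z (5 * r)" if "S v" "t \<in> {0..1}" for v t
  proof -
    have "norm (integral {0..t} v) \<le> 4 * r" using that unfolding S_def by (intro integral_bound01) auto
    moreover have "norm (z - a) \<le> r" using ab by (simp add: dist_norm)
    moreover have "z - X v t = (z - a) - integral {0..t} v" by (simp add: X_def)
    ultimately have "norm (z - X v t) \<le> r + 4 * r"
      by (metis add_mono norm_triangle_ineq4 order_trans)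
    then show ?thesis by (simp add: dist_norm)
  qed
  have X6: "X v t \<in> cball z (6 * r)" if "S v" "t \<in> {0..1}" for v t
    using X[OF that] R by simp
  have cX: "continuous_on {0..1} (X v)" if "S v" for v
    unfolding X_def using that unfolding S_def by (intro continuous_intros indefinite_integral_cont) auto
  have cQ: "continuous_on {0..1} (Q v)" if "S v" for v
    unfolding Q_def using that X6[OF that] R(1) cX[OF that] unfolding S_def
    by (intro continuous_intros continuous_on_compose2[OF continuous_on_Rm(2)]) auto
  have cI: "continuous_on {0..1} (I v)" if "S v" for v
    unfolding I_def by (intro indefinite_integral_cont cQ that)
  \<comment> \<open>The acceleration is at most \<open>16 * C * r * r\<close>. It enters
    \<open>\<Phi>\<close> twice, in addition to \<open>b - a\<close> of norm at most
    \<open>2 * r\<close>, so the bound \<open>4 * r\<close> on the velocity is reproduced.\<close>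
  have nQ: "norm (Q v t) \<le> r / 6" if "S v" "t \<in> {0..1}" for v t
  proof -
    have "norm (Q v t) \<le> norm (chr G (X v t)) * norm (v t) * norm (v t)"
      unfolding Q_def norm_minus_cancel by (rule norm_blinfun2)
    also have "\<dots> \<le> C * (4 * r) * (4 * r)"
      using C(1)[OF X6[OF that]] that R C0 unfolding S_def by (intro mult_mono) auto
    also have "\<dots> = (96 * C * r) * r / 6" by simp
    also have "\<dots> \<le> 1 * r / 6" using r R by (intro divide_right_mono mult_right_mono) auto
    finally show ?thesis by simp
  qed
  have nI: "norm (I v t) \<le> r / 6" if "S v" "t \<in> {0..1}" for v t
    unfolding I_def by (intro integral_bound01 cQ nQ that)
  have "\<exists>v. (continuous_on {0..1} v \<and> (\<forall>t\<in>{0..1}. norm (v t) \<le> 4 * r)) \<and> (\<forall>t\<in>{0..1}. \<Phi> v t = v t)"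
  proof (rule fixpoint_C01, fold S_def)
    show "0 \<le> 4 * r" using R by simp
    show "S (\<Phi> v)" if "S v" for v
      unfolding S_def
    proof (intro conjI ballI)
      show "continuous_on {0..1} (\<Phi> v)" unfolding \<Phi>_def by (intro continuous_intros cI that)
      fix t :: real assume t: "t \<in> {0..1}"
      have "norm (integral {0..1} (I v)) \<le> r / 6" by (intro integral_bound01 cI nI that) auto
      then have "norm (\<Phi> v t) \<le> 2 * r + r / 6 + r / 6"
        unfolding \<Phi>_def using nba nI[OF that t] by norm
      then show "norm (\<Phi> v t) \<le> 4 * r" using R by simp
    qed
    fix v w D and t :: real
    assume v: "S v" and w: "S w" and D: "\<And>t. t \<in> {0..1} \<Longrightarrow> norm (v t - w t) \<le> D" and t: "t \<in> {0..1}"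
    have D0: "0 \<le> D" using D[OF t] norm_ge_zero order_trans by blast
    have dX: "norm (X v s - X w s) \<le> D" if s: "s \<in> {0..1}" for s
    proof -
      have "X v s - X w s = integral {0..s} (\<lambda>u. v u - w u)"
        unfolding X_def using v w s unfolding S_def
        by (subst integral_diff) (auto intro!: integrable_continuous_interval intro: continuous_on_subset)
      moreover have "norm (integral {0..s} (\<lambda>u. v u - w u)) \<le> D"
        using v w s D unfolding S_def by (intro integral_bound01 continuous_intros) auto
      ultimately show ?thesis by simp
    qed
    \<comment> \<open>One term comes from moving the base point and two from changing the velocity:
      together at most \<open>24 * C * r * D\<close>. The factor 96 turns this into
      \<open>D / 4\<close>, and the two occurrences of \<open>I\<close> in \<open>\<Phi>\<close> add
      up to the required \<open>D / 2\<close>.\<close>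
    have dQ: "norm (Q v s - Q w s) \<le> D / 4" if s: "s \<in> {0..1}" for s
    proof -
      have vs: "norm (v s) \<le> 4 * r" "norm (w s) \<le> 4 * r" using v w s by (auto simp: S_def)
      have eq: "Q w s - Q v s = (chr G (X v s) - chr G (X w s)) (v s) (v s) + chr G (X w s) (v s - w s) (v s)
         + chr G (X w s) (w s) (v s - w s)" by (simp add: Q_def blinfun.bilinear_simps)
      have "norm ((chr G (X v s) - chr G (X w s)) (v s) (v s)) \<le> (C * D) * (4 * r) * (4 * r)"
        by (rule order_trans[OF norm_blinfun2], intro mult_mono order_trans[OF lip] mult_left_mono X6 dX v w s vs)
           (use C0 D0 R in auto)
      moreover have "norm (chr G (X w s) (v s - w s) (v s)) \<le> C * D * (4 * r)"
        by (rule order_trans[OF norm_blinfun2], intro mult_mono C X6 D v w s vs) (use C0 D0 R in auto)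
      moreover have "norm (chr G (X w s) (w s) (v s - w s)) \<le> C * (4 * r) * D"
        by (rule order_trans[OF norm_blinfun2], intro mult_mono C X6 D v w s vs) (use C0 D0 R in auto)
      ultimately have "norm (Q w s - Q v s) \<le> (C * D) * (4 * r) * (4 * r) + C * D * (4 * r) + C * (4 * r) * D"
        unfolding eq using norm_triangle_ineq norm_add_rule_thm by (smt (verit))
      also have "\<dots> = (C * D * r) * (16 * r + 8)" by (simp add: algebra_simps)
      also have "\<dots> \<le> (C * D * r) * 24" using R C0 D0 by (intro mult_left_mono) auto
      also have "\<dots> = (96 * C * r) * D / 4" by simp
      also have "\<dots> \<le> 1 * D / 4" using r D0 by (intro divide_right_mono mult_right_mono) auto
      finally show ?thesis by (simp add: norm_minus_commute)
    qed
    have dI: "norm (I v s - I w s) \<le> D / 4" if s: "s \<in> {0..1}" for s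
    proof -
      have "I v s - I w s = integral {0..s} (\<lambda>u. Q v u - Q w u)"
        unfolding I_def using s
        by (subst integral_diff) (auto intro!: integrable_continuous_interval intro: continuous_on_subset[OF cQ[OF v]] continuous_on_subset[OF cQ[OF w]])
      moreover have "norm (integral {0..s} (\<lambda>u. Q v u - Q w u)) \<le> D / 4"
        by (intro integral_bound01 continuous_intros cQ v w dQ s)
      ultimately show ?thesis by simp
    qed
    have "integral {0..1} (I v) - integral {0..1} (I w) = integral {0..1} (\<lambda>s. I v s - I w s)"
      by (subst integral_diff) (auto intro!: integrable_continuous_interval cI v w)
    moreover have "norm (integral {0..1} (\<lambda>s. I v s - I w s)) \<le> D / 4"
      by (intro integral_bound01 continuous_intros cI v w dI) auto
    ultimately have "norm (integral {0..1} (I v) - integral {0..1} (I w)) \<le> D / 4" by simp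
    then show "norm (\<Phi> v t - \<Phi> w t) \<le> D / 2"
      unfolding \<Phi>_def using dI[OF t] by norm
  qed
  then obtain v where v: "S v" "\<And>t. t \<in> {0..1} \<Longrightarrow> \<Phi> v t = v t" unfolding S_def by blast
  have cv: "continuous_on {0..1} v" using v by (simp add: S_def)
  have "(v has_vector_derivative Q v t) (at t within {0..1})" if t: "t \<in> {0..1}" for t
  proof (rule has_vector_derivative_transform[OF t v(2)[symmetric]])
    show "(\<Phi> v has_vector_derivative Q v t) (at t within {0..1})"
      unfolding \<Phi>_def I_def using indefinite_integral_vd[OF cQ[OF v(1)] t] by (auto intro!: derivative_eq_intros)
  qed auto
  moreover have "(X v has_vector_derivative v t) (at t within {0..1})" if t: "t \<in> {0..1}" for t
    unfolding X_def using indefinite_integral_vd[OF cv t] by (auto intro!: derivative_eq_intros)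
  ultimately have "geodesic01 U G (X v) v"
    using X6[OF v(1)] R(1) by (auto simp: geodesic01_def Q_def)
  moreover have "X v 0 = a" by (simp add: X_def)
  moreover have "X v 1 = b"
  proof -
    have "integral {0..1} v = integral {0..1} (\<Phi> v)" using v(2) by (intro Henstock_Kurzweil_Integration.integral_cong) auto
    also have "\<dots> = (b - a) + integral {0..1} (I v) - integral {0..1} (I v)"
      unfolding \<Phi>_def by (subst integral_diff, (auto intro!: integrable_continuous_interval continuous_intros cI v)[2])
        (subst integral_add, auto intro!: integrable_continuous_interval continuous_intros cI v)
    finally show ?thesis by (simp add: X_def)
  qed
  ultimately show ?thesis using X[OF v(1)] v(1) unfolding S_def by blast
qed

end

text \<open>Radius \<open>r\<close> bounds the end points, \<open>5 * r\<close> the geodesics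
  between them, and \<open>6 * r\<close> their competitors, which leaves room to perturb. As the
  speed is at most \<open>4 * r\<close>, the bound with \<open>8 * r\<close> makes the coefficients
  of parallel transport have norm at most 1/2.\<close>

definition good_ball :: "(real^'n) set \<Rightarrow> (real^'n \<Rightarrow> real^'n^'n) \<Rightarrow> real^'n::finite \<Rightarrow> real \<Rightarrow> real \<Rightarrow> real \<Rightarrow> bool"
  where "good_ball U G z r lam Lam \<longleftrightarrow> 0 < r \<and> 0 < lam \<and> cball z (6 * r) \<subseteq> U \<and>
    (\<forall>p\<in>cball z (6 * r). (\<forall>v. lam * (norm v)\<^sup>2 \<le> gb G p v v \<and> gb G p v v \<le> Lam * (norm v)\<^sup>2) \<and> norm (chr G p) * (8 * r) \<le> 1) \<and>
    (\<forall>a\<in>cball z r. \<forall>b\<in>cball z r. \<exists>x x'. geodesic01 U G x x' \<and> x 0 = a \<and> x 1 = b \<and>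
       (\<forall>t\<in>{0..1}. x t \<in> cball z (5 * r) \<and> norm (x' t) \<le> 4 * r) \<and>
       (\<forall>y y'. C1_curve y y' \<and> (\<forall>t\<in>{0..1}. y t \<in> cball z (6 * r)) \<and> y 0 = a \<and> y 1 = b \<longrightarrow> energy G x x' \<le> energy G y y'))"

text \<open>On a fixed compact ball all relevant derivatives are bounded and the metric has a
  positive minimum on unit vectors; these bounds persist when the radius shrinks, so a small radius
  satisfies all requirements.\<close>

lemma (in lmetric) good_ball_exists:
  assumes z: "z \<in> U"
  shows "\<exists>r lam Lam. good_ball U G z r lam Lam"
proof -
  obtain R where R: "R > 0" "cball z R \<subseteq> U" using open_U z open_contains_cball by blast
  have bd: "\<exists>B. \<forall>p\<in>cball z R. norm (f p) \<le> B" if "continuous_on U f" for f :: "real^'n \<Rightarrow> 'c::real_normed_vector"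
  proof -
    have "compact (f ` cball z R)" using that R(2) by (intro compact_continuous_image) (auto intro: continuous_on_subset)
    then show ?thesis using compact_imp_bounded bounded_iff by (metis imageI)
  qed
  obtain B1 B2 B3 B4 B5 where B: "\<forall>p\<in>cball z R. norm (chr G p) \<le> B1" "\<forall>p\<in>cball z R. norm (Dbl (chr G) p) \<le> B2"
    "\<forall>p\<in>cball z R. norm (Dbl (gb G) p) \<le> B3" "\<forall>p\<in>cball z R. norm (Dbl (Dbl (gb G)) p) \<le> B4" "\<forall>p\<in>cball z R. norm (gb G p) \<le> B5"
    using bd[OF continuous_on_Rm(2)] bd[OF continuous_on_Rm(1)] bd[OF smooth_on_continuous[OF smooth_on_Dbl[OF open_U smooth_gb]]]
      bd[OF smooth_on_continuous[OF smooth_on_Dbl[OF open_U smooth_on_Dbl[OF open_U smooth_gb]]]] bd[OF continuous_on_Rm(3)] by metis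
  define C where "C = max 1 (max (max B1 B2) (max B3 B4))"
  have C: "C \<ge> 1" "B1 \<le> C" "B2 \<le> C" "B3 \<le> C" "B4 \<le> C" by (auto simp: C_def)
  let ?S = "cball z R \<times> sphere (0::real^'n) 1"
  have "continuous_on ?S (\<lambda>q. gb G (fst q) (snd q) (snd q))"
    using R(2) by (intro continuous_intros continuous_on_compose2[OF continuous_on_Rm(3)]) auto
  moreover have "compact ?S" by (intro compact_Times compact_cball compact_sphere)
  moreover obtain e :: "real^'n" where "norm e = 1" using vector_choose_size[of 1] by auto
  then have "?S \<noteq> {}" using R(1) by (auto intro!: exI[of _ e])
  ultimately obtain q0 where q0: "q0 \<in> ?S" "\<And>q. q \<in> ?S \<Longrightarrow> gb G (fst q0) (snd q0) (snd q0) \<le> gb G (fst q) (snd q) (snd q)"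
    using continuous_attains_inf[of ?S "\<lambda>q. gb G (fst q) (snd q) (snd q)"] by blast
  define lam where "lam = gb G (fst q0) (snd q0) (snd q0)"
  have lam0: "lam > 0" unfolding lam_def using q0(1) R(2) by (intro pos) (auto simp: mem_Times_iff)
  have lam: "lam * (norm v)\<^sup>2 \<le> gb G p v v" if "p \<in> cball z R" for p v
  proof (cases "v = 0")
    case False
    have "lam \<le> gb G p (v /\<^sub>R norm v) (v /\<^sub>R norm v)"
      using q0(2)[of "(p, v /\<^sub>R norm v)"] that False by (simp add: lam_def)
    then show ?thesis using False by (simp add: blinfun.bilinear_simps power2_eq_square field_simps)
  qed (simp add: blinfun.bilinear_simps)
  \<comment> \<open>\<open>R / 6\<close> keeps the large ball inside, \<open>1 / (96 * C)\<close> is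
    for solving the boundary value problem, and \<open>lam / (24 * C)\<close> is the minimality
    condition for speed \<open>4 * r\<close>. The bound 1 keeps that speed at most 4.\<close>
  define r where "r = min (min 1 (R / 6)) (min (1 / (96 * C)) (lam / (24 * C)))"
  have rle: "r \<le> 1" "r \<le> R / 6" "r \<le> 1 / (96 * C)" "r \<le> lam / (24 * C)" by (auto simp: r_def)
  have r: "0 < r" "r \<le> 1" "6 * r \<le> R" "96 * C * r \<le> 1" "24 * C * r \<le> lam"
    using R(1) C(1) lam0 rle by (auto simp: r_def) (simp_all add: field_simps)
  have sub: "cball z (6 * r) \<subseteq> cball z R" using r by auto
  have "good_ball U G z r lam B5"
    unfolding good_ball_def
  proof (intro conjI ballI allI)
    show "0 < r" "0 < lam" "cball z (6 * r) \<subseteq> U" using r lam0 sub R by auto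
    fix p assume p: "p \<in> cball z (6 * r)"
    show "lam * (norm v)\<^sup>2 \<le> gb G p v v" for v using lam p sub by blast
    show "gb G p v v \<le> B5 * (norm v)\<^sup>2" for v
    proof -
      have "norm (gb G p v v) \<le> norm (gb G p) * norm v * norm v"
        by (rule norm_blinfun2)
      also have "\<dots> \<le> B5 * norm v * norm v" using B(5) p sub by (intro mult_right_mono) auto
      finally show ?thesis by (simp add: power2_eq_square)
    qed
    have "norm (chr G p) * (8 * r) \<le> C * (8 * r)" using order_trans[OF _ C(2)] B(1) p sub r by (intro mult_right_mono) (blast, simp)
    also have "\<dots> \<le> 1" using r C by (simp add: algebra_simps)
    finally show "norm (chr G p) * (8 * r) \<le> 1" .
  next
    fix a b assume ab: "a \<in> cball z r" "b \<in> cball z r"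
    have cb: "norm (chr G p) \<le> C" "norm (Dbl (chr G) p) \<le> C" "norm (Dbl (gb G) p) \<le> C" "norm (Dbl (Dbl (gb G)) p) \<le> C"
      if "p \<in> cball z (6 * r)" for p using B C sub that by (meson order_trans subsetD)+
    obtain x x' where x: "geodesic01 U G x x'" "x 0 = a" "x 1 = b" "\<forall>t\<in>{0..1}. x t \<in> cball z (5 * r) \<and> norm (x' t) \<le> 4 * r"
      using geodesic_bvp[of z r C a b] sub R r cb ab by blast
    have xK: "x t \<in> cball z (6 * r)" if "t \<in> {0..1}" for t
      using x(4) that r(1) by (auto intro: order_trans[of _ "5 * r"])
    have lam': "lam * (norm v)\<^sup>2 \<le> gb G p v v" if "p \<in> cball z (6 * r)" for p v using lam that sub by blast
    have "energy G x x' \<le> energy G y y'" if "C1_curve y y' \<and> (\<forall>t\<in>{0..1}. y t \<in> cball z (6 * r)) \<and> y 0 = a \<and> y 1 = b" for y y'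
      by (rule geodesic_minimal[of x x' "cball z (6 * r)" "4 * r" y y' lam C])
         (use x that r sub R lam' cb xK in \<open>simp_all del: mem_cball\<close>)
    then show "\<exists>x x'. geodesic01 U G x x' \<and> x 0 = a \<and> x 1 = b \<and>
       (\<forall>t\<in>{0..1}. x t \<in> cball z (5 * r) \<and> norm (x' t) \<le> 4 * r) \<and>
       (\<forall>y y'. C1_curve y y' \<and> (\<forall>t\<in>{0..1}. y t \<in> cball z (6 * r)) \<and> y 0 = a \<and> y 1 = b \<longrightarrow> energy G x x' \<le> energy G y y')"
      using x by blast
  qed
  then show ?thesis by blast
qed

section \<open>A fixed vector of an isometry\<close>

definition outer :: "real^'n \<Rightarrow> real^'n \<Rightarrow> real^'n^'n"
  where "outer u v = (\<chi> i j. u $ i * v $ j)"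

lemma outer_mult_vec: "outer u v *v w = (v \<bullet> w) *\<^sub>R u"
  by (simp add: outer_def matrix_vector_mult_def inner_vec_def vec_eq_iff sum_distrib_left mult_ac)

text \<open>The map w -> w - 2 (v . w) u negates \<open>u\<close> and fixes the kernel of
  \<open>v\<close>. In a basis adapted to this splitting it is diagonal with a single entry
  -1.\<close>

lemma det_reflection:
  fixes u v :: "real^'n"
  assumes "v \<bullet> u = 1"
  shows "det (mat 1 - 2 *\<^sub>R outer u v) = -1"
proof -
  let ?R = "mat 1 - 2 *\<^sub>R outer u v"
  have "u \<noteq> 0" using assms by auto
  then obtain k where k: "u $ k \<noteq> 0" by (auto simp: vec_eq_iff)
  \<comment> \<open>Since \<open>u $ k\<close> is nonzero, \<open>u\<close> may replace the k-th
    basis vector; every other basis vector is projected along \<open>u\<close> into the kernel of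
    \<open>v\<close>.\<close>
  define c where "c j = (if j = k then u else axis j 1 - v $ j *\<^sub>R u)" for j
  define Q :: "real^'n^'n" where "Q = (\<chi> i j. c j $ i)"
  define D :: "real^'n^'n" where "D = (\<chi> i j. if i = j then (if i = k then -1 else 1) else 0)"
  have Qax: "Q *v axis j 1 = c j" for j
    by (simp add: Q_def matrix_vector_mult_basis column_def vec_eq_iff)
  have Dax: "D *v axis j 1 = (if j = k then -1 else 1) *\<^sub>R axis j 1" for j
    by (simp only: matrix_vector_mult_basis) (auto simp: D_def column_def vec_eq_iff axis_def)
  have R: "?R *v w = w - (2 * (v \<bullet> w)) *\<^sub>R u" for w
    by (simp add: matrix_vector_mult_diff_rdistrib scaleR_matrix_vector_assoc[symmetric] outer_mult_vec)
  have vc: "v \<bullet> c j = (if j = k then 1 else 0)" for j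
    using assms by (simp add: c_def inner_diff_right inner_axis)
  have "(?R ** Q) *v axis j 1 = (Q ** D) *v axis j 1" for j
  proof -
    have "(?R ** Q) *v axis j 1 = c j - (2 * (v \<bullet> c j)) *\<^sub>R u" by (simp only: matrix_vector_mul_assoc[symmetric] Qax R)
    moreover have "(Q ** D) *v axis j 1 = (if j = k then -1 else 1) *\<^sub>R c j"
      by (simp only: matrix_vector_mul_assoc[symmetric] Qax Dax matrix_vector_mult_scaleR)
    moreover have "c j - (2 * (v \<bullet> c j)) *\<^sub>R u = (if j = k then -1 else 1) *\<^sub>R c j"
    proof (cases "j = k")
      case True
      then have "c j = u" by (simp add: c_def)
      then show ?thesis using True vc[of j] by (simp add: scaleR_2)
    next
      case False
      then show ?thesis using vc[of j] by simp
    qed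
    ultimately show ?thesis by (simp only:)
  qed
  then have "(?R ** Q) *v w = (Q ** D) *v w" for w
    using linear_eq_axis[OF matrix_vector_mul_linear matrix_vector_mul_linear, of "?R ** Q" "Q ** D" w] by simp
  then have RQ: "?R ** Q = Q ** D" by (simp add: matrix_eq)
  have "det Q \<noteq> 0"
  proof
    assume "det Q = 0"
    then obtain w where w: "w \<noteq> 0" "Q *v w = 0"
      using matrix_left_invertible_ker[of Q] invertible_det_nz[of Q] invertible_left_inverse[of Q] by metis
    have e: "Q *v w = (\<Sum>j\<in>UNIV. w $ j *\<^sub>R c j)"
      using matrix_mult_sum[of Q w] by (simp add: Q_def column_def scalar_mult_eq_scaleR)
    have "v \<bullet> (Q *v w) = w $ k" unfolding e by (simp add: inner_sum_right vc if_distrib[of "\<lambda>r. _ * r"] cong: if_cong)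
    then have wk: "w $ k = 0" using w by simp
    have "w $ j *\<^sub>R c j = w $ j *\<^sub>R (axis j 1 - v $ j *\<^sub>R u)" for j using wk by (auto simp: c_def)
    then have "Q *v w = (\<Sum>j\<in>UNIV. w $ j *\<^sub>R axis j 1) - (\<Sum>j\<in>UNIV. w $ j * v $ j) *\<^sub>R u"
      unfolding e by (simp add: scaleR_diff_right sum_subtractf scaleR_sum_left)
    also have "(\<Sum>j\<in>UNIV. w $ j *\<^sub>R axis j 1) = w"
      using basis_expansion[of w] by (simp add: scalar_mult_eq_scaleR)
    finally have wu: "w = (\<Sum>j\<in>UNIV. w $ j * v $ j) *\<^sub>R u" using w by simp
    have "w $ k = (\<Sum>j\<in>UNIV. w $ j * v $ j) * u $ k" using arg_cong[OF wu, of "\<lambda>z. z $ k"] by simp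
    then have "(\<Sum>j\<in>UNIV. w $ j * v $ j) = 0" using wk k by simp
    then show False using wu w(1) by (metis scaleR_zero_left)
  qed
  moreover have "det D = (\<Prod>i\<in>UNIV. D $ i $ i)" by (rule det_diagonal) (simp add: D_def)
  moreover have "(\<Prod>i\<in>UNIV. D $ i $ i) = -1"
    by (simp add: D_def prod.delta)
  ultimately show ?thesis using arg_cong[OF RQ, of det] mult_right_cancel[of "det Q" "det ?R" "-1"] by (simp add: det_mul)
qed

lemma det_uminus: "det (- A :: real^'n^'n) = (-1) ^ CARD('n) * det A"
proof -
  have "- A = mat (-1) ** A"
    by (simp add: matrix_matrix_mult_def mat_def vec_eq_iff if_distrib[of "\<lambda>r. r * _"] sum.delta cong: if_cong)
  moreover have "det (mat (-1) :: real^'n^'n) = (-1) ^ CARD('n)"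
    by (subst det_diagonal) (simp_all add: mat_def)
  ultimately show ?thesis by (simp add: det_mul)
qed

text \<open>A kernel vector of \<open>N\<close> is fixed by \<open>H\<close> and orthogonal to
  \<open>T\<close>, so it is what is sought. If there is none, \<open>N\<close> is invertible, and
  the determinant of the identity below, in which a reflection of determinant -1 appears, forces
  \<open>det H\<close> to be the excluded value.\<close>

lemma isometry_fixed_vector:
  fixes H S :: "real^'n^'n"
  assumes iso: "transpose H ** S ** H = S" and S: "transpose S = S" "det S \<noteq> 0"
    and T: "H *v T = T" "T \<bullet> (S *v T) = 1"
    and det: "det H \<noteq> - ((-1) ^ CARD('n))"
  shows "\<exists>w. w \<noteq> 0 \<and> H *v w = w \<and> w \<bullet> (S *v T) = 0"
proof (rule ccontr)
  assume no: "\<not> ?thesis"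
  define s where "s = S *v T"
  \<comment> \<open>The rank-one term raises \<open>mat 1 - H\<close> by the projection onto
    \<open>T\<close>: pairing \<open>N *v w\<close> with \<open>s\<close> gives the T-component of
    \<open>w\<close> alone, because \<open>H\<close> preserves \<open>s\<close>.\<close>
  define N where "N = mat 1 - H + outer T s"
  have Sdot: "a \<bullet> (S *v b) = (S *v a) \<bullet> b" for a b
    by (metis S(1) dot_lmul_matrix vector_transpose_matrix)
  have HS: "transpose H *v s = s"
  proof -
    have "transpose H *v (S *v (H *v T)) = S *v T" using iso by (metis matrix_vector_mul_assoc)
    then show ?thesis by (simp add: T s_def)
  qed
  have detN: "det N \<noteq> 0"
  proof
    assume "det N = 0"
    then obtain w where w: "w \<noteq> 0" "N *v w = 0"
      using matrix_left_invertible_ker[of N] invertible_det_nz[of N] invertible_left_inverse[of N] by metis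
    have Nw: "N *v w = w - H *v w + (s \<bullet> w) *\<^sub>R T"
      by (simp add: N_def matrix_vector_mult_diff_rdistrib matrix_vector_mult_add_rdistrib outer_mult_vec)
    have "s \<bullet> (H *v w) = (transpose H *v s) \<bullet> w"
      by (metis dot_lmul_matrix vector_transpose_matrix transpose_transpose)
    then have "s \<bullet> (H *v w) = s \<bullet> w" unfolding HS .
    moreover have "s \<bullet> T = 1" using T(2) by (simp add: s_def inner_commute)
    ultimately have "s \<bullet> (N *v w) = s \<bullet> w" by (simp add: Nw inner_add_right inner_diff_right)
    then have "s \<bullet> w = 0" using w by simp
    then have "H *v w = w" "w \<bullet> s = 0" using Nw w by (simp_all add: inner_commute)
    then show False using no w(1) by (auto simp: s_def)
  qed
  \<comment> \<open>Applied to \<open>w\<close>, both sides are \<open>transpose H *v (S *v w) - S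
    *v w + (s \<bullet> w) *\<^sub>R s\<close>. On the right the reflection corrects the sign of the
    last term, which would otherwise be negative.\<close>
  have "transpose H ** S ** N = - (transpose N ** S ** (mat 1 - 2 *\<^sub>R outer T s))"
  proof -
    have tN: "transpose N *v w = w - transpose H *v w + (T \<bullet> w) *\<^sub>R s" for w
    proof -
      have "transpose N = mat 1 - transpose H + outer s T"
        by (simp add: N_def transpose_def vec_eq_iff outer_def mat_def)
      then show ?thesis by (simp add: matrix_vector_mult_diff_rdistrib matrix_vector_mult_add_rdistrib outer_mult_vec)
    qed
    have "(transpose H ** S ** N) *v w = (- (transpose N ** S ** (mat 1 - 2 *\<^sub>R outer T s))) *v w" for w
    proof -
      have Hs: "transpose H *v (S *v (H *v w)) = S *v w" using iso by (metis matrix_vector_mul_assoc)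
      have l: "(transpose H ** S ** N) *v w = transpose H *v (S *v w) - S *v w + (s \<bullet> w) *\<^sub>R s"
      proof -
        have "(transpose H ** S ** N) *v w = transpose H *v (S *v (w - H *v w + (s \<bullet> w) *\<^sub>R T))"
          by (simp add: matrix_vector_mul_assoc[symmetric] N_def matrix_vector_mult_diff_rdistrib matrix_vector_mult_add_rdistrib outer_mult_vec)
        also have "\<dots> = transpose H *v (S *v w) - S *v w + (s \<bullet> w) *\<^sub>R s"
          using HS by (simp add: matrix_vector_right_distrib matrix_vector_mult_diff_distrib matrix_vector_mult_scaleR Hs s_def del: transpose_matrix_vector)
        finally show ?thesis .
      qed
      have "(transpose N ** S ** (mat 1 - 2 *\<^sub>R outer T s)) *v w = transpose N *v (S *v (w - (2 * (s \<bullet> w)) *\<^sub>R T))"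
        by (simp add: matrix_vector_mul_assoc[symmetric] matrix_vector_mult_diff_rdistrib scaleR_matrix_vector_assoc[symmetric] outer_mult_vec)
      also have "\<dots> = transpose N *v (S *v w) - (2 * (s \<bullet> w)) *\<^sub>R (transpose N *v s)"
        by (simp add: matrix_vector_mult_diff_distrib matrix_vector_mult_scaleR s_def)
      also have "transpose N *v s = s" by (simp add: tN HS T(2)[folded s_def] del: transpose_matrix_vector)
      also have "transpose N *v (S *v w) = S *v w - transpose H *v (S *v w) + (s \<bullet> w) *\<^sub>R s"
        by (simp add: tN Sdot s_def del: transpose_matrix_vector)
      finally have r: "(transpose N ** S ** (mat 1 - 2 *\<^sub>R outer T s)) *v w = S *v w - transpose H *v (S *v w) - (s \<bullet> w) *\<^sub>R s"
        by (simp add: vec_eq_iff algebra_simps del: transpose_matrix_vector)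
      have neg: "(- A) *v w = - (A *v w)" for A :: "real^'n^'n"
        by (simp add: matrix_vector_mult_def vec_eq_iff sum_negf)
      show ?thesis unfolding l neg r by simp
    qed
    then show ?thesis by (simp add: matrix_eq)
  qed
  then have "det H * det S * det N = det (- (transpose N ** S ** (mat 1 - 2 *\<^sub>R outer T s)))"
    by (metis det_mul det_transpose)
  also have "\<dots> = (-1) ^ CARD('n) * det (transpose N ** S ** (mat 1 - 2 *\<^sub>R outer T s))"
    by (rule det_uminus)
  also have "\<dots> = (-1) ^ CARD('n) * (det N * det S * (-1))"
    using T(2) by (simp add: det_mul det_transpose det_reflection s_def inner_commute)
  finally have "(det H + (-1) ^ CARD('n)) * (det S * det N) = 0" by (simp add: algebra_simps)
  then have "det H = - ((-1) ^ CARD('n))" using detN S(2) by (simp add: eq_neg_iff_add_eq_0)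
  then show False using det by simp
qed

section \<open>Variations of the energy\<close>

text \<open>A negative second derivative would make the first derivative negative just to the right
  of 0, and by the mean value theorem the function would drop below its minimum there.\<close>

lemma second_derivative_test:
  fixes E :: "real \<Rightarrow> real"
  assumes d: "d > 0" and E1: "\<And>s. s \<in> {-d..d} \<Longrightarrow> (E has_real_derivative E1 s) (at s within {-d..d})"
    and E2: "(E1 has_real_derivative e2) (at 0 within {-d..d})"
    and min: "\<And>s. s \<in> {-d..d} \<Longrightarrow> E 0 \<le> E s"
  shows "E1 0 = 0" "0 \<le> e2"
proof -
  have at: "at s within {-d..d} = at s" if "s \<in> {-d<..<d}" for s
    by (rule at_within_interior) (use that in auto)
  have 1: "DERIV E s :> E1 s" if "s \<in> {-d<..<d}" for s using E1[of s] at[OF that] that by auto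
  have 2: "DERIV E1 0 :> e2" using E2 at[of 0] d by simp
  show E10: "E1 0 = 0"
  proof (rule DERIV_local_min[OF 1[of 0] d])
    show "\<forall>y. \<bar>0 - y\<bar> < d \<longrightarrow> E 0 \<le> E y" using min by (auto simp: abs_less_iff)
  qed (use d in auto)
  show "0 \<le> e2"
  proof (rule ccontr)
    assume "\<not> 0 \<le> e2"
    from DERIV_neg_dec_right[OF 2] this obtain d' where d': "d' > 0" "\<And>h. 0 < h \<Longrightarrow> h < d' \<Longrightarrow> E1 h < 0"
      using E10 by auto
    define h where "h = min d d' / 2"
    have h: "0 < h" "h < d" "h < d'" using d d' by (auto simp: h_def)
    obtain z where z: "0 < z" "z < h" "E h - E 0 = (h - 0) * E1 z"
      using MVT2[of 0 h E E1] h 1 by auto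
    have "E1 z < 0" using d' z h by auto
    then have "E h < E 0" using z(3) h mult_pos_neg[of h "E1 z"] by simp
    then show False using min[of h] h by auto
  qed
qed

context lmetric begin

text \<open>The variation \<open>x t + s *\<^sub>R V t\<close> moves the right end along a straight
  line, while the gluing maps prescribe a curved path. The term \<open>t *\<^sub>R q s\<close> bends
  that end and leaves the left end alone. Both derivatives are taken under the integral
  sign.\<close>

lemma energy_variation:
  fixes x x' V V' :: "real \<Rightarrow> real^'n" and q q1 q2 :: "real \<Rightarrow> real^'n"
  defines "Y \<equiv> \<lambda>s t. x t + s *\<^sub>R V t + t *\<^sub>R q s"
    and "Y' \<equiv> \<lambda>s t. x' t + s *\<^sub>R V' t + q s"
    and "Ys \<equiv> \<lambda>s t. V t + t *\<^sub>R q1 s"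
    and "Ys' \<equiv> \<lambda>s t. V' t + q1 s"
  defines "E1 \<equiv> \<lambda>s. integral {0..1} (\<lambda>t. Dbl (gb G) (Y s t) (Ys s t) (Y' s t) (Y' s t) + 2 * gb G (Y s t) (Y' s t) (Ys' s t))"
    and "E2 \<equiv> \<lambda>s. integral {0..1} (\<lambda>t. Dbl (Dbl (gb G)) (Y s t) (Ys s t) (Ys s t) (Y' s t) (Y' s t)
       + Dbl (gb G) (Y s t) (t *\<^sub>R q2 s) (Y' s t) (Y' s t) + 4 * Dbl (gb G) (Y s t) (Ys s t) (Y' s t) (Ys' s t)
       + 2 * gb G (Y s t) (Ys' s t) (Ys' s t) + 2 * gb G (Y s t) (Y' s t) (q2 s))"
  assumes d: "d > 0" and x: "C1_curve x x'" and V: "C1_curve V V'"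
    and q: "\<And>s. s \<in> {-d..d} \<Longrightarrow> (q has_vector_derivative q1 s) (at s within {-d..d})"
       "\<And>s. s \<in> {-d..d} \<Longrightarrow> (q1 has_vector_derivative q2 s) (at s within {-d..d})"
       "continuous_on {-d..d} q2"
    and Y: "\<And>s t. s \<in> {-d..d} \<Longrightarrow> t \<in> {0..1} \<Longrightarrow> Y s t \<in> U"
    and s: "s \<in> {-d..d}"
  shows "((\<lambda>s. energy G (Y s) (Y' s)) has_real_derivative E1 s) (at s within {-d..d})"
    and "(E1 has_real_derivative E2 s) (at s within {-d..d})"
proof -
  let ?I = "{-d..d}" and ?T = "cbox 0 (1::real)"
  have T: "?T = {0..1}" by simp
  have cq: "continuous_on ?I q" "continuous_on ?I q1" by (rule continuous_on_vector_derivative[OF q(1)], assumption, rule continuous_on_vector_derivative[OF q(2)])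
  note cx = C1_curve_continuous[OF x] C1_curve_continuous[OF V]
  have cY: "continuous_on (?I \<times> ?T) (\<lambda>p. Y (fst p) (snd p))" "continuous_on (?I \<times> ?T) (\<lambda>p. Y' (fst p) (snd p))"
     "continuous_on (?I \<times> ?T) (\<lambda>p. Ys (fst p) (snd p))" "continuous_on (?I \<times> ?T) (\<lambda>p. Ys' (fst p) (snd p))"
     "continuous_on (?I \<times> ?T) (\<lambda>p. q2 (fst p))"
    unfolding Y_def Y'_def Ys_def Ys'_def
    by (intro continuous_intros continuous_on_compose2[OF cx(1)] continuous_on_compose2[OF cx(2)] continuous_on_compose2[OF cx(3)]
        continuous_on_compose2[OF cx(4)] continuous_on_compose2[OF cq(1)] continuous_on_compose2[OF cq(2)] continuous_on_compose2[OF q(3)]; auto)+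
  have YU: "(\<lambda>p. Y (fst p) (snd p)) ` (?I \<times> ?T) \<subseteq> U" using Y by auto
  have cG: "continuous_on (?I \<times> ?T) (\<lambda>p. gb G (Y (fst p) (snd p)))"
    "continuous_on (?I \<times> ?T) (\<lambda>p. Dbl (gb G) (Y (fst p) (snd p)))"
    "continuous_on (?I \<times> ?T) (\<lambda>p. Dbl (Dbl (gb G)) (Y (fst p) (snd p)))"
    by (rule continuous_on_compose2[OF _ cY(1) YU]; 
        intro smooth_on_continuous smooth_gb smooth_on_Dbl[OF open_U] smooth_on_Dbl[OF open_U smooth_on_Dbl[OF open_U]])+
  have c0: "continuous_on {0..1} (\<lambda>t. gb G (Y s t) (Y' s t) (Y' s t))" 
    and c1: "continuous_on {0..1} (\<lambda>t. Dbl (gb G) (Y s t) (Ys s t) (Y' s t) (Y' s t) + 2 * gb G (Y s t) (Y' s t) (Ys' s t))"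
    if "s \<in> ?I" for s
  proof -
    have c2: "continuous_on {0..1} (\<lambda>t. F (s, t))" if "continuous_on (?I \<times> ?T) F" for F :: "real \<times> real \<Rightarrow> real"
      by (rule continuous_on_compose2[OF that]) (use \<open>s \<in> ?I\<close> in \<open>auto intro!: continuous_intros\<close>)
    show "continuous_on {0..1} (\<lambda>t. gb G (Y s t) (Y' s t) (Y' s t))"
      apply (rule c2[of "\<lambda>p. gb G (Y (fst p) (snd p)) (Y' (fst p) (snd p)) (Y' (fst p) (snd p))", unfolded fst_conv snd_conv])
      apply (intro continuous_intros cG cY)
      done
    show "continuous_on {0..1} (\<lambda>t. Dbl (gb G) (Y s t) (Ys s t) (Y' s t) (Y' s t) + 2 * gb G (Y s t) (Y' s t) (Ys' s t))"
      apply (rule c2[of "\<lambda>p. Dbl (gb G) (Y (fst p) (snd p)) (Ys (fst p) (snd p)) (Y' (fst p) (snd p)) (Y' (fst p) (snd p)) + 2 * gb G (Y (fst p) (snd p)) (Y' (fst p) (snd p)) (Ys' (fst p) (snd p))", unfolded fst_conv snd_conv])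
      apply (intro continuous_intros cG cY)
      done
  qed
  have vY: "((\<lambda>s. Y s t) has_vector_derivative Ys s t) (at s within ?I)"
    "((\<lambda>s. Y' s t) has_vector_derivative Ys' s t) (at s within ?I)"
    "((\<lambda>s. Ys s t) has_vector_derivative t *\<^sub>R q2 s) (at s within ?I)"
    "((\<lambda>s. Ys' s t) has_vector_derivative q2 s) (at s within ?I)"
    if "s \<in> ?I" for s t
    unfolding Y_def Y'_def Ys_def Ys'_def using q(1,2)[OF that]
    by (auto intro!: derivative_eq_intros)
  have d1: "((\<lambda>s. gb G (Y s t) (Y' s t) (Y' s t)) has_real_derivative
      Dbl (gb G) (Y s t) (Ys s t) (Y' s t) (Y' s t) + 2 * gb G (Y s t) (Y' s t) (Ys' s t)) (at s within ?I)"
    if "s \<in> ?I" "t \<in> ?T" for s t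
    using gb_vd[of "\<lambda>s. Y s t" s "Ys s t" ?I "\<lambda>s. Y' s t" "Ys' s t" "\<lambda>s. Y' s t" "Ys' s t", OF _ vY(1,2,2)[OF that(1)]] Y that
      sym[OF Y[OF that(1)], of t "Ys' s t" "Y' s t"]
    by (simp add: has_real_derivative_iff_has_vector_derivative add.commute)
  have d2: "((\<lambda>s. Dbl (gb G) (Y s t) (Ys s t) (Y' s t) (Y' s t) + 2 * gb G (Y s t) (Y' s t) (Ys' s t)) has_real_derivative
      Dbl (Dbl (gb G)) (Y s t) (Ys s t) (Ys s t) (Y' s t) (Y' s t)
       + Dbl (gb G) (Y s t) (t *\<^sub>R q2 s) (Y' s t) (Y' s t) + 4 * Dbl (gb G) (Y s t) (Ys s t) (Y' s t) (Ys' s t)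
       + 2 * gb G (Y s t) (Ys' s t) (Ys' s t) + 2 * gb G (Y s t) (Y' s t) (q2 s)) (at s within ?I)"
    if st: "s \<in> ?I" "t \<in> ?T" for s t
  proof -
    have YU: "Y s t \<in> U" using Y st by simp
    note v = vY[OF st(1), of t, unfolded has_vector_derivative_def]
    have 1: "((\<lambda>s. Dbl (gb G) (Y s t)) has_derivative (\<lambda>h. Dbl (Dbl (gb G)) (Y s t) (h *\<^sub>R Ys s t))) (at s within ?I)"
      using has_derivative_compose[OF v(1) has_derivative_Dgb[OF YU]] .
    note 2 = bounded_bilinear.FDERIV[OF bounded_bilinear_blinfun_apply 1 v(3)]
    note 3 = bounded_bilinear.FDERIV[OF bounded_bilinear_blinfun_apply 2 v(2)]
    note 4 = bounded_bilinear.FDERIV[OF bounded_bilinear_blinfun_apply 3 v(2)]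
    have 5: "((\<lambda>s. gb G (Y s t) (Y' s t) (Ys' s t)) has_vector_derivative
      Dbl (gb G) (Y s t) (Ys s t) (Y' s t) (Ys' s t) + gb G (Y s t) (Ys' s t) (Ys' s t) + gb G (Y s t) (Y' s t) (q2 s)) (at s within ?I)"
      by (rule gb_vd[of "\<lambda>s. Y s t" s "Ys s t" ?I "\<lambda>s. Y' s t" "Ys' s t" "\<lambda>s. Ys' s t" "q2 s", OF YU vY(1,2,4)[OF st(1)]])
    show ?thesis
      unfolding has_field_derivative_def
    proof (rule has_derivative_eq_rhs[OF has_derivative_add[OF 4 has_derivative_mult_right[OF 5[unfolded has_vector_derivative_def]]]], rule ext)
      fix h
      have alg: "h * C + (h * C + (h * (t * B) + h * A)) + 2 * (h * (C + D + E)) = (A + t * B + 4 * C + 2 * D + 2 * E) * h"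
        for A B C D E :: real by (simp add: algebra_simps)
      show "(blinfun_apply (blinfun_apply (Dbl (gb G) (Y s t)) (Ys s t)) (Y' s t)) (h *\<^sub>R Ys' s t) +
        (blinfun_apply (blinfun_apply (Dbl (gb G) (Y s t)) (Ys s t)) (h *\<^sub>R Ys' s t) +
         blinfun_apply (Dbl (gb G) (Y s t) (h *\<^sub>R (t *\<^sub>R q2 s)) + Dbl (Dbl (gb G)) (Y s t) (h *\<^sub>R Ys s t) (Ys s t)) (Y' s t)) (Y' s t) +
        2 * (h *\<^sub>R (Dbl (gb G) (Y s t) (Ys s t) (Y' s t) (Ys' s t) + gb G (Y s t) (Ys' s t) (Ys' s t) + gb G (Y s t) (Y' s t) (q2 s))) =
        (Dbl (Dbl (gb G)) (Y s t) (Ys s t) (Ys s t) (Y' s t) (Y' s t)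
       + Dbl (gb G) (Y s t) (t *\<^sub>R q2 s) (Y' s t) (Y' s t) + 4 * Dbl (gb G) (Y s t) (Ys s t) (Y' s t) (Ys' s t)
       + 2 * gb G (Y s t) (Ys' s t) (Ys' s t) + 2 * gb G (Y s t) (Y' s t) (q2 s)) * h"
        by (simp only: blinfun.add_left blinfun.scaleR_left blinfun.scaleR_right Dgb_sym[OF YU, of _ "Ys' s t" "Y' s t"] real_scaleR_def alg)
    qed
  qed
  show "((\<lambda>s. energy G (Y s) (Y' s)) has_real_derivative E1 s) (at s within ?I)"
    unfolding energy_def E1_def T[symmetric]
  proof (rule leibniz_rule_field_derivative[OF d1 _ _ s])
    show "(\<lambda>t. gb G (Y s t) (Y' s t) (Y' s t)) integrable_on ?T" if "s \<in> ?I" for s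
      unfolding T by (rule integrable_continuous_interval[OF c0[OF that]])
    show "continuous_on (?I \<times> ?T) (\<lambda>(s, t). Dbl (gb G) (Y s t) (Ys s t) (Y' s t) (Y' s t) + 2 * gb G (Y s t) (Y' s t) (Ys' s t))"
      unfolding split_beta by (intro continuous_intros cG cY)
  qed auto
  show "(E1 has_real_derivative E2 s) (at s within ?I)"
    unfolding E1_def E2_def T[symmetric]
  proof (rule leibniz_rule_field_derivative[OF d2 _ _ s])
    show "(\<lambda>t. Dbl (gb G) (Y s t) (Ys s t) (Y' s t) (Y' s t) + 2 * gb G (Y s t) (Y' s t) (Ys' s t)) integrable_on ?T" if "s \<in> ?I" for s
      unfolding T by (rule integrable_continuous_interval[OF c1[OF that]])
    show "continuous_on (?I \<times> ?T) (\<lambda>(s, t). Dbl (Dbl (gb G)) (Y s t) (Ys s t) (Ys s t) (Y' s t) (Y' s t)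
       + Dbl (gb G) (Y s t) (t *\<^sub>R q2 s) (Y' s t) (Y' s t) + 4 * Dbl (gb G) (Y s t) (Ys s t) (Y' s t) (Ys' s t)
       + 2 * gb G (Y s t) (Ys' s t) (Ys' s t) + 2 * gb G (Y s t) (Y' s t) (q2 s))"
      unfolding split_beta by (intro continuous_intros cG cY)
  qed auto
qed

text \<open>Covariant form of the second derivative of the energy density.
  \<open>W + chr G p X V\<close> is the covariant derivative of the variation field; along a
  geodesic the last group is twice the derivative of g(X, Z + chr V V), hence contributes only
  boundary terms.\<close>

lemma second_variation_pointwise:
  assumes p: "p \<in> U"
  shows "Dbl (Dbl (gb G)) p V V X X + Dbl (gb G) p Z X X + 4 * Dbl (gb G) p V X W + 2 * gb G p W W + 2 * gb G p X Z'
   = 2 * gb G p (W + chr G p X V) (W + chr G p X V) - 2 * gb G p (Rm G p V X X) V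
    + 2 * (Dbl (gb G) p X X (Z + chr G p V V) + gb G p (- chr G p X X) (Z + chr G p V V)
       + gb G p X (Z' + (Dbl (chr G) p X V V + chr G p W V + chr G p V W)))"
proof -
  have r: "gb G p (Rm G p V X X) V = - gb G p (Rm G p V X V) X"
    using Rm_antisym[OF p, of V X V X] sym[OF p, of V "Rm G p V X X"] by simp
  show ?thesis unfolding r
    by (simp add: D2gb[OF p] metric_compat[OF p] Rm_def blinfun.bilinear_simps arg_cong[OF chr_sym[OF p, of W V], of "gb G p X"] chr_sym[OF p, of X V] chr_sym[OF p, of X Z]
       Dchr_sym[OF p, of V X V] sym[OF p, of W "chr G p V X"] sym[OF p, of "chr G p V W" X] sym[OF p, of "chr G p Z X" X]
       sym[OF p, of "chr G p V (chr G p V X)" X] sym[OF p, of "Dbl (chr G) p V V X" X]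
       sym[OF p, of "Dbl (chr G) p X V V" X] sym[OF p, of "chr G p X (chr G p V V)" X])
qed

lemma continuous_on_curvature:
  assumes "\<And>t. t \<in> {0..1} \<Longrightarrow> x t \<in> U" "continuous_on {0..1} x" "continuous_on {0..1} X" "continuous_on {0..1} P"
  shows "continuous_on {0..1::real} (\<lambda>t. gb G (x t) (Rm G (x t) (P t) (X t) (X t)) (P t))"
proof -
  have c: "continuous_on {0..1} (\<lambda>t. gb G (x t))" "continuous_on {0..1} (\<lambda>t. chr G (x t))" "continuous_on {0..1} (\<lambda>t. Dbl (chr G) (x t))"
    by (rule continuous_on_compose2[OF continuous_on_Rm(3) assms(2)] continuous_on_compose2[OF continuous_on_Rm(2) assms(2)]
        continuous_on_compose2[OF continuous_on_Rm(1) assms(2)]; use assms(1) in auto)+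
  show ?thesis unfolding Rm_def by (intro continuous_intros c assms)
qed

text \<open>As \<open>P\<close> is parallel of unit length, the covariant derivative of
  \<open>V\<close> is \<open>\<phi>' t *\<^sub>R P t\<close>, which reduces the integral to a scalar
  expression. The boundary terms pair the velocity with the covariant accelerations of the end
  points.\<close>

lemma second_variation:
  fixes x x' P :: "real \<Rightarrow> real^'n" and \<phi> \<phi>' :: "real \<Rightarrow> real"
  defines "V \<equiv> \<lambda>t. \<phi> t *\<^sub>R P t" and "V' \<equiv> \<lambda>t. \<phi>' t *\<^sub>R P t - \<phi> t *\<^sub>R chr G (x t) (x' t) (P t)"
  assumes x: "geodesic01 U G x x'" and \<phi>: "C1_curve \<phi> \<phi>'"
    and P: "\<And>t. t \<in> {0..1} \<Longrightarrow> (P has_vector_derivative - chr G (x t) (x' t) (P t)) (at t within {0..1})"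
      "\<And>t. t \<in> {0..1} \<Longrightarrow> gb G (x t) (P t) (P t) = 1"
  shows "C1_curve V V'"
    and "integral {0..1} (\<lambda>t. Dbl (Dbl (gb G)) (x t) (V t) (V t) (x' t) (x' t) + Dbl (gb G) (x t) (t *\<^sub>R Z) (x' t) (x' t)
        + 4 * Dbl (gb G) (x t) (V t) (x' t) (V' t) + 2 * gb G (x t) (V' t) (V' t) + 2 * gb G (x t) (x' t) Z)
     = 2 * integral {0..1} (\<lambda>t. (\<phi>' t)\<^sup>2 - (\<phi> t)\<^sup>2 * gb G (x t) (Rm G (x t) (P t) (x' t) (x' t)) (P t))
      + 2 * gb G (x 1) (x' 1) (Z + chr G (x 1) (V 1) (V 1)) - 2 * gb G (x 0) (x' 0) (chr G (x 0) (V 0) (V 0))"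
proof -
  have xU: "x t \<in> U" if "t \<in> {0..1}" for t using x that by (simp add: geodesic01_def)
  note xC = geodesic01_C1[OF x]
  have cP: "continuous_on {0..1} P" by (rule continuous_on_vd[OF P(1)])
  have cchr: "continuous_on {0..1} (\<lambda>t. chr G (x t))"
    by (rule continuous_on_compose2[OF continuous_on_Rm(2) C1_curve_continuous(1)[OF xC]]) (use xU in auto)
  have vV: "(V has_vector_derivative V' t) (at t within {0..1})" if "t \<in> {0..1}" for t
  proof -
    have "(\<phi> has_real_derivative \<phi>' t) (at t within {0..1})"
      using \<phi> that by (simp add: C1_curve_def has_real_derivative_iff_has_vector_derivative)
    from has_vector_derivative_scaleR[OF this P(1)[OF that]] show ?thesis unfolding V_def V'_def by (simp add: algebra_simps)
  qed
  show VC: "C1_curve V V'"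
    unfolding C1_curve_def
  proof (intro conjI ballI vV)
    show "continuous_on {0..1} V'"
      unfolding V'_def by (intro continuous_intros cchr cP C1_curve_continuous[OF xC] C1_curve_continuous[OF \<phi>])
  qed
  define K where "K t = gb G (x t) (Rm G (x t) (P t) (x' t) (x' t)) (P t)" for t
  \<comment> \<open>The covariant acceleration of the varied curves in the variation parameter:
    \<open>t *\<^sub>R Z\<close> is the coordinate acceleration caused by the correction of the
    right end.\<close>
  define B where "B t = t *\<^sub>R Z + chr G (x t) (V t) (V t)" for t
  define B' where "B' t = Z + (Dbl (chr G) (x t) (x' t) (V t) (V t) + chr G (x t) (V' t) (V t) + chr G (x t) (V t) (V' t))" for t
  define f' where "f' t = Dbl (gb G) (x t) (x' t) (x' t) (B t) + gb G (x t) (- chr G (x t) (x' t) (x' t)) (B t) + gb G (x t) (x' t) (B' t)" for t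
  have "(B has_vector_derivative B' t) (at t within {0..1})" if t: "t \<in> {0..1}" for t
  proof -
    have "((\<lambda>t. t *\<^sub>R Z) has_vector_derivative Z) (at t within {0..1})" by (auto intro!: derivative_eq_intros)
    moreover have "(x has_vector_derivative x' t) (at t within {0..1})" using x t by (simp add: geodesic01_def)
    ultimately show ?thesis unfolding B_def B'_def
      by (intro has_vector_derivative_add chr_vd[of x t, OF xU[OF t]] vV t)
  qed
  then have "((\<lambda>t. gb G (x t) (x' t) (B t)) has_vector_derivative f' t) (at t within {0..1})" if t: "t \<in> {0..1}" for t
    unfolding f'_def using x t by (intro gb_vd[of x t, OF xU[OF t]]) (auto simp: geodesic01_def)
  from ftc01[OF this, of 1] have If: "(f' has_integral gb G (x 1) (x' 1) (B 1) - gb G (x 0) (x' 0) (B 0)) {0..1}" by simp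
  have Iq: "((\<lambda>t. (\<phi>' t)\<^sup>2 - (\<phi> t)\<^sup>2 * K t) has_integral integral {0..1} (\<lambda>t. (\<phi>' t)\<^sup>2 - (\<phi> t)\<^sup>2 * K t)) {0..1}"
    unfolding K_def
    by (intro integrable_integral integrable_continuous_interval continuous_intros C1_curve_continuous[OF \<phi>]
         continuous_on_curvature xU C1_curve_continuous[OF xC] cP)
  have "((\<lambda>t. Dbl (Dbl (gb G)) (x t) (V t) (V t) (x' t) (x' t) + Dbl (gb G) (x t) (t *\<^sub>R Z) (x' t) (x' t)
        + 4 * Dbl (gb G) (x t) (V t) (x' t) (V' t) + 2 * gb G (x t) (V' t) (V' t) + 2 * gb G (x t) (x' t) Z) has_integral
        (2 * integral {0..1} (\<lambda>t. (\<phi>' t)\<^sup>2 - (\<phi> t)\<^sup>2 * K t) + 2 * (gb G (x 1) (x' 1) (B 1) - gb G (x 0) (x' 0) (B 0)))) {0..1}"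
  proof (rule has_integral_eq[OF _ has_integral_add[OF has_integral_mult_right[OF Iq] has_integral_mult_right[OF If]]])
    fix t :: real assume t: "t \<in> {0..1}"
    have D: "V' t + chr G (x t) (x' t) (V t) = \<phi>' t *\<^sub>R P t" by (simp add: V_def V'_def blinfun.bilinear_simps)
    have 1: "gb G (x t) (V' t + chr G (x t) (x' t) (V t)) (V' t + chr G (x t) (x' t) (V t)) = (\<phi>' t)\<^sup>2"
      unfolding D by (simp add: blinfun.bilinear_simps P(2)[OF t] power2_eq_square)
    have 2: "gb G (x t) (Rm G (x t) (V t) (x' t) (x' t)) (V t) = (\<phi> t)\<^sup>2 * K t"
      by (simp add: V_def K_def Rm_linear(1)[THEN linear_scale] blinfun.bilinear_simps power2_eq_square)
    show "2 * ((\<phi>' t)\<^sup>2 - (\<phi> t)\<^sup>2 * K t) + 2 * f' t = Dbl (Dbl (gb G)) (x t) (V t) (V t) (x' t) (x' t) + Dbl (gb G) (x t) (t *\<^sub>R Z) (x' t) (x' t)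
        + 4 * Dbl (gb G) (x t) (V t) (x' t) (V' t) + 2 * gb G (x t) (V' t) (V' t) + 2 * gb G (x t) (x' t) Z"
      unfolding second_variation_pointwise[OF xU[OF t]] 1 2 f'_def B_def B'_def by simp
  qed
  from integral_unique[OF this] show "integral {0..1} (\<lambda>t. Dbl (Dbl (gb G)) (x t) (V t) (V t) (x' t) (x' t) + Dbl (gb G) (x t) (t *\<^sub>R Z) (x' t) (x' t)
        + 4 * Dbl (gb G) (x t) (V t) (x' t) (V' t) + 2 * gb G (x t) (V' t) (V' t) + 2 * gb G (x t) (x' t) Z)
     = 2 * integral {0..1} (\<lambda>t. (\<phi>' t)\<^sup>2 - (\<phi> t)\<^sup>2 * gb G (x t) (Rm G (x t) (P t) (x' t) (x' t)) (P t))
      + 2 * gb G (x 1) (x' 1) (Z + chr G (x 1) (V 1) (V 1)) - 2 * gb G (x 0) (x' 0) (chr G (x 0) (V 0) (V 0))"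
    by (simp add: B_def K_def)
qed

end

section \<open>Closed chains of geodesics\<close>

text \<open>Consecutive segments live in different charts; \<open>th i\<close> is the local isometry from the chart of
  segment \<open>Suc i mod m\<close> to the chart of segment \<open>i\<close> by which the chain is closed up.\<close>

locale geodesic_loop =
  fixes m :: nat and U :: "nat \<Rightarrow> (real^'n::finite) set" and G :: "nat \<Rightarrow> real^'n \<Rightarrow> real^'n^'n"
    and W :: "nat \<Rightarrow> (real^'n) set" and th :: "nat \<Rightarrow> real^'n \<Rightarrow> real^'n"
    and x x' :: "nat \<Rightarrow> real \<Rightarrow> real^'n" and C :: "nat \<Rightarrow> (real^'n) set"
  assumes m: "0 < m"
    and iso: "i < m \<Longrightarrow> lisom (U (Suc i mod m)) (G (Suc i mod m)) (U i) (G i) (W i) (th i)"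
    and start: "i < m \<Longrightarrow> x (Suc i mod m) 0 \<in> W i" and glue: "i < m \<Longrightarrow> th i (x (Suc i mod m) 0) = x i 1"
    and geod: "i < m \<Longrightarrow> geodesic01 (U i) (G i) (x i) (x' i)"
    and open_C: "i < m \<Longrightarrow> open (C i)" and C_sub: "i < m \<Longrightarrow> C i \<subseteq> U i"
    and x_in: "i < m \<Longrightarrow> t \<in> {0..1} \<Longrightarrow> x i t \<in> C i"
    and small: "i < m \<Longrightarrow> t \<in> {0..1} \<Longrightarrow> norm (chr (G i) (x i t)) * norm (x' i t) \<le> 1 / 2"
    and minimal: "\<exists>e>0. \<forall>y y' d. (\<forall>i<m. norm (d i) < e \<and> C1_curve (y i) (y' i) \<and> (\<forall>t\<in>{0..1}. y i t \<in> C i) \<and>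
        y i 0 = x i 0 + d i \<and> y i 1 = th i (x (Suc i mod m) 0 + d (Suc i mod m))) \<longrightarrow>
        (\<Sum>i<m. energy (G i) (x i) (x' i)) \<le> (\<Sum>i<m. energy (G i) (y i) (y' i))"
begin

abbreviation sc :: "nat \<Rightarrow> nat" where "sc i \<equiv> Suc i mod m"

lemma sc_less: "sc i < m" using m by simp

lemma sc_inj: "i < m \<Longrightarrow> j < m \<Longrightarrow> sc i = sc j \<Longrightarrow> i = j"
  by (auto simp: mod_Suc split: if_splits)

lemma sc_bij: "bij_betw sc {..<m} {..<m}"
proof -
  have inj: "inj_on sc {..<m}" using sc_inj by (auto intro: inj_onI)
  have "sc ` {..<m} \<subseteq> {..<m}" using sc_less by auto
  then show ?thesis using inj by (simp add: bij_betw_def endo_inj_surj)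
qed

lemma sum_sc: "(\<Sum>i<m. f (sc i)) = (\<Sum>i<m. f i)" for f :: "nat \<Rightarrow> real"
  by (rule sum.reindex_bij_betw[OF sc_bij])

lemma met: "i < m \<Longrightarrow> lmetric (U i) (G i)"
  using iso lisom.axioms by blast

text \<open>Fields that match to first order at the joints are completed to genuine variations
  through closed chains. Minimality then says that the energy of this one-parameter family has
  derivative zero and nonnegative second derivative.\<close>

lemma variation:
  fixes V V' :: "nat \<Rightarrow> real \<Rightarrow> real^'n"
  assumes V: "\<And>i. i < m \<Longrightarrow> C1_curve (V i) (V' i)"
    and V1: "\<And>i. i < m \<Longrightarrow> V i 1 = Dbl (th i) (x (sc i) 0) (V (sc i) 0)"
  shows "(\<Sum>i<m. 2 * gb (G i) (x i 1) (x' i 1) (V i 1) - 2 * gb (G i) (x i 0) (x' i 0) (V i 0)) = 0"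
    and "0 \<le> (\<Sum>i<m. integral {0..1} (\<lambda>t. Dbl (Dbl (gb (G i))) (x i t) (V i t) (V i t) (x' i t) (x' i t)
       + Dbl (gb (G i)) (x i t) (t *\<^sub>R Dbl (Dbl (th i)) (x (sc i) 0) (V (sc i) 0) (V (sc i) 0)) (x' i t) (x' i t)
       + 4 * Dbl (gb (G i)) (x i t) (V i t) (x' i t) (V' i t) + 2 * gb (G i) (x i t) (V' i t) (V' i t)
       + 2 * gb (G i) (x i t) (x' i t) (Dbl (Dbl (th i)) (x (sc i) 0) (V (sc i) 0) (V (sc i) 0))))"
proof -
  define a where "a i = x (sc i) 0" for i
  define v where "v i = V (sc i) 0" for i
  \<comment> \<open>The failure of the straight motion of the right end to agree with the image
    under \<open>th i\<close> of the motion of the next left end. It vanishes to second order at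
    \<open>s = 0\<close>, so the first variation sees \<open>V\<close> only.\<close>
  define q where "q i s = th i (a i + s *\<^sub>R v i) - x i 1 - s *\<^sub>R V i 1" for i s
  define q1 where "q1 i s = Dbl (th i) (a i + s *\<^sub>R v i) (v i) - V i 1" for i s
  define q2 where "q2 i s = Dbl (Dbl (th i)) (a i + s *\<^sub>R v i) (v i) (v i)" for i s
  define Y where "Y i s t = x i t + s *\<^sub>R V i t + t *\<^sub>R q i s" for i s t
  define Y' where "Y' i s t = x' i t + s *\<^sub>R V' i t + q i s" for i s t
  obtain e where e: "e > 0" "\<And>y y' d. (\<And>i. i < m \<Longrightarrow> norm (d i) < e \<and> C1_curve (y i) (y' i) \<and> (\<forall>t\<in>{0..1}. y i t \<in> C i) \<and>
        y i 0 = x i 0 + d i \<and> y i 1 = th i (x (sc i) 0 + d (sc i))) \<Longrightarrow>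
        (\<Sum>i<m. energy (G i) (x i) (x' i)) \<le> (\<Sum>i<m. energy (G i) (y i) (y' i))"
    using minimal by blast
  have q0: "q i 0 = 0" "q1 i 0 = 0" if "i < m" for i
    using glue[OF that] V1[OF that] by (simp_all add: q_def q1_def a_def v_def)
  have dq: "(q i has_vector_derivative q1 i s) (at s within S)" "(q1 i has_vector_derivative q2 i s) (at s within S)"
    if i: "i < m" and s: "a i + s *\<^sub>R v i \<in> W i" for i s S
  proof -
    interpret lisom "U (sc i)" "G (sc i)" "U i" "G i" "W i" "th i" by (rule iso[OF i])
    have d: "((\<lambda>s. a i + s *\<^sub>R v i) has_derivative (\<lambda>h. h *\<^sub>R v i)) (at s within S)"
      by (auto intro!: derivative_eq_intros)
    have 1: "((\<lambda>s. th i (a i + s *\<^sub>R v i)) has_derivative (\<lambda>h. Dbl (th i) (a i + s *\<^sub>R v i) (h *\<^sub>R v i))) (at s within S)"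
      using has_derivative_compose[OF d has_derivative_psi[OF s]] .
    have 2: "((\<lambda>s. Dbl (th i) (a i + s *\<^sub>R v i)) has_derivative (\<lambda>h. Dbl (Dbl (th i)) (a i + s *\<^sub>R v i) (h *\<^sub>R v i))) (at s within S)"
      using has_derivative_compose[OF d has_derivative_Dpsi[OF s]] .
    have 3: "((\<lambda>s. th i (a i + s *\<^sub>R v i)) has_vector_derivative Dbl (th i) (a i + s *\<^sub>R v i) (v i)) (at s within S)"
      using 1 by (simp add: has_vector_derivative_def blinfun.bilinear_simps)
    show "(q i has_vector_derivative q1 i s) (at s within S)"
    proof -
      have "((\<lambda>s. s *\<^sub>R V i 1) has_vector_derivative V i 1) (at s within S)"
        by (auto intro!: derivative_eq_intros)
      from has_vector_derivative_diff[OF has_vector_derivative_diff[OF 3 has_vector_derivative_const[of "x i 1"]] this]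
      show ?thesis unfolding q_def[abs_def] q1_def by simp
    qed
    have 4: "((\<lambda>s. Dbl (th i) (a i + s *\<^sub>R v i) (v i)) has_vector_derivative q2 i s) (at s within S)"
      unfolding has_vector_derivative_def q2_def
      by (rule has_derivative_eq_rhs[OF bounded_bilinear.FDERIV[OF bounded_bilinear_blinfun_apply 2 has_derivative_const]])
         (simp add: blinfun.bilinear_simps)
    from has_vector_derivative_diff[OF 4 has_vector_derivative_const[of "V i 1"]]
    show "(q1 i has_vector_derivative q2 i s) (at s within S)" unfolding q1_def[abs_def] by simp
  qed
  \<comment> \<open>For small \<open>s\<close> everything stays where it is allowed: junctions in
    the domains \<open>W\<close>, displacements below \<open>e\<close>, and, by a positive distance
    from the compact segment to the complement, whole curves in \<open>C i\<close>.\<close>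
  have ev: "\<forall>\<^sub>F s in nhds 0. a i + s *\<^sub>R v i \<in> W i \<and> norm (s *\<^sub>R V i 0) < e \<and> (\<forall>t\<in>{0..1}. Y i s t \<in> C i)" if i: "i < m" for i
  proof -
    interpret lisom "U (sc i)" "G (sc i)" "U i" "G i" "W i" "th i" by (rule iso[OF i])
    have aW: "a i \<in> W i" using start[OF i] by (simp add: a_def)
    have nh: "(f \<longlongrightarrow> f 0) (nhds 0)" if "isCont f 0" for f :: "real \<Rightarrow> 'z::topological_space"
      using that by (simp add: isCont_def tendsto_at_iff_tendsto_nhds)
    have t1: "((\<lambda>s::real. a i + s *\<^sub>R v i) \<longlongrightarrow> a i) (nhds 0)"
      using nh[of "\<lambda>s. a i + s *\<^sub>R v i"] by simp
    then have 1: "\<forall>\<^sub>F s in nhds 0. a i + s *\<^sub>R v i \<in> W i" using topological_tendstoD[OF _ open_W aW] by blast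
    have t2: "((\<lambda>s::real. norm (s *\<^sub>R V i 0)) \<longlongrightarrow> 0) (nhds 0)"
      using nh[of "\<lambda>s. norm (s *\<^sub>R V i 0)"] by simp
    then have 2: "\<forall>\<^sub>F s in nhds 0. norm (s *\<^sub>R V i 0) < e" using e(1) by (rule order_tendstoD(2))
    have cV: "compact (V i ` {0..1})" "compact (x i ` {0..1})"
      using C1_curve_continuous(1)[OF V[OF i]] C1_curve_continuous(1)[OF geodesic01_C1[OF geod[OF i]]]
      by (auto intro: compact_continuous_image)
    obtain B where B: "\<And>t. t \<in> {0..1} \<Longrightarrow> norm (V i t) \<le> B"
      using compact_imp_bounded[OF cV(1)] unfolding bounded_iff by blast
    obtain k where k: "k > 0" "(\<Union>p\<in>x i ` {0..1}. ball p k) \<subseteq> C i"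
      by (rule compact_subset_open_imp_ball_epsilon_subset[OF cV(2) open_C[OF i]]) (use x_in[OF i] in auto)
    have "isCont (q i) 0"
      using dq(1)[OF i, of 0 UNIV] aW by (auto dest: has_vector_derivative_continuous)
    then have "((\<lambda>s. \<bar>s\<bar> * B + norm (q i s)) \<longlongrightarrow> 0) (nhds 0)"
      using nh[of "\<lambda>s. \<bar>s\<bar> * B + norm (q i s)"] q0[OF i] by simp
    then have 3: "\<forall>\<^sub>F s in nhds 0. \<bar>s\<bar> * B + norm (q i s) < k" using k(1) by (rule order_tendstoD(2))
    have 4: "\<forall>t\<in>{0..1}. Y i s t \<in> C i" if s: "\<bar>s\<bar> * B + norm (q i s) < k" for s
    proof
      fix t :: real assume t: "t \<in> {0..1}"
      have "norm (s *\<^sub>R V i t + t *\<^sub>R q i s) \<le> \<bar>s\<bar> * norm (V i t) + \<bar>t\<bar> * norm (q i s)"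
        by (rule order_trans[OF norm_triangle_ineq]) simp
      also have "\<dots> \<le> \<bar>s\<bar> * B + 1 * norm (q i s)" using B[OF t] t by (intro add_mono mult_left_mono mult_right_mono) auto
      finally have "dist (x i t) (Y i s t) < k" using s by (simp add: dist_norm Y_def norm_minus_commute algebra_simps)
      then have "Y i s t \<in> ball (x i t) k" by simp
      then show "Y i s t \<in> C i" using k(2) t by blast
    qed
    show ?thesis using 1 2 3 by eventually_elim (use 4 in auto)
  qed
  have "\<forall>\<^sub>F s in nhds 0. \<forall>i\<in>{..<m}. a i + s *\<^sub>R v i \<in> W i \<and> norm (s *\<^sub>R V i 0) < e \<and> (\<forall>t\<in>{0..1}. Y i s t \<in> C i)"
    by (rule eventually_ball_finite) (use ev in auto)
  then obtain d' where d': "d' > 0" "\<And>s. dist s 0 < d' \<Longrightarrow> \<forall>i\<in>{..<m}. a i + s *\<^sub>R v i \<in> W i \<and> norm (s *\<^sub>R V i 0) < e \<and> (\<forall>t\<in>{0..1}. Y i s t \<in> C i)"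
    unfolding eventually_nhds_metric by blast
  define d where "d = d' / 2"
  have dd: "dist s 0 < d'" if "s \<in> {-d..d}" for s using that d'(1) by (simp add: d_def dist_real_def abs_if)
  have d: "d > 0" "\<And>s i. s \<in> {-d..d} \<Longrightarrow> i < m \<Longrightarrow> a i + s *\<^sub>R v i \<in> W i"
     "\<And>s i. s \<in> {-d..d} \<Longrightarrow> i < m \<Longrightarrow> norm (s *\<^sub>R V i 0) < e"
     "\<And>s i t. s \<in> {-d..d} \<Longrightarrow> i < m \<Longrightarrow> t \<in> {0..1} \<Longrightarrow> Y i s t \<in> C i"
    using d'(1) d'(2)[OF dd] by (simp_all add: d_def)
  define E1 where "E1 i s = integral {0..1} (\<lambda>t. Dbl (gb (G i)) (Y i s t) (V i t + t *\<^sub>R q1 i s) (Y' i s t) (Y' i s t) + 2 * gb (G i) (Y i s t) (Y' i s t) (V' i t + q1 i s))" for i s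
  define E2 where "E2 i s = integral {0..1} (\<lambda>t. Dbl (Dbl (gb (G i))) (Y i s t) (V i t + t *\<^sub>R q1 i s) (V i t + t *\<^sub>R q1 i s) (Y' i s t) (Y' i s t)
       + Dbl (gb (G i)) (Y i s t) (t *\<^sub>R q2 i s) (Y' i s t) (Y' i s t) + 4 * Dbl (gb (G i)) (Y i s t) (V i t + t *\<^sub>R q1 i s) (Y' i s t) (V' i t + q1 i s)
       + 2 * gb (G i) (Y i s t) (V' i t + q1 i s) (V' i t + q1 i s) + 2 * gb (G i) (Y i s t) (Y' i s t) (q2 i s))" for i s
  have der: "((\<lambda>s. energy (G i) (Y i s) (Y' i s)) has_real_derivative E1 i s) (at s within {-d..d})"
    "(E1 i has_real_derivative E2 i s) (at s within {-d..d})" if s: "s \<in> {-d..d}" and i: "i < m" for s i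
  proof -
    interpret lisom "U (sc i)" "G (sc i)" "U i" "G i" "W i" "th i" by (rule iso[OF i])
    have cq2: "continuous_on {-d..d} (q2 i)"
    proof -
      have "continuous_on {-d..d} (\<lambda>s. Dbl (Dbl (th i)) (a i + s *\<^sub>R v i))"
        by (rule continuous_on_compose2[OF smooth_on_continuous[OF smooth_on_Dbl[OF open_W smooth_on_Dbl[OF open_W smooth_psi]]]])
           (use d(2)[OF _ i] in \<open>auto intro!: continuous_intros\<close>)
      then show ?thesis unfolding q2_def[abs_def] by (intro continuous_intros)
    qed
    have YU: "x i t + s *\<^sub>R V i t + t *\<^sub>R q i s \<in> U i" if "s \<in> {-d..d}" "t \<in> {0..1}" for s t
      using d(4)[OF that(1) i that(2)] C_sub[OF i] by (auto simp: Y_def)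
    note ev = B.energy_variation[OF d(1) geodesic01_C1[OF geod[OF i]] V[OF i] dq(1)[OF i d(2)[OF _ i]] dq(2)[OF i d(2)[OF _ i]] cq2 YU s]
    show "((\<lambda>s. energy (G i) (Y i s) (Y' i s)) has_real_derivative E1 i s) (at s within {-d..d})"
      using ev(1) unfolding E1_def Y_def[abs_def] Y'_def[abs_def] by simp
    show "(E1 i has_real_derivative E2 i s) (at s within {-d..d})"
      using ev(2) unfolding E1_def[abs_def] E2_def Y_def[abs_def] Y'_def[abs_def] by simp
  qed
  define E where "E s = (\<Sum>i<m. energy (G i) (Y i s) (Y' i s))" for s
  have E1: "(E has_real_derivative (\<Sum>i<m. E1 i s)) (at s within {-d..d})" if "s \<in> {-d..d}" for s
    unfolding E_def using der(1)[OF that] by (intro DERIV_sum) auto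
  have E2: "((\<lambda>s. \<Sum>i<m. E1 i s) has_real_derivative (\<Sum>i<m. E2 i 0)) (at 0 within {-d..d})"
    using der(2)[of 0] d(1) by (intro DERIV_sum) auto
  have Y0: "Y i 0 = x i" "Y' i 0 = x' i" if "i < m" for i
    using q0[OF that] by (auto simp: Y_def Y'_def)
  have mn: "E 0 \<le> E s" if s: "s \<in> {-d..d}" for s
  proof -
    have "E 0 = (\<Sum>i<m. energy (G i) (x i) (x' i))" unfolding E_def using Y0 by simp
    also have "\<dots> \<le> E s"
      unfolding E_def
    proof (rule e(2)[where d="\<lambda>i. s *\<^sub>R V i 0"])
      fix i assume i: "i < m"
      have "C1_curve (Y i s) (Y' i s)"
        using V[OF i] geodesic01_C1[OF geod[OF i]] unfolding C1_curve_def Y_def[abs_def] Y'_def[abs_def]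
        by (auto intro!: derivative_eq_intros continuous_intros)
      then show "norm (s *\<^sub>R V i 0) < e \<and> C1_curve (Y i s) (Y' i s) \<and> (\<forall>t\<in>{0..1}. Y i s t \<in> C i) \<and>
        Y i s 0 = x i 0 + s *\<^sub>R V i 0 \<and> Y i s 1 = th i (x (sc i) 0 + s *\<^sub>R V (sc i) 0)"
        using d(3,4)[OF s i] by (auto simp: Y_def q_def a_def v_def)
    qed
    finally show ?thesis .
  qed
  note test = second_derivative_test[OF d(1) E1 E2 mn]
  have "E1 i 0 = 2 * gb (G i) (x i 1) (x' i 1) (V i 1) - 2 * gb (G i) (x i 0) (x' i 0) (V i 0)" if i: "i < m" for i
  proof -
    interpret lmetric "U i" "G i" by (rule met[OF i])
    show ?thesis using integral_unique[OF first_variation[OF geod[OF i] V[OF i]]] by (simp add: E1_def Y0[OF i] q0[OF i])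
  qed
  then show "(\<Sum>i<m. 2 * gb (G i) (x i 1) (x' i 1) (V i 1) - 2 * gb (G i) (x i 0) (x' i 0) (V i 0)) = 0"
    using test(1) by simp
  have "E2 i 0 = integral {0..1} (\<lambda>t. Dbl (Dbl (gb (G i))) (x i t) (V i t) (V i t) (x' i t) (x' i t)
       + Dbl (gb (G i)) (x i t) (t *\<^sub>R Dbl (Dbl (th i)) (x (sc i) 0) (V (sc i) 0) (V (sc i) 0)) (x' i t) (x' i t)
       + 4 * Dbl (gb (G i)) (x i t) (V i t) (x' i t) (V' i t) + 2 * gb (G i) (x i t) (V' i t) (V' i t)
       + 2 * gb (G i) (x i t) (x' i t) (Dbl (Dbl (th i)) (x (sc i) 0) (V (sc i) 0) (V (sc i) 0)))" if i: "i < m" for i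
    by (simp add: E2_def Y0[OF i] q0[OF i] q2_def a_def v_def)
  then show "0 \<le> (\<Sum>i<m. integral {0..1} (\<lambda>t. Dbl (Dbl (gb (G i))) (x i t) (V i t) (V i t) (x' i t) (x' i t)
       + Dbl (gb (G i)) (x i t) (t *\<^sub>R Dbl (Dbl (th i)) (x (sc i) 0) (V (sc i) 0) (V (sc i) 0)) (x' i t) (x' i t)
       + 4 * Dbl (gb (G i)) (x i t) (V i t) (x' i t) (V' i t) + 2 * gb (G i) (x i t) (V' i t) (V' i t)
       + 2 * gb (G i) (x i t) (x' i t) (Dbl (Dbl (th i)) (x (sc i) 0) (V (sc i) 0) (V (sc i) 0))))"
    using test(2) by simp
qed

text \<open>The first variation is tested on fields that are nonzero at one joint only. The incoming
  and outgoing velocities then have equal inner products with every vector, so they correspond under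
  the differential of \<open>th i\<close>.\<close>

lemma no_corner:
  assumes i: "i < m"
  shows "x' i 1 = Dbl (th i) (x (sc i) 0) (x' (sc i) 0)"
proof -
  interpret lisom "U (sc i)" "G (sc i)" "U i" "G i" "W i" "th i" by (rule iso[OF i])
  note a = start[OF i]
  have x1: "x i 1 \<in> U i" using psi_in[OF a] glue[OF i] by simp
  have eq: "gb (G i) (x i 1) (x' i 1) (Dbl (th i) (x (sc i) 0) u) = gb (G (sc i)) (x (sc i) 0) (x' (sc i) 0) u" for u
  proof -
    \<comment> \<open>Prescribed left ends of the field; \<open>w\<close> gives the right ends
      forced by the gluing, and \<open>V\<close> interpolates linearly. With a single segment both
      ends belong to the same curve, which the sums cover as well.\<close>
    define v where "v j = (if j = sc i then u else 0)" for j
    define w where "w j = Dbl (th j) (x (sc j) 0) (v (sc j))" for j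
    define V where "V j t = v j + t *\<^sub>R (w j - v j)" for j t
    define V' where "V' j t = w j - v j" for j and t :: real
    have "C1_curve (V j) (V' j)" for j
    proof -
      have "((\<lambda>t. v j + t *\<^sub>R (w j - v j)) has_vector_derivative (w j - v j)) (at t within S)" for t S
        by (auto intro!: derivative_eq_intros)
      then show ?thesis unfolding C1_curve_def V_def[abs_def] V'_def[abs_def] by simp
    qed
    then have "(\<Sum>j<m. 2 * gb (G j) (x j 1) (x' j 1) (V j 1) - 2 * gb (G j) (x j 0) (x' j 0) (V j 0)) = 0"
      by (intro variation(1)[of V V']) (auto simp: V_def w_def)
    then have "(\<Sum>j<m. gb (G j) (x j 1) (x' j 1) (w j)) = (\<Sum>j<m. gb (G j) (x j 0) (x' j 0) (v j))"
      by (simp add: V_def sum_subtractf flip: sum_distrib_left)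
    moreover have "(\<Sum>j<m. gb (G j) (x j 1) (x' j 1) (w j)) = (\<Sum>j<m. if j = i then gb (G i) (x i 1) (x' i 1) (Dbl (th i) (x (sc i) 0) u) else 0)"
    proof (rule sum.cong[OF refl])
      fix j assume "j \<in> {..<m}"
      then have "sc j = sc i \<longleftrightarrow> j = i" using sc_inj[OF _ i, of j] by auto
      then show "gb (G j) (x j 1) (x' j 1) (w j) = (if j = i then gb (G i) (x i 1) (x' i 1) (Dbl (th i) (x (sc i) 0) u) else 0)"
        by (simp add: w_def v_def)
    qed
    moreover have "(\<Sum>j<m. gb (G j) (x j 0) (x' j 0) (v j)) = (\<Sum>j<m. if j = sc i then gb (G (sc i)) (x (sc i) 0) (x' (sc i) 0) u else 0)"
      by (intro sum.cong) (auto simp: v_def)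
    ultimately show ?thesis using i sc_less[of i] by simp
  qed
  show ?thesis
  proof (rule B.nondeg_eq[OF x1])
    fix z
    obtain u where u: "z = Dbl (th i) (x (sc i) 0) u" using bij_Dpsi[OF a] by (metis bij_pointE)
    show "gb (G i) (x i 1) (x' i 1) z = gb (G i) (x i 1) (Dbl (th i) (x (sc i) 0) (x' (sc i) 0)) z"
      unfolding u eq using isom[OF a, of "x' (sc i) 0" u] glue[OF i] by simp
  qed
qed

text \<open>Left ends move on coordinate lines, whose covariant acceleration is the Christoffel
  term. \<open>chr_law\<close> says that \<open>th i\<close> maps it to the acceleration of the
  matching right end, so with \<open>no_corner\<close> the boundary terms
  \<open>b (sc i) - b i\<close> cancel around the loop.\<close>

lemma stability:
  fixes P :: "nat \<Rightarrow> real \<Rightarrow> real^'n" and \<phi> \<phi>' :: "nat \<Rightarrow> real \<Rightarrow> real"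
  assumes P: "\<And>i t. i < m \<Longrightarrow> t \<in> {0..1} \<Longrightarrow> (P i has_vector_derivative - chr (G i) (x i t) (x' i t) (P i t)) (at t within {0..1})"
      "\<And>i t. i < m \<Longrightarrow> t \<in> {0..1} \<Longrightarrow> gb (G i) (x i t) (P i t) (P i t) = 1"
      "\<And>i. i < m \<Longrightarrow> P i 1 = Dbl (th i) (x (sc i) 0) (P (sc i) 0)"
    and \<phi>: "\<And>i. i < m \<Longrightarrow> C1_curve (\<phi> i) (\<phi>' i)" "\<And>i. i < m \<Longrightarrow> \<phi> i 1 = \<phi> (sc i) 0"
  shows "0 \<le> (\<Sum>i<m. integral {0..1} (\<lambda>t. (\<phi>' i t)\<^sup>2 - (\<phi> i t)\<^sup>2 * gb (G i) (x i t) (Rm (G i) (x i t) (P i t) (x' i t) (x' i t)) (P i t)))"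
proof -
  define V where "V i t = \<phi> i t *\<^sub>R P i t" for i t
  define V' where "V' i t = \<phi>' i t *\<^sub>R P i t - \<phi> i t *\<^sub>R chr (G i) (x i t) (x' i t) (P i t)" for i t
  define Z where "Z i = Dbl (Dbl (th i)) (x (sc i) 0) (V (sc i) 0) (V (sc i) 0)" for i
  define I where "I i = integral {0..1} (\<lambda>t. (\<phi>' i t)\<^sup>2 - (\<phi> i t)\<^sup>2 * gb (G i) (x i t) (Rm (G i) (x i t) (P i t) (x' i t) (x' i t)) (P i t))" for i
  define b where "b i = gb (G i) (x i 0) (x' i 0) (chr (G i) (x i 0) (V i 0) (V i 0))" for i
  have VC: "C1_curve (V i) (V' i)" if i: "i < m" for i
  proof -
    interpret lmetric "U i" "G i" by (rule met[OF i])
    show ?thesis using second_variation(1)[OF geod[OF i] \<phi>(1)[OF i] P(1)[OF i] P(2)[OF i]]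
      by (simp add: V_def[abs_def] V'_def[abs_def])
  qed
  have V1: "V i 1 = Dbl (th i) (x (sc i) 0) (V (sc i) 0)" if i: "i < m" for i
    using P(3)[OF i] \<phi>(2)[OF i] by (simp add: V_def blinfun.bilinear_simps)
  have "integral {0..1} (\<lambda>t. Dbl (Dbl (gb (G i))) (x i t) (V i t) (V i t) (x' i t) (x' i t)
       + Dbl (gb (G i)) (x i t) (t *\<^sub>R Z i) (x' i t) (x' i t)
       + 4 * Dbl (gb (G i)) (x i t) (V i t) (x' i t) (V' i t) + 2 * gb (G i) (x i t) (V' i t) (V' i t)
       + 2 * gb (G i) (x i t) (x' i t) (Z i)) = 2 * I i + 2 * (b (sc i) - b i)" if i: "i < m" for i
  proof -
    interpret lisom "U (sc i)" "G (sc i)" "U i" "G i" "W i" "th i" by (rule iso[OF i])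
    have "Z i + chr (G i) (x i 1) (V i 1) (V i 1) = Dbl (th i) (x (sc i) 0) (chr (G (sc i)) (x (sc i) 0) (V (sc i) 0) (V (sc i) 0))"
      using chr_law[OF start[OF i], of "V (sc i) 0" "V (sc i) 0"] by (simp add: Z_def V1[OF i] glue[OF i])
    then have "gb (G i) (x i 1) (x' i 1) (Z i + chr (G i) (x i 1) (V i 1) (V i 1)) = b (sc i)"
      using isom[OF start[OF i]] by (simp add: no_corner[OF i] b_def glue[OF i])
    then show ?thesis
      using B.second_variation(2)[OF geod[OF i] \<phi>(1)[OF i] P(1)[OF i] P(2)[OF i], of "Z i"]
      by (simp add: V_def[abs_def] V'_def[abs_def] I_def b_def)
  qed
  then have "0 \<le> (\<Sum>i<m. 2 * I i + 2 * (b (sc i) - b i))"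
    using variation(2)[OF VC V1] by (simp add: Z_def)
  also have "\<dots> = 2 * (\<Sum>i<m. I i) + 2 * ((\<Sum>i<m. b (sc i)) - (\<Sum>i<m. b i))"
    by (simp add: sum.distrib sum_subtractf sum_distrib_left)
  finally show ?thesis unfolding sum_sc by (simp add: I_def)
qed

end

section \<open>Parallel transport around the loop\<close>

lemma vd_zero_constant01:
  fixes f :: "real \<Rightarrow> 'b::banach"
  assumes "\<And>t. t \<in> {0..1} \<Longrightarrow> (f has_vector_derivative 0) (at t within {0..1})" "t \<in> {0..1}"
  shows "f t = f 0"
proof -
  have "((\<lambda>t. 0) has_integral (f t - f 0)) {0..t}" by (rule ftc01[OF assms])
  from has_integral_unique[OF this has_integral_0] show ?thesis by simp
qed

lemma matrix_blinfun: "matrix (blinfun_apply B) *v v = B v" for B :: "(real^'n) \<Rightarrow>\<^sub>L (real^'n)"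
  by (rule linear_eq_axis[OF matrix_vector_mul_linear bounded_linear.linear[OF blinfun.bounded_linear_right]])
     (simp add: matrix_vector_mult_basis column_def matrix_def)

definition is_transport :: "(real^'n \<Rightarrow> real^'n^'n) \<Rightarrow> (real \<Rightarrow> real^'n::finite) \<Rightarrow> (real \<Rightarrow> real^'n) \<Rightarrow> (real \<Rightarrow> (real^'n) \<Rightarrow>\<^sub>L (real^'n)) \<Rightarrow> bool"
  where "is_transport G x x' Q \<longleftrightarrow> Q 0 = id_blinfun \<and>
    (\<forall>t\<in>{0..1}. \<forall>v. ((\<lambda>t. blinfun_apply (Q t) v) has_vector_derivative - chr G (x t) (x' t) (Q t v)) (at t within {0..1})) \<and>
    (\<forall>t\<in>{0..1}. \<forall>v w. gb G (x t) (Q t v) (Q t w) = gb G (x 0) v w) \<and>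
    (\<forall>t\<in>{0..1}. Q t (x' 0) = x' t) \<and> det (matrix (Q 1)) > 0"

text \<open>Smallness lets the linear equation be solved on all of [0,1] at once. Inner products of
  parallel fields are constant; applied to \<open>Q t (x' 0) - x' t\<close>, a parallel field that
  starts at 0, this shows that the velocity is transported. The determinant never vanishes and
  starts at 1, so it stays positive.\<close>

lemma (in lmetric) parallel_transport:
  assumes x: "geodesic01 U G x x'" and small: "\<And>t. t \<in> {0..1} \<Longrightarrow> norm (chr G (x t)) * norm (x' t) \<le> 1 / 2"
  shows "\<exists>Q. is_transport G x x' Q"
proof -
  have xU: "x t \<in> U" if "t \<in> {0..1}" for t using x that by (simp add: geodesic01_def)
  have xv: "(x has_vector_derivative x' t) (at t within {0..1})" "(x' has_vector_derivative - chr G (x t) (x' t) (x' t)) (at t within {0..1})"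
    if "t \<in> {0..1}" for t using x that by (simp_all add: geodesic01_def)
  note xC = geodesic01_C1[OF x]
  define A where "A t = - chr G (x t) (x' t)" for t
  have cchr: "continuous_on {0..1} (\<lambda>t. chr G (x t))"
    by (rule continuous_on_compose2[OF continuous_on_Rm(2) C1_curve_continuous(1)[OF xC]]) (use xU in auto)
  have "continuous_on {0..1} A" unfolding A_def by (intro continuous_intros cchr C1_curve_continuous[OF xC])
  moreover have "norm (A t) \<le> 1/2" if "t \<in> {0..1}" for t
    unfolding A_def norm_minus_cancel using order_trans[OF norm_blinfun small[OF that]] .
  ultimately obtain Q where Q: "Q 0 = id_blinfun" "\<And>t. t \<in> {0..1} \<Longrightarrow> (Q has_vector_derivative A t o\<^sub>L Q t) (at t within {0..1})"
    using linear_ode_fundamental[of A] by blast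
  have Qv: "((\<lambda>t. blinfun_apply (Q t) v) has_vector_derivative - chr G (x t) (x' t) (Q t v)) (at t within {0..1})"
    if t: "t \<in> {0..1}" for t v
    using bounded_linear.has_vector_derivative[OF bounded_linear_apply_blinfun Q(2)[OF t], of v] 
    by (simp add: A_def blinfun.bilinear_simps)
  have pres: "gb G (x t) (f t) (h t) = gb G (x 0) (f 0) (h 0)"
    if f: "\<And>t. t \<in> {0..1} \<Longrightarrow> (f has_vector_derivative - chr G (x t) (x' t) (f t)) (at t within {0..1})"
    and h: "\<And>t. t \<in> {0..1} \<Longrightarrow> (h has_vector_derivative - chr G (x t) (x' t) (h t)) (at t within {0..1})"
    and t: "t \<in> {0..1}" for f h t
  proof (rule vd_zero_constant01[OF _ t])
    fix t :: real assume t: "t \<in> {0..1}"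
    show "((\<lambda>t. gb G (x t) (f t) (h t)) has_vector_derivative 0) (at t within {0..1})"
      by (rule has_vector_derivative_eq_rhs[OF gb_vd[of x t, OF xU[OF t] xv(1)[OF t] f[OF t] h[OF t]]])
         (simp add: metric_compat[OF xU[OF t]] blinfun.bilinear_simps)
  qed
  have iso: "gb G (x t) (Q t v) (Q t w) = gb G (x 0) v w" if t: "t \<in> {0..1}" for t v w
    using pres[OF Qv Qv t, of v w] by (simp add: Q)
  have tan: "Q t (x' 0) = x' t" if t: "t \<in> {0..1}" for t
  proof -
    define d where "d t = Q t (x' 0) - x' t" for t
    have "(d has_vector_derivative - chr G (x t) (x' t) (d t)) (at t within {0..1})" if "t \<in> {0..1}" for t
      using has_vector_derivative_diff[OF Qv[OF that, of "x' 0"] xv(2)[OF that]] unfolding d_def[abs_def]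
      by (simp add: blinfun.bilinear_simps)
    from pres[OF this this t] have "gb G (x t) (d t) (d t) = 0" by (simp add: d_def Q blinfun.bilinear_simps)
    then have "d t = 0" using pos[OF xU[OF t], of "d t"] by force
    then show ?thesis by (simp add: d_def)
  qed
  have det0: "det (matrix (Q t)) \<noteq> 0" if t: "t \<in> {0..1}" for t
  proof -
    have lin: "linear (Q t)" by (rule bounded_linear.linear[OF blinfun.bounded_linear_right])
    have "v = 0" if "Q t v = 0" for v
    proof (rule ccontr)
      assume "v \<noteq> 0"
      then have "gb G (x 0) v v > 0" by (intro pos xU) auto
      then show False using iso[OF t, of v v] that by (simp add: blinfun.bilinear_simps)
    qed
    then have "inj (Q t)" using linear_injective_0[OF lin] by blast
    then show ?thesis using det_nz_iff_inj[OF lin] by simp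
  qed
  have cdet: "continuous_on {0..1} (\<lambda>t. det (matrix (Q t)))"
  proof -
    have "continuous_on {0..1} (\<lambda>t. matrix (Q t) $ i $ j)" for i j
      unfolding matrix_def by (simp, intro continuous_intros continuous_on_vd[OF Qv])
    then show ?thesis unfolding det_def
      by (intro continuous_on_sum continuous_on_mult continuous_on_const continuous_on_prod)
  qed
  have d00: "det (matrix (Q 0)) = 1" by (simp add: Q(1) matrix_id_mat_1[unfolded id_def])
  have "det (matrix (Q 1)) > 0"
  proof (rule ccontr)
    assume "\<not> ?thesis"
    then have "\<exists>t\<ge>0. t \<le> 1 \<and> det (matrix (Q t)) = 0"
      by (intro IVT2'[OF _ _ _ cdet]) (simp_all add: d00)
    then show False using det0 by force
  qed
  then have "is_transport G x x' Q" unfolding is_transport_def using Q(1) Qv iso tan by blast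
  then show ?thesis by blast
qed

primrec matrix_chain :: "(nat \<Rightarrow> real^'n^'n) \<Rightarrow> nat \<Rightarrow> real^'n^'n"
  where "matrix_chain L 0 = mat 1"
  | "matrix_chain L (Suc i) = L i ** matrix_chain L i"

lemma det_matrix_chain: "det (matrix_chain L i) = (\<Prod>j<i. det (L j))"
  by (induction i) (simp_all add: det_mul)

lemma sgn_prod_lessThan: "sgn (\<Prod>j<i. f j) = (\<Prod>j<i. sgn (f j))" for f :: "nat \<Rightarrow> real"
  by (induction i) (simp_all add: sgn_mult)

context geodesic_loop begin

definition "Theta i = matrix (Dbl (th i) (x (sc i) 0))"

lemma Theta_apply: "Theta i *v v = Dbl (th i) (x (sc i) 0) v"
  unfolding Theta_def by (rule matrix_blinfun)

lemma Theta_inv: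
  assumes "i < m" shows "invertible (Theta i)"
proof -
  interpret lisom "U (sc i)" "G (sc i)" "U i" "G i" "W i" "th i" by (rule iso[OF assms])
  have lin: "linear (Dbl (th i) (x (sc i) 0))" by (rule bounded_linear.linear[OF blinfun.bounded_linear_right])
  show ?thesis unfolding Theta_def
    using bij_Dpsi[OF start[OF assms]] det_nz_iff_inj[OF lin] by (simp add: invertible_det_nz bij_def)
qed

text \<open>Transport once around the loop is an isometry of the first tangent space that fixes the
  initial velocity; by the orientation hypothesis it fixes another direction.\<close>

lemma parallel_field:
  assumes nz: "x' 0 0 \<noteq> 0" and sgn: "(\<Prod>i<m. sgn (det (Theta i))) \<noteq> - ((-1) ^ CARD('n))"
  shows "\<exists>P. (\<forall>i<m. \<forall>t\<in>{0..1}. (P i has_vector_derivative - chr (G i) (x i t) (x' i t) (P i t)) (at t within {0..1})) \<and>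
      (\<forall>i<m. \<forall>t\<in>{0..1}. gb (G i) (x i t) (P i t) (P i t) = 1 \<and> gb (G i) (x i t) (P i t) (x' i t) = 0) \<and>
      (\<forall>i<m. P i 1 = Dbl (th i) (x (sc i) 0) (P (sc i) 0))"
    and "\<And>i t. i < m \<Longrightarrow> t \<in> {0..1} \<Longrightarrow> gb (G i) (x i t) (x' i t) (x' i t) = gb (G 0) (x 0 0) (x' 0 0) (x' 0 0)"
proof -
  have "\<forall>i. \<exists>Q. i < m \<longrightarrow> is_transport (G i) (x i) (x' i) Q"
    using lmetric.parallel_transport[OF met geod small] by blast
  then obtain Q where QQ: "\<And>i. i < m \<Longrightarrow> is_transport (G i) (x i) (x' i) (Q i)" by metis
  have Q: "\<And>i. i < m \<Longrightarrow> Q i 0 = id_blinfun"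
    "\<And>i t v. i < m \<Longrightarrow> t \<in> {0..1} \<Longrightarrow> ((\<lambda>t. blinfun_apply (Q i t) v) has_vector_derivative - chr (G i) (x i t) (x' i t) (Q i t v)) (at t within {0..1})"
    "\<And>i t v w. i < m \<Longrightarrow> t \<in> {0..1} \<Longrightarrow> gb (G i) (x i t) (Q i t v) (Q i t w) = gb (G i) (x i 0) v w"
    "\<And>i t. i < m \<Longrightarrow> t \<in> {0..1} \<Longrightarrow> Q i t (x' i 0) = x' i t" "\<And>i. i < m \<Longrightarrow> det (matrix (Q i 1)) > 0"
    using QQ by (simp_all add: is_transport_def)
  \<comment> \<open>Transport along segment \<open>i\<close>, followed by the inverse of the gluing
    differential: a map between the initial tangent spaces of consecutive segments. Its product over
    all segments is the holonomy \<open>H\<close>.\<close>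
  define L where "L i = matrix_inv (Theta i) ** matrix (Q i 1)" for i
  define N where "N = matrix_chain L"
  have TL: "Theta i *v (L i *v v) = Q i 1 v" if "i < m" for i v
  proof -
    have "Theta i *v (L i *v v) = (Theta i ** matrix_inv (Theta i)) *v (matrix (Q i 1) *v v)"
      by (simp add: L_def matrix_vector_mul_assoc matrix_mul_assoc)
    also have "\<dots> = Q i 1 v"
      using matrix_inv_works[OF Theta_inv[OF that]] matrix_blinfun[of "Q i 1" v] by simp
    finally show ?thesis .
  qed
  have Nstep: "N (Suc i) *v v = L i *v (N i *v v)" for i v
    by (simp add: N_def matrix_vector_mul_assoc)
  have Ltan: "L i *v x' i 0 = x' (sc i) 0" if i: "i < m" for i
  proof -
    have "Theta i *v (L i *v x' i 0) = Theta i *v x' (sc i) 0"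
      using no_corner[OF i] Q(4)[OF i, of 1] by (simp only: TL[OF i]) (simp add: Theta_apply)
    then show ?thesis using Theta_inv[OF i] by (metis matrix_inv_works matrix_vector_mul_assoc matrix_vector_mul_lid)
  qed
  have Liso: "gb (G (sc i)) (x (sc i) 0) (L i *v v) (L i *v w) = gb (G i) (x i 0) v w" if i: "i < m" for i v w
  proof -
    interpret lisom "U (sc i)" "G (sc i)" "U i" "G i" "W i" "th i" by (rule iso[OF i])
    have "gb (G (sc i)) (x (sc i) 0) (L i *v v) (L i *v w) = gb (G i) (x i 1) (Q i 1 v) (Q i 1 w)"
      using isom[OF start[OF i], of "L i *v v" "L i *v w"] by (simp add: glue[OF i] TL[OF i] flip: Theta_apply)
    then show ?thesis using Q(3)[OF i, of 1] by simp
  qed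
  \<comment> \<open>The index is reduced modulo \<open>m\<close> so that \<open>i = m\<close>
    returns to the first tangent space; there the claim says that the holonomy is an isometry fixing
    the initial velocity.\<close>
  have N: "N i *v x' 0 0 = x' (i mod m) 0 \<and>
     (\<forall>v w. gb (G (i mod m)) (x (i mod m) 0) (N i *v v) (N i *v w) = gb (G 0) (x 0 0) v w)" if "i \<le> m" for i
    using that
  proof (induction i)
    case 0
    then show ?case by (simp add: N_def)
  next
    case (Suc i)
    then have i: "i < m" "i mod m = i" by auto
    then show ?case using Suc Ltan[OF i(1)] Liso[OF i(1)] by (simp add: Nstep)
  qed
  have speed: "gb (G i) (x i t) (x' i t) (x' i t) = gb (G 0) (x 0 0) (x' 0 0) (x' 0 0)" if i: "i < m" and t: "t \<in> {0..1}" for i t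
    using Q(3)[OF i t, of "x' i 0" "x' i 0"] N[of i] i Q(4)[OF i t] by (metis less_imp_le mod_less)
  then show "\<And>i t. i < m \<Longrightarrow> t \<in> {0..1} \<Longrightarrow> gb (G i) (x i t) (x' i t) (x' i t) = gb (G 0) (x 0 0) (x' 0 0) (x' 0 0)" .
  interpret M: lmetric "U 0" "G 0" by (rule met[OF m])
  define p where "p = x 0 0"
  have p: "p \<in> U 0" using geod[OF m] by (auto simp: geodesic01_def p_def)
  define S where "S = G 0 p"
  define H where "H = N m"
  define c where "c = sqrt (gb (G 0) p (x' 0 0) (x' 0 0))"
  have c: "c > 0" using M.pos[OF p nz] by (simp add: c_def)
  define T where "T = x' 0 0 /\<^sub>R c"
  have HT: "H *v T = T" using N[of m] by (simp add: H_def T_def matrix_vector_mult_scaleR)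
  have Hiso: "(H *v v) \<bullet> (S *v (H *v w)) = v \<bullet> (S *v w)" for v w
    using N[of m] by (simp add: H_def S_def p_def flip: gb_matrix)
  have ent: "axis i 1 \<bullet> (A *v axis j 1) = A $ i $ j" for A :: "real^'n^'n" and i j
    by (simp add: inner_axis' matrix_vector_mult_basis column_def)
  have 1: "transpose H ** S ** H = S"
  proof -
    have "(transpose H ** S ** H) $ i $ j = S $ i $ j" for i j
    proof -
      have "(transpose H ** S ** H) $ i $ j = axis i 1 \<bullet> (transpose H *v (S *v (H *v axis j 1)))"
        by (simp add: matrix_vector_mul_assoc matrix_mul_assoc del: transpose_matrix_vector flip: ent)
      also have "\<dots> = (H *v axis i 1) \<bullet> (S *v (H *v axis j 1))"
        by (metis dot_lmul_matrix inner_commute transpose_matrix_vector)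
      also have "\<dots> = S $ i $ j" by (simp only: Hiso ent)
      finally show ?thesis .
    qed
    then show ?thesis by (simp add: vec_eq_iff)
  qed
  have 2: "transpose S = S"
  proof -
    have "S $ i $ j = S $ j $ i" for i j
      using M.sym[OF p, of "axis i 1" "axis j 1"] by (simp add: gb_axis S_def)
    then show ?thesis by (simp add: vec_eq_iff transpose_def)
  qed
  have 3: "det S \<noteq> 0" unfolding S_def by (rule M.det_G[OF p])
  have 4: "T \<bullet> (S *v T) = 1"
  proof -
    have "c * c = gb (G 0) p (x' 0 0) (x' 0 0)" using M.pos[OF p nz] by (simp add: c_def)
    moreover have "T \<bullet> (S *v T) = gb (G 0) p T T" by (simp add: gb_matrix S_def)
    moreover have "gb (G 0) p T T = gb (G 0) p (x' 0 0) (x' 0 0) / (c * c)"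
      by (simp add: T_def blinfun.bilinear_simps divide_inverse)
    ultimately show ?thesis using M.pos[OF p nz] by simp
  qed
  \<comment> \<open>Only the sign matters: transport has positive determinant, so each factor
    \<open>L i\<close> has the sign of \<open>Theta i\<close>, and the product of these signs is
    excluded by hypothesis.\<close>
  have 5: "det H \<noteq> - ((-1) ^ CARD('n))"
  proof
    assume "det H = - ((-1) ^ CARD('n))"
    then have "sgn (det H) = - ((-1) ^ CARD('n))" by (simp add: minus_one_power_iff split: if_splits)
    moreover have "sgn (det H) = (\<Prod>i<m. sgn (det (L i)))"
      by (simp add: H_def N_def det_matrix_chain sgn_prod_lessThan)
    moreover have "sgn (det (L i)) = sgn (det (Theta i))" if "i < m" for i
    proof -
      have "Theta i ** L i = matrix (Q i 1)"
        using matrix_inv_works[OF Theta_inv[OF that]] by (simp add: L_def matrix_mul_assoc)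
      then have "det (Theta i) * det (L i) > 0" using Q(5)[OF that] by (metis det_mul)
      then show ?thesis by (auto simp: zero_less_mult_iff)
    qed
    ultimately show False using sgn by simp
  qed
  obtain w where w: "w \<noteq> 0" "H *v w = w" "w \<bullet> (S *v T) = 0"
    using isometry_fixed_vector[OF 1 2 3 HT 4 5] by blast
  define n where "n = sqrt (gb (G 0) p w w)"
  have n: "n > 0" "n * n = gb (G 0) p w w" using M.pos[OF p w(1)] by (simp_all add: n_def)
  define w1 where "w1 = w /\<^sub>R n"
  have w1: "gb (G 0) p w1 w1 = 1" "H *v w1 = w1" "gb (G 0) p w1 (x' 0 0) = 0"
  proof -
    have "gb (G 0) p w1 w1 = gb (G 0) p w w / (n * n)"
      by (simp add: w1_def blinfun.bilinear_simps divide_inverse)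
    then show "gb (G 0) p w1 w1 = 1" using n M.pos[OF p w(1)] by simp
    show "H *v w1 = w1" using w(2) by (simp add: w1_def matrix_vector_mult_scaleR)
    have "gb (G 0) p w T = 0" using w(3) by (simp add: gb_matrix S_def)
    then show "gb (G 0) p w1 (x' 0 0) = 0" using c by (simp add: w1_def T_def blinfun.bilinear_simps)
  qed
  define P where "P i t = Q i t (N i *v w1)" for i t
  have a: "(P i has_vector_derivative - chr (G i) (x i t) (x' i t) (P i t)) (at t within {0..1})" if "i < m" "t \<in> {0..1}" for i t
    unfolding P_def[abs_def] using Q(2)[OF that] .
  have b: "gb (G i) (x i t) (P i t) (P i t) = 1" "gb (G i) (x i t) (P i t) (x' i t) = 0" if i: "i < m" and t: "t \<in> {0..1}" for i t
  proof -
    have im: "i \<le> m" "i mod m = i" using i by auto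
    show "gb (G i) (x i t) (P i t) (P i t) = 1" using Q(3)[OF i t] N[OF im(1)] w1(1) im by (simp add: P_def p_def)
    have "gb (G i) (x i t) (P i t) (Q i t (N i *v x' 0 0)) = gb (G i) (x i 0) (N i *v w1) (N i *v x' 0 0)"
      unfolding P_def by (rule Q(3)[OF i t])
    also have "\<dots> = gb (G 0) (x 0 0) w1 (x' 0 0)" using conjunct2[OF N[OF im(1)]] im(2) by metis
    also have "\<dots> = 0" using w1(3) by (simp add: p_def)
    finally have "gb (G i) (x i t) (P i t) (Q i t (N i *v x' 0 0)) = 0" .
    then show "gb (G i) (x i t) (P i t) (x' i t) = 0" using N[OF im(1)] im Q(4)[OF i t] by simp
  qed
  have d: "P i 1 = Dbl (th i) (x (sc i) 0) (P (sc i) 0)" if i: "i < m" for i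
  proof -
    \<comment> \<open>At the last segment \<open>sc i\<close> is 0, and the equation says that
      \<open>w1\<close> is fixed by the holonomy; this is where the field closes up.\<close>
    have "N (sc i) *v w1 = N (Suc i) *v w1"
    proof (cases "Suc i = m")
      case True
      then show ?thesis using w1(2) by (simp add: H_def) (simp add: N_def)
    next
      case False
      then show ?thesis using i by simp
    qed
    then have "P (sc i) 0 = L i *v (N i *v w1)" using Q(1)[OF sc_less] by (simp add: P_def Nstep)
    then show ?thesis using TL[OF i] by (simp add: P_def flip: Theta_apply)
  qed
  show "\<exists>P. (\<forall>i<m. \<forall>t\<in>{0..1}. (P i has_vector_derivative - chr (G i) (x i t) (x' i t) (P i t)) (at t within {0..1})) \<and>
      (\<forall>i<m. \<forall>t\<in>{0..1}. gb (G i) (x i t) (P i t) (P i t) = 1 \<and> gb (G i) (x i t) (P i t) (x' i t) = 0) \<and>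
      (\<forall>i<m. P i 1 = Dbl (th i) (x (sc i) 0) (P (sc i) 0))"
    using a b d by blast
qed

text \<open>A zero velocity is carried along by transport and across joints by injective
  differentials, so it spreads over the loop. Later this excludes a constant minimiser.\<close>

lemma zero_velocity:
  assumes z: "x' 0 0 = 0" and i: "i < m" and t: "t \<in> {0..1}"
  shows "x' i t = 0"
proof -
  have const: "x' i t = 0" if im: "i < m" and "x' i 0 = 0" "t \<in> {0..1}" for i t
  proof -
    obtain Q where "is_transport (G i) (x i) (x' i) Q"
      using lmetric.parallel_transport[OF met[OF im] geod[OF im] small[OF im]] by blast
    then have "Q t (x' i 0) = x' i t" using that(3) unfolding is_transport_def by blast
    then show ?thesis using that(2) by (simp add: blinfun.bilinear_simps)
  qed
  have "x' i 0 = 0" using i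
  proof (induction i)
    case (Suc i)
    interpret lisom "U (sc i)" "G (sc i)" "U i" "G i" "W i" "th i" by (rule iso) (use Suc.prems in simp)
    have "x' i 1 = 0" using const[of i 1] Suc by simp
    then have "Dbl (th i) (x (sc i) 0) (x' (sc i) 0) = 0" using no_corner[of i] Suc by simp
    then have "x' (sc i) 0 = 0" using inj_Dpsi[OF start[of i]] Suc by simp
    then show ?case using Suc by simp
  qed (use z in simp)
  then show ?thesis using const i t by blast
qed

end

section \<open>Charts\<close>

abbreviation img_c :: "('a, 'n) chart \<Rightarrow> (real^'n) set"
  where "img_c c \<equiv> map_c c ` dom_c c"

definition dom2 :: "('a \<Rightarrow> 'a) \<Rightarrow> ('a, 'n) chart \<Rightarrow> ('a, 'n) chart \<Rightarrow> (real^'n) set"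
  where "dom2 H c d = map_c c ` {p \<in> dom_c c. H p \<in> dom_c d}"

text \<open>With \<open>H = id\<close> this is a coordinate change, so facts about maps in charts
  and about changes of charts are proved once.\<close>

definition rep :: "('a \<Rightarrow> 'a) \<Rightarrow> ('a, 'n) chart \<Rightarrow> ('a, 'n) chart \<Rightarrow> real^'n \<Rightarrow> real^'n"
  where "rep H c d = map_c d \<circ> H \<circ> inv_c c"

locale manifold_atlas =
  fixes T :: "'a topology" and A :: "('a, 'n::finite) chart set"
  assumes atlas: "smooth_atlas T A"
begin

lemma chart: "c \<in> A \<Longrightarrow> is_chart T c"
  using atlas by (simp add: smooth_atlas_def)

lemma open_dom: "c \<in> A \<Longrightarrow> openin T (dom_c c)"
  using chart by (simp add: is_chart_def)

lemma open_img: "c \<in> A \<Longrightarrow> open (img_c c)"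
  using chart by (simp add: is_chart_def)

lemma dom_sub: "c \<in> A \<Longrightarrow> p \<in> dom_c c \<Longrightarrow> p \<in> topspace T"
  using openin_subset[OF open_dom] by blast

lemma topspace_subtopology_dom: "c \<in> A \<Longrightarrow> topspace (subtopology T (dom_c c)) = dom_c c"
  using openin_subset[OF open_dom] by (simp add: Int_absorb1)

lemma chart_homeo: "c \<in> A \<Longrightarrow> homeomorphic_map (subtopology T (dom_c c)) (top_of_set (img_c c)) (map_c c)"
  using chart by (simp add: is_chart_def)

lemma chart_inj: "c \<in> A \<Longrightarrow> inj_on (map_c c) (dom_c c)"
  using homeomorphic_imp_injective_map[OF chart_homeo] topspace_subtopology_dom by fastforce

lemma inv_map [simp]: "c \<in> A \<Longrightarrow> p \<in> dom_c c \<Longrightarrow> inv_c c (map_c c p) = p"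
  unfolding inv_c_def by (rule inv_into_f_f[OF chart_inj])

lemma map_inv [simp]: "x \<in> img_c c \<Longrightarrow> map_c c (inv_c c x) = x"
  unfolding inv_c_def by (rule f_inv_into_f)

lemma inv_in: "x \<in> img_c c \<Longrightarrow> inv_c c x \<in> dom_c c"
  unfolding inv_c_def by (rule inv_into_into)

lemma map_continuous: "c \<in> A \<Longrightarrow> continuous_map (subtopology T (dom_c c)) euclidean (map_c c)"
  using homeomorphic_imp_continuous_map[OF chart_homeo] by (simp add: continuous_map_in_subtopology)

lemma inv_continuous: "c \<in> A \<Longrightarrow> continuous_map (top_of_set (img_c c)) T (inv_c c)"
proof -
  assume c: "c \<in> A"
  obtain h where h: "homeomorphic_maps (subtopology T (dom_c c)) (top_of_set (img_c c)) (map_c c) h"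
    using chart_homeo[OF c] by (auto simp: homeomorphic_map_maps)
  then have ch: "continuous_map (top_of_set (img_c c)) (subtopology T (dom_c c)) h"
    and hm: "\<And>p. p \<in> dom_c c \<Longrightarrow> h (map_c c p) = p"
    using topspace_subtopology_dom[OF c] by (auto simp: homeomorphic_maps_def)
  have "continuous_map (top_of_set (img_c c)) T h" using ch by (simp add: continuous_map_in_subtopology)
  then show ?thesis
    by (rule continuous_map_eq) (use hm c in auto)
qed

lemma map_open:
  assumes c: "c \<in> A" and S: "openin T S" "S \<subseteq> dom_c c"
  shows "open (map_c c ` S)"
proof -
  have "openin (subtopology T (dom_c c)) S" using S by (simp add: openin_open_subtopology open_dom[OF c])
  then have "openin (top_of_set (img_c c)) (map_c c ` S)"
    using homeomorphic_imp_open_map[OF chart_homeo[OF c]] by (simp add: open_map_def)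
  then show ?thesis using openin_open_trans open_img[OF c] by blast
qed

lemma map_preimage_open:
  assumes c: "c \<in> A" and S: "open S"
  shows "openin T {p \<in> dom_c c. map_c c p \<in> S}"
proof -
  have "openin (subtopology T (dom_c c)) {p \<in> topspace (subtopology T (dom_c c)). map_c c p \<in> S}"
    using map_continuous[OF c] S by (simp add: continuous_map_def)
  then have "openin (subtopology T (dom_c c)) {p \<in> dom_c c. map_c c p \<in> S}"
    by (simp only: topspace_subtopology_dom[OF c])
  then show ?thesis using openin_trans_full open_dom[OF c] by blast
qed

lemma dom2_iff: "c \<in> A \<Longrightarrow> x \<in> dom2 H c d \<longleftrightarrow> x \<in> img_c c \<and> H (inv_c c x) \<in> dom_c d"
  by (auto simp: dom2_def)

lemma dom2_map: "c \<in> A \<Longrightarrow> p \<in> dom_c c \<Longrightarrow> H p \<in> dom_c d \<Longrightarrow> map_c c p \<in> dom2 H c d"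
  by (auto simp: dom2_def)

lemma dom2_sub: "dom2 H c d \<subseteq> img_c c"
  by (auto simp: dom2_def)

lemma rep_map [simp]: "c \<in> A \<Longrightarrow> p \<in> dom_c c \<Longrightarrow> rep H c d (map_c c p) = map_c d (H p)"
  by (simp add: rep_def)

lemma rep_in: "c \<in> A \<Longrightarrow> x \<in> dom2 H c d \<Longrightarrow> rep H c d x \<in> img_c d"
  by (auto simp: dom2_def)

lemma smooth_map_continuous: "smooth_map T A H \<Longrightarrow> continuous_map T T H"
  by (simp add: smooth_map_def)

lemma smooth_rep: "smooth_map T A H \<Longrightarrow> c \<in> A \<Longrightarrow> d \<in> A \<Longrightarrow> smooth_on (dom2 H c d) (rep H c d)"
  by (simp add: smooth_map_def dom2_def rep_def)

lemma smooth_map_id: "smooth_map T A id"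
proof -
  have "{p \<in> dom_c c. p \<in> dom_c d} = dom_c c \<inter> dom_c d" for c d :: "('a, 'n) chart" by auto
  then show ?thesis using atlas by (simp add: smooth_map_def smooth_atlas_def)
qed

lemma open_dom2:
  assumes H: "continuous_map T T H" and c: "c \<in> A" and d: "d \<in> A"
  shows "open (dom2 H c d)"
  unfolding dom2_def
proof (rule map_open[OF c])
  have "openin T {p \<in> topspace T. H p \<in> dom_c d}" using H open_dom[OF d] by (simp add: continuous_map_def)
  from openin_Int[OF open_dom[OF c] this] show "openin T {p \<in> dom_c c. H p \<in> dom_c d}"
    by (rule back_subst[of "openin T"]) (use dom_sub[OF c] in auto)
qed auto

lemma rep_derivative:
  assumes "smooth_map T A H" "c \<in> A" "d \<in> A" "p \<in> dom_c c" "H p \<in> dom_c d"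
  shows "(rep H c d has_derivative Dbl (rep H c d) (map_c c p)) (at (map_c c p))"
    and "frechet_derivative (rep H c d) (at (map_c c p)) = blinfun_apply (Dbl (rep H c d) (map_c c p))"
  using smooth_on_has_derivative[OF smooth_rep[OF assms(1-3)] dom2_map[of c p H d]] 
    smooth_on_frechet_eq[OF smooth_rep[OF assms(1-3)] dom2_map[of c p H d]] assms by auto

text \<open>Taking \<open>id\<close> for one of the two maps gives the behaviour of the differential
  of the other under a change of chart at its source or target.\<close>

lemma rep_chain:
  assumes H1: "smooth_map T A H1" and H2: "smooth_map T A H2" and H: "\<And>p. p \<in> topspace T \<Longrightarrow> H p = H2 (H1 p)" and c: "c \<in> A" "d \<in> A" "e \<in> A"
    and p: "p \<in> dom_c c" "H1 p \<in> dom_c d" "H2 (H1 p) \<in> dom_c e"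
  shows "Dbl (rep H c e) (map_c c p) u = Dbl (rep H2 d e) (map_c d (H1 p)) (Dbl (rep H1 c d) (map_c c p) u)"
proof -
  have cont: "continuous_map T T H" 
    by (rule continuous_map_eq[OF continuous_map_compose[OF smooth_map_continuous[OF H1] smooth_map_continuous[OF H2]]]) (simp add: H)
  have "(rep H2 d e has_derivative Dbl (rep H2 d e) (rep H1 c d (map_c c p))) (at (rep H1 c d (map_c c p)))"
    using rep_derivative(1)[OF H2 c(2,3) p(2,3)] c p by simp
  from has_derivative_compose[OF rep_derivative(1)[OF H1 c(1,2) p(1,2)] this]
  have "((\<lambda>x. rep H2 d e (rep H1 c d x)) has_derivative (\<lambda>u. Dbl (rep H2 d e) (map_c d (H1 p)) (Dbl (rep H1 c d) (map_c c p) u))) (at (map_c c p))"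
    using c p by simp
  moreover have "open (dom2 H1 c d)" by (rule open_dom2[OF smooth_map_continuous[OF H1] c(1,2)])
  moreover have "map_c c p \<in> dom2 H1 c d" using dom2_map c p by simp
  moreover have "rep H2 d e (rep H1 c d x) = rep H c e x" if "x \<in> dom2 H1 c d" for x
    using that c dom_sub[OF c(1)] by (auto simp: dom2_def rep_def H)
  ultimately have "(rep H c e has_derivative (\<lambda>u. Dbl (rep H2 d e) (map_c d (H1 p)) (Dbl (rep H1 c d) (map_c c p) u))) (at (map_c c p))"
    using has_derivative_transform_within_open by blast
  from Dbl_eq[OF this] show ?thesis by simp
qed

abbreviation tr :: "('a, 'n) chart \<Rightarrow> ('a, 'n) chart \<Rightarrow> real^'n \<Rightarrow> real^'n"
  where "tr c d \<equiv> rep id c d"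

lemma tr_eq: "map_c d \<circ> inv_c c = tr c d"
  by (simp add: rep_def)

lemma Dtr_self: "c \<in> A \<Longrightarrow> p \<in> dom_c c \<Longrightarrow> Dbl (tr c c) (map_c c p) u = u"
proof -
  assume c: "c \<in> A" and p: "p \<in> dom_c c"
  have "(tr c c has_derivative (\<lambda>u. u)) (at (map_c c p))"
    by (rule has_derivative_transform_within_open[OF has_derivative_ident open_img[OF c]]) (use c p in \<open>auto simp: rep_def\<close>)
  from Dbl_eq[OF this] show ?thesis by simp
qed

lemma vec_at_eq:
  assumes "c \<in> A" "p \<in> dom_c c"
  shows "vec_at A c p u d = (if d \<in> A \<and> p \<in> dom_c d then Dbl (tr c d) (map_c c p) u else 0)"
  unfolding vec_at_def tr_eq using rep_derivative(2)[OF smooth_map_id assms(1) _ assms(2), of d] by simp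

lemma vec_at_self: "c \<in> A \<Longrightarrow> p \<in> dom_c c \<Longrightarrow> vec_at A c p u c = u"
  by (simp add: vec_at_eq Dtr_self)

lemma vec_at_tangent:
  assumes "c \<in> A" "p \<in> dom_c c"
  shows "vec_at A c p u \<in> tangent_space A p"
  unfolding tangent_space_def tr_eq mem_Collect_eq
proof (intro conjI ballI impI allI)
  fix d e assume d: "d \<in> A" and e: "e \<in> A" and "p \<in> dom_c d \<inter> dom_c e"
  then show "vec_at A c p u e = frechet_derivative (tr d e) (at (map_c d p)) (vec_at A c p u d)"
    using rep_chain[OF smooth_map_id smooth_map_id _ assms(1) d e, of id p u]
      rep_derivative(2)[OF smooth_map_id d e, of p] assms by (simp add: vec_at_eq[OF assms])
qed (auto simp: vec_at_eq[OF assms])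

lemma tangent_vec_at:
  assumes v: "v \<in> tangent_space A p" and c: "c \<in> A" "p \<in> dom_c c"
  shows "v = vec_at A c p (v c)"
proof
  fix d
  show "v d = vec_at A c p (v c) d"
  proof (cases "d \<in> A \<and> p \<in> dom_c d")
    case True
    have "v d = frechet_derivative (map_c d \<circ> inv_c c) (at (map_c c p)) (v c)"
      using v c True unfolding tangent_space_def by blast
    then show ?thesis
      using True rep_derivative(2)[OF smooth_map_id c(1) _ c(2), of d] by (simp add: vec_at_eq[OF c] tr_eq)
  next
    case False
    then have "v d = 0" using v unfolding tangent_space_def by blast
    then show ?thesis using False by (auto simp: vec_at_eq[OF c])
  qed
qed

lemma vec_at_linear:
  assumes "c \<in> A" "p \<in> dom_c c"
  shows "vec_at A c p (u + v) = (\<lambda>d. vec_at A c p u d + vec_at A c p v d)"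
    "vec_at A c p (r *\<^sub>R u) = (\<lambda>d. r *\<^sub>R vec_at A c p u d)"
  by (auto simp: fun_eq_iff vec_at_eq[OF assms] blinfun.bilinear_simps)

lemma vec_at_tr:
  assumes "c \<in> A" "p \<in> dom_c c" "d \<in> A" "p \<in> dom_c d"
  shows "vec_at A d p (Dbl (tr c d) (map_c c p) u) = vec_at A c p u"
  using tangent_vec_at[OF vec_at_tangent[OF assms(1,2), of u] assms(3,4)] assms by (simp add: vec_at_eq)

end

section \<open>The metric and isometries in charts\<close>

locale riemannian = manifold_atlas T A
  for T :: "'a topology" and A :: "('a, 'n::finite) chart set" +
  fixes g :: "('a, 'n) metric"
  assumes metric: "riemannian_metric T A g"
begin

abbreviation mc :: "('a, 'n) chart \<Rightarrow> real^'n \<Rightarrow> real^'n^'n"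
  where "mc c \<equiv> metric_coord A g c"

lemma g_props:
  assumes "p \<in> topspace T" "u \<in> tangent_space A p" "v \<in> tangent_space A p"
  shows "g p u v = g p v u" "w \<in> tangent_space A p \<Longrightarrow> g p (\<lambda>c. u c + v c) w = g p u w + g p v w"
    "g p (\<lambda>c. r *\<^sub>R u c) v = r * g p u v" "u \<noteq> (\<lambda>c. 0) \<Longrightarrow> g p u u > 0"
  using metric assms unfolding riemannian_metric_def by blast+

lemma gb_mc:
  assumes c: "c \<in> A" "p \<in> dom_c c"
  shows "gb (mc c) (map_c c p) u v = g p (vec_at A c p u) (vec_at A c p v)"
proof -
  note t = vec_at_tangent[OF c] and ps = dom_sub[OF c]
  have lin1: "linear (\<lambda>u. g p (vec_at A c p u) w)" if "w \<in> tangent_space A p" for w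
    by (rule linearI) (simp_all add: vec_at_linear[OF c] g_props[OF ps t] that t)
  have lin2: "linear (\<lambda>v. g p w (vec_at A c p v))" if "w \<in> tangent_space A p" for w
    using lin1[OF that] g_props(1)[OF ps that t] by simp
  have lb: "linear (\<lambda>u. gb (mc c) x u v)" "linear (\<lambda>v. gb (mc c) x u v)" for x u v
    by (auto intro!: linearI simp: blinfun.bilinear_simps)
  have 1: "gb (mc c) (map_c c p) (axis i 1) (axis j 1) = g p (vec_at A c p (axis i 1)) (vec_at A c p (axis j 1))" for i j
    by (simp add: gb_axis metric_coord_def c)
  have 2: "gb (mc c) (map_c c p) (axis i 1) v = g p (vec_at A c p (axis i 1)) (vec_at A c p v)" for i v
    by (rule linear_eq_axis[OF lb(2) lin2[OF t] 1])
  show ?thesis by (rule linear_eq_axis[OF lb(1) lin1[OF t] 2])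
qed

lemma g_coord:
  assumes c: "c \<in> A" "p \<in> dom_c c" and "u \<in> tangent_space A p" "v \<in> tangent_space A p"
  shows "g p u v = gb (mc c) (map_c c p) (u c) (v c)"
  using gb_mc[OF c, of "u c" "v c"] tangent_vec_at[OF _ c] assms by metis

lemma lmetric_chart: "c \<in> A \<Longrightarrow> lmetric (img_c c) (mc c)"
proof unfold_locales
  assume c: "c \<in> A"
  show "open (img_c c)" by (rule open_img[OF c])
  show "smooth_on (img_c c) (mc c)" using metric c by (simp add: riemannian_metric_def)
  fix x u v assume x: "x \<in> img_c c"
  then obtain p where p: "p \<in> dom_c c" "x = map_c c p" by auto
  show "gb (mc c) x u v = gb (mc c) x v u"
    unfolding p(2) gb_mc[OF c p(1)] by (intro g_props(1) dom_sub[OF c p(1)] vec_at_tangent[OF c p(1)])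
  assume "u \<noteq> 0"
  then have "vec_at A c p u \<noteq> (\<lambda>c. 0)" using vec_at_self[OF c p(1), of u] by metis
  then show "0 < gb (mc c) x u u"
    unfolding p(2) gb_mc[OF c p(1)] by (rule g_props(4)[OF dom_sub[OF c p(1)] vec_at_tangent[OF c p(1)] vec_at_tangent[OF c p(1)]])
qed

text \<open>A chart form of metric preservation that the identity and \<open>F\<close> share, since
  both occur as gluing maps of a chain; it passes directly to \<open>lisom\<close>.\<close>

definition isometric :: "('a \<Rightarrow> 'a) \<Rightarrow> bool"
  where "isometric H \<longleftrightarrow> smooth_map T A H \<and>
    (\<forall>c\<in>A. \<forall>d\<in>A. \<forall>p\<in>dom_c c. H p \<in> dom_c d \<longrightarrow> (\<forall>u v.
      gb (mc c) (map_c c p) u v = gb (mc d) (map_c d (H p)) (Dbl (rep H c d) (map_c c p) u) (Dbl (rep H c d) (map_c c p) v)))"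

lemma isometric_smooth: "isometric H \<Longrightarrow> smooth_map T A H"
  by (simp add: isometric_def)

lemma isometric_id: "isometric id"
  by (simp add: isometric_def smooth_map_id gb_mc vec_at_tr)

text \<open>The relation \<open>dmap\<close> demands the right components in every chart. The vector
  with the components predicted by one pair of charts meets this by the chain rule, and metric
  preservation can then be read off in that pair.\<close>

lemma isometric_riem_isometry:
  assumes F: "riem_isometry T A g F"
  shows "isometric F"
  unfolding isometric_def
proof (intro conjI ballI impI allI)
  show sm: "smooth_map T A F" using F unfolding riem_isometry_def diffeomorphism_def by blast
  fix c d p u v assume c: "c \<in> A" and d: "d \<in> A" and p: "p \<in> dom_c c" and Fp: "F p \<in> dom_c d"
  have dm: "dmap A F p (vec_at A c p u) (vec_at A d (F p) (Dbl (rep F c d) (map_c c p) u))" for u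
    unfolding dmap_def
  proof (intro conjI ballI impI)
    show "vec_at A d (F p) (Dbl (rep F c d) (map_c c p) u) \<in> tangent_space A (F p)" by (rule vec_at_tangent[OF d Fp])
    fix c' d' assume c': "c' \<in> A" and d': "d' \<in> A" and *: "p \<in> dom_c c' \<and> F p \<in> dom_c d'"
    have "Dbl (tr d d') (map_c d (F p)) (Dbl (rep F c d) (map_c c p) u) = Dbl (rep F c d') (map_c c p) u"
      using rep_chain[OF sm smooth_map_id _ c d d' p Fp, of F u] * by simp
    moreover have "Dbl (rep F c' d') (map_c c' p) (Dbl (tr c c') (map_c c p) u) = Dbl (rep F c d') (map_c c p) u"
      using rep_chain[OF smooth_map_id sm _ c c' d' p, of F u] * by simp
    ultimately show "vec_at A d (F p) (Dbl (rep F c d) (map_c c p) u) d' = frechet_derivative (map_c d' \<circ> F \<circ> inv_c c') (at (map_c c' p)) (vec_at A c p u c')"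
      using * c' d' rep_derivative(2)[OF sm c' d', of p] unfolding rep_def[symmetric] by (simp add: vec_at_eq c d p Fp)
  qed
  have "\<forall>u'\<in>tangent_space A p. \<forall>v'\<in>tangent_space A p. \<forall>u'' v''. dmap A F p u' u'' \<and> dmap A F p v' v'' \<longrightarrow> g (F p) u'' v'' = g p u' v'"
    using F dom_sub[OF c p] unfolding riem_isometry_def by blast
  then have "g (F p) (vec_at A d (F p) (Dbl (rep F c d) (map_c c p) u)) (vec_at A d (F p) (Dbl (rep F c d) (map_c c p) v))
      = g p (vec_at A c p u) (vec_at A c p v)"
    using dm[of u] dm[of v] vec_at_tangent[OF c p] by blast
  then show "gb (mc c) (map_c c p) u v = gb (mc d) (map_c d (F p)) (Dbl (rep F c d) (map_c c p) u) (Dbl (rep F c d) (map_c c p) v)"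
    by (simp add: gb_mc[OF c p] gb_mc[OF d Fp])
qed

lemma isometric_lisom:
  assumes H: "isometric H" and c: "c \<in> A" and d: "d \<in> A"
  shows "lisom (img_c c) (mc c) (img_c d) (mc d) (dom2 H c d) (rep H c d)"
proof -
  interpret A: lmetric "img_c c" "mc c" by (rule lmetric_chart[OF c])
  interpret B: lmetric "img_c d" "mc d" by (rule lmetric_chart[OF d])
  show ?thesis
  proof unfold_locales
    show "open (dom2 H c d)" by (rule open_dom2[OF smooth_map_continuous[OF isometric_smooth[OF H]] c d])
    show "dom2 H c d \<subseteq> img_c c" by (rule dom2_sub)
    show "smooth_on (dom2 H c d) (rep H c d)" by (rule smooth_rep[OF isometric_smooth[OF H] c d])
    show "rep H c d x \<in> img_c d" if "x \<in> dom2 H c d" for x using rep_in[OF c that] .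
    fix x u v assume "x \<in> dom2 H c d"
    then obtain p where p: "p \<in> dom_c c" "H p \<in> dom_c d" "x = map_c c p" by (auto simp: dom2_def)
    then show "gb (mc c) x u v = gb (mc d) (rep H c d x) (Dbl (rep H c d) x u) (Dbl (rep H c d) x v)"
      using H c d by (simp add: isometric_def)
  qed
qed

end

section \<open>Minimal chains\<close>

text \<open>A chart, and in it the centre and radius of a good ball, together with lower and upper bounds
  for the metric.\<close>

type_synonym ('a, 'n) gball = "('a, 'n) chart \<times> (real^'n) \<times> real \<times> real \<times> real"

abbreviation "ch (j :: ('a, 'n::finite) gball) \<equiv> fst j"
abbreviation "ce (j :: ('a, 'n::finite) gball) \<equiv> fst (snd j)"
abbreviation "ra (j :: ('a, 'n::finite) gball) \<equiv> fst (snd (snd j))"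
abbreviation "lo (j :: ('a, 'n::finite) gball) \<equiv> fst (snd (snd (snd j)))"
abbreviation "hi (j :: ('a, 'n::finite) gball) \<equiv> snd (snd (snd (snd j)))"

text \<open>Three nested neighbourhoods: the closed ball for compactness, the open ball for freedom
  to vary, and the half ball for a cover with margin.\<close>

definition cinner :: "('a, 'n::finite) gball \<Rightarrow> 'a set"
  where "cinner j = {p \<in> dom_c (ch j). map_c (ch j) p \<in> cball (ce j) (ra j)}"

definition inner :: "('a, 'n::finite) gball \<Rightarrow> 'a set"
  where "inner j = {p \<in> dom_c (ch j). map_c (ch j) p \<in> ball (ce j) (ra j)}"

definition half :: "('a, 'n::finite) gball \<Rightarrow> 'a set"
  where "half j = {p \<in> dom_c (ch j). map_c (ch j) p \<in> ball (ce j) (ra j / 2)}"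

context riemannian begin

abbreviation mcb :: "('a, 'n) gball \<Rightarrow> real^'n \<Rightarrow> real^'n^'n" where "mcb j \<equiv> mc (ch j)"

definition good :: "('a, 'n) gball \<Rightarrow> bool"
  where "good j \<longleftrightarrow> ch j \<in> A \<and> good_ball (img_c (ch j)) (mcb j) (ce j) (ra j) (lo j) (hi j)"

lemma goodD:
  assumes "good j"
  shows "ch j \<in> A" "0 < ra j" "0 < lo j" "cball (ce j) (6 * ra j) \<subseteq> img_c (ch j)"
    "p \<in> cball (ce j) (6 * ra j) \<Longrightarrow> lo j * (norm v)\<^sup>2 \<le> gb (mcb j) p v v"
    "p \<in> cball (ce j) (6 * ra j) \<Longrightarrow> gb (mcb j) p v v \<le> hi j * (norm v)\<^sup>2"
    "p \<in> cball (ce j) (6 * ra j) \<Longrightarrow> norm (chr (mcb j) p) * (8 * ra j) \<le> 1"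
  using assms unfolding good_def good_ball_def by blast+

definition seg :: "('a, 'n) gball \<Rightarrow> real^'n \<Rightarrow> real^'n \<Rightarrow> (real \<Rightarrow> real^'n) \<Rightarrow> (real \<Rightarrow> real^'n) \<Rightarrow> bool"
  where "seg j a b x x' \<longleftrightarrow> geodesic01 (img_c (ch j)) (mcb j) x x' \<and> x 0 = a \<and> x 1 = b \<and>
       (\<forall>t\<in>{0..1}. x t \<in> cball (ce j) (5 * ra j) \<and> norm (x' t) \<le> 4 * ra j) \<and>
       (\<forall>y y'. C1_curve y y' \<and> (\<forall>t\<in>{0..1}. y t \<in> cball (ce j) (6 * ra j)) \<and> y 0 = a \<and> y 1 = b \<longrightarrow>
          energy (mcb j) x x' \<le> energy (mcb j) y y')"

text \<open>The choice is harmless: two segments with the same end points are competitors of each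
  other and so have equal energy.\<close>

definition emin :: "('a, 'n) gball \<Rightarrow> real^'n \<Rightarrow> real^'n \<Rightarrow> real"
  where "emin j a b = (SOME e. \<exists>x x'. seg j a b x x' \<and> e = energy (mcb j) x x')"

lemma emin_seg:
  assumes "good j" "a \<in> cball (ce j) (ra j)" "b \<in> cball (ce j) (ra j)"
  shows "\<exists>x x'. seg j a b x x' \<and> emin j a b = energy (mcb j) x x'"
proof -
  have "\<exists>e x x'. seg j a b x x' \<and> e = energy (mcb j) x x'"
    using assms unfolding good_def good_ball_def seg_def by blast
  then show ?thesis unfolding emin_def by (rule someI_ex)
qed

lemma emin_le:
  assumes "good j" "C1_curve y y'" "\<And>t. t \<in> {0..1} \<Longrightarrow> y t \<in> cball (ce j) (6 * ra j)"
    "y 0 \<in> cball (ce j) (ra j)" "y 1 \<in> cball (ce j) (ra j)"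
  shows "emin j (y 0) (y 1) \<le> energy (mcb j) y y'"
proof -
  obtain x x' where x: "seg j (y 0) (y 1) x x'" "emin j (y 0) (y 1) = energy (mcb j) x x'"
    using emin_seg[OF assms(1,4,5)] by blast
  then show ?thesis using assms(2,3) unfolding seg_def by metis
qed

lemma energy_lower:
  assumes j: "good j" and y: "C1_curve y y'" "\<And>t. t \<in> {0..1} \<Longrightarrow> y t \<in> cball (ce j) (6 * ra j)" and t: "t \<in> {0..1}"
  shows "lo j * (norm (y t - y 0))\<^sup>2 \<le> energy (mcb j) y y'"
proof -
  interpret lmetric "img_c (ch j)" "mcb j" by (rule lmetric_chart[OF goodD(1)[OF j]])
  have "C1_curve (\<lambda>t. y t - y 0) y'" using y(1) unfolding C1_curve_def by (auto intro!: derivative_eq_intros)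
  from poincare01[OF this _ t] have 1: "(norm (y t - y 0))\<^sup>2 \<le> integral {0..1} (\<lambda>t. (norm (y' t))\<^sup>2)" by simp
  have i: "(\<lambda>t. (norm (y' t))\<^sup>2) integrable_on {0..1}"
    by (intro integrable_continuous_interval continuous_intros C1_curve_continuous[OF y(1)])
  have "lo j * integral {0..1} (\<lambda>t. (norm (y' t))\<^sup>2) = integral {0..1} (\<lambda>t. lo j * (norm (y' t))\<^sup>2)" by simp
  also have "\<dots> \<le> energy (mcb j) y y'"
    unfolding energy_def
    by (intro integral_le integrable_on_mult_right i energy_integrable y(1) goodD(5)[OF j] y(2)) (use y(2) goodD(4)[OF j] in blast)
  finally show ?thesis using mult_left_mono[OF 1, of "lo j"] goodD(3)[OF j] by linarith
qed

lemma emin_lower: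
  assumes j: "good j" and a: "a \<in> cball (ce j) (ra j)" and b: "b \<in> cball (ce j) (ra j)"
  shows "lo j * (norm (b - a))\<^sup>2 \<le> emin j a b"
proof -
  obtain x x' where x: "seg j a b x x'" "emin j a b = energy (mcb j) x x'" using emin_seg[OF assms] by blast
  have xC: "C1_curve x x'" using x(1) geodesic01_C1 unfolding seg_def by blast
  have "x t \<in> cball (ce j) (6 * ra j)" if "t \<in> {0..1}" for t
    using x(1) that goodD(2)[OF j] by (auto simp: seg_def intro: order_trans[of _ "5 * ra j"])
  from energy_lower[OF j xC this, of 1] show ?thesis using x by (simp add: seg_def)
qed

text \<open>The straight line is a competitor. That the bound is quadratic in the distance is what
  makes subdivision reduce the total cost.\<close>

lemma emin_line:
  assumes j: "good j" and a: "a \<in> cball (ce j) (ra j)" and b: "b \<in> cball (ce j) (ra j)"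
  shows "emin j a b \<le> hi j * (norm (b - a))\<^sup>2"
proof -
  interpret lmetric "img_c (ch j)" "mcb j" by (rule lmetric_chart[OF goodD(1)[OF j]])
  define y where "y t = a + t *\<^sub>R (b - a)" for t
  have yC: "C1_curve y (\<lambda>t. b - a)" unfolding C1_curve_def y_def[abs_def] by (auto intro!: derivative_eq_intros)
  have yb: "y t \<in> cball (ce j) (ra j)" if "t \<in> {0..1}" for t
  proof -
    have "y t = (1 - t) *\<^sub>R a + t *\<^sub>R b" by (simp add: y_def algebra_simps)
    then show ?thesis using convexD_alt[OF convex_cball a b, of t] that by simp
  qed
  have y6: "y t \<in> cball (ce j) (6 * ra j)" if "t \<in> {0..1}" for t
    using yb[OF that] goodD(2)[OF j] by (auto intro: order_trans[of _ "ra j"])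
  have "emin j a b \<le> energy (mcb j) y (\<lambda>t. b - a)"
  proof -
    have y01: "y 0 = a" "y 1 = b" by (simp_all add: y_def)
    show ?thesis using emin_le[OF j yC y6] a b unfolding y01 by blast
  qed
  also have "\<dots> \<le> integral {0..1} (\<lambda>t::real. hi j * (norm (b - a))\<^sup>2)"
    unfolding energy_def
    by (intro integral_le energy_integrable yC integrable_const_ivl goodD(6)[OF j] y6) (use y6 goodD(4)[OF j] in blast)+
  finally show ?thesis by simp
qed

text \<open>If the end points move slightly, adding an affine function of time to a minimal segment
  gives a competitor for the new ends whose energy density is uniformly close. Exchanging the two
  pairs of ends gives the opposite estimate.\<close>

lemma emin_continuous:
  assumes j: "good j"
  shows "continuous_on (cball (ce j) (ra j) \<times> cball (ce j) (ra j)) (\<lambda>(a, b). emin j a b)"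
proof -
  interpret lmetric "img_c (ch j)" "mcb j" by (rule lmetric_chart[OF goodD(1)[OF j]])
  let ?z = "ce j" and ?r = "ra j"
  let ?B = "cball ?z ?r" and ?K = "cball ?z (6 * ?r) \<times> cball (0::real^'n) (8 * ?r)"
  note r = goodD(2)[OF j]
  have "continuous_on ?K (\<lambda>q. gb (mcb j) (fst q) (snd q) (snd q))"
    using goodD(4)[OF j] by (intro continuous_intros continuous_on_compose2[OF continuous_on_Rm(3)]) auto
  then have uc: "uniformly_continuous_on ?K (\<lambda>q. gb (mcb j) (fst q) (snd q) (snd q))"
    by (intro compact_uniformly_continuous compact_Times compact_cball)
  have key: "\<exists>d>0. \<forall>a\<in>?B. \<forall>b\<in>?B. \<forall>a'\<in>?B. \<forall>b'\<in>?B. norm (a' - a) < d \<and> norm (b' - b) < d \<longrightarrow> emin j a' b' \<le> emin j a b + e"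
    if e: "e > 0" for e
  proof -
    obtain d0 where d0: "d0 > 0" "\<And>q q'. q \<in> ?K \<Longrightarrow> q' \<in> ?K \<Longrightarrow> dist q' q < d0 \<Longrightarrow>
       dist (gb (mcb j) (fst q') (snd q') (snd q')) (gb (mcb j) (fst q) (snd q) (snd q)) < e"
      using uc e unfolding uniformly_continuous_on_def by metis
    \<comment> \<open>The bound by the radius keeps the shifted curve in the large ball and its
      velocity below \<open>8 * ra j\<close>. Position moves by less than \<open>d\<close> and
      velocity by less than \<open>2 * d\<close>, which \<open>d0 / 4\<close> covers.\<close>
    define d where "d = min (d0 / 4) ?r"
    have d: "d > 0" "4 * d \<le> d0" "d \<le> ?r" using d0 r by (auto simp: d_def)
    have "emin j a' b' \<le> emin j a b + e"
      if ab: "a \<in> ?B" "b \<in> ?B" "a' \<in> ?B" "b' \<in> ?B" and da: "norm (a' - a) < d" and db: "norm (b' - b) < d" for a b a' b'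
    proof -
      obtain x x' where x: "seg j a b x x'" "emin j a b = energy (mcb j) x x'" using emin_seg[OF j ab(1,2)] by blast
      have xC: "C1_curve x x'" using x(1) geodesic01_C1 unfolding seg_def by blast
      define s where "s t = (a' - a) + t *\<^sub>R ((b' - b) - (a' - a))" for t :: real
      define y where "y t = x t + s t" for t
      define y' where "y' t = x' t + ((b' - b) - (a' - a))" for t
      have sv: "(s has_vector_derivative ((b' - b) - (a' - a))) (at t within S)" for t S
        unfolding s_def[abs_def] by (auto intro!: derivative_eq_intros)
      have yC: "C1_curve y y'" using xC unfolding C1_curve_def y_def[abs_def] y'_def[abs_def]
        by (auto intro!: has_vector_derivative_add sv continuous_intros)
      have sd: "norm (s t) < d" if t: "t \<in> {0..1}" for t
      proof -
        have "s t = (1 - t) *\<^sub>R (a' - a) + t *\<^sub>R (b' - b)" by (simp add: s_def algebra_simps)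
        then have "s t \<in> ball 0 d" using convexD_alt[OF convex_ball, of "a' - a" 0 d "b' - b" t] da db t by simp
        then show ?thesis by simp
      qed
      have xb: "x t \<in> cball ?z (5 * ?r)" "norm (x' t) \<le> 4 * ?r" if "t \<in> {0..1}" for t
        using x(1) that by (auto simp: seg_def)
      have n2: "norm ((b' - b) - (a' - a)) < 2 * d" using da db norm_triangle_ineq4[of "b' - b" "a' - a"] by linarith
      have yK: "(y t, y' t) \<in> ?K" if t: "t \<in> {0..1}" for t
      proof -
        have "dist ?z (y t) \<le> dist ?z (x t) + norm (s t)"
          using norm_triangle_ineq4[of "?z - x t" "s t"] by (simp add: dist_norm y_def algebra_simps)
        then have "y t \<in> cball ?z (6 * ?r)" using sd[OF t] xb(1)[OF t] d by simp
        moreover have "norm (y' t) \<le> 8 * ?r"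
          unfolding y'_def using norm_triangle_ineq[of "x' t" "(b' - b) - (a' - a)"] n2 xb(2)[OF t] d r by linarith
        ultimately show ?thesis by simp
      qed
      have xK: "(x t, x' t) \<in> ?K" if t: "t \<in> {0..1}" for t
        using xb[OF t] r by (auto intro: order_trans[of _ "5 * ?r"])
      have close: "gb (mcb j) (y t) (y' t) (y' t) \<le> gb (mcb j) (x t) (x' t) (x' t) + e" if t: "t \<in> {0..1}" for t
      proof -
        have "dist (y t, y' t) (x t, x' t) \<le> dist (y t) (x t) + dist (y' t) (x' t)"
          by (simp add: dist_prod_def sqrt_sum_squares_le_sum)
        also have "\<dots> < d + 2 * d" using sd[OF t] n2 by (simp add: y_def y'_def dist_norm)
        also have "\<dots> \<le> d0" using d by simp
        finally show ?thesis using d0(2)[OF xK[OF t] yK[OF t]] by (simp add: dist_real_def)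
      qed
      have "y 0 = a'" "y 1 = b'" using x(1) by (auto simp: y_def s_def seg_def)
      then have "emin j a' b' \<le> energy (mcb j) y y'" using emin_le[OF j yC] yK ab by auto
      also have "\<dots> \<le> integral {0..1} (\<lambda>t. gb (mcb j) (x t) (x' t) (x' t) + e)"
        unfolding energy_def
        by (intro integral_le energy_integrable yC xC integrable_add integrable_const_ivl close)
           (use yK xK goodD(4)[OF j] in blast)+
      also have "\<dots> = emin j a b + e"
        unfolding x(2) energy_def
        by (subst integral_add) (use xK goodD(4)[OF j] in \<open>auto intro!: energy_integrable(2) xC\<close>)
      finally show ?thesis .
    qed
    then show ?thesis using d(1) by blast
  qed
  show ?thesis
    unfolding continuous_on_iff
  proof (intro ballI allI impI)
    fix q e assume q: "q \<in> ?B \<times> ?B" and e: "(0::real) < e"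
    then have "e / 2 > 0" by simp
    from key[OF this] obtain d where d: "d > 0" "\<And>a b a' b'. a \<in> ?B \<Longrightarrow> b \<in> ?B \<Longrightarrow> a' \<in> ?B \<Longrightarrow> b' \<in> ?B \<Longrightarrow>
       norm (a' - a) < d \<Longrightarrow> norm (b' - b) < d \<Longrightarrow> emin j a' b' \<le> emin j a b + e / 2" by metis
    show "\<exists>d>0. \<forall>q'\<in>?B \<times> ?B. dist q' q < d \<longrightarrow> dist (case q' of (a, b) \<Rightarrow> emin j a b) (case q of (a, b) \<Rightarrow> emin j a b) < e"
    proof (intro exI conjI ballI impI)
      fix q' assume q': "q' \<in> ?B \<times> ?B" and "dist q' q < d"
      then have n: "norm (fst q' - fst q) < d" "norm (snd q' - snd q) < d"
        using dist_fst_le[of q' q] dist_snd_le[of q' q] by (auto simp: dist_norm)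
      have "emin j (fst q') (snd q') \<le> emin j (fst q) (snd q) + e / 2"
        using q q' n by (intro d(2)) auto
      moreover have "emin j (fst q) (snd q) \<le> emin j (fst q') (snd q') + e / 2"
        using q q' n by (intro d(2)) (auto simp: norm_minus_commute)
      ultimately show "dist (case q' of (a, b) \<Rightarrow> emin j a b) (case q of (a, b) \<Rightarrow> emin j a b) < e"
        using e by (simp add: split_beta dist_real_def abs_less_iff)
    qed (rule d(1))
  qed
qed

lemma half_inner: "good j \<Longrightarrow> half j \<subseteq> inner j" "good j \<Longrightarrow> inner j \<subseteq> cinner j"
  using goodD(2) by (fastforce simp: half_def inner_def cinner_def)+

lemma open_half: "good j \<Longrightarrow> openin T (half j)" "good j \<Longrightarrow> openin T (inner j)"
  unfolding half_def inner_def by (rule map_preimage_open[OF goodD(1) open_ball], assumption)+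

lemma compactin_cball_preimage:
  assumes j: "good j" and "s \<le> 6 * ra j"
  shows "compactin T {p \<in> dom_c (ch j). map_c (ch j) p \<in> cball (ce j) s}"
proof -
  have sub: "cball (ce j) s \<subseteq> img_c (ch j)" using goodD(4)[OF j] assms(2) by (meson order_trans subset_cball)
  then have "compactin (top_of_set (img_c (ch j))) (cball (ce j) s)" by (simp add: compactin_subtopology)
  from image_compactin[OF this inv_continuous[OF goodD(1)[OF j]]]
  have "compactin T (inv_c (ch j) ` cball (ce j) s)" .
  moreover have "inv_c (ch j) ` cball (ce j) s = {p \<in> dom_c (ch j). map_c (ch j) p \<in> cball (ce j) s}"
  proof (intro equalityI subsetI)
    fix p assume "p \<in> inv_c (ch j) ` cball (ce j) s"
    then obtain x where x: "x \<in> cball (ce j) s" "p = inv_c (ch j) x" by blast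
    then have "x \<in> img_c (ch j)" using sub by blast
    then show "p \<in> {p \<in> dom_c (ch j). map_c (ch j) p \<in> cball (ce j) s}" using x inv_in[of x "ch j"] map_inv[of x "ch j"] by simp
  next
    fix p assume p: "p \<in> {p \<in> dom_c (ch j). map_c (ch j) p \<in> cball (ce j) s}"
    then have "p = inv_c (ch j) (map_c (ch j) p)" using inv_map[OF goodD(1)[OF j], of p] by simp
    then show "p \<in> inv_c (ch j) ` cball (ce j) s" using p by blast
  qed
  ultimately show ?thesis by simp
qed

lemma good_exists:
  assumes p: "p \<in> topspace T"
  shows "\<exists>j. good j \<and> p \<in> half j"
proof -
  obtain c where c: "c \<in> A" "p \<in> dom_c c" using p atlas unfolding smooth_atlas_def by blast
  interpret lmetric "img_c c" "mc c" by (rule lmetric_chart[OF c(1)])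
  obtain r lam Lam where "good_ball (img_c c) (mc c) (map_c c p) r lam Lam" using good_ball_exists[of "map_c c p"] c by auto
  then have "good (c, map_c c p, r, lam, Lam)" "p \<in> half (c, map_c c p, r, lam, Lam)"
    using c by (auto simp: good_def half_def good_ball_def)
  then show ?thesis by blast
qed

end

lemma energy_isometric:
  assumes "lisom U G U' G' W \<psi>" and y: "C1_curve y y'" "\<And>t. t \<in> {0..1} \<Longrightarrow> y t \<in> W"
  shows "C1_curve (\<lambda>t. \<psi> (y t)) (\<lambda>t. Dbl \<psi> (y t) (y' t))"
    and "energy G' (\<lambda>t. \<psi> (y t)) (\<lambda>t. Dbl \<psi> (y t) (y' t)) = energy G y y'"
proof -
  interpret lisom U G U' G' W \<psi> by fact
  show "C1_curve (\<lambda>t. \<psi> (y t)) (\<lambda>t. Dbl \<psi> (y t) (y' t))"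
    unfolding C1_curve_def
  proof (intro conjI ballI)
    fix t :: real assume t: "t \<in> {0..1}"
    have "(y has_derivative (\<lambda>h. h *\<^sub>R y' t)) (at t within {0..1})"
      using y(1) t by (simp add: C1_curve_def has_vector_derivative_def)
    from has_derivative_compose[OF this has_derivative_psi[OF y(2)[OF t]]]
    show "((\<lambda>t. \<psi> (y t)) has_vector_derivative Dbl \<psi> (y t) (y' t)) (at t within {0..1})"
      by (simp add: has_vector_derivative_def blinfun.bilinear_simps)
  next
    have "continuous_on {0..1} (\<lambda>t. Dbl \<psi> (y t))"
      by (rule continuous_on_compose2[OF smooth_on_continuous[OF smooth_on_Dbl[OF open_W smooth_psi]] C1_curve_continuous(1)[OF y(1)]])
         (use y(2) in auto)
    then show "continuous_on {0..1} (\<lambda>t. Dbl \<psi> (y t) (y' t))"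
      by (intro continuous_intros C1_curve_continuous(2)[OF y(1)])
  qed
  show "energy G' (\<lambda>t. \<psi> (y t)) (\<lambda>t. Dbl \<psi> (y t) (y' t)) = energy G y y'"
    unfolding energy_def by (intro Henstock_Kurzweil_Integration.integral_cong) (simp add: isom y(2))
qed

section \<open>Chains of small cost and their minima\<close>

context riemannian begin

definition cost :: "('a, 'n) gball \<Rightarrow> 'a \<Rightarrow> 'a \<Rightarrow> real"
  where "cost j p q = emin j (map_c (ch j) p) (map_c (ch j) q)"

lemma cinner_map: "p \<in> cinner j \<Longrightarrow> map_c (ch j) p \<in> cball (ce j) (ra j)" "p \<in> cinner j \<Longrightarrow> p \<in> dom_c (ch j)"
  unfolding cinner_def by blast+

end

locale covered = riemannian T A g for T :: "'a topology" and A :: "('a, 'n::finite) chart set" and g +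
  fixes J :: "('a, 'n) gball set" and F :: "'a \<Rightarrow> 'a"
  assumes compact: "compact_space T" and hausdorff: "Hausdorff_space T" and connected: "connected_space T"
    and finJ: "finite J" and goodJ: "j \<in> J \<Longrightarrow> good j" and coverJ: "p \<in> topspace T \<Longrightarrow> \<exists>j\<in>J. p \<in> half j"
    and F: "isometric F"
begin

lemma cinner_top: "j \<in> J \<Longrightarrow> p \<in> cinner j \<Longrightarrow> p \<in> topspace T"
  by (rule dom_sub[OF goodD(1)[OF goodJ] cinner_map(2)])

lemma half_cinner: "j \<in> J \<Longrightarrow> p \<in> half j \<Longrightarrow> p \<in> cinner j"
  by (rule subsetD[OF half_inner(2)[OF goodJ] subsetD[OF half_inner(1)[OF goodJ]]])

inductive reach :: "'a \<Rightarrow> 'a \<Rightarrow> real \<Rightarrow> bool" where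
  reach_refl: "reach p p 0"
| reach_step: "reach p q s \<Longrightarrow> j \<in> J \<Longrightarrow> q \<in> cinner j \<Longrightarrow> r \<in> cinner j \<Longrightarrow> reach p r (s + cost j q r)"

lemma reach_trans: "reach q r t \<Longrightarrow> reach p q s \<Longrightarrow> reach p r (s + t)"
proof (induction rule: reach.induct)
  case (reach_step q q' t j r)
  from reach.reach_step[OF reach_step.IH[OF reach_step.prems] reach_step.hyps(2-4)] show ?case by (simp add: add.assoc)
qed simp

text \<open>Cutting the coordinate segment into \<open>N\<close> equal pieces makes each cost at
  most \<open>L\<close> divided by the square of \<open>N\<close>, so the total is at most
  \<open>L / N\<close>, below any prescribed \<open>e\<close>.\<close>

lemma reach_ball:
  assumes j: "j \<in> J" and p: "p \<in> cinner j" and q: "q \<in> cinner j" and e: "e > 0"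
  shows "\<exists>s\<le>e. reach p q s"
proof -
  note gj = goodJ[OF j]
  define a where "a = map_c (ch j) p"
  define b where "b = map_c (ch j) q"
  have ab: "a \<in> cball (ce j) (ra j)" "b \<in> cball (ce j) (ra j)" using cinner_map(1)[OF p] cinner_map(1)[OF q] by (simp_all add: a_def b_def)
  define L where "L = hi j * (norm (b - a))\<^sup>2"
  obtain N' :: nat where "L / e < real N'" using reals_Archimedean2 by blast
  then obtain N :: nat where N: "N > 0" "L / e < real N" by (intro that[of "Suc N'"]) auto
  define y where "y k = a + (real k / real N) *\<^sub>R (b - a)" for k :: nat
  have yb: "y k \<in> cball (ce j) (ra j)" if "k \<le> N" for k
  proof -
    have "y k = (1 - real k / real N) *\<^sub>R a + (real k / real N) *\<^sub>R b" by (simp add: y_def algebra_simps)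
    then show ?thesis using convexD_alt[OF convex_cball ab, of "real k / real N"] that N by simp
  qed
  define r where "r k = inv_c (ch j) (y k)" for k
  have img: "cball (ce j) (ra j) \<subseteq> img_c (ch j)"
    using goodD(4)[OF gj] goodD(2)[OF gj] subset_cball[of "ra j" "6 * ra j" "ce j"] by (simp add: subset_trans)
  have r: "r k \<in> cinner j" "map_c (ch j) (r k) = y k" if "k \<le> N" for k
  proof -
    have "y k \<in> img_c (ch j)" using yb[OF that] img by blast
    then show "map_c (ch j) (r k) = y k" "r k \<in> cinner j" using yb[OF that] by (simp_all add: r_def cinner_def inv_in)
  qed
  define M where "M = L / (real N)\<^sup>2"
  have step: "y (Suc k) - y k = (1 / real N) *\<^sub>R (b - a)" for k
    by (simp add: y_def algebra_simps add_divide_distrib)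
  have "\<exists>s\<le>real k * M. reach p (r k) s" if "k \<le> N" for k
    using that
  proof (induction k)
    case 0
    have "r 0 = p" using p inv_map[OF goodD(1)[OF gj]] by (simp add: r_def y_def a_def cinner_def)
    then show ?case using reach_refl by (intro exI[of _ 0]) simp
  next
    case (Suc k)
    then obtain s where s: "s \<le> real k * M" "reach p (r k) s" by auto
    have "cost j (r k) (r (Suc k)) \<le> hi j * (norm (y (Suc k) - y k))\<^sup>2"
      unfolding cost_def using Suc.prems r emin_line[OF gj yb yb, of k "Suc k"] by simp
    also have "\<dots> = M" by (simp add: step L_def M_def power_divide)
    finally have "cost j (r k) (r (Suc k)) \<le> M" .
    then have "s + cost j (r k) (r (Suc k)) \<le> real (Suc k) * M" using s(1) by (simp add: distrib_right)
    moreover have "reach p (r (Suc k)) (s + cost j (r k) (r (Suc k)))"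
      by (rule reach_step[OF s(2) j r(1) r(1)]) (use Suc.prems in auto)
    ultimately show ?case by blast
  qed
  from this[of N] obtain s where s: "s \<le> real N * M" "reach p (r N) s" by auto
  have "real N * M = L / N" using N by (simp add: M_def power2_eq_square)
  also have "\<dots> \<le> e" using N e by (simp add: field_simps)
  finally have "s \<le> e" using s(1) by simp
  moreover have "r N = q" using q N inv_map[OF goodD(1)[OF gj]] by (simp add: r_def y_def b_def cinner_def)
  ultimately show ?thesis using s(2) by blast
qed

text \<open>The points that can be reached from \<open>p\<close> at arbitrarily small cost form a
  set \<open>R\<close> such that \<open>R\<close> and its complement are both unions of half balls;
  connectedness leaves only the whole space.\<close>

lemma reach_all:
  assumes p: "p \<in> topspace T" and q: "q \<in> topspace T" and e: "e > 0"
  shows "\<exists>s\<le>e. reach p q s"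
proof -
  define R where "R = {q \<in> topspace T. \<forall>e>0. \<exists>s\<le>e. reach p q s}"
  have close: "r \<in> R" if qR: "q \<in> R" and j: "j \<in> J" "q \<in> cinner j" "r \<in> cinner j" for q r j
    unfolding R_def
  proof (intro CollectI conjI allI impI)
    show "r \<in> topspace T" using cinner_top j by blast
    fix e :: real assume "e > 0"
    then have e: "e / 2 > 0" by simp
    obtain s where s: "s \<le> e / 2" "reach p q s" using qR e unfolding R_def by blast
    obtain t where t: "t \<le> e / 2" "reach q r t" using reach_ball[OF j e] by blast
    show "\<exists>s\<le>e. reach p r s" using reach_trans[OF t(2) s(2)] s t by (intro exI[of _ "s + t"]) simp
  qed
  have o1: "openin T R"
  proof (subst openin_subopen, intro ballI)
    fix q assume q: "q \<in> R"
    then obtain j where j: "j \<in> J" "q \<in> half j" using coverJ unfolding R_def by blast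
    then have "half j \<subseteq> R" using close[OF q j(1)] half_cinner by blast
    then show "\<exists>S. openin T S \<and> q \<in> S \<and> S \<subseteq> R" using open_half(1)[OF goodJ[OF j(1)]] j by blast
  qed
  have o2: "openin T (topspace T - R)"
  proof (subst openin_subopen, intro ballI)
    fix q assume q: "q \<in> topspace T - R"
    then obtain j where j: "j \<in> J" "q \<in> half j" using coverJ by blast
    have "half j \<subseteq> topspace T - R"
    proof
      fix r assume r: "r \<in> half j"
      then have "r \<notin> R" using close[of r j q] q j half_cinner by blast
      then show "r \<in> topspace T - R" using cinner_top[OF j(1) half_cinner[OF j(1) r]] by blast
    qed
    then show "\<exists>S. openin T S \<and> q \<in> S \<and> S \<subseteq> topspace T - R" using open_half(1)[OF goodJ[OF j(1)]] j by blast
  qed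
  have "p \<in> R" unfolding R_def using p reach_refl[of p] by (auto intro!: exI[of _ 0])
  then have "topspace T - R = {}"
    using connected_spaceD[OF connected o1 o2] by blast
  then show ?thesis using q e unfolding R_def by blast
qed

lemma reach_chain:
  "reach p q s \<Longrightarrow> \<exists>n r k. r 0 = p \<and> r n = q \<and> (\<forall>i<n. k i \<in> J \<and> r i \<in> cinner (k i) \<and> r (Suc i) \<in> cinner (k i)) \<and>
     (\<Sum>i<n. cost (k i) (r i) (r (Suc i))) = s"
proof (induction rule: reach.induct)
  case (reach_refl p)
  show ?case
  proof (rule exI[of _ 0], rule exI[of _ "\<lambda>_. p"], rule exI[of _ "\<lambda>_. undefined"], intro conjI)
    show "\<forall>i<(0::nat). undefined \<in> J \<and> p \<in> cinner (undefined :: ('a, 'n) gball) \<and> p \<in> cinner (undefined :: ('a, 'n) gball)" by simp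
  qed simp_all
next
  case (reach_step p q s j q')
  from reach_step.IH obtain n r k where h: "r 0 = p" "r n = q" "\<And>i. i < n \<Longrightarrow> k i \<in> J \<and> r i \<in> cinner (k i) \<and> r (Suc i) \<in> cinner (k i)"
     "(\<Sum>i<n. cost (k i) (r i) (r (Suc i))) = s" by blast
  define r' where "r' = r(Suc n := q')"
  define k' where "k' = k(n := j)"
  have r'k': "r' i = r i" "i < n \<Longrightarrow> k' i = k i" if "i \<le> n" for i using that by (auto simp: r'_def k'_def)
  have last: "r' (Suc n) = q'" "k' n = j" by (simp_all add: r'_def k'_def)
  have A: "r' 0 = p" using h(1) by (simp add: r'k')
  have C: "k' i \<in> J \<and> r' i \<in> cinner (k' i) \<and> r' (Suc i) \<in> cinner (k' i)" if "i < Suc n" for i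
  proof (cases "i = n")
    case True
    then show ?thesis using reach_step.hyps h(2) by (simp add: last r'k')
  next
    case False
    then have "i < n" using that by simp
    then show ?thesis using h(3)[of i] by (simp add: r'k')
  qed
  have "(\<Sum>i<n. cost (k' i) (r' i) (r' (Suc i))) = (\<Sum>i<n. cost (k i) (r i) (r (Suc i)))"
    by (rule sum.cong) (simp_all add: r'k')
  then have D: "(\<Sum>i<Suc n. cost (k' i) (r' i) (r' (Suc i))) = s + cost j q q'" using h(2,4) by (simp add: last r'k')
  show ?case using A last(1) C D by blast
qed

text \<open>A chain \<open>p 0, \<dots>, p (m - 1)\<close> is closed up by \<open>F\<close>: its last segment runs from \<open>p (m - 1)\<close> to \<open>F (p 0)\<close>.\<close>

definition Hm :: "nat \<Rightarrow> nat \<Rightarrow> 'a \<Rightarrow> 'a"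
  where "Hm m i = (if Suc i < m then id else F)"

definition nxt :: "nat \<Rightarrow> (nat \<Rightarrow> 'a) \<Rightarrow> nat \<Rightarrow> 'a"
  where "nxt m p i = Hm m i (p (Suc i mod m))"

definition cfg :: "nat \<Rightarrow> (nat \<Rightarrow> ('a, 'n) gball) \<Rightarrow> (nat \<Rightarrow> 'a) \<Rightarrow> bool"
  where "cfg m k p \<longleftrightarrow> (\<forall>i<m. k i \<in> J \<and> p i \<in> cinner (k i) \<and> nxt m p i \<in> cinner (k i))"

definition total :: "nat \<Rightarrow> (nat \<Rightarrow> ('a, 'n) gball) \<Rightarrow> (nat \<Rightarrow> 'a) \<Rightarrow> real"
  where "total m k p = (\<Sum>i<m. cost (k i) (p i) (nxt m p i))"

lemma Hm_isometric: "isometric (Hm m i)"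
  by (simp add: Hm_def F isometric_id)

lemma Hm_continuous: "continuous_map T T (Hm m i)"
  using smooth_map_continuous isometric_smooth Hm_isometric by blast

text \<open>A cheap chain from some point to its image under \<open>F\<close> is a closed-up
  configuration; it has at least one segment because the point is not fixed. Its number of segments
  is kept in the minimisation.\<close>

lemma cfg_small:
  assumes nofix: "\<And>p. p \<in> topspace T \<Longrightarrow> F p \<noteq> p" and ne: "topspace T \<noteq> {}" and e: "e > 0"
  shows "\<exists>m k p. m > 0 \<and> cfg m k p \<and> total m k p \<le> e"
proof -
  obtain p where p: "p \<in> topspace T" using ne by blast
  then have Fp: "F p \<in> topspace T"
    using smooth_map_continuous[OF isometric_smooth[OF F]] by (auto simp: continuous_map_def)
  obtain s where s: "s \<le> e" "reach p (F p) s" using reach_all[OF p Fp e] by blast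
  then obtain n r k where h: "r 0 = p" "r n = F p" "\<And>i. i < n \<Longrightarrow> k i \<in> J \<and> r i \<in> cinner (k i) \<and> r (Suc i) \<in> cinner (k i)"
     "(\<Sum>i<n. cost (k i) (r i) (r (Suc i))) = s" using reach_chain[OF s(2)] by blast
  have n: "n > 0" using h(1,2) nofix[OF p] by (cases n) auto
  have nx: "nxt n r i = r (Suc i)" if "i < n" for i
  proof (cases "Suc i < n")
    case False
    then have "Suc i = n" using that by simp
    then show ?thesis using h(1,2) by (simp add: nxt_def Hm_def)
  qed (simp add: nxt_def Hm_def)
  have "cfg n k r" using h(3) by (simp add: cfg_def nx)
  moreover have "total n k r \<le> e" using h(4) s(1) by (simp add: total_def nx)
  ultimately show ?thesis using n by blast
qed

text \<open>For a fixed assignment of balls the admissible point tuples form a closed subset of a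
  compact product, on which the total cost is continuous. There are finitely many assignments, so
  the least of these minima is attained.\<close>

lemma min_exists:
  assumes m: "m > 0" and c0: "cfg m k0 p0"
  shows "\<exists>k p. cfg m k p \<and> (\<forall>k' p'. cfg m k' p' \<longrightarrow> total m k p \<le> total m k' p')"
proof -
  define PT where "PT = product_topology (\<lambda>_::nat. T) {..<m}"
  define K where "K k = {p \<in> topspace PT. \<forall>i<m. p i \<in> cinner (k i) \<and> nxt m p i \<in> cinner (k i)}" for k :: "nat \<Rightarrow> ('a, 'n) gball"
  have comp: "compact_space PT" unfolding PT_def compact_space_product_topology using compact by blast
  have proj: "continuous_map PT T (\<lambda>p. p i)" if "i < m" for i
    unfolding PT_def using that by (intro continuous_map_product_projection) auto
  have projn: "continuous_map PT T (\<lambda>p. nxt m p i)" for i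
    unfolding nxt_def using continuous_map_compose[OF proj[of "Suc i mod m"] Hm_continuous[of m i]] m by (simp add: o_def)
  have clin: "closedin T (cinner j)" if "j \<in> J" for j
    unfolding cinner_def using goodD(2)[OF goodJ[OF that]]
    by (intro compactin_imp_closedin hausdorff compactin_cball_preimage goodJ that) auto
  have minK: "\<exists>p\<in>K k. \<forall>p'\<in>K k. total m k p \<le> total m k p'" if k: "\<And>i. i < m \<Longrightarrow> k i \<in> J" and ne: "K k \<noteq> {}" for k
  proof -
    have "K k = topspace PT \<inter> (\<Inter>i\<in>{..<m}. {p \<in> topspace PT. p i \<in> cinner (k i)} \<inter> {p \<in> topspace PT. nxt m p i \<in> cinner (k i)})"
      by (auto simp: K_def)
    moreover have "closedin PT {p \<in> topspace PT. p i \<in> cinner (k i)}" if "i < m" for i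
      using closedin_continuous_map_preimage[OF proj[OF that] clin[OF k[OF that]]] .
    moreover have "closedin PT {p \<in> topspace PT. nxt m p i \<in> cinner (k i)}" if "i < m" for i
      using closedin_continuous_map_preimage[OF projn clin[OF k[OF that]]] .
    ultimately have "closedin PT (K k)" using m by (auto intro!: closedin_Int closedin_Inter)
    then have cK: "compactin PT (K k)" using closedin_compact_space[OF comp] by blast
    have "continuous_map (subtopology PT (K k)) euclideanreal (\<lambda>p. total m k p)"
      unfolding total_def
    proof (rule continuous_map_sum)
      fix i assume "i \<in> {..<m}"
      then have i: "i < m" by simp
      note gi = goodJ[OF k[OF i]]
      have sub: "continuous_map (subtopology PT (K k)) euclidean (\<lambda>p. map_c (ch (k i)) (f p))"
        if f: "continuous_map PT T f" and fK: "\<And>p. p \<in> K k \<Longrightarrow> f p \<in> cinner (k i)" for f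
      proof -
        have "continuous_map (subtopology PT (K k)) (subtopology T (dom_c (ch (k i)))) f"
          unfolding continuous_map_in_subtopology
        proof (intro conjI continuous_map_from_subtopology[OF f] Pi_I)
          fix p assume "p \<in> topspace (subtopology PT (K k))"
          then show "f p \<in> dom_c (ch (k i))" by (intro cinner_map(2)[OF fK]) simp
        qed
        from continuous_map_compose[OF this map_continuous[OF goodD(1)[OF gi]]] show ?thesis by (simp add: o_def)
      qed
      let ?B = "cball (ce (k i)) (ra (k i))"
      let ?h = "\<lambda>p. (map_c (ch (k i)) (p i), map_c (ch (k i)) (nxt m p i))"
      have hc: "continuous_map (subtopology PT (K k)) (prod_topology euclidean euclidean) ?h"
        unfolding continuous_map_paired
        by (intro conjI sub proj[OF i] projn) (auto simp: K_def i)
      have "continuous_map (subtopology PT (K k)) (top_of_set (?B \<times> ?B)) ?h"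
        unfolding continuous_map_in_subtopology
      proof (intro conjI Pi_I)
        fix p assume "p \<in> topspace (subtopology PT (K k))"
        then have "p i \<in> cinner (k i)" "nxt m p i \<in> cinner (k i)" using i by (simp_all add: K_def)
        then show "?h p \<in> ?B \<times> ?B" by (intro SigmaI cinner_map(1))
      qed (use hc in \<open>simp only: prod_topology_euclidean\<close>)
      moreover have "continuous_map (top_of_set (?B \<times> ?B)) euclideanreal (\<lambda>(a, b). emin (k i) a b)"
        using emin_continuous[OF gi] by simp
      ultimately have "continuous_map (subtopology PT (K k)) euclideanreal ((\<lambda>(a, b). emin (k i) a b) \<circ> ?h)"
        by (rule continuous_map_compose)
      then show "continuous_map (subtopology PT (K k)) euclideanreal (\<lambda>p. cost (k i) (p i) (nxt m p i))"
        by (simp add: o_def cost_def)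
    qed simp
    moreover have "compactin (subtopology PT (K k)) (K k)" using cK by (simp add: compactin_subtopology)
    ultimately have "compactin euclideanreal (total m k ` K k)" by (rule image_compactin[rotated])
    then have "compact (total m k ` K k)" by simp
    then show ?thesis using compact_attains_inf[of "total m k ` K k"] ne by blast
  qed
  \<comment> \<open>Assignments are made extensional on the first \<open>m\<close> indices;
    otherwise infinitely many functions would represent the same assignment.\<close>
  define N where "N = {k \<in> PiE {..<m} (\<lambda>_. J). K k \<noteq> {}}"
  have finN: "finite N" unfolding N_def using finJ by (auto intro!: finite_PiE)
  have "\<forall>k\<in>N. \<exists>p. p \<in> K k \<and> (\<forall>p'\<in>K k. total m k p \<le> total m k p')" using minK by (fastforce simp: N_def)
  then obtain P where P: "\<And>k. k \<in> N \<Longrightarrow> P k \<in> K k" "\<And>k p'. k \<in> N \<Longrightarrow> p' \<in> K k \<Longrightarrow> total m k (P k) \<le> total m k p'" by metis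
  have red: "restrict k {..<m} \<in> N \<and> restrict p {..<m} \<in> K (restrict k {..<m}) \<and> total m (restrict k {..<m}) (restrict p {..<m}) = total m k p"
    if c: "cfg m k p" for k p
  proof -
    have nx: "nxt m (restrict p {..<m}) i = nxt m p i" for i using m by (simp add: nxt_def)
    have "p i \<in> topspace T" if "i < m" for i using c that cinner_top unfolding cfg_def by blast
    then have "restrict p {..<m} \<in> topspace PT" by (auto simp: PT_def)
    then have 1: "restrict p {..<m} \<in> K (restrict k {..<m})" using c by (auto simp: K_def cfg_def nx)
    moreover have "restrict k {..<m} \<in> N" using c 1 by (auto simp: N_def cfg_def)
    moreover have "total m (restrict k {..<m}) (restrict p {..<m}) = total m k p"
      unfolding total_def by (intro sum.cong) (auto simp: nx)
    ultimately show ?thesis by blast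
  qed
  have "N \<noteq> {}" using red[OF c0] by blast
  let ?S = "(\<lambda>k. total m k (P k)) ` N"
  have S: "finite ?S" "?S \<noteq> {}" using finN \<open>N \<noteq> {}\<close> by simp_all
  obtain k where k: "Min ?S = total m k (P k)" "k \<in> N" using Min_in[OF S] by (rule imageE)
  have "cfg m k (P k)" unfolding cfg_def
  proof (intro allI impI)
    fix i assume i: "i < m"
    have "k i \<in> J" using k(2) i unfolding N_def by (intro PiE_mem[of k "{..<m}" "\<lambda>_. J"]) simp_all
    then show "k i \<in> J \<and> P k i \<in> cinner (k i) \<and> nxt m (P k) i \<in> cinner (k i)"
      using P(1)[OF k(2)] i unfolding K_def by simp
  qed
  moreover have "total m k (P k) \<le> total m k' p'" if c: "cfg m k' p'" for k' p'
  proof -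
    let ?k = "restrict k' {..<m}" and ?p = "restrict p' {..<m}"
    note r = red[OF c, THEN conjunct1] red[OF c, THEN conjunct2, THEN conjunct1] red[OF c, THEN conjunct2, THEN conjunct2]
    have "total m k (P k) \<le> total m ?k (P ?k)" unfolding k(1)[symmetric] by (intro Min_le S imageI r(1))
    also have "\<dots> \<le> total m ?k ?p" by (rule P(2)[OF r(1,2)])
    finally show ?thesis by (simp only: r(3))
  qed
  ultimately show ?thesis by (intro exI[of _ k] exI[of _ "P k"]) simp
qed

text \<open>In the chart of \<open>j\<close>, the points of the closed half ball of \<open>k\<close>
  form a compact set inside the open preimage of \<open>inner k\<close>, so a distance
  \<open>d\<close> separates it from the complement. Small energy forces the displacement below
  \<open>d\<close>.\<close>

lemma short_pair:
  assumes j: "j \<in> J" and k: "k \<in> J"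
  shows "\<exists>e>0. \<forall>y y'. C1_curve y y' \<and> (\<forall>t\<in>{0..1}. y t \<in> cball (ce j) (6 * ra j)) \<and> energy (mcb j) y y' \<le> e \<and>
    inv_c (ch j) (y 0) \<in> half k \<longrightarrow> (\<forall>t\<in>{0..1}. inv_c (ch j) (y t) \<in> inner k)"
proof -
  note gj = goodJ[OF j] and gk = goodJ[OF k]
  define hc where "hc = {p \<in> dom_c (ch k). map_c (ch k) p \<in> cball (ce k) (ra k / 2)}"
  have hcc: "closedin T hc"
    unfolding hc_def using goodD(2)[OF gk] by (intro compactin_imp_closedin hausdorff compactin_cball_preimage gk) auto
  have hci: "hc \<subseteq> inner k" using goodD(2)[OF gk] by (auto simp: hc_def inner_def)
  let ?c = "ch j" and ?B = "cball (ce j) (6 * ra j)"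
  define Q where "Q = {x \<in> ?B. inv_c ?c x \<in> hc}"
  have "continuous_map (top_of_set ?B) T (inv_c ?c)"
    using continuous_map_from_subtopology_mono[OF inv_continuous[OF goodD(1)[OF gj]] goodD(4)[OF gj]] .
  from closedin_continuous_map_preimage[OF this hcc] have "closedin (top_of_set ?B) Q" by (simp add: Q_def)
  then have cQ: "compact Q" using closedin_compact[OF compact_cball] by blast
  define O' where "O' = map_c ?c ` (dom_c ?c \<inter> inner k)"
  have oO: "open O'" unfolding O'_def
    by (intro map_open goodD(1)[OF gj] openin_Int open_dom open_half(2)[OF gk]) auto
  have "Q \<subseteq> O'"
  proof
    fix x assume x: "x \<in> Q"
    then have "x \<in> img_c ?c" using goodD(4)[OF gj] unfolding Q_def by blast
    moreover have "inv_c ?c x \<in> inner k" using x hci by (auto simp: Q_def)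
    ultimately show "x \<in> O'" unfolding O'_def using inv_in map_inv by (metis IntI image_eqI)
  qed
  then obtain d where d: "d > 0" "(\<Union>x\<in>Q. ball x d) \<subseteq> O'"
    using compact_subset_open_imp_ball_epsilon_subset[OF cQ oO] by blast
  show ?thesis
  proof (intro exI conjI allI impI ballI)
    \<comment> \<open>By \<open>energy_lower\<close> an energy of at most this amount keeps the
      curve within \<open>d / 2\<close> of its start.\<close>
    show "lo j * (d / 2)\<^sup>2 > 0" using d goodD(3)[OF gj] by simp
    fix y y' and t :: real
    assume y: "C1_curve y y' \<and> (\<forall>t\<in>{0..1}. y t \<in> ?B) \<and> energy (mcb j) y y' \<le> lo j * (d / 2)\<^sup>2 \<and> inv_c ?c (y 0) \<in> half k" and t: "t \<in> {0..1}"
    have "lo j * (norm (y t - y 0))\<^sup>2 \<le> energy (mcb j) y y'" using y t by (intro energy_lower[OF gj]) auto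
    then have "lo j * (norm (y t - y 0))\<^sup>2 \<le> lo j * (d / 2)\<^sup>2" using y by linarith
    then have "norm (y t - y 0) \<le> d / 2"
      using goodD(3)[OF gj] d(1) by (simp add: power2_le_iff_abs_le)
    then have "y t \<in> ball (y 0) d" using d(1) by (simp add: dist_norm norm_minus_commute)
    moreover have "inv_c ?c (y 0) \<in> hc" using y goodD(2)[OF gk] by (auto simp: half_def hc_def)
    then have "y 0 \<in> Q" using y by (simp add: Q_def)
    ultimately have "y t \<in> O'" using d(2) by blast
    then obtain p where p: "p \<in> dom_c ?c" "p \<in> inner k" "y t = map_c ?c p" unfolding O'_def by blast
    then show "inv_c ?c (y t) \<in> inner k" using inv_map[OF goodD(1)[OF gj]] by simp
  qed
qed

lemma short:
  shows "\<exists>e>0. \<forall>j\<in>J. \<forall>k\<in>J. \<forall>y y'. C1_curve y y' \<and> (\<forall>t\<in>{0..1}. y t \<in> cball (ce j) (6 * ra j)) \<and> energy (mcb j) y y' \<le> e \<and>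
    inv_c (ch j) (y 0) \<in> half k \<longrightarrow> (\<forall>t\<in>{0..1}. inv_c (ch j) (y t) \<in> inner k)"
proof -
  have "\<forall>q\<in>J \<times> J. \<exists>e>0. \<forall>y y'. C1_curve y y' \<and> (\<forall>t\<in>{0..1}. y t \<in> cball (ce (fst q)) (6 * ra (fst q))) \<and> energy (mcb (fst q)) y y' \<le> e \<and>
    inv_c (ch (fst q)) (y 0) \<in> half (snd q) \<longrightarrow> (\<forall>t\<in>{0..1}. inv_c (ch (fst q)) (y t) \<in> inner (snd q))"
    using short_pair by force
  then obtain e where e: "\<And>q. q \<in> J \<times> J \<Longrightarrow> e q > 0" "\<And>q y y'. q \<in> J \<times> J \<Longrightarrow> C1_curve y y' \<Longrightarrow> (\<forall>t\<in>{0..1}. y t \<in> cball (ce (fst q)) (6 * ra (fst q))) \<Longrightarrow>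
    energy (mcb (fst q)) y y' \<le> e q \<Longrightarrow> inv_c (ch (fst q)) (y 0) \<in> half (snd q) \<Longrightarrow> (\<forall>t\<in>{0..1}. inv_c (ch (fst q)) (y t) \<in> inner (snd q))"
    by metis
  define d where "d = Min (insert 1 (e ` (J \<times> J)))"
  have d: "d > 0" "\<And>q. q \<in> J \<times> J \<Longrightarrow> d \<le> e q" using finJ e(1) by (auto simp: d_def)
  show ?thesis
  proof (intro exI[of _ d] conjI ballI allI impI d(1))
    fix j k y y' and t :: real
    assume jk: "j \<in> J" "k \<in> J" and y: "C1_curve y y' \<and> (\<forall>t\<in>{0..1}. y t \<in> cball (ce j) (6 * ra j)) \<and> energy (mcb j) y y' \<le> d \<and>
      inv_c (ch j) (y 0) \<in> half k" and t: "t \<in> {0..1}"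
    have q: "(j, k) \<in> J \<times> J" using jk by simp
    show "inv_c (ch j) (y t) \<in> inner k" using e(2)[OF q, of y y'] y t d(2)[OF q] by auto
  qed
qed

end

context covered
begin

text \<open>A minimiser over closed balls may touch their boundaries. Its total is at most
  \<open>e\<close>, hence so is each single cost, and every segment is short enough to stay inside a
  ball whose half contains its start. With these balls no cost increases, so the chain is still
  minimal and now admits variations.\<close>

lemma minimal_interior:
  assumes nofix: "\<And>p. p \<in> topspace T \<Longrightarrow> F p \<noteq> p" and ne: "topspace T \<noteq> {}"
  shows "\<exists>m k p. 0 < m \<and> (\<forall>i<m. k i \<in> J \<and> p i \<in> half (k i) \<and> nxt m p i \<in> inner (k i)) \<and>
    (\<forall>k' p'. cfg m k' p' \<longrightarrow> total m k p \<le> total m k' p')"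
proof -
  obtain e where e: "e > 0" "\<And>j k y y' t. j \<in> J \<Longrightarrow> k \<in> J \<Longrightarrow> C1_curve y y' \<Longrightarrow> (\<And>t. t \<in> {0..1} \<Longrightarrow> y t \<in> cball (ce j) (6 * ra j)) \<Longrightarrow> energy (mcb j) y y' \<le> e \<Longrightarrow>
    inv_c (ch j) (y 0) \<in> half k \<Longrightarrow> t \<in> {0..1} \<Longrightarrow> inv_c (ch j) (y t) \<in> inner k" proof -
    from short obtain e where e: "e > 0" and E: "\<forall>j\<in>J. \<forall>k\<in>J. \<forall>y y'. C1_curve y y' \<and> (\<forall>t\<in>{0..1}. y t \<in> cball (ce j) (6 * ra j)) \<and> energy (mcb j) y y' \<le> e \<and>
    inv_c (ch j) (y 0) \<in> half k \<longrightarrow> (\<forall>t\<in>{0..1}. inv_c (ch j) (y t) \<in> inner k)" by (elim exE conjE)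
    show thesis
    proof (rule that[OF e])
      fix j k y y' and t :: real
      assume h: "j \<in> J" "k \<in> J" "C1_curve y y'" "\<And>t. t \<in> {0..1} \<Longrightarrow> y t \<in> cball (ce j) (6 * ra j)" "energy (mcb j) y y' \<le> e" "inv_c (ch j) (y 0) \<in> half k" "t \<in> {0..1}"
      have "C1_curve y y' \<and> (\<forall>t\<in>{0..1}. y t \<in> cball (ce j) (6 * ra j)) \<and> energy (mcb j) y y' \<le> e \<and> inv_c (ch j) (y 0) \<in> half k" using h(3-6) by blast
      with E[rule_format, OF h(1,2), rule_format, of y y' t] h(7) show "inv_c (ch j) (y t) \<in> inner k" by blast
    qed
  qed
  obtain m k0 p0 where m: "m > 0" "cfg m k0 p0" "total m k0 p0 \<le> e" using cfg_small[OF nofix ne e(1)] by blast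
  obtain k1 p where k1: "cfg m k1 p" "\<And>k' p'. cfg m k' p' \<Longrightarrow> total m k1 p \<le> total m k' p'"
    using min_exists[OF m(1,2)] by blast
  have tot: "total m k1 p \<le> e" using k1(2)[OF m(2)] m(3) by linarith
  have cf: "k1 i \<in> J" "p i \<in> cinner (k1 i)" "nxt m p i \<in> cinner (k1 i)" if "i < m" for i
    using k1(1) that unfolding cfg_def by blast+
  have nonneg: "0 \<le> cost (k1 i) (p i) (nxt m p i)" if "i < m" for i
    unfolding cost_def
    by (rule order_trans[OF _ emin_lower[OF goodJ[OF cf(1)[OF that]] cinner_map(1)[OF cf(2)[OF that]] cinner_map(1)[OF cf(3)[OF that]]]])
       (use goodD(3)[OF goodJ[OF cf(1)[OF that]]] in simp)
  have cle: "cost (k1 i) (p i) (nxt m p i) \<le> e" if "i < m" for i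
    using member_le_sum[of i "{..<m}" "\<lambda>i. cost (k1 i) (p i) (nxt m p i)"] that nonneg tot by (simp add: total_def)
  have "\<exists>k. k \<in> J \<and> p i \<in> half k" if "i < m" for i
    using coverJ[OF cinner_top[OF cf(1,2)[OF that]]] by blast
  then obtain k where k: "\<And>i. i < m \<Longrightarrow> k i \<in> J" "\<And>i. i < m \<Longrightarrow> p i \<in> half (k i)" by metis
  \<comment> \<open>The old segment, carried by the coordinate change into the chart of the new
    ball, is a competitor there with the same energy.\<close>
  have main: "nxt m p i \<in> inner (k i) \<and> cost (k i) (p i) (nxt m p i) \<le> cost (k1 i) (p i) (nxt m p i)" if i: "i < m" for i
  proof -
    define j where "j = k1 i"
    define l where "l = k i"
    have jJ: "j \<in> J" "l \<in> J" using cf(1)[OF i] k(1)[OF i] by (simp_all add: j_def l_def)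
    note gj = goodJ[OF jJ(1)] and gl = goodJ[OF jJ(2)]
    note pj = cf(2)[OF i, folded j_def] and nj = cf(3)[OF i, folded j_def] and pl = k(2)[OF i, folded l_def]
    obtain x x' where x: "seg j (map_c (ch j) (p i)) (map_c (ch j) (nxt m p i)) x x'" and xe: "cost j (p i) (nxt m p i) = energy (mcb j) x x'"
      using emin_seg[OF gj cinner_map(1)[OF pj] cinner_map(1)[OF nj]] unfolding cost_def by blast
    have xC: "C1_curve x x'" using x geodesic01_C1 unfolding seg_def by blast
    have x01: "x 0 = map_c (ch j) (p i)" "x 1 = map_c (ch j) (nxt m p i)" using x unfolding seg_def by blast+
    have x5: "x t \<in> cball (ce j) (5 * ra j)" if "t \<in> {0..1}" for t using x that unfolding seg_def by blast
    have x6: "x t \<in> cball (ce j) (6 * ra j)" if "t \<in> {0..1}" for t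
      using x5[OF that] goodD(2)[OF gj] by (simp only: mem_cball)
    have ximg: "x t \<in> img_c (ch j)" if "t \<in> {0..1}" for t using x6[OF that] goodD(4)[OF gj] by blast
    have xinv: "inv_c (ch j) (x 0) = p i" "inv_c (ch j) (x 1) = nxt m p i"
      using inv_map[OF goodD(1)[OF gj]] cinner_map(2)[OF pj] cinner_map(2)[OF nj] by (simp_all add: x01)
    have inn: "inv_c (ch j) (x t) \<in> inner l" if "t \<in> {0..1}" for t
    proof (rule e(2)[OF jJ xC x6 _ _ that])
      show "energy (mcb j) x x' \<le> e" using xe cle[OF i] by (simp add: j_def)
      show "inv_c (ch j) (x 0) \<in> half l" using pl by (simp only: xinv)
    qed
    have dl: "inv_c (ch j) (x t) \<in> dom_c (ch l)" "map_c (ch l) (inv_c (ch j) (x t)) \<in> ball (ce l) (ra l)" if "t \<in> {0..1}" for t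
      using inn[OF that] unfolding inner_def by blast+
    define \<psi> where "\<psi> = tr (ch j) (ch l)"
    have L: "lisom (img_c (ch j)) (mcb j) (img_c (ch l)) (mcb l) (dom2 id (ch j) (ch l)) \<psi>"
      unfolding \<psi>_def by (rule isometric_lisom[OF isometric_id goodD(1)[OF gj] goodD(1)[OF gl]])
    have xd: "x t \<in> dom2 id (ch j) (ch l)" if "t \<in> {0..1}" for t
      using dl(1)[OF that] ximg[OF that] dom2_iff[OF goodD(1)[OF gj]] by simp
    note en = energy_isometric[OF L xC xd]
    have \<psi>: "\<psi> (x t) = map_c (ch l) (inv_c (ch j) (x t))" for t by (simp add: \<psi>_def rep_def)
    have y6: "\<psi> (x t) \<in> cball (ce l) (6 * ra l)" if "t \<in> {0..1}" for t
      using dl(2)[OF that] goodD(2)[OF gl] by (simp add: \<psi>)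
    have y0: "\<psi> (x 0) \<in> cball (ce l) (ra l)" "\<psi> (x 1) \<in> cball (ce l) (ra l)"
      using dl(2)[of 0] dl(2)[of 1] by (simp_all add: \<psi>)
    have "emin l (\<psi> (x 0)) (\<psi> (x 1)) \<le> energy (mcb j) x x'"
      using emin_le[OF gl en(1) y6 y0] by (simp only: en(2))
    then have "cost l (p i) (nxt m p i) \<le> cost j (p i) (nxt m p i)"
      unfolding xe by (simp add: cost_def \<psi> xinv)
    moreover have "nxt m p i \<in> inner l" using inn[of 1] by (simp add: xinv)
    ultimately show ?thesis by (simp add: j_def l_def)
  qed
  have "total m k p \<le> total m k1 p" unfolding total_def using main by (intro sum_mono) simp
  then have "\<forall>k' p'. cfg m k' p' \<longrightarrow> total m k p \<le> total m k' p'" using k1(2) order_trans by blast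
  then show ?thesis using m(1) k main by blast
qed

text \<open>Minimality passes from point chains to curves: nearby curves determine nearby junction
  points, which still lie in the balls, and the cost of the resulting chain is at most the energy of
  the curves.\<close>

lemma loop_exists:
  assumes fixfree: "\<forall>p\<in>topspace T. F p \<noteq> p" and ne: "topspace T \<noteq> {}"
  shows "\<exists>m k p x x'. geodesic_loop m (\<lambda>i. img_c (ch (k i))) (\<lambda>i. mcb (k i)) (\<lambda>i. dom2 (Hm m i) (ch (k (Suc i mod m))) (ch (k i)))
      (\<lambda>i. rep (Hm m i) (ch (k (Suc i mod m))) (ch (k i))) x x' (\<lambda>i. ball (ce (k i)) (6 * ra (k i))) \<and>
    (\<forall>i<m. k i \<in> J \<and> p i \<in> dom_c (ch (k i)) \<and> nxt m p i \<in> dom_c (ch (k i)) \<and> x i 0 = map_c (ch (k i)) (p i) \<and> x i 1 = map_c (ch (k i)) (nxt m p i)) \<and>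
    x' 0 0 \<noteq> 0"
proof -
  have nofix: "F p \<noteq> p" if "p \<in> topspace T" for p using fixfree that by blast
  obtain m k p where m: "0 < m" and kp: "\<And>i. i < m \<Longrightarrow> k i \<in> J" "\<And>i. i < m \<Longrightarrow> p i \<in> half (k i)" "\<And>i. i < m \<Longrightarrow> nxt m p i \<in> inner (k i)"
    and min: "\<And>k' p'. cfg m k' p' \<Longrightarrow> total m k p \<le> total m k' p'"
    using minimal_interior[OF nofix ne] by blast
  note gk = goodJ[OF kp(1)]
  note cA = goodD(1)[OF gk]
  have sc: "Suc i mod m < m" for i using m by simp
  have pin: "p i \<in> cinner (k i)" "nxt m p i \<in> cinner (k i)" if "i < m" for i
    using half_cinner[OF kp(1,2)[OF that]] half_inner(2)[OF gk[OF that]] kp(3)[OF that] by blast+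
  have "\<exists>x x'. seg (k i) (map_c (ch (k i)) (p i)) (map_c (ch (k i)) (nxt m p i)) x x' \<and> cost (k i) (p i) (nxt m p i) = energy (mcb (k i)) x x'"
    if "i < m" for i
    unfolding cost_def by (rule emin_seg[OF gk[OF that] cinner_map(1)[OF pin(1)[OF that]] cinner_map(1)[OF pin(2)[OF that]]])
  then obtain x x' where x: "\<And>i. i < m \<Longrightarrow> seg (k i) (map_c (ch (k i)) (p i)) (map_c (ch (k i)) (nxt m p i)) (x i) (x' i)"
    and xe: "\<And>i. i < m \<Longrightarrow> cost (k i) (p i) (nxt m p i) = energy (mcb (k i)) (x i) (x' i)" by metis
  have x01: "x i 0 = map_c (ch (k i)) (p i)" "x i 1 = map_c (ch (k i)) (nxt m p i)" if "i < m" for i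
    using x[OF that] unfolding seg_def by blast+
  have xb: "x i t \<in> cball (ce (k i)) (5 * ra (k i))" "norm (x' i t) \<le> 4 * ra (k i)" if "i < m" "t \<in> {0..1}" for i t
    using x[OF that(1)] that(2) unfolding seg_def by blast+
  have x6: "x i t \<in> ball (ce (k i)) (6 * ra (k i))" if "i < m" "t \<in> {0..1}" for i t
    using xb(1)[OF that] goodD(2)[OF gk[OF that(1)]] by simp
  define U where "U i = img_c (ch (k i))" for i
  define G where "G i = mcb (k i)" for i
  define W where "W i = dom2 (Hm m i) (ch (k (Suc i mod m))) (ch (k i))" for i
  define th where "th i = rep (Hm m i) (ch (k (Suc i mod m))) (ch (k i))" for i
  define C where "C i = ball (ce (k i)) (6 * ra (k i))" for i
  have pd: "p i \<in> dom_c (ch (k i))" "nxt m p i \<in> dom_c (ch (k i))" if "i < m" for i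
    using cinner_map(2)[OF pin(1)[OF that]] cinner_map(2)[OF pin(2)[OF that]] .
  have iso: "lisom (U (Suc i mod m)) (G (Suc i mod m)) (U i) (G i) (W i) (th i)" if "i < m" for i
    unfolding U_def G_def W_def th_def by (rule isometric_lisom[OF Hm_isometric cA[OF sc] cA[OF that]])
  have start: "x (Suc i mod m) 0 \<in> W i" if "i < m" for i
    unfolding x01(1)[OF sc] W_def by (rule dom2_map[OF cA[OF sc] pd(1)[OF sc]]) (use pd(2)[OF that] in \<open>simp add: nxt_def\<close>)
  have glue: "th i (x (Suc i mod m) 0) = x i 1" if "i < m" for i
    unfolding x01(1)[OF sc] x01(2)[OF that] th_def using rep_map[OF cA[OF sc] pd(1)[OF sc]] by (simp add: nxt_def)
  have "geodesic_loop m U G W th x x' C"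
  proof (rule geodesic_loop.intro)
    show "0 < m" by fact
    show "\<And>i. i < m \<Longrightarrow> lisom (U (Suc i mod m)) (G (Suc i mod m)) (U i) (G i) (W i) (th i)" by (rule iso)
    show "x (Suc i mod m) 0 \<in> W i" if "i < m" for i by (rule start[OF that])
    show "th i (x (Suc i mod m) 0) = x i 1" if "i < m" for i by (rule glue[OF that])
    show "geodesic01 (U i) (G i) (x i) (x' i)" if "i < m" for i using x[OF that] unfolding seg_def U_def G_def by blast
    show "open (C i)" for i by (simp add: C_def)
    show "C i \<subseteq> U i" if "i < m" for i
      unfolding C_def U_def using goodD(4)[OF gk[OF that]] ball_subset_cball by blast
    show "x i t \<in> C i" if "i < m" "t \<in> {0..1}" for i t using x6[OF that] by (simp add: C_def)
    show "norm (chr (G i) (x i t)) * norm (x' i t) \<le> 1 / 2" if it: "i < m" "t \<in> {0..1}" for i t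
    proof -
      have "norm (chr (G i) (x i t)) * (8 * ra (k i)) \<le> 1"
        unfolding G_def using x6[OF it] by (intro goodD(7)[OF gk[OF it(1)]]) simp
      moreover have "norm (chr (G i) (x i t)) * norm (x' i t) \<le> norm (chr (G i) (x i t)) * (4 * ra (k i))"
        using xb(2)[OF it] by (intro mult_left_mono) auto
      ultimately show ?thesis by simp
    qed
    have ev: "\<forall>\<^sub>F v in nhds 0. x (Suc i mod m) 0 + v \<in> W i \<and> th i (x (Suc i mod m) 0 + v) \<in> ball (ce (k i)) (ra (k i)) \<and> x i 0 + v \<in> ball (ce (k i)) (ra (k i))"
      if i: "i < m" for i
    proof -
      interpret lisom "U (Suc i mod m)" "G (Suc i mod m)" "U i" "G i" "W i" "th i" by (rule iso[OF i])
      have t: "((\<lambda>v. q + v) \<longlongrightarrow> q) (nhds 0)" for q :: "real^'n"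
        using tendsto_add[OF tendsto_const[of q "nhds 0"] filterlim_ident[of "nhds (0::real^'n)"]] by simp
      have 1: "\<forall>\<^sub>F v in nhds 0. x (Suc i mod m) 0 + v \<in> W i"
        by (rule topological_tendstoD[OF t open_W start[OF i]])
      have "isCont (th i) (x (Suc i mod m) 0)" using has_derivative_continuous[OF has_derivative_psi[OF start[OF i]]] .
      from isCont_tendsto_compose[OF this t] have "((\<lambda>v. th i (x (Suc i mod m) 0 + v)) \<longlongrightarrow> x i 1) (nhds 0)" by (simp add: glue[OF i])
      moreover have "x i 1 \<in> ball (ce (k i)) (ra (k i))" using kp(3)[OF i] x01(2)[OF i] unfolding inner_def by simp
      ultimately have 2: "\<forall>\<^sub>F v in nhds 0. th i (x (Suc i mod m) 0 + v) \<in> ball (ce (k i)) (ra (k i))"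
        using topological_tendstoD[OF _ open_ball] by blast
      have "p i \<in> inner (k i)" using half_inner(1)[OF gk[OF i]] kp(2)[OF i] by blast
      then have "x i 0 \<in> ball (ce (k i)) (ra (k i))" using x01(1)[OF i] unfolding inner_def by simp
      then have 3: "\<forall>\<^sub>F v in nhds 0. x i 0 + v \<in> ball (ce (k i)) (ra (k i))"
        using topological_tendstoD[OF t open_ball] by blast
      show ?thesis by (rule eventually_conj[OF 1 eventually_conj[OF 2 3]])
    qed
    have "\<forall>\<^sub>F v in nhds 0. \<forall>i\<in>{..<m}. x (Suc i mod m) 0 + v \<in> W i \<and> th i (x (Suc i mod m) 0 + v) \<in> ball (ce (k i)) (ra (k i)) \<and> x i 0 + v \<in> ball (ce (k i)) (ra (k i))"
      by (rule eventually_ball_finite) (use ev in auto)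
    then obtain e where e: "e > 0" "\<And>v i. norm v < e \<Longrightarrow> i < m \<Longrightarrow> x (Suc i mod m) 0 + v \<in> W i"
       "\<And>v i. norm v < e \<Longrightarrow> i < m \<Longrightarrow> th i (x (Suc i mod m) 0 + v) \<in> ball (ce (k i)) (ra (k i))"
       "\<And>v i. norm v < e \<Longrightarrow> i < m \<Longrightarrow> x i 0 + v \<in> ball (ce (k i)) (ra (k i))"
      unfolding eventually_nhds_metric by (simp only: dist_norm diff_zero) (metis lessThan_iff)
    show "\<exists>e>0. \<forall>y y' d. (\<forall>i<m. norm (d i) < e \<and> C1_curve (y i) (y' i) \<and> (\<forall>t\<in>{0..1}. y i t \<in> C i) \<and>
        y i 0 = x i 0 + d i \<and> y i 1 = th i (x (Suc i mod m) 0 + d (Suc i mod m))) \<longrightarrow>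
        (\<Sum>i<m. energy (G i) (x i) (x' i)) \<le> (\<Sum>i<m. energy (G i) (y i) (y' i))"
    proof (intro exI conjI allI impI)
      show "e > 0" by fact
      fix y y' d
      assume "\<forall>i<m. norm (d i) < e \<and> C1_curve (y i) (y' i) \<and> (\<forall>t\<in>{0..1}. y i t \<in> C i) \<and>
        y i 0 = x i 0 + d i \<and> y i 1 = th i (x (Suc i mod m) 0 + d (Suc i mod m))"
      then have y: "\<And>i. i < m \<Longrightarrow> norm (d i) < e" "\<And>i. i < m \<Longrightarrow> C1_curve (y i) (y' i)"
        "\<And>i t. i < m \<Longrightarrow> t \<in> {0..1} \<Longrightarrow> y i t \<in> C i" "\<And>i. i < m \<Longrightarrow> y i 0 = x i 0 + d i"
        "\<And>i. i < m \<Longrightarrow> y i 1 = th i (x (Suc i mod m) 0 + d (Suc i mod m))" by blast+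
      \<comment> \<open>Only left ends are free; the right ends are then determined by the gluing
        and remain in the open balls because the displacements are small.\<close>
      define p' where "p' i = inv_c (ch (k i)) (x i 0 + d i)" for i
      have b6: "ball (ce (k i)) (ra (k i)) \<subseteq> img_c (ch (k i))" if "i < m" for i
        using goodD(2,4)[OF gk[OF that]] by (auto simp: subset_iff)
      have a0: "x i 0 + d i \<in> ball (ce (k i)) (ra (k i))" if "i < m" for i using e(4)[OF y(1)[OF that] that] .
      have mp: "map_c (ch (k i)) (p' i) = x i 0 + d i" "p' i \<in> cinner (k i)" if "i < m" for i
      proof -
        have *: "x i 0 + d i \<in> img_c (ch (k i))" using a0[OF that] b6[OF that] by blast
        show "map_c (ch (k i)) (p' i) = x i 0 + d i" unfolding p'_def by (rule map_inv[OF *])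
        then show "p' i \<in> cinner (k i)" using inv_in[OF *] a0[OF that] unfolding cinner_def by (simp add: p'_def)
      qed
      have nx: "nxt m p' i \<in> cinner (k i)" "map_c (ch (k i)) (nxt m p' i) = y i 1" if i: "i < m" for i
      proof -
        have "x (Suc i mod m) 0 + d (Suc i mod m) \<in> W i" by (rule e(2)[OF y(1)[OF sc] i])
        then have "nxt m p' i \<in> dom_c (ch (k i))"
          unfolding W_def dom2_iff[OF cA[OF sc]] nxt_def p'_def by blast
        moreover show *: "map_c (ch (k i)) (nxt m p' i) = y i 1"
          unfolding y(5)[OF i] th_def nxt_def p'_def rep_def by simp
        moreover have "y i 1 \<in> ball (ce (k i)) (ra (k i))" unfolding y(5)[OF i] by (rule e(3)[OF y(1)[OF sc] i])
        ultimately show "nxt m p' i \<in> cinner (k i)" unfolding cinner_def by simp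
      qed
      have "cfg m k p'" unfolding cfg_def using kp(1) mp(2) nx(1) by blast
      have "(\<Sum>i<m. energy (G i) (x i) (x' i)) = total m k p" unfolding total_def G_def using xe by simp
      also have "\<dots> \<le> total m k p'" by (rule min) fact
      also have "\<dots> \<le> (\<Sum>i<m. energy (G i) (y i) (y' i))"
        unfolding total_def
      proof (rule sum_mono)
        fix i assume "i \<in> {..<m}"
        then have i: "i < m" by simp
        have y0: "y i 0 = map_c (ch (k i)) (p' i)" by (simp only: y(4)[OF i] mp(1)[OF i])
        have "emin (k i) (y i 0) (y i 1) \<le> energy (mcb (k i)) (y i) (y' i)"
        proof (rule emin_le[OF gk[OF i] y(2)[OF i]])
          show "y i t \<in> cball (ce (k i)) (6 * ra (k i))" if "t \<in> {0..1}" for t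
            using y(3)[OF i that] by (simp add: C_def)
          show "y i 0 \<in> cball (ce (k i)) (ra (k i))" unfolding y0 by (rule cinner_map(1)[OF mp(2)[OF i]])
          show "y i 1 \<in> cball (ce (k i)) (ra (k i))" unfolding nx(2)[OF i, symmetric] by (rule cinner_map(1)[OF nx(1)[OF i]])
        qed
        then show "cost (k i) (p' i) (nxt m p' i) \<le> energy (G i) (y i) (y' i)"
          unfolding cost_def G_def nx(2)[OF i] y0 .
      qed
      finally show "(\<Sum>i<m. energy (G i) (x i) (x' i)) \<le> (\<Sum>i<m. energy (G i) (y i) (y' i))" .
    qed
  qed
  then interpret L: geodesic_loop m U G W th x x' C .
  \<comment> \<open>If it were zero, all segments would be constant, all junction points equal, and
    the last joint would make \<open>p 0\<close> a fixed point of \<open>F\<close>.\<close>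
  have "x' 0 0 \<noteq> 0"
  proof
    assume z: "x' 0 0 = 0"
    have pn: "p i = nxt m p i" if i: "i < m" for i
    proof -
      have "x i 1 = x i 0"
      proof (rule vd_zero_constant01)
        fix t :: real assume t: "t \<in> {0..1}"
        have "(x i has_vector_derivative x' i t) (at t within {0..1})" using L.geod[OF i] t unfolding geodesic01_def by blast
        then show "(x i has_vector_derivative 0) (at t within {0..1})" by (simp only: L.zero_velocity[OF z i t])
      qed simp
      then have "map_c (ch (k i)) (p i) = map_c (ch (k i)) (nxt m p i)" using x01[OF i] by simp
      then show ?thesis using chart_inj[OF cA[OF i]] pd[OF i] by (meson inj_onD)
    qed
    have p0: "p 0 = p i" if "i < m" for i using that
    proof (induction i)
      case (Suc i)
      then show ?case using pn[of i] by (simp add: nxt_def Hm_def)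
    qed simp
    have "p 0 = p (m - 1)" by (rule p0) (use m in simp)
    also have "\<dots> = F (p 0)" using pn[of "m - 1"] m by (simp add: nxt_def Hm_def)
    finally show False using nofix[OF cinner_top[OF kp(1)[OF m] pin(1)[OF m]]] by (elim notE) (rule sym)
  qed
  show ?thesis
  proof (intro exI conjI)
    show "geodesic_loop m (\<lambda>i. img_c (ch (k i))) (\<lambda>i. mcb (k i)) (\<lambda>i. dom2 (Hm m i) (ch (k (Suc i mod m))) (ch (k i)))
      (\<lambda>i. rep (Hm m i) (ch (k (Suc i mod m))) (ch (k i))) x x' (\<lambda>i. ball (ce (k i)) (6 * ra (k i)))"
      using L.geodesic_loop_axioms unfolding U_def G_def W_def th_def C_def .
    show "\<forall>i<m. k i \<in> J \<and> p i \<in> dom_c (ch (k i)) \<and> nxt m p i \<in> dom_c (ch (k i)) \<and> x i 0 = map_c (ch (k i)) (p i) \<and> x i 1 = map_c (ch (k i)) (nxt m p i)"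
      by (intro allI impI conjI kp(1) pd x01)
  qed fact
qed

end

section \<open>Contradictions from second variation\<close>

lemma sum_telescope_loop:
  fixes a b :: "nat \<Rightarrow> real"
  assumes "0 < m" "\<And>i. Suc i < m \<Longrightarrow> b i = a (Suc i)"
  shows "(\<Sum>i<m. b i - a i) = b (m - 1) - a 0"
  using assms
proof (induction m)
  case (Suc n)
  show ?case
  proof (cases "n = 0")
    case False
    then have "(\<Sum>i<n. b i - a i) = b (n - 1) - a 0" by (intro Suc.IH Suc.prems(2)) simp_all
    moreover have "b (n - 1) = a n" using Suc.prems(2)[of "n - 1"] False by simp
    ultimately show ?thesis by simp
  qed simp
qed simp

text \<open>Here \<open>k\<close> counts images under the isometry and \<open>i\<close> segments of
  one period. Each period raises \<open>h\<close> by at least \<delta>, because the integrals of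
  \<open>K\<close> do not use up the gain; boundedness at the starts of the periods fails after
  finitely many.\<close>

lemma bounded_slope_contradiction:
  fixes h h' :: "nat \<Rightarrow> nat \<Rightarrow> real \<Rightarrow> real" and K :: "nat \<Rightarrow> real \<Rightarrow> real"
  assumes m: "0 < m" and d: "0 < \<delta>"
    and K: "\<And>i. i < m \<Longrightarrow> continuous_on {0..1} (K i)" "(\<Sum>i<m. integral {0..1} (K i)) \<le> 0"
    and h: "\<And>k i t. i < m \<Longrightarrow> t \<in> {0..1} \<Longrightarrow> (h k i has_vector_derivative h' k i t) (at t within {0..1})"
      "\<And>k i t. i < m \<Longrightarrow> t \<in> {0..1} \<Longrightarrow> \<delta> - K i t \<le> h' k i t"
    and B: "\<And>k. \<bar>h k 0 0\<bar> \<le> B"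
    and glue: "\<And>k i. Suc i < m \<Longrightarrow> h k i 1 = h k (Suc i) 0" "\<And>k. h k (m - 1) 1 = h (Suc k) 0 0"
  shows False
proof -
  have inc: "\<delta> - integral {0..1} (K i) \<le> h k i 1 - h k i 0" if i: "i < m" for i k
  proof -
    have "((\<lambda>t. \<delta> - K i t) has_integral (\<delta> - integral {0..1} (K i))) {0..1}"
      using has_integral_diff[OF has_integral_const_real[of \<delta> 0 1] integrable_integral[OF integrable_continuous_real[OF K(1)[OF i]]]] by simp
    moreover have "(h' k i has_integral (h k i 1 - h k i 0)) {0..1}"
      using ftc01[OF h(1)[OF i], of 1] by simp
    ultimately show ?thesis using h(2)[OF i] by (rule has_integral_le)
  qed
  have step: "h k 0 0 + \<delta> \<le> h (Suc k) 0 0" for k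
  proof -
    have "\<delta> * 1 \<le> \<delta> * real m" using m d by (intro mult_left_mono) simp_all
    also have "\<dots> \<le> \<delta> * real m - (\<Sum>i<m. integral {0..1} (K i))" using K(2) by simp
    also have "\<dots> = (\<Sum>i<m. \<delta> - integral {0..1} (K i))" by (simp add: sum_subtractf mult.commute)
    also have "\<dots> \<le> (\<Sum>i<m. h k i 1 - h k i 0)" by (intro sum_mono inc) simp
    also have "\<dots> = h (Suc k) 0 0 - h k 0 0" by (subst sum_telescope_loop[OF m], erule glue(1)) (simp only: glue(2))
    finally show ?thesis by simp
  qed
  have "h 0 0 0 + real k * \<delta> \<le> h k 0 0" for k
  proof (induction k)
    case (Suc k)
    then show ?case using step[of k] by (simp add: distrib_right)
  qed simp
  then have "real k * \<delta> \<le> 2 * B" for k using B[of 0] B[of k] by (smt (verit))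
  then show False using reals_Archimedean3[OF d] by (meson not_le)
qed

text \<open>The average \<open>w\<close> of \<open>u\<close> over \<open>n\<close> periods satisfies
  the same linear inequality but misses closing up by a difference of order 1/n. Spreading that
  defect linearly over the last segment gives an admissible test function. Integration by parts
  turns its index form into boundary terms of order 1/n plus at most -m \<delta> \<alpha>^2 and an
  error of order 1/n.\<close>

lemma index_form_contradiction:
  fixes u u' u'' :: "nat \<Rightarrow> nat \<Rightarrow> real \<Rightarrow> real" and K :: "nat \<Rightarrow> real \<Rightarrow> real"
  assumes m: "0 < m" and d: "0 < \<delta>" and \<alpha>: "0 < \<alpha>" and \<beta>: "0 < \<beta>"
    and K: "\<And>i. i < m \<Longrightarrow> continuous_on {0..1} (K i)"
    and stab: "\<And>\<phi> \<phi>'. (\<And>i. i < m \<Longrightarrow> C1_curve (\<phi> i) (\<phi>' i)) \<Longrightarrow> (\<And>i. i < m \<Longrightarrow> \<phi> i 1 = \<phi> (Suc i mod m) 0) \<Longrightarrow>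
      0 \<le> (\<Sum>i<m. integral {0..1} (\<lambda>t. (\<phi>' i t)\<^sup>2 - (\<phi> i t)\<^sup>2 * K i t))"
    and u: "\<And>k i t. i < m \<Longrightarrow> t \<in> {0..1} \<Longrightarrow> (u k i has_vector_derivative u' k i t) (at t within {0..1})"
      "\<And>k i t. i < m \<Longrightarrow> t \<in> {0..1} \<Longrightarrow> (u' k i has_vector_derivative u'' k i t) (at t within {0..1})"
      "\<And>k i t. i < m \<Longrightarrow> t \<in> {0..1} \<Longrightarrow> (\<delta> - K i t) * u k i t \<le> u'' k i t"
    and bd: "\<And>k i t. i < m \<Longrightarrow> t \<in> {0..1} \<Longrightarrow> \<alpha> \<le> u k i t \<and> u k i t \<le> \<beta> \<and> \<bar>u' k i t\<bar> \<le> \<beta>"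
    and glue: "\<And>k i. Suc i < m \<Longrightarrow> u k i 1 = u k (Suc i) 0" "\<And>k. u k (m - 1) 1 = u (Suc k) 0 0"
      "\<And>k i. Suc i < m \<Longrightarrow> u' k i 1 = u' k (Suc i) 0" "\<And>k. u' k (m - 1) 1 = u' (Suc k) 0 0"
  shows False
proof -
  have "\<exists>\<kappa>>0. \<forall>i<m. \<forall>t\<in>{0..1}. \<bar>K i t\<bar> \<le> \<kappa>"
  proof -
    have "compact (\<Union>i<m. (\<lambda>t. \<bar>K i t\<bar>) ` {0..1})"
      by (intro compact_UN compact_continuous_image continuous_intros K) auto
    then obtain b where "\<And>y. y \<in> (\<Union>i<m. (\<lambda>t. \<bar>K i t\<bar>) ` {0..1}) \<Longrightarrow> norm y \<le> b"
      using compact_imp_bounded bounded_iff by metis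
    then show ?thesis by (intro exI[of _ "\<bar>b\<bar> + 1"]) force
  qed
  then obtain \<kappa> where \<kappa>: "\<kappa> > 0" "\<And>i t. i < m \<Longrightarrow> t \<in> {0..1} \<Longrightarrow> \<bar>K i t\<bar> \<le> \<kappa>" by metis
  \<comment> \<open>The correction changes the integrand by \<open>c i\<close> times a factor of
    size at most \<open>2 * \<beta> + \<beta> + 3 * \<beta> * \<kappa>\<close>; as
    \<open>c i\<close> is at most \<open>\<beta> / n\<close>, the change is at most
    \<open>E / n\<close>.\<close>
  define E where "E = 3 * \<beta>\<^sup>2 * (1 + \<kappa>)"
  \<comment> \<open>Read off from the last inequality of the proof, multiplied by
    \<open>n\<close>.\<close>
  obtain n where n: "5 * \<beta>\<^sup>2 + m * E < real n * (m * (\<delta> * \<alpha>\<^sup>2))"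
    using reals_Archimedean3[of "m * (\<delta> * \<alpha>\<^sup>2)"] m d \<alpha> by auto
  have E0: "E > 0" unfolding E_def using \<beta> \<kappa>(1) by simp
  have N: "real n > 0"
  proof (rule ccontr)
    assume "\<not> real n > 0"
    then have "5 * \<beta>\<^sup>2 + m * E < 0" using n by simp
    moreover have "0 \<le> 5 * \<beta>\<^sup>2" "0 \<le> m * E" using E0 by simp_all
    ultimately show False by linarith
  qed
  define w where "w i t = (\<Sum>k<n. u k i t) / n" for i t
  define w' where "w' i t = (\<Sum>k<n. u' k i t) / n" for i t
  define w'' where "w'' i t = (\<Sum>k<n. u'' k i t) / n" for i t
  have wd: "(w i has_vector_derivative w' i t) (at t within {0..1})" "(w' i has_vector_derivative w'' i t) (at t within {0..1})"
    if "i < m" "t \<in> {0..1}" for i t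
    unfolding w_def w'_def w''_def by (intro has_vector_derivative_divide has_vector_derivative_sum u that)+
  have avg: "c \<le> (\<Sum>k<n. f k) / n \<and> (\<Sum>k<n. f k) / n \<le> e" if "\<And>k. k < n \<Longrightarrow> c \<le> f k \<and> f k \<le> e" for f :: "nat \<Rightarrow> real" and c e
  proof -
    have "(\<Sum>k<n. c) \<le> (\<Sum>k<n. f k)" by (rule sum_mono) (use that in simp)
    moreover have "(\<Sum>k<n. f k) \<le> (\<Sum>k<n. e)" by (rule sum_mono) (use that in simp)
    ultimately show ?thesis using N by (simp add: field_simps)
  qed
  have wb: "\<alpha> \<le> w i t" "w i t \<le> \<beta>" "- \<beta> \<le> w' i t" "w' i t \<le> \<beta>" if "i < m" "t \<in> {0..1}" for i t
    unfolding w_def w'_def using avg[of \<alpha> "\<lambda>k. u k i t" \<beta>] avg[of "- \<beta>" "\<lambda>k. u' k i t" \<beta>] bd[OF that] abs_le_iff by (smt (verit))+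
  have ww: "(\<delta> - K i t) * w i t \<le> w'' i t" if "i < m" "t \<in> {0..1}" for i t
  proof -
    have "(\<Sum>k<n. (\<delta> - K i t) * u k i t) \<le> (\<Sum>k<n. u'' k i t)" using u(3)[OF that] by (intro sum_mono)
    then have "(\<delta> - K i t) * (\<Sum>k<n. u k i t) / n \<le> (\<Sum>k<n. u'' k i t) / n"
      unfolding sum_distrib_left[symmetric] by (rule divide_right_mono) simp
    then show ?thesis unfolding w_def w''_def by simp
  qed
  define \<eta> where "\<eta> = (u n 0 0 - u 0 0 0) / n"
  define \<eta>' where "\<eta>' = (u' n 0 0 - u' 0 0 0) / n"
  have glw: "w i 1 = w (Suc i) 0" "w' i 1 = w' (Suc i) 0" if "Suc i < m" for i
    unfolding w_def w'_def using glue(1,3)[OF that] by simp_all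
  have tele: "(\<Sum>k<n. f (Suc k)) = (\<Sum>k<n. f k) + (f n - f 0)" for f :: "nat \<Rightarrow> real"
    using sum_lessThan_telescope[of f n] by (simp add: sum_subtractf)
  have gll: "w (m - 1) 1 = w 0 0 + \<eta>" "w' (m - 1) 1 = w' 0 0 + \<eta>'"
    unfolding w_def w'_def \<eta>_def \<eta>'_def glue(2,4) by (simp_all only: tele[of "\<lambda>k. u k 0 0"] tele[of "\<lambda>k. u' k 0 0"] add_divide_distrib)
  have eb: "\<bar>\<eta>\<bar> \<le> \<beta> / n" "\<bar>\<eta>'\<bar> \<le> 2 * \<beta> / n"
  proof -
    \<comment> \<open>Values of \<open>u\<close> lie between 0 and \<beta>, so they differ by at
      most \<beta>; the derivatives may have either sign, hence the factor 2.\<close>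
    have "\<bar>u n 0 0 - u 0 0 0\<bar> \<le> \<beta>" "\<bar>u' n 0 0 - u' 0 0 0\<bar> \<le> 2 * \<beta>" using bd[OF m, of 0 n] bd[OF m, of 0 0] \<alpha> by auto
    then show "\<bar>\<eta>\<bar> \<le> \<beta> / n" "\<bar>\<eta>'\<bar> \<le> 2 * \<beta> / n"
      unfolding \<eta>_def \<eta>'_def abs_divide using N by (auto intro!: divide_right_mono)
  qed
  have "real n \<ge> 1" using N by simp
  then have "\<beta> / n \<le> \<beta>" using \<beta> N by (simp add: field_simps)
  \<comment> \<open>Only the last segment is corrected, by \<open>t * \<eta>\<close>, which vanishes
    at its start and so leaves the inner joints intact.\<close>
  define c where "c i = (if Suc i < m then 0 else \<eta>)" for i
  have cb: "\<bar>c i\<bar> \<le> \<beta> / n" for i unfolding c_def using eb(1) \<beta> N by auto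
  define \<phi> where "\<phi> i t = w i t - t * c i" for i t
  define \<phi>' where "\<phi>' i t = w' i t - c i" for i t
  have pd: "(\<phi> i has_vector_derivative \<phi>' i t) (at t within {0..1})" if "i < m" "t \<in> {0..1}" for i t
    unfolding \<phi>_def \<phi>'_def using has_vector_derivative_diff[OF wd(1)[OF that] has_vector_derivative_mult_left[OF has_vector_derivative_id, of "c i"]] by simp
  have cw: "continuous_on {0..1} (w i)" "continuous_on {0..1} (w' i)" if "i < m" for i
    by (rule continuous_on_vd[OF wd(1)[OF that]], assumption, rule continuous_on_vd[OF wd(2)[OF that]])
  have C1: "C1_curve (\<phi> i) (\<phi>' i)" if "i < m" for i
    unfolding C1_curve_def using pd[OF that] cw(2)[OF that] by (auto simp: \<phi>'_def intro!: continuous_intros)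
  have cyc: "\<phi> i 1 = \<phi> (Suc i mod m) 0" if "i < m" for i
  proof (cases "Suc i < m")
    case False
    then have "i = m - 1" using that by simp
    then show ?thesis using gll m by (simp add: \<phi>_def c_def)
  qed (simp add: \<phi>_def c_def glw)
  \<comment> \<open>Multiplying the inequality for \<open>w''\<close> by \<open>w\<close> bounds the
    uncorrected integrand by the derivative of \<open>w * w'\<close> minus \<delta> times the square
    of \<open>w\<close>; the rest is the effect of the correction.\<close>
  have ineq: "(\<phi>' i t)\<^sup>2 - (\<phi> i t)\<^sup>2 * K i t \<le> (w' i t * w' i t + w i t * w'' i t) - (\<delta> * \<alpha>\<^sup>2 - E / n)" if it: "i < m" "t \<in> {0..1}" for i t
  proof -
    note b = wb[OF it]
    have t: "0 \<le> t" "t \<le> 1" using it(2) by auto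
    have "\<delta> * \<alpha>\<^sup>2 \<le> \<delta> * (w i t)\<^sup>2" using b \<alpha> d by (intro mult_left_mono power_mono) auto
    moreover have "w i t * ((\<delta> - K i t) * w i t) \<le> w i t * w'' i t"
      using ww[OF it] b(1) \<alpha> by (intro mult_left_mono) auto
    moreover have "(\<phi>' i t)\<^sup>2 - (\<phi> i t)\<^sup>2 * K i t = (w' i t)\<^sup>2 - (w i t)\<^sup>2 * K i t + c i * (- 2 * w' i t + c i + (2 * w i t - t * c i) * t * K i t)"
      unfolding \<phi>_def \<phi>'_def by (simp add: power2_eq_square algebra_simps)
    moreover have "c i * (- 2 * w' i t + c i + (2 * w i t - t * c i) * t * K i t) \<le> E / n"
    proof -
      have cb': "\<bar>c i\<bar> \<le> \<beta>" using cb[of i] \<open>\<beta> / n \<le> \<beta>\<close> by linarith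
      have "\<bar>t * c i\<bar> \<le> 1 * \<beta>" unfolding abs_mult using t cb' \<beta> by (intro mult_mono) auto
      then have "\<bar>2 * w i t - t * c i\<bar> \<le> 3 * \<beta>" using b \<alpha> by linarith
      then have "\<bar>2 * w i t - t * c i\<bar> * \<bar>t\<bar> * \<bar>K i t\<bar> \<le> 3 * \<beta> * 1 * \<kappa>"
        using t \<kappa>(2)[OF it] \<beta> by (intro mult_mono) auto
      then have "\<bar>(2 * w i t - t * c i) * t * K i t\<bar> \<le> 3 * \<beta> * \<kappa>" by (simp add: abs_mult)
      then have "\<bar>- 2 * w' i t + c i + (2 * w i t - t * c i) * t * K i t\<bar> \<le> 3 * \<beta> + 3 * \<beta> * \<kappa>" using b cb' by linarith
      then have "\<bar>c i\<bar> * \<bar>- 2 * w' i t + c i + (2 * w i t - t * c i) * t * K i t\<bar> \<le> \<beta> / n * (3 * \<beta> + 3 * \<beta> * \<kappa>)"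
        using cb[of i] by (intro mult_mono) (use \<beta> N in auto)
      also have "\<dots> = E / n" by (simp add: E_def power2_eq_square algebra_simps add_divide_distrib)
      finally show ?thesis by (simp add: abs_mult[symmetric] abs_le_iff)
    qed
    ultimately show ?thesis by (simp add: power2_eq_square algebra_simps)
  qed
  have int: "integral {0..1} (\<lambda>t. (\<phi>' i t)\<^sup>2 - (\<phi> i t)\<^sup>2 * K i t) \<le> (w i 1 * w' i 1 - w i 0 * w' i 0) - (\<delta> * \<alpha>\<^sup>2 - E / n)" if i: "i < m" for i
  proof (rule has_integral_le)
    show "((\<lambda>t. (\<phi>' i t)\<^sup>2 - (\<phi> i t)\<^sup>2 * K i t) has_integral integral {0..1} (\<lambda>t. (\<phi>' i t)\<^sup>2 - (\<phi> i t)\<^sup>2 * K i t)) {0..1}"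
      unfolding \<phi>_def \<phi>'_def by (intro integrable_integral integrable_continuous_real continuous_intros cw[OF i] K[OF i])
    have "((\<lambda>t. w i t * w' i t) has_vector_derivative (w' i t * w' i t + w i t * w'' i t)) (at t within {0..1})" if "t \<in> {0..1}" for t
      using has_vector_derivative_mult[OF wd[OF i that]] by (simp add: add.commute)
    from ftc01[of "\<lambda>t. w i t * w' i t", OF this, of 1]
    have "((\<lambda>t. w' i t * w' i t + w i t * w'' i t) has_integral (w i 1 * w' i 1 - w i 0 * w' i 0)) {0..1}" by simp
    from has_integral_diff[OF this has_integral_const_real[of "\<delta> * \<alpha>\<^sup>2 - E / n" 0 1]]
    show "((\<lambda>t. (w' i t * w' i t + w i t * w'' i t) - (\<delta> * \<alpha>\<^sup>2 - E / n)) has_integral (w i 1 * w' i 1 - w i 0 * w' i 0) - (\<delta> * \<alpha>\<^sup>2 - E / n)) {0..1}" by simp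
  qed (rule ineq[OF i])
  have "0 \<le> (\<Sum>i<m. integral {0..1} (\<lambda>t. (\<phi>' i t)\<^sup>2 - (\<phi> i t)\<^sup>2 * K i t))" by (rule stab[of \<phi> \<phi>', OF C1 cyc])
  also have "\<dots> \<le> (\<Sum>i<m. (w i 1 * w' i 1 - w i 0 * w' i 0) - (\<delta> * \<alpha>\<^sup>2 - E / n))" by (intro sum_mono int) simp
  also have "\<dots> = (\<Sum>i<m. w i 1 * w' i 1 - w i 0 * w' i 0) - m * (\<delta> * \<alpha>\<^sup>2 - E / n)" by (simp add: sum_subtractf)
  also have "(\<Sum>i<m. w i 1 * w' i 1 - w i 0 * w' i 0) = w (m - 1) 1 * w' (m - 1) 1 - w 0 0 * w' 0 0"
    by (rule sum_telescope_loop[OF m]) (simp add: glw)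
  also have "\<dots> = w 0 0 * \<eta>' + \<eta> * w' 0 0 + \<eta> * \<eta>'" unfolding gll by (simp add: algebra_simps)
  \<comment> \<open>Of the five parts, two come from the defect of the derivative, one from the
    defect of the value, and two from their product.\<close>
  also have "\<dots> \<le> 5 * \<beta>\<^sup>2 / n"
  proof -
    note b = wb[OF m, of 0]
    have "\<bar>w 0 0\<bar> * \<bar>\<eta>'\<bar> \<le> \<beta> * (2 * \<beta> / n)" using b eb \<alpha> \<beta> by (intro mult_mono) auto
    moreover have "\<bar>\<eta>\<bar> * \<bar>w' 0 0\<bar> \<le> \<beta> / n * \<beta>" using b eb \<beta> N by (intro mult_mono) auto
    moreover have "\<bar>\<eta>\<bar> * \<bar>\<eta>'\<bar> \<le> \<beta> * (2 * \<beta> / n)" using eb \<open>\<beta> / n \<le> \<beta>\<close> \<beta> by (intro mult_mono) auto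
    moreover have "5 * \<beta>\<^sup>2 / n = \<beta> * (2 * \<beta> / n) + \<beta> / n * \<beta> + \<beta> * (2 * \<beta> / n)" by (simp add: power2_eq_square field_simps)
    ultimately show ?thesis unfolding abs_mult[symmetric] by linarith
  qed
  finally have "m * (\<delta> * \<alpha>\<^sup>2) \<le> 5 * \<beta>\<^sup>2 / n + m * (E / n)" by (simp add: algebra_simps)
  then have "real n * (m * (\<delta> * \<alpha>\<^sup>2)) \<le> 5 * \<beta>\<^sup>2 + m * E" using N by (simp add: field_simps)
  then show False using n by linarith
qed

section \<open>Images of the geodesic under iterates of the isometry\<close>

lemma has_vector_derivative_chain:
  assumes "(f has_derivative f') (at (y t))" "(y has_vector_derivative v) (at t within S)"
  shows "((\<lambda>s. f (y s)) has_vector_derivative f' v) (at t within S)"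
proof -
  have "((\<lambda>s. f (y s)) has_derivative (\<lambda>h. f' (h *\<^sub>R v))) (at t within S)"
    using has_derivative_compose[OF assms(2)[unfolded has_vector_derivative_def] assms(1)] .
  then show ?thesis
    by (simp add: has_vector_derivative_def linear_scale[OF has_derivative_linear[OF assms(1)]])
qed

lemma has_vector_derivative_apply:
  assumes "(f has_vector_derivative f') (at t within S)" "(v has_vector_derivative v') (at t within S)"
  shows "((\<lambda>s. blinfun_apply (f s) (v s)) has_vector_derivative f' (v t) + f t v') (at t within S)"
  using bounded_bilinear.has_vector_derivative[OF bounded_bilinear_blinfun_apply assms] by (simp add: add.commute)

lemma curve_nhd:
  assumes c: "continuous_map (top_of_set {0..1}) T \<gamma>" and S: "openin T S" and t: "t \<in> {0..1::real}" "\<gamma> t \<in> S"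
  shows "\<exists>e>0. \<forall>s. s \<in> {0..1} \<longrightarrow> dist s t < e \<longrightarrow> \<gamma> s \<in> S"
proof -
  have "openin (top_of_set {0..1}) {s \<in> {0..1}. \<gamma> s \<in> S}"
    using openin_continuous_map_preimage[OF c S] by simp
  then obtain e where "e > 0" "ball t e \<inter> {0..1} \<subseteq> {s \<in> {0..1}. \<gamma> s \<in> S}"
    using t unfolding openin_contains_ball by blast
  then show ?thesis by (intro exI[of _ e]) (auto simp: subset_iff dist_commute)
qed

definition vel :: "('a, 'n::finite) chart \<Rightarrow> (real \<Rightarrow> 'a) \<Rightarrow> real \<Rightarrow> real^'n"
  where "vel c \<gamma> t = vector_derivative (\<lambda>s. map_c c (\<gamma> s)) (at t within {0..1})"

lemma velI: "t \<in> {0..1} \<Longrightarrow> ((\<lambda>s. map_c c (\<gamma> s)) has_vector_derivative v) (at t within {0..1}) \<Longrightarrow> vel c \<gamma> t = v"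
  unfolding vel_def by (rule vector_derivative_within_closed_interval) simp_all

context riemannian
begin

text \<open>Besides the geodesic equation, only the existence of some normal unit vector with curvature
  term \<open>K t\<close> is recorded. Each isometry and each change of chart preserves this, so no
  smoothness of iterates of \<open>F\<close> is needed.\<close>

definition geo_at :: "(real \<Rightarrow> real) \<Rightarrow> real \<Rightarrow> (real \<Rightarrow> 'a) \<Rightarrow> ('a, 'n) chart \<Rightarrow> real \<Rightarrow> bool"
  where "geo_at K L \<gamma> c t \<longleftrightarrow> (let x = map_c c (\<gamma> t); v = vel c \<gamma> t in
    ((\<lambda>s. map_c c (\<gamma> s)) has_vector_derivative v) (at t within {0..1}) \<and>
    (vel c \<gamma> has_vector_derivative - chr (mc c) x v v) (at t within {0..1}) \<and>
    gb (mc c) x v v = L \<and>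
    (\<exists>u. gb (mc c) x u u = 1 \<and> gb (mc c) x u v = 0 \<and> gb (mc c) x (Rm (mc c) x u v v) u = K t))"

definition geo :: "(real \<Rightarrow> real) \<Rightarrow> real \<Rightarrow> (real \<Rightarrow> 'a) \<Rightarrow> bool"
  where "geo K L \<gamma> \<longleftrightarrow> continuous_map (top_of_set {0..1}) T \<gamma> \<and>
    (\<forall>t\<in>{0..1}. \<forall>c\<in>A. \<gamma> t \<in> dom_c c \<longrightarrow> geo_at K L \<gamma> c t)"

text \<open>Components are collected in all charts at once, so that agreement of velocities at a
  joint is an equality independent of charts and passes to every quantity built from point and
  tangent vector.\<close>

definition velocity :: "(real \<Rightarrow> 'a) \<Rightarrow> real \<Rightarrow> ('a, 'n) tvec"
  where "velocity \<gamma> t = (\<lambda>c. if c \<in> A \<and> \<gamma> t \<in> dom_c c then vel c \<gamma> t else 0)"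

lemma geo_continuous: "geo K L \<gamma> \<Longrightarrow> continuous_map (top_of_set {0..1}) T \<gamma>"
  unfolding geo_def by (rule conjunct1)

lemma geo_top: "geo K L \<gamma> \<Longrightarrow> t \<in> {0..1} \<Longrightarrow> \<gamma> t \<in> topspace T"
  using geo_continuous by (fastforce simp: continuous_map_def)

lemma geoD:
  assumes "geo K L \<gamma>" "t \<in> {0..1}" "c \<in> A" "\<gamma> t \<in> dom_c c"
  shows "geo_at K L \<gamma> c t"
  using assms(1)[unfolded geo_def, THEN conjunct2, rule_format, OF assms(2-4)] .

lemma geo_atD:
  assumes "geo_at K L \<gamma> c t"
  shows "((\<lambda>s. map_c c (\<gamma> s)) has_vector_derivative vel c \<gamma> t) (at t within {0..1})"
    and "(vel c \<gamma> has_vector_derivative - chr (mc c) (map_c c (\<gamma> t)) (vel c \<gamma> t) (vel c \<gamma> t)) (at t within {0..1})"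
    and "gb (mc c) (map_c c (\<gamma> t)) (vel c \<gamma> t) (vel c \<gamma> t) = L"
    and "\<exists>u. gb (mc c) (map_c c (\<gamma> t)) u u = 1 \<and> gb (mc c) (map_c c (\<gamma> t)) u (vel c \<gamma> t) = 0 \<and>
      gb (mc c) (map_c c (\<gamma> t)) (Rm (mc c) (map_c c (\<gamma> t)) u (vel c \<gamma> t) (vel c \<gamma> t)) u = K t"
  using assms unfolding geo_at_def Let_def by blast+

lemma ex_chart: "p \<in> topspace T \<Longrightarrow> \<exists>c. c \<in> A \<and> p \<in> dom_c c"
  using atlas unfolding smooth_atlas_def by blast

lemma vel_chain:
  assumes H: "smooth_map T A H" and \<gamma>: "continuous_map (top_of_set {0..1}) T \<gamma>" and cd: "c \<in> A" "d \<in> A"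
    and t: "t \<in> {0..1}" "\<gamma> t \<in> dom_c c" "H (\<gamma> t) \<in> dom_c d"
    and v: "((\<lambda>s. map_c c (\<gamma> s)) has_vector_derivative v) (at t within {0..1})"
  shows "((\<lambda>s. map_c d (H (\<gamma> s))) has_vector_derivative Dbl (rep H c d) (map_c c (\<gamma> t)) v) (at t within {0..1})"
proof -
  obtain e where e: "e > 0" "\<And>s. s \<in> {0..1} \<Longrightarrow> dist s t < e \<Longrightarrow> \<gamma> s \<in> dom_c c"
    using curve_nhd[OF \<gamma> open_dom[OF cd(1)] t(1,2)] by blast
  have "((\<lambda>s. rep H c d (map_c c (\<gamma> s))) has_vector_derivative Dbl (rep H c d) (map_c c (\<gamma> t)) v) (at t within {0..1})"
    by (rule has_vector_derivative_chain[OF rep_derivative(1)[OF H cd t(2,3)] v])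
  then show ?thesis
    by (rule has_vector_derivative_transform_within[OF _ e(1) t(1)]) (simp add: rep_map[OF cd(1) e(2)])
qed

text \<open>The chain rule produces the second derivative of the coordinate map, and
  \<open>chr_law\<close> absorbs it into the geodesic equation of the target. Speed, normal vector
  and curvature term are carried over by \<open>isom\<close> and \<open>sec_law\<close>. The case
  \<open>H = id\<close> is a change of chart.\<close>

lemma geo_at_step:
  assumes H: "isometric H" and \<gamma>: "continuous_map (top_of_set {0..1}) T \<gamma>" and cd: "c \<in> A" "d \<in> A"
    and g: "\<And>s. s \<in> {0..1} \<Longrightarrow> \<gamma> s \<in> dom_c c \<Longrightarrow> geo_at K L \<gamma> c s"
    and t: "t \<in> {0..1}" "\<gamma> t \<in> dom_c c" "H (\<gamma> t) \<in> dom_c d"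
  shows "geo_at K L (\<lambda>s. H (\<gamma> s)) d t" "vel d (\<lambda>s. H (\<gamma> s)) t = Dbl (rep H c d) (map_c c (\<gamma> t)) (vel c \<gamma> t)"
proof -
  interpret lisom "img_c c" "mc c" "img_c d" "mc d" "dom2 H c d" "rep H c d"
    by (rule isometric_lisom[OF H cd])
  let ?S = "{p \<in> dom_c c. H p \<in> dom_c d}"
  have H': "smooth_map T A H" by (rule isometric_smooth[OF H])
  have vd: "((\<lambda>s. map_c d (H (\<gamma> s))) has_vector_derivative Dbl (rep H c d) (map_c c (\<gamma> s)) (vel c \<gamma> s)) (at s within {0..1})"
    if "s \<in> {0..1}" "\<gamma> s \<in> ?S" for s
    using that by (intro vel_chain[OF H' \<gamma> cd that(1)] geo_atD(1)[OF g]) simp_all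
  have ve: "vel d (\<lambda>s. H (\<gamma> s)) s = Dbl (rep H c d) (map_c c (\<gamma> s)) (vel c \<gamma> s)" if "s \<in> {0..1}" "\<gamma> s \<in> ?S" for s
    by (rule velI[OF that(1) vd[OF that]])
  have tS: "\<gamma> t \<in> ?S" using t by simp
  show vt: "vel d (\<lambda>s. H (\<gamma> s)) t = Dbl (rep H c d) (map_c c (\<gamma> t)) (vel c \<gamma> t)" by (rule ve[OF t(1) tS])
  have S: "openin T ?S"
  proof -
    have "?S = dom_c c \<inter> {p \<in> topspace T. H p \<in> dom_c d}" using dom_sub[OF cd(1)] by blast
    moreover have "openin T {p \<in> topspace T. H p \<in> dom_c d}"
      by (rule openin_continuous_map_preimage[OF smooth_map_continuous[OF H'] open_dom[OF cd(2)]])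
    ultimately show ?thesis using open_dom[OF cd(1)] by auto
  qed
  obtain e where e: "e > 0" "\<And>s. s \<in> {0..1} \<Longrightarrow> dist s t < e \<Longrightarrow> \<gamma> s \<in> ?S"
    using curve_nhd[OF \<gamma> S t(1) tS] by metis
  define y where "y = map_c c (\<gamma> t)"
  define v where "v = vel c \<gamma> t"
  have yW: "y \<in> dom2 H c d" unfolding y_def by (rule dom2_map[OF cd(1), where H = H and d = d, OF t(2,3)])
  have py: "rep H c d y = map_c d (H (\<gamma> t))" unfolding y_def by (rule rep_map[OF cd(1) t(2)])
  note G = geo_atD[OF g[OF t(1,2)], folded v_def, folded y_def]
  have "((\<lambda>s. Dbl (rep H c d) (map_c c (\<gamma> s))) has_vector_derivative Dbl (Dbl (rep H c d)) y v) (at t within {0..1})"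
    by (rule has_vector_derivative_chain[OF has_derivative_Dpsi[OF yW, unfolded y_def] G(1), folded y_def])
  from has_vector_derivative_apply[OF this G(2)]
  have "((\<lambda>s. Dbl (rep H c d) (map_c c (\<gamma> s)) (vel c \<gamma> s)) has_vector_derivative
      Dbl (Dbl (rep H c d)) y v v + Dbl (rep H c d) y (- chr (mc c) y v v)) (at t within {0..1})"
    by (simp only: v_def y_def)
  also have "Dbl (Dbl (rep H c d)) y v v + Dbl (rep H c d) y (- chr (mc c) y v v) =
      - chr (mc d) (rep H c d y) (Dbl (rep H c d) y v) (Dbl (rep H c d) y v)"
    using chr_law[OF yW, of v v] by (simp add: blinfun.bilinear_simps algebra_simps)
  finally have 2: "(vel d (\<lambda>s. H (\<gamma> s)) has_vector_derivative
      - chr (mc d) (rep H c d y) (Dbl (rep H c d) y v) (Dbl (rep H c d) y v)) (at t within {0..1})"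
    by (rule has_vector_derivative_transform_within[OF _ e(1) t(1)]) (simp add: ve[OF _ e(2)])
  obtain u where u: "gb (mc c) y u u = 1" "gb (mc c) y u v = 0" "gb (mc c) y (Rm (mc c) y u v v) u = K t"
    using G(4) by blast
  show "geo_at K L (\<lambda>s. H (\<gamma> s)) d t"
    unfolding geo_at_def Let_def vt py[symmetric] v_def[symmetric] y_def[symmetric]
  proof (intro conjI exI[of _ "Dbl (rep H c d) y u"])
    show "((\<lambda>s. map_c d (H (\<gamma> s))) has_vector_derivative Dbl (rep H c d) y v) (at t within {0..1})"
      unfolding y_def v_def by (rule vd[OF t(1) tS])
  qed (simp_all only: 2 isom[OF yW, symmetric] sec_law[OF yW] u G(3))
qed

lemma geo_step:
  assumes H: "isometric H" and g: "geo K L \<gamma>"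
  shows "geo K L (\<lambda>s. H (\<gamma> s))"
  unfolding geo_def
proof (intro conjI ballI impI)
  note \<gamma> = geo_continuous[OF g]
  show "continuous_map (top_of_set {0..1}) T (\<lambda>s. H (\<gamma> s))"
    using continuous_map_compose[OF \<gamma> smooth_map_continuous[OF isometric_smooth[OF H]]] by (simp add: o_def)
  fix t d assume t: "t \<in> {0..1}" and d: "d \<in> A" "H (\<gamma> t) \<in> dom_c d"
  obtain c where c: "c \<in> A" "\<gamma> t \<in> dom_c c" using ex_chart[OF geo_top[OF g t]] by (elim exE conjE)
  show "geo_at K L (\<lambda>s. H (\<gamma> s)) d t"
    by (rule geo_at_step(1)[OF H \<gamma> c(1) d(1) geoD[OF g _ c(1)] t c(2) d(2)])
qed

lemma velocity_vec_at:
  assumes g: "geo K L \<gamma>" and t: "t \<in> {0..1}" and c: "c \<in> A" "\<gamma> t \<in> dom_c c"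
  shows "velocity \<gamma> t = vec_at A c (\<gamma> t) (vel c \<gamma> t)"
proof
  fix d
  show "velocity \<gamma> t d = vec_at A c (\<gamma> t) (vel c \<gamma> t) d"
  proof (cases "d \<in> A \<and> \<gamma> t \<in> dom_c d")
    case True
    have i: "id (\<gamma> t) \<in> dom_c d" using True by simp
    have "vel d (\<lambda>s. id (\<gamma> s)) t = Dbl (tr c d) (map_c c (\<gamma> t)) (vel c \<gamma> t)"
      by (rule geo_at_step(2)[OF isometric_id geo_continuous[OF g] c(1) conjunct1[OF True] geoD[OF g _ c(1)] t c(2) i])
    then show ?thesis by (simp add: velocity_def vec_at_eq[OF c] True)
  next
    case False
    then show ?thesis unfolding velocity_def vec_at_eq[OF c] by (simp only: if_False)
  qed
qed

lemma velocity_self: "c \<in> A \<Longrightarrow> \<gamma> t \<in> dom_c c \<Longrightarrow> velocity \<gamma> t c = vel c \<gamma> t"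
  by (simp add: velocity_def)

lemma velocity_tangent:
  assumes g: "geo K L \<gamma>" and t: "t \<in> {0..1}"
  shows "velocity \<gamma> t \<in> tangent_space A (\<gamma> t)"
proof -
  obtain c where c: "c \<in> A" "\<gamma> t \<in> dom_c c" using ex_chart[OF geo_top[OF g t]] by (elim exE conjE)
  show ?thesis unfolding velocity_vec_at[OF g t c] by (rule vec_at_tangent[OF c])
qed

text \<open>Joints stay smooth: two curves that meet with equal velocities have images that meet
  with equal velocities.\<close>

lemma velocity_step:
  assumes H: "isometric H" and g: "geo K L \<gamma>" "geo K' L' \<eta>" and st: "s \<in> {0..1}" "t \<in> {0..1}"
    and eq: "\<gamma> s = \<eta> t" "velocity \<gamma> s = velocity \<eta> t"
  shows "velocity (\<lambda>s. H (\<gamma> s)) s = velocity (\<lambda>s. H (\<eta> s)) t"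
proof
  fix d
  obtain c where c: "c \<in> A" "\<gamma> s \<in> dom_c c" using ex_chart[OF geo_top[OF g(1) st(1)]] by (elim exE conjE)
  have c': "\<eta> t \<in> dom_c c" using c(2) eq(1) by simp
  have v: "vel c \<gamma> s = vel c \<eta> t" using fun_cong[OF eq(2), of c] by (simp add: velocity_self c c')
  show "velocity (\<lambda>s. H (\<gamma> s)) s d = velocity (\<lambda>s. H (\<eta> s)) t d"
  proof (cases "d \<in> A \<and> H (\<gamma> s) \<in> dom_c d")
    case True
    have "vel d (\<lambda>s. H (\<gamma> s)) s = Dbl (rep H c d) (map_c c (\<gamma> s)) (vel c \<gamma> s)"
      by (rule geo_at_step(2)[OF H geo_continuous[OF g(1)] c(1) conjunct1[OF True] geoD[OF g(1) _ c(1)] st(1) c(2) conjunct2[OF True]])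
    moreover have "vel d (\<lambda>s. H (\<eta> s)) t = Dbl (rep H c d) (map_c c (\<eta> t)) (vel c \<eta> t)"
      by (rule geo_at_step(2)[OF H geo_continuous[OF g(2)] c(1) conjunct1[OF True] geoD[OF g(2) _ c(1)] st(2) c' conjunct2[OF True[unfolded eq(1)]]])
    ultimately show ?thesis by (simp add: velocity_def eq(1) v)
  next
    case False
    then show ?thesis unfolding velocity_def eq(1) by (simp only: if_False)
  qed
qed

end

section \<open>Weighted curvature along geodesics\<close>

lemma bilinear_axis_sum:
  fixes B :: "real^'n \<Rightarrow> real^'n \<Rightarrow> real"
  assumes "\<And>v. linear (\<lambda>u. B u v)" "\<And>u. linear (B u)"
  shows "(\<Sum>i\<in>UNIV. \<Sum>j\<in>UNIV. B (axis i 1) (axis j 1) * u $ i * v $ j) = B u v"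
proof -
  have e: "x = (\<Sum>i\<in>UNIV. x $ i *\<^sub>R axis i 1)" for x :: "real^'n"
    using basis_expansion[of x] by (simp add: scalar_mult_eq_scaleR)
  have "B u v = (\<Sum>i\<in>UNIV. u $ i * B (axis i 1) v)"
    by (subst e[of u]) (simp add: linear_sum[OF assms(1)] linear_scale[OF assms(1)])
  also have "\<dots> = (\<Sum>i\<in>UNIV. u $ i * (\<Sum>j\<in>UNIV. v $ j * B (axis i 1) (axis j 1)))"
    by (subst e[of v]) (simp add: linear_sum[OF assms(2)] linear_scale[OF assms(2)])
  finally show ?thesis by (simp add: sum_distrib_left mult_ac)
qed

lemma linear_blinfun_comp: "linear f \<Longrightarrow> linear (\<lambda>u. blinfun_apply b (f u))"
  using linear_compose[OF _ bounded_linear.linear[OF blinfun.bounded_linear_right], of f b] by (simp add: o_def)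

lemma linear_blinfun_left: "linear f \<Longrightarrow> linear (\<lambda>u. blinfun_apply (f u) v)"
  using linear_compose[OF _ bounded_linear.linear[OF blinfun.bounded_linear_left], of f v] by (simp add: o_def)

lemmas linear_blinfun_intros = linear_blinfun_comp linear_blinfun_left linear_ident linear_compose_add

text \<open>Half the Lie derivative of the metric on (w, w), in the form g(nabla_w Y, w) for the
  Levi-Civita connection.\<close>

definition half_lie :: "(real^'n \<Rightarrow> real^'n^'n) \<Rightarrow> (real^'n \<Rightarrow> real^'n) \<Rightarrow> real^'n::finite \<Rightarrow> real^'n \<Rightarrow> real"
  where "half_lie G Y x w = gb G x (chr G x w (Y x)) w + gb G x (Dbl Y x w) w"

definition hessq :: "(real^'n \<Rightarrow> real^'n^'n) \<Rightarrow> (real^'n \<Rightarrow> real) \<Rightarrow> real^'n::finite \<Rightarrow> real^'n \<Rightarrow> real"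
  where "hessq G h x w = Dbl (Dbl h) x w w - Dbl h x (chr G x w w)"

context lmetric
begin

text \<open>The index formula is bilinear in \<open>w\<close>, hence determined by basis vectors.
  Metric compatibility replaces the derivative of the metric along \<open>Y\<close>, and symmetry of
  the connection turns it into the covariant derivative of \<open>Y\<close>.\<close>

lemma lie_sum:
  assumes x: "x \<in> U" and Y: "smooth_on U Y"
  shows "(\<Sum>i\<in>UNIV. \<Sum>j\<in>UNIV. (\<Sum>k\<in>UNIV.
         Y x $ k * pd k (\<lambda>y. G y $ i $ j) x
         + G x $ k $ j * pd i (\<lambda>y. Y y $ k) x
         + G x $ i $ k * pd j (\<lambda>y. Y y $ k) x) * w $ i * w $ j) = 2 * half_lie G Y x w"
proof -
  define B where "B u v = Dbl (gb G) x (Y x) u v + gb G x (Dbl Y x u) v + gb G x u (Dbl Y x v)" for u v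
  have pdY: "pd i (\<lambda>y. Y y $ k) x = Dbl Y x (axis i 1) $ k" for i k
  proof -
    have "((\<lambda>y. Y y $ k) has_derivative (\<lambda>v. Dbl Y x v $ k)) (at x)"
      by (rule bounded_linear.has_derivative[OF bounded_linear_vec_nth smooth_on_has_derivative[OF Y x]])
    from frechet_derivative_at[OF this] show ?thesis unfolding pd_def by metis
  qed
  have g1: "(\<Sum>k\<in>UNIV. G x $ k $ j * a $ k) = gb G x a (axis j 1)" for a j
    unfolding blinfun_axis_expand[of "blinfun_apply (gb G x) a" "axis j 1"] gb_apply
    by (simp add: axis_def if_distrib cong: if_cong)
  have g2: "(\<Sum>k\<in>UNIV. G x $ i $ k * a $ k) = gb G x (axis i 1) a" for a i
    by (subst blinfun_axis_expand[of "gb G x (axis i 1)" a]) (simp add: gb_axis mult.commute)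
  have d: "(\<Sum>k\<in>UNIV. Y x $ k * pd k (\<lambda>y. G y $ i $ j) x) = Dbl (gb G) x (Y x) (axis i 1) (axis j 1)" for i j
    by (subst blinfun_axis_expand[of "Dbl (gb G) x"]) (simp add: pd_G[OF x] blinfun.bilinear_simps blinfun.sum_left)
  have "(\<Sum>k\<in>UNIV. Y x $ k * pd k (\<lambda>y. G y $ i $ j) x + G x $ k $ j * pd i (\<lambda>y. Y y $ k) x
         + G x $ i $ k * pd j (\<lambda>y. Y y $ k) x) = B (axis i 1) (axis j 1)" for i j
    unfolding sum.distrib pdY g1 g2 d B_def ..
  then have "(\<Sum>i\<in>UNIV. \<Sum>j\<in>UNIV. (\<Sum>k\<in>UNIV.
         Y x $ k * pd k (\<lambda>y. G y $ i $ j) x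
         + G x $ k $ j * pd i (\<lambda>y. Y y $ k) x
         + G x $ i $ k * pd j (\<lambda>y. Y y $ k) x) * w $ i * w $ j) = (\<Sum>i\<in>UNIV. \<Sum>j\<in>UNIV. B (axis i 1) (axis j 1) * w $ i * w $ j)"
    by (simp only:)
  also have "\<dots> = B w w"
    by (rule bilinear_axis_sum; unfold B_def; intro linear_blinfun_intros)
  also have "\<dots> = 2 * half_lie G Y x w"
    unfolding B_def half_lie_def metric_compat[OF x]
    using sym[OF x, of w "Dbl Y x w"] sym[OF x, of w "chr G x (Y x) w"] chr_sym[OF x, of "Y x" w] by simp
  finally show ?thesis .
qed

lemma hess_sum:
  assumes x: "x \<in> U" and h: "smooth_on U h"
  shows "(\<Sum>i\<in>UNIV. \<Sum>j\<in>UNIV.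
        (pd i (pd j h) x - (\<Sum>k\<in>UNIV. christoffel G k i j x * pd k h x)) * w $ i * w $ j) = hessq G h x w"
proof -
  define B where "B u v = Dbl (Dbl h) x u v - Dbl h x (chr G x u v)" for u v
  have pd1: "pd k h y = Dbl h y (axis k 1)" if "y \<in> U" for k y
    unfolding pd_def smooth_on_frechet_eq[OF h that] ..
  have pd2: "pd i (pd j h) x = Dbl (Dbl h) x (axis i 1) (axis j 1)" for i j
  proof -
    have "((\<lambda>y. Dbl h y (axis j 1)) has_derivative (\<lambda>w. Dbl (Dbl h) x w (axis j 1))) (at x)"
      by (rule bounded_linear.has_derivative[OF blinfun.bounded_linear_left smooth_on_has_derivative[OF smooth_on_Dbl[OF open_U h] x]])
    then have "(pd j h has_derivative (\<lambda>w. Dbl (Dbl h) x w (axis j 1))) (at x)"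
      by (rule has_derivative_transform_within_open[OF _ open_U x]) (simp add: pd1)
    from frechet_derivative_at[OF this] show ?thesis unfolding pd_def[of i] by metis
  qed
  have c: "(\<Sum>k\<in>UNIV. christoffel G k i j x * pd k h x) = Dbl h x (chr G x (axis i 1) (axis j 1))" for i j
    by (subst blinfun_axis_expand[of "Dbl h x"]) (simp add: pd1[OF x] chr_axis)
  have "pd i (pd j h) x - (\<Sum>k\<in>UNIV. christoffel G k i j x * pd k h x) = B (axis i 1) (axis j 1)" for i j
    unfolding pd2 c B_def ..
  then have "(\<Sum>i\<in>UNIV. \<Sum>j\<in>UNIV.
        (pd i (pd j h) x - (\<Sum>k\<in>UNIV. christoffel G k i j x * pd k h x)) * w $ i * w $ j) =
     (\<Sum>i\<in>UNIV. \<Sum>j\<in>UNIV. B (axis i 1) (axis j 1) * w $ i * w $ j)" by (simp only:)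
  also have "\<dots> = B w w"
    by (rule bilinear_axis_sum; unfold B_def; intro linear_compose_sub linear_blinfun_intros)
  finally show ?thesis unfolding B_def hessq_def .
qed

text \<open>Along a geodesic the velocity is parallel, so only the covariant derivative of
  \<open>Y\<close> contributes to the derivative of g(Y, x').\<close>

lemma vf_velocity_vd:
  assumes x: "x t \<in> U" and Y: "smooth_on U Y" and d: "(x has_vector_derivative x' t) (at t within S)"
    "(x' has_vector_derivative - chr G (x t) (x' t) (x' t)) (at t within S)"
  shows "((\<lambda>s. gb G (x s) (Y (x s)) (x' s)) has_vector_derivative half_lie G Y (x t) (x' t)) (at t within S)"
proof (rule has_vector_derivative_eq_rhs)
  show "((\<lambda>s. gb G (x s) (Y (x s)) (x' s)) has_vector_derivative
     Dbl (gb G) (x t) (x' t) (Y (x t)) (x' t) + gb G (x t) (Dbl Y (x t) (x' t)) (x' t) +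
     gb G (x t) (Y (x t)) (- chr G (x t) (x' t) (x' t))) (at t within S)"
    by (rule gb_vd[OF x d(1) has_vector_derivative_chain[OF smooth_on_has_derivative[OF Y x] d(1)] d(2)])
qed (simp add: metric_compat[OF x] half_lie_def blinfun.bilinear_simps)

lemma fun_velocity_vd:
  assumes x: "x t \<in> U" and h: "smooth_on U h" and d: "(x has_vector_derivative x' t) (at t within S)"
    "(x' has_vector_derivative - chr G (x t) (x' t) (x' t)) (at t within S)"
  shows "((\<lambda>s. h (x s)) has_vector_derivative Dbl h (x t) (x' t)) (at t within S)"
    and "((\<lambda>s. Dbl h (x s) (x' s)) has_vector_derivative hessq G h (x t) (x' t)) (at t within S)"
proof -
  show "((\<lambda>s. h (x s)) has_vector_derivative Dbl h (x t) (x' t)) (at t within S)"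
    by (rule has_vector_derivative_chain[OF smooth_on_has_derivative[OF h x] d(1)])
  have "((\<lambda>s. Dbl h (x s)) has_vector_derivative Dbl (Dbl h) (x t) (x' t)) (at t within S)"
    by (rule has_vector_derivative_chain[OF smooth_on_has_derivative[OF smooth_on_Dbl[OF open_U h] x] d(1)])
  from has_vector_derivative_apply[OF this d(2)]
  show "((\<lambda>s. Dbl h (x s) (x' s)) has_vector_derivative hessq G h (x t) (x' t)) (at t within S)"
    by (rule has_vector_derivative_eq_rhs) (simp add: hessq_def blinfun.bilinear_simps)
qed

end

lemma (in lmetric) Rm_scale2: "Rm G x u (s *\<^sub>R v) (s *\<^sub>R v) = (s * s) *\<^sub>R Rm G x u v v"
  unfolding linear_scale[OF Rm_linear(2)] linear_scale[OF Rm_linear(3)] by simp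

lemma half_lie_scale: "half_lie G Y x (s *\<^sub>R w) = s * s * half_lie G Y x w"
  by (simp add: half_lie_def blinfun.bilinear_simps distrib_left)

lemma hessq_scale: "hessq G h x (s *\<^sub>R w) = s * s * hessq G h x w"
  by (simp add: hessq_def blinfun.bilinear_simps right_diff_distrib)

lemma (in lmetric) continuous_on_pair:
  assumes "continuous_on S y" "continuous_on S u" "continuous_on S v" "\<And>s. s \<in> S \<Longrightarrow> y s \<in> U"
  shows "continuous_on S (\<lambda>s. gb G (y s) (u s) (v s))"
    "continuous_on S (\<lambda>s. gb G (y s) (Rm G (y s) (u s) (v s) (v s)) (u s))"
    "smooth_on U Y \<Longrightarrow> continuous_on S (\<lambda>s. gb G (y s) (Y (y s)) (v s))"
    "smooth_on U Y \<Longrightarrow> continuous_on S (\<lambda>s. half_lie G Y (y s) (v s))"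
    "smooth_on U h \<Longrightarrow> continuous_on S (\<lambda>s. Dbl h (y s) (v s))"
    "smooth_on U h \<Longrightarrow> continuous_on S (\<lambda>s. hessq G h (y s) (v s))"
proof -
  have sub: "y ` S \<subseteq> U" using assms(4) by blast
  have c: "continuous_on S (\<lambda>s. gb G (y s))" "continuous_on S (\<lambda>s. chr G (y s))" "continuous_on S (\<lambda>s. Dbl (chr G) (y s))"
    by (rule continuous_on_compose2[OF continuous_on_Rm(3) assms(1) sub] continuous_on_compose2[OF continuous_on_Rm(2) assms(1) sub]
        continuous_on_compose2[OF continuous_on_Rm(1) assms(1) sub])+
  have s: "continuous_on S (\<lambda>s. q (y s))" if "smooth_on U q" for q :: "real^'n \<Rightarrow> 'z::real_normed_vector"
    by (rule continuous_on_compose2[OF smooth_on_continuous[OF that] assms(1) sub])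
  show "continuous_on S (\<lambda>s. gb G (y s) (u s) (v s))" by (intro continuous_intros c assms)
  show "continuous_on S (\<lambda>s. gb G (y s) (Rm G (y s) (u s) (v s) (v s)) (u s))"
    unfolding Rm_def by (intro continuous_intros c assms)
  show "continuous_on S (\<lambda>s. gb G (y s) (Y (y s)) (v s))" if "smooth_on U Y"
    by (intro continuous_intros c assms s that)
  show "continuous_on S (\<lambda>s. half_lie G Y (y s) (v s))" if "smooth_on U Y"
    unfolding half_lie_def by (intro continuous_intros c assms s that smooth_on_Dbl open_U)
  show "continuous_on S (\<lambda>s. Dbl h (y s) (v s))" if "smooth_on U h"
    by (intro continuous_intros c assms s that smooth_on_Dbl open_U)
  show "continuous_on S (\<lambda>s. hessq G h (y s) (v s))" if "smooth_on U h"
    unfolding hessq_def by (intro continuous_intros c assms s that smooth_on_Dbl open_U)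
qed

context riemannian
begin

lemma orthonormal_vec_at:
  assumes c: "c \<in> A" "x \<in> img_c c" and L: "L > 0"
    and uv: "gb (mc c) x u u = 1" "gb (mc c) x v v = L" "gb (mc c) x u v = 0"
  defines "p \<equiv> inv_c c x" and "w \<equiv> (1 / sqrt L) *\<^sub>R v"
  shows "p \<in> topspace T" "p \<in> dom_c c" "map_c c p = x"
    "orthonormal_pair A g p (vec_at A c p u) (vec_at A c p w)"
    "vec_at A c p u c = u" "vec_at A c p w c = w" "v = sqrt L *\<^sub>R w"
    "sec A g c p (vec_at A c p u) (vec_at A c p w) = gb (mc c) x (Rm (mc c) x u w w) u"
proof -
  interpret M: lmetric "img_c c" "mc c" by (rule lmetric_chart[OF c(1)])
  show p: "p \<in> dom_c c" unfolding p_def by (rule inv_in[OF c(2)])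
  then show "p \<in> topspace T" by (rule dom_sub[OF c(1)])
  show px: "map_c c p = x" unfolding p_def by (rule map_inv[OF c(2)])
  show u: "vec_at A c p u c = u" and w: "vec_at A c p w c = w" by (rule vec_at_self[OF c(1) p])+
  note ip = gb_mc[OF c(1) p, unfolded px, symmetric]
  have ww: "gb (mc c) x w w = 1" "gb (mc c) x u w = 0"
    unfolding w_def using uv L by (simp_all add: blinfun.bilinear_simps power2_eq_square[symmetric] power_divide)
  show "orthonormal_pair A g p (vec_at A c p u) (vec_at A c p w)"
    unfolding orthonormal_pair_def by (intro conjI vec_at_tangent c(1) p) (simp_all only: ip uv ww)
  show "v = sqrt L *\<^sub>R w" using L by (simp add: w_def)
  show "sec A g c p (vec_at A c p u) (vec_at A c p w) = gb (mc c) x (Rm (mc c) x u w w) u"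
    unfolding sec_def Let_def u w px M.sec_sum[OF c(2)] ip by (simp add: uv ww)
qed

text \<open>The curvature hypothesis is applied to \<open>u\<close> as \<open>U\<close> and the
  normalised \<open>v\<close> as \<open>V\<close>. Both terms are quadratic in \<open>V\<close>, so
  multiplying by \<open>L\<close> removes the normalisation; the velocity of a geodesic can then be
  inserted as it is.\<close>

lemma sec_X_coord:
  assumes pos: "sec_X_positive T A g X" and X: "smooth_vector_field T A X"
    and c: "c \<in> A" "x \<in> img_c c" and L: "L > 0"
    and uv: "gb (mc c) x u u = 1" "gb (mc c) x v v = L" "gb (mc c) x u v = 0"
  shows "0 < gb (mc c) x (Rm (mc c) x u v v) u + half_lie (mc c) (vf_coord X c) x v"
proof -
  interpret M: lmetric "img_c c" "mc c" by (rule lmetric_chart[OF c(1)])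
  define p where "p = inv_c c x"
  define w where "w = (1 / sqrt L) *\<^sub>R v"
  note o = orthonormal_vec_at[OF c L uv, folded p_def, folded w_def]
  have Y: "smooth_on (img_c c) (vf_coord X c)" using X c(1) unfolding smooth_vector_field_def by blast
  have "0 < sec_X A g X c p (vec_at A c p w) (vec_at A c p u)"
    using pos[unfolded sec_X_positive_def, rule_format, OF o(1) c(1) o(2,4)] .
  also have "\<dots> = gb (mc c) x (Rm (mc c) x u w w) u + half_lie (mc c) (vf_coord X c) x w"
    unfolding sec_X_def o(8) lie_metric_def Let_def o(3,6) M.lie_sum[OF c(2) Y] by simp
  finally have "0 < L * (gb (mc c) x (Rm (mc c) x u w w) u + half_lie (mc c) (vf_coord X c) x w)" using L by simp
  also have "\<dots> = gb (mc c) x (Rm (mc c) x u v v) u + half_lie (mc c) (vf_coord X c) x v"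
    unfolding o(7) M.Rm_scale2 half_lie_scale using L
    by (simp add: blinfun.scaleR_left blinfun.scaleR_right distrib_left)
  finally show ?thesis .
qed

lemma sec_bar_coord:
  assumes pos: "sec_bar_positive T A g f" and f: "smooth_fun A f"
    and c: "c \<in> A" "x \<in> img_c c" and L: "L > 0"
    and uv: "gb (mc c) x u u = 1" "gb (mc c) x v v = L" "gb (mc c) x u v = 0"
  shows "0 < gb (mc c) x (Rm (mc c) x u v v) u + (hessq (mc c) (f \<circ> inv_c c) x v + (Dbl (f \<circ> inv_c c) x v)\<^sup>2)"
proof -
  interpret M: lmetric "img_c c" "mc c" by (rule lmetric_chart[OF c(1)])
  define p where "p = inv_c c x"
  define w where "w = (1 / sqrt L) *\<^sub>R v"
  note o = orthonormal_vec_at[OF c L uv, folded p_def, folded w_def]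
  have h: "smooth_on (img_c c) (f \<circ> inv_c c)" using f c(1) unfolding smooth_fun_def by blast
  have "0 < sec_bar A g f c p (vec_at A c p w) (vec_at A c p u)"
    using pos[unfolded sec_bar_positive_def, rule_format, OF o(1) c(1) o(2,4)] .
  also have "\<dots> = gb (mc c) x (Rm (mc c) x u w w) u + (hessq (mc c) (f \<circ> inv_c c) x w + (Dbl (f \<circ> inv_c c) x w)\<^sup>2)"
    unfolding sec_bar_def o(8) hess_def Let_def o(3,6) M.hess_sum[OF c(2) h] dfun_def smooth_on_frechet_eq[OF h c(2)] by simp
  finally have "0 < L * (gb (mc c) x (Rm (mc c) x u w w) u + (hessq (mc c) (f \<circ> inv_c c) x w + (Dbl (f \<circ> inv_c c) x w)\<^sup>2))" using L by simp
  also have "\<dots> = gb (mc c) x (Rm (mc c) x u v v) u + (hessq (mc c) (f \<circ> inv_c c) x v + (Dbl (f \<circ> inv_c c) x v)\<^sup>2)"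
    unfolding o(7) M.Rm_scale2 hessq_scale using L
    by (simp add: blinfun.scaleR_left blinfun.scaleR_right distrib_left power_mult_distrib)
  finally show ?thesis .
qed

end

section \<open>Uniform constants from compactness\<close>

context covered
begin

text \<open>The lower bound \<open>lo j\<close> confines vectors of fixed squared length
  \<open>L\<close> to a compact ball, on which the continuous expression is bounded; finitely many
  balls cover the manifold.\<close>

lemma uniform_bound:
  assumes c: "\<And>j. j \<in> J \<Longrightarrow> continuous_on (cball (ce j) (ra j) \<times> UNIV) (\<lambda>(y, v). E (ch j) y v :: real)"
  shows "\<exists>B\<ge>0. \<forall>j\<in>J. \<forall>y\<in>cball (ce j) (ra j). \<forall>v. gb (mcb j) y v v = L \<longrightarrow> \<bar>E (ch j) y v\<bar> \<le> B"
proof -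
  have "\<exists>B. \<forall>y\<in>cball (ce j) (ra j). \<forall>v. gb (mcb j) y v v = L \<longrightarrow> \<bar>E (ch j) y v\<bar> \<le> B" if j: "j \<in> J" for j
  proof -
    note gj = goodJ[OF j]
    have "compact (cball (ce j) (ra j) \<times> cball (0::real^'n) (sqrt (L / lo j)))" by (intro compact_Times compact_cball)
    from compact_continuous_image[OF continuous_on_subset[OF c[OF j]] this]
    have "bounded ((\<lambda>(y, v). E (ch j) y v) ` (cball (ce j) (ra j) \<times> cball 0 (sqrt (L / lo j))))"
      by (intro compact_imp_bounded) auto
    then obtain B where B: "\<And>z. z \<in> (\<lambda>(y, v). E (ch j) y v) ` (cball (ce j) (ra j) \<times> cball 0 (sqrt (L / lo j))) \<Longrightarrow> norm z \<le> B"
      unfolding bounded_iff by blast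
    show ?thesis
    proof (intro exI[of _ B] ballI allI impI)
      fix y v assume y: "y \<in> cball (ce j) (ra j)" and v: "gb (mcb j) y v v = L"
      have "y \<in> cball (ce j) (6 * ra j)" using y goodD(2)[OF gj] by simp
      from goodD(5)[OF gj this, of v] have "(norm v)\<^sup>2 \<le> L / lo j"
        using goodD(3)[OF gj] by (simp add: v field_simps)
      then have "v \<in> cball 0 (sqrt (L / lo j))" by (simp add: real_le_rsqrt)
      then have "norm (E (ch j) y v) \<le> B" by (intro B image_eqI[of _ _ "(y, v)"] SigmaI y) simp_all
      then show "\<bar>E (ch j) y v\<bar> \<le> B" by simp
    qed
  qed
  then have "\<forall>j\<in>J. \<exists>B. \<forall>y\<in>cball (ce j) (ra j). \<forall>v. gb (mcb j) y v v = L \<longrightarrow> \<bar>E (ch j) y v\<bar> \<le> B" by (rule ballI)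
  from bchoice[OF this] obtain B where B: "\<forall>j\<in>J. \<forall>y\<in>cball (ce j) (ra j). \<forall>v. gb (mcb j) y v v = L \<longrightarrow> \<bar>E (ch j) y v\<bar> \<le> B j"
    by (elim exE)
  show ?thesis
  proof (intro exI[of _ "Max (insert 0 (B ` J))"] conjI ballI allI impI)
    show "0 \<le> Max (insert 0 (B ` J))" using finJ by simp
    fix j y v assume h: "j \<in> J" "y \<in> cball (ce j) (ra j)" "gb (mcb j) y v v = L"
    have "B j \<le> Max (insert 0 (B ` J))" using finJ h(1) by simp
    then show "\<bar>E (ch j) y v\<bar> \<le> Max (insert 0 (B ` J))" using B[rule_format, OF h] by linarith
  qed
qed

text \<open>Strict positivity at each point becomes a positive lower bound, because the triples of a
  point, a unit normal and a vector of squared length \<open>L\<close> form a compact set in each of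
  finitely many balls.\<close>

lemma uniform_positive:
  assumes c: "\<And>j. j \<in> J \<Longrightarrow> continuous_on (cball (ce j) (ra j) \<times> UNIV) (\<lambda>(y, v). E (ch j) y v :: real)"
    and pos: "\<And>j y u v. j \<in> J \<Longrightarrow> y \<in> cball (ce j) (ra j) \<Longrightarrow> gb (mcb j) y u u = 1 \<Longrightarrow> gb (mcb j) y v v = L \<Longrightarrow> gb (mcb j) y u v = 0 \<Longrightarrow>
      0 < gb (mcb j) y (Rm (mcb j) y u v v) u + E (ch j) y v"
  shows "\<exists>\<delta>>0. \<forall>j\<in>J. \<forall>y\<in>cball (ce j) (ra j). \<forall>u v. gb (mcb j) y u u = 1 \<longrightarrow> gb (mcb j) y v v = L \<longrightarrow> gb (mcb j) y u v = 0 \<longrightarrow>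
      \<delta> \<le> gb (mcb j) y (Rm (mcb j) y u v v) u + E (ch j) y v"
proof -
  have "\<exists>\<delta>>0. \<forall>y\<in>cball (ce j) (ra j). \<forall>u v. gb (mcb j) y u u = 1 \<longrightarrow> gb (mcb j) y v v = L \<longrightarrow> gb (mcb j) y u v = 0 \<longrightarrow>
      \<delta> \<le> gb (mcb j) y (Rm (mcb j) y u v v) u + E (ch j) y v" if j: "j \<in> J" for j
  proof -
    note gj = goodJ[OF j]
    interpret M: lmetric "img_c (ch j)" "mcb j" by (rule lmetric_chart[OF goodD(1)[OF gj]])
    let ?b = "cball (ce j) (ra j)" and ?r = "sqrt (1 / lo j)" and ?R = "sqrt (L / lo j)"
    let ?C = "?b \<times> cball (0::real^'n) ?r \<times> cball (0::real^'n) ?R"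
    let ?y = "\<lambda>z. fst z :: real^'n" and ?u = "\<lambda>z. fst (snd z) :: real^'n" and ?v = "\<lambda>z. snd (snd z) :: real^'n"
    let ?\<Phi> = "\<lambda>z. gb (mcb j) (?y z) (Rm (mcb j) (?y z) (?u z) (?v z) (?v z)) (?u z) + E (ch j) (?y z) (?v z)"
    \<comment> \<open>The orthogonality conditions are closed, and the norm bounds in
      \<open>?C\<close> follow from them, so all admissible triples over the ball lie in this
      compact set.\<close>
    define S where "S = ?C \<inter> (\<lambda>z. (gb (mcb j) (?y z) (?u z) (?u z), gb (mcb j) (?y z) (?v z) (?v z), gb (mcb j) (?y z) (?u z) (?v z))) -` {(1, L, 0)}"
    have sub: "?b \<subseteq> img_c (ch j)" using goodD(2,4)[OF gj] by (auto simp: subset_iff)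
    have yU: "?y z \<in> img_c (ch j)" if "z \<in> ?C" for z using that sub by auto
    have cc: "continuous_on ?C ?y" "continuous_on ?C ?u" "continuous_on ?C ?v" by (intro continuous_intros)+
    have C: "compact ?C" by (intro compact_Times compact_cball)
    have "closed S" unfolding S_def
    proof (rule continuous_closed_preimage)
      show "continuous_on ?C (\<lambda>z. (gb (mcb j) (?y z) (?u z) (?u z), gb (mcb j) (?y z) (?v z) (?v z), gb (mcb j) (?y z) (?u z) (?v z)))"
        by (rule continuous_on_Pair[OF M.continuous_on_pair(1)[OF cc(1,2,2) yU]
          continuous_on_Pair[OF M.continuous_on_pair(1)[OF cc(1,3,3) yU] M.continuous_on_pair(1)[OF cc(1,2,3) yU]]])
    qed (rule compact_imp_closed[OF C], rule closed_singleton)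
    then have "compact (?C \<inter> S)" by (rule compact_Int_closed[OF C])
    moreover have SC: "?C \<inter> S = S" unfolding S_def by blast
    ultimately have cS: "compact S" by simp
    have cE: "continuous_on ?C (\<lambda>z. E (ch j) (?y z) (?v z))"
    proof -
      have "continuous_on ?C (\<lambda>z. (\<lambda>(y, v). E (ch j) y v) (?y z, ?v z))"
        by (rule continuous_on_compose2[OF c[OF j]]) (auto intro!: continuous_intros)
      then show ?thesis by simp
    qed
    have c\<Phi>: "continuous_on S ?\<Phi>"
    proof (rule continuous_on_subset)
      show "continuous_on ?C ?\<Phi>" by (rule continuous_on_add[OF M.continuous_on_pair(2)[OF cc yU] cE])
      show "S \<subseteq> ?C" unfolding S_def by blast
    qed
    have norms: "norm u \<le> sqrt (a / lo j)" if y: "y \<in> ?b" and "gb (mcb j) y u u = a" for y u a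
    proof -
      have "y \<in> cball (ce j) (6 * ra j)" using y goodD(2)[OF gj] by simp
      from goodD(5)[OF gj this, of u] have "(norm u)\<^sup>2 \<le> a / lo j"
        using goodD(3)[OF gj] by (simp add: that field_simps)
      then show ?thesis by (simp add: real_le_rsqrt)
    qed
    have inS: "(y, u, v) \<in> S" if "y \<in> ?b" "gb (mcb j) y u u = 1" "gb (mcb j) y v v = L" "gb (mcb j) y u v = 0" for y u v
      unfolding S_def using that norms[OF that(1,2)] norms[OF that(1,3)] by simp
    have posS: "0 < ?\<Phi> z" if "z \<in> S" for z
      using that unfolding S_def by (intro pos[OF j]) auto
    show ?thesis
    \<comment> \<open>In dimension one a nonzero vector has no unit normal; then there is nothing to
      bound and any positive constant serves.\<close>
    proof (cases "S = {}")
      case True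
      have "1 \<le> gb (mcb j) y (Rm (mcb j) y u v v) u + E (ch j) y v"
        if "y \<in> ?b" "gb (mcb j) y u u = 1" "gb (mcb j) y v v = L" "gb (mcb j) y u v = 0" for y u v
        using inS[OF that] unfolding True by (rule emptyE)
      then show ?thesis by (intro exI[of _ 1] conjI zero_less_one ballI allI impI)
    next
      case False
      obtain z where z: "z \<in> S" "\<And>z'. z' \<in> S \<Longrightarrow> ?\<Phi> z \<le> ?\<Phi> z'" using continuous_attains_inf[OF cS False c\<Phi>] by blast
      show ?thesis
      proof (intro exI[of _ "?\<Phi> z"] conjI posS[OF z(1)] ballI allI impI)
        fix y u v assume "y \<in> ?b" "gb (mcb j) y u u = 1" "gb (mcb j) y v v = L" "gb (mcb j) y u v = 0"
        from z(2)[OF inS[OF this]] show "?\<Phi> z \<le> gb (mcb j) y (Rm (mcb j) y u v v) u + E (ch j) y v" by simp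
      qed
    qed
  qed
  then have "\<forall>j\<in>J. \<exists>\<delta>>0. \<forall>y\<in>cball (ce j) (ra j). \<forall>u v. gb (mcb j) y u u = 1 \<longrightarrow> gb (mcb j) y v v = L \<longrightarrow> gb (mcb j) y u v = 0 \<longrightarrow>
      \<delta> \<le> gb (mcb j) y (Rm (mcb j) y u v v) u + E (ch j) y v" by (rule ballI)
  from bchoice[OF this] obtain \<delta> where \<delta>: "\<forall>j\<in>J. \<delta> j > 0 \<and> (\<forall>y\<in>cball (ce j) (ra j). \<forall>u v. gb (mcb j) y u u = 1 \<longrightarrow> gb (mcb j) y v v = L \<longrightarrow> gb (mcb j) y u v = 0 \<longrightarrow>
      \<delta> j \<le> gb (mcb j) y (Rm (mcb j) y u v v) u + E (ch j) y v)" by (elim exE)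
  show ?thesis
  proof (intro exI[of _ "Min (insert 1 (\<delta> ` J))"] conjI ballI allI impI)
    have "\<delta> j > 0" if "j \<in> J" for j using bspec[OF \<delta> that] by (rule conjunct1)
    then have "z > 0" if "z \<in> insert 1 (\<delta> ` J)" for z using that by (elim insertE imageE) simp_all
    then have "\<forall>z\<in>insert 1 (\<delta> ` J). 0 < z" by (rule ballI)
    then show "0 < Min (insert 1 (\<delta> ` J))" using finJ by (subst Min_gr_iff) simp_all
    fix j y u v assume h: "j \<in> J" "y \<in> cball (ce j) (ra j)" "gb (mcb j) y u u = 1" "gb (mcb j) y v v = L" "gb (mcb j) y u v = 0"
    have "Min (insert 1 (\<delta> ` J)) \<le> \<delta> j" using finJ h(1) by simp
    then show "Min (insert 1 (\<delta> ` J)) \<le> gb (mcb j) y (Rm (mcb j) y u v v) u + E (ch j) y v"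
      using bspec[OF \<delta> h(1), THEN conjunct2, rule_format, OF h(2-5)] by linarith
  qed
qed

end

context riemannian
begin

text \<open>\<open>dfun\<close> depends on a chart, but consecutive segments use different ones.
  Fixing some chart for each point gives a function of point and tangent vector, to which equality
  of velocities at joints applies directly.\<close>

definition differential :: "('a \<Rightarrow> real) \<Rightarrow> 'a \<Rightarrow> ('a, 'n) tvec \<Rightarrow> real"
  where "differential f p w = dfun (SOME c. c \<in> A \<and> p \<in> dom_c c) f p w"

lemma vf_along_geo:
  assumes X: "smooth_vector_field T A X" and g: "geo K L \<gamma>" and t: "t \<in> {0..1}" and c: "c \<in> A" "\<gamma> t \<in> dom_c c"
  shows "g (\<gamma> t) (X (\<gamma> t)) (velocity \<gamma> t) = gb (mc c) (map_c c (\<gamma> t)) (vf_coord X c (map_c c (\<gamma> t))) (vel c \<gamma> t)"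
    and "((\<lambda>s. g (\<gamma> s) (X (\<gamma> s)) (velocity \<gamma> s)) has_vector_derivative half_lie (mc c) (vf_coord X c) (map_c c (\<gamma> t)) (vel c \<gamma> t)) (at t within {0..1})"
proof -
  interpret M: lmetric "img_c c" "mc c" by (rule lmetric_chart[OF c(1)])
  have Y: "smooth_on (img_c c) (vf_coord X c)" using X c(1) unfolding smooth_vector_field_def by blast
  have Xt: "X p \<in> tangent_space A p" if "p \<in> topspace T" for p using X that unfolding smooth_vector_field_def by blast
  have eq: "g (\<gamma> s) (X (\<gamma> s)) (velocity \<gamma> s) = gb (mc c) (map_c c (\<gamma> s)) (vf_coord X c (map_c c (\<gamma> s))) (vel c \<gamma> s)"
    if s: "s \<in> {0..1}" "\<gamma> s \<in> dom_c c" for s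
    unfolding g_coord[OF c(1) s(2) Xt[OF geo_top[OF g s(1)]] velocity_tangent[OF g s(1)]]
    by (simp only: vf_coord_def inv_map[OF c(1) s(2)] velocity_self[where \<gamma> = \<gamma> and t = s, OF c(1) s(2)])
  show "g (\<gamma> t) (X (\<gamma> t)) (velocity \<gamma> t) = gb (mc c) (map_c c (\<gamma> t)) (vf_coord X c (map_c c (\<gamma> t))) (vel c \<gamma> t)"
    by (rule eq[OF t c(2)])
  obtain e where e: "e > 0" "\<And>s. s \<in> {0..1} \<Longrightarrow> dist s t < e \<Longrightarrow> \<gamma> s \<in> dom_c c"
    using curve_nhd[OF geo_continuous[OF g] open_dom[OF c(1)] t c(2)] by blast
  have im: "map_c c (\<gamma> t) \<in> img_c c" using c(2) by (rule imageI)
  note G = geo_atD[OF geoD[OF g t c]]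
  have "((\<lambda>s. gb (mc c) (map_c c (\<gamma> s)) (vf_coord X c (map_c c (\<gamma> s))) (vel c \<gamma> s)) has_vector_derivative
      half_lie (mc c) (vf_coord X c) (map_c c (\<gamma> t)) (vel c \<gamma> t)) (at t within {0..1})"
    by (rule M.vf_velocity_vd[OF im Y G(1,2)])
  then show "((\<lambda>s. g (\<gamma> s) (X (\<gamma> s)) (velocity \<gamma> s)) has_vector_derivative half_lie (mc c) (vf_coord X c) (map_c c (\<gamma> t)) (vel c \<gamma> t)) (at t within {0..1})"
    by (rule has_vector_derivative_transform_within[OF _ e(1) t]) (simp only: eq[OF _ e(2)])
qed

lemma fun_along_geo:
  assumes f: "smooth_fun A f" and g: "geo K L \<gamma>" and t: "t \<in> {0..1}" and c: "c \<in> A" "\<gamma> t \<in> dom_c c"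
  defines "h \<equiv> f \<circ> inv_c c"
  shows "differential f (\<gamma> t) (velocity \<gamma> t) = Dbl h (map_c c (\<gamma> t)) (vel c \<gamma> t)"
    and "((\<lambda>s. f (\<gamma> s)) has_vector_derivative differential f (\<gamma> t) (velocity \<gamma> t)) (at t within {0..1})"
    and "((\<lambda>s. differential f (\<gamma> s) (velocity \<gamma> s)) has_vector_derivative hessq (mc c) h (map_c c (\<gamma> t)) (vel c \<gamma> t)) (at t within {0..1})"
proof -
  have h: "smooth_on (img_c d) (f \<circ> inv_c d)" if "d \<in> A" for d using f that unfolding smooth_fun_def by blast
  have vd: "((\<lambda>s. f (\<gamma> s)) has_vector_derivative Dbl (f \<circ> inv_c d) (map_c d (\<gamma> s)) (vel d \<gamma> s)) (at s within {0..1})"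
    if s: "s \<in> {0..1}" and d: "d \<in> A" "\<gamma> s \<in> dom_c d" for s d
  proof -
    interpret M: lmetric "img_c d" "mc d" by (rule lmetric_chart[OF d(1)])
    obtain e where e: "e > 0" "\<And>r. r \<in> {0..1} \<Longrightarrow> dist r s < e \<Longrightarrow> \<gamma> r \<in> dom_c d"
      using curve_nhd[OF geo_continuous[OF g] open_dom[OF d(1)] s d(2)] by blast
    note G = geo_atD[OF geoD[OF g s d]]
    have "((\<lambda>s. (f \<circ> inv_c d) (map_c d (\<gamma> s))) has_vector_derivative Dbl (f \<circ> inv_c d) (map_c d (\<gamma> s)) (vel d \<gamma> s)) (at s within {0..1})"
      by (rule M.fun_velocity_vd(1)[OF imageI[OF d(2)] h[OF d(1)] G(1,2)])
    then show ?thesis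
      by (rule has_vector_derivative_transform_within[OF _ e(1) s]) (simp only: o_apply inv_map[OF d(1) e(2)])
  qed
  \<comment> \<open>Independence of the chosen chart needs no comparison of charts: in each of them
    the expression is the derivative of the same function of time, and that derivative is
    unique.\<close>
  have df: "differential f (\<gamma> s) (velocity \<gamma> s) = Dbl (f \<circ> inv_c d) (map_c d (\<gamma> s)) (vel d \<gamma> s)"
    if s: "s \<in> {0..1}" and d: "d \<in> A" "\<gamma> s \<in> dom_c d" for s d
  proof -
    define b where "b = (SOME c. c \<in> A \<and> \<gamma> s \<in> dom_c c)"
    have b: "b \<in> A \<and> \<gamma> s \<in> dom_c b" unfolding b_def by (rule someI_ex[OF ex_chart[OF geo_top[OF g s]]])
    note b1 = conjunct1[OF b] and b2 = conjunct2[OF b]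
    have "differential f (\<gamma> s) (velocity \<gamma> s) = Dbl (f \<circ> inv_c b) (map_c b (\<gamma> s)) (vel b \<gamma> s)"
      unfolding differential_def b_def[symmetric] dfun_def smooth_on_frechet_eq[OF h[OF b1] imageI[OF b2]] velocity_self[where \<gamma> = \<gamma> and t = s, OF b1 b2] ..
    also have "\<dots> = Dbl (f \<circ> inv_c d) (map_c d (\<gamma> s)) (vel d \<gamma> s)"
      by (rule vector_derivative_unique_within[OF _ vd[OF s b1 b2] vd[OF s d]])
         (use s in \<open>simp add: trivial_limit_within islimpt_Icc\<close>)
    finally show ?thesis .
  qed
  interpret M: lmetric "img_c c" "mc c" by (rule lmetric_chart[OF c(1)])
  show 1: "differential f (\<gamma> t) (velocity \<gamma> t) = Dbl h (map_c c (\<gamma> t)) (vel c \<gamma> t)" unfolding h_def by (rule df[OF t c])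
  show "((\<lambda>s. f (\<gamma> s)) has_vector_derivative differential f (\<gamma> t) (velocity \<gamma> t)) (at t within {0..1})"
    unfolding 1 h_def by (rule vd[OF t c])
  obtain e where e: "e > 0" "\<And>s. s \<in> {0..1} \<Longrightarrow> dist s t < e \<Longrightarrow> \<gamma> s \<in> dom_c c"
    using curve_nhd[OF geo_continuous[OF g] open_dom[OF c(1)] t c(2)] by blast
  note G = geo_atD[OF geoD[OF g t c]]
  have "((\<lambda>s. Dbl h (map_c c (\<gamma> s)) (vel c \<gamma> s)) has_vector_derivative hessq (mc c) h (map_c c (\<gamma> t)) (vel c \<gamma> t)) (at t within {0..1})"
    unfolding h_def by (rule M.fun_velocity_vd(2)[OF imageI[OF c(2)] h[OF c(1)] G(1,2)])
  then show "((\<lambda>s. differential f (\<gamma> s) (velocity \<gamma> s)) has_vector_derivative hessq (mc c) h (map_c c (\<gamma> t)) (vel c \<gamma> t)) (at t within {0..1})"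
    by (rule has_vector_derivative_transform_within[OF _ e(1) t]) (simp only: h_def df[OF _ c(1) e(2)])
qed

end

section \<open>Estimates along all geodesics of one speed\<close>

context covered
begin

lemma geo_in_ball:
  assumes g: "geo K L \<gamma>" and t: "t \<in> {0..1}"
  shows "\<exists>j. j \<in> J \<and> \<gamma> t \<in> dom_c (ch j) \<and> map_c (ch j) (\<gamma> t) \<in> cball (ce j) (ra j)"
proof -
  obtain j where j: "j \<in> J" "\<gamma> t \<in> half j" using coverJ[OF geo_top[OF g t]] by (elim bexE)
  show ?thesis using cinner_map[OF half_cinner[OF j]] j(1) by (intro exI conjI)
qed

lemma ball_img: "j \<in> J \<Longrightarrow> y \<in> cball (ce j) (ra j) \<Longrightarrow> y \<in> img_c (ch j)"
  using subsetD[OF goodD(4)[OF goodJ], of j y] goodD(2)[OF goodJ, of j] by (simp add: mem_cball)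

lemma continuous_on_ball:
  assumes j: "j \<in> J"
  shows "smooth_on (img_c (ch j)) Y \<Longrightarrow> continuous_on (cball (ce j) (ra j) \<times> UNIV) (\<lambda>(y, v). gb (mcb j) y (Y y) v)"
    "smooth_on (img_c (ch j)) Y \<Longrightarrow> continuous_on (cball (ce j) (ra j) \<times> UNIV) (\<lambda>(y, v). half_lie (mcb j) Y y v)"
    "smooth_on (img_c (ch j)) h \<Longrightarrow> continuous_on (cball (ce j) (ra j) \<times> UNIV) (\<lambda>(y, v). Dbl h y v)"
    "smooth_on (img_c (ch j)) h \<Longrightarrow> continuous_on (cball (ce j) (ra j) \<times> UNIV) (\<lambda>(y, v). hessq (mcb j) h y v)"
proof -
  interpret M: lmetric "img_c (ch j)" "mcb j" by (rule lmetric_chart[OF goodD(1)[OF goodJ[OF j]]])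
  let ?S = "cball (ce j) (ra j) \<times> (UNIV :: (real^'n) set)"
  have c: "continuous_on ?S fst" "continuous_on ?S snd" by (intro continuous_intros)+
  have i: "fst z \<in> img_c (ch j)" if "z \<in> ?S" for z using that by (intro ball_img[OF j]) (simp only: mem_Times_iff)
  show "continuous_on ?S (\<lambda>(y, v). gb (mcb j) y (Y y) v)" "continuous_on ?S (\<lambda>(y, v). half_lie (mcb j) Y y v)"
    if "smooth_on (img_c (ch j)) Y"
    unfolding split_beta by (rule M.continuous_on_pair(3,4)[OF c(1,2,2) _ that], rule i, assumption)+
  show "continuous_on ?S (\<lambda>(y, v). Dbl h y v)" "continuous_on ?S (\<lambda>(y, v). hessq (mcb j) h y v)"
    if "smooth_on (img_c (ch j)) h"
    unfolding split_beta by (rule M.continuous_on_pair(5,6)[OF c(1,2,2) _ that], rule i, assumption)+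
qed

text \<open>The order of quantifiers is the point: \<open>\<delta>\<close> and \<open>B\<close> are
  chosen before the curve and depend on the speed only, so one pair serves all iterates of the
  loop.\<close>

lemma vf_estimates:
  assumes X: "smooth_vector_field T A X" and pos: "sec_X_positive T A g X" and L: "L > 0"
  shows "\<exists>\<delta>>0. \<exists>B. \<forall>K \<gamma>. geo K L \<gamma> \<longrightarrow> (\<forall>t\<in>{0..1}. \<bar>g (\<gamma> t) (X (\<gamma> t)) (velocity \<gamma> t)\<bar> \<le> B \<and>
    (\<exists>h'. ((\<lambda>s. g (\<gamma> s) (X (\<gamma> s)) (velocity \<gamma> s)) has_vector_derivative h') (at t within {0..1}) \<and> \<delta> - K t \<le> h'))"
proof -
  have Y: "smooth_on (img_c (ch j)) (vf_coord X (ch j))" if "j \<in> J" for j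
    using X goodD(1)[OF goodJ[OF that]] unfolding smooth_vector_field_def by blast
  have c1: "continuous_on (cball (ce j) (ra j) \<times> UNIV) (\<lambda>(y, v). gb (mcb j) y (vf_coord X (ch j) y) v)"
    and c2: "continuous_on (cball (ce j) (ra j) \<times> UNIV) (\<lambda>(y, v). half_lie (mcb j) (vf_coord X (ch j)) y v)" if "j \<in> J" for j
    by (rule continuous_on_ball(1)[OF that Y[OF that]], rule continuous_on_ball(2)[OF that Y[OF that]])
  have p: "0 < gb (mcb j) y (Rm (mcb j) y u v v) u + half_lie (mcb j) (vf_coord X (ch j)) y v"
    if "j \<in> J" "y \<in> cball (ce j) (ra j)" "gb (mcb j) y u u = 1" "gb (mcb j) y v v = L" "gb (mcb j) y u v = 0" for j y u v
    by (rule sec_X_coord[OF pos X goodD(1)[OF goodJ[OF that(1)]] ball_img[OF that(1,2)] L that(3-5)])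
  obtain B where B: "\<forall>j\<in>J. \<forall>y\<in>cball (ce j) (ra j). \<forall>v. gb (mcb j) y v v = L \<longrightarrow> \<bar>gb (mcb j) y (vf_coord X (ch j) y) v\<bar> \<le> B"
    by (rule exE[OF uniform_bound[where E = "\<lambda>c y v. gb (mc c) y (vf_coord X c y) v" and L = L, OF c1]])
       (assumption | blast)+
  obtain \<delta> where \<delta>: "\<delta> > 0" "\<forall>j\<in>J. \<forall>y\<in>cball (ce j) (ra j). \<forall>u v. gb (mcb j) y u u = 1 \<longrightarrow> gb (mcb j) y v v = L \<longrightarrow> gb (mcb j) y u v = 0 \<longrightarrow>
      \<delta> \<le> gb (mcb j) y (Rm (mcb j) y u v v) u + half_lie (mcb j) (vf_coord X (ch j)) y v"
    by (rule exE[OF uniform_positive[where E = "\<lambda>c y v. half_lie (mc c) (vf_coord X c) y v" and L = L,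
        OF c2 p]])
       (assumption | blast)+
  show ?thesis
  proof (rule exI[of _ \<delta>], rule conjI[OF \<delta>(1)], rule exI[of _ B], intro conjI allI impI ballI)
    fix K \<gamma> and t :: real assume g: "geo K L \<gamma>" and t: "t \<in> {0..1}"
    obtain j where j: "j \<in> J" "\<gamma> t \<in> dom_c (ch j)" "map_c (ch j) (\<gamma> t) \<in> cball (ce j) (ra j)"
      using geo_in_ball[OF g t] by (elim exE conjE)
    note c = goodD(1)[OF goodJ[OF j(1)]]
    note G = geo_atD[OF geoD[OF g t c j(2)]]
    note V = vf_along_geo[OF X g t c j(2)]
    show "\<bar>g (\<gamma> t) (X (\<gamma> t)) (velocity \<gamma> t)\<bar> \<le> B"
      unfolding V(1) by (rule B[rule_format, OF j(1,3) G(3)])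
    obtain u where u: "gb (mcb j) (map_c (ch j) (\<gamma> t)) u u = 1" "gb (mcb j) (map_c (ch j) (\<gamma> t)) u (vel (ch j) \<gamma> t) = 0"
      "gb (mcb j) (map_c (ch j) (\<gamma> t)) (Rm (mcb j) (map_c (ch j) (\<gamma> t)) u (vel (ch j) \<gamma> t) (vel (ch j) \<gamma> t)) u = K t"
      using G(4) by (elim exE conjE)
    have "\<delta> \<le> K t + half_lie (mcb j) (vf_coord X (ch j)) (map_c (ch j) (\<gamma> t)) (vel (ch j) \<gamma> t)"
      using \<delta>(2)[rule_format, OF j(1,3) u(1) G(3) u(2)] unfolding u(3) .
    then show "\<exists>h'. ((\<lambda>s. g (\<gamma> s) (X (\<gamma> s)) (velocity \<gamma> s)) has_vector_derivative h') (at t within {0..1}) \<and> \<delta> - K t \<le> h'"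
      using V(2) by (intro exI conjI) (assumption, linarith)
  qed
qed

lemma fun_estimates:
  assumes f: "smooth_fun A f" and pos: "sec_bar_positive T A g f" and L: "L > 0"
  shows "\<exists>\<delta>>0. \<exists>B\<ge>0. \<forall>K \<gamma>. geo K L \<gamma> \<longrightarrow> (\<forall>t\<in>{0..1}. \<bar>f (\<gamma> t)\<bar> \<le> B \<and> \<bar>differential f (\<gamma> t) (velocity \<gamma> t)\<bar> \<le> B \<and>
    (\<exists>h2. ((\<lambda>s. differential f (\<gamma> s) (velocity \<gamma> s)) has_vector_derivative h2) (at t within {0..1}) \<and>
      \<delta> \<le> K t + (h2 + (differential f (\<gamma> t) (velocity \<gamma> t))\<^sup>2)))"
proof -
  have h: "smooth_on (img_c (ch j)) (f \<circ> inv_c (ch j))" if "j \<in> J" for j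
    using f goodD(1)[OF goodJ[OF that]] unfolding smooth_fun_def by blast
  have ch: "continuous_on (cball (ce j) (ra j) \<times> UNIV) (\<lambda>(y, v::real^'n). (f \<circ> inv_c (ch j)) y)" if j: "j \<in> J" for j
    unfolding split_beta
  proof (rule continuous_on_compose2[OF smooth_on_continuous[OF h[OF j]] continuous_on_fst[OF continuous_on_id]])
    show "fst ` (cball (ce j) (ra j) \<times> (UNIV :: (real^'n) set)) \<subseteq> img_c (ch j)"
      using ball_img[OF j] by (intro image_subsetI) (simp only: mem_Times_iff)
  qed
  have c1: "continuous_on (cball (ce j) (ra j) \<times> UNIV) (\<lambda>(y, v). Dbl (f \<circ> inv_c (ch j)) y v)" if "j \<in> J" for j
    by (rule continuous_on_ball(3)[OF that h[OF that]])
  obtain B0 where B0: "\<forall>j\<in>J. \<forall>y\<in>cball (ce j) (ra j). \<forall>v. gb (mcb j) y v v = L \<longrightarrow> \<bar>(f \<circ> inv_c (ch j)) y\<bar> \<le> B0"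
    by (rule exE[OF uniform_bound[where E = "\<lambda>c y v. (f \<circ> inv_c c) y" and L = L, OF ch]])
       (assumption | blast)+
  obtain B1 where B1: "\<forall>j\<in>J. \<forall>y\<in>cball (ce j) (ra j). \<forall>v. gb (mcb j) y v v = L \<longrightarrow> \<bar>Dbl (f \<circ> inv_c (ch j)) y v\<bar> \<le> B1" "0 \<le> B1"
    by (rule exE[OF uniform_bound[where E = "\<lambda>c y v. Dbl (f \<circ> inv_c c) y v" and L = L, OF c1]])
       (assumption | blast)+
  have c2: "continuous_on (cball (ce j) (ra j) \<times> UNIV) (\<lambda>(y, v). hessq (mcb j) (f \<circ> inv_c (ch j)) y v + (Dbl (f \<circ> inv_c (ch j)) y v)\<^sup>2)" if j: "j \<in> J" for j
    using continuous_on_add[OF continuous_on_ball(4)[OF j h[OF j]] continuous_on_power[OF continuous_on_ball(3)[OF j h[OF j]], of 2]]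
    unfolding split_beta .
  have p: "0 < gb (mcb j) y (Rm (mcb j) y u v v) u + (hessq (mcb j) (f \<circ> inv_c (ch j)) y v + (Dbl (f \<circ> inv_c (ch j)) y v)\<^sup>2)"
    if "j \<in> J" "y \<in> cball (ce j) (ra j)" "gb (mcb j) y u u = 1" "gb (mcb j) y v v = L" "gb (mcb j) y u v = 0" for j y u v
    by (rule sec_bar_coord[OF pos f goodD(1)[OF goodJ[OF that(1)]] ball_img[OF that(1,2)] L that(3-5)])
  obtain \<delta> where \<delta>: "\<delta> > 0" "\<forall>j\<in>J. \<forall>y\<in>cball (ce j) (ra j). \<forall>u v. gb (mcb j) y u u = 1 \<longrightarrow> gb (mcb j) y v v = L \<longrightarrow> gb (mcb j) y u v = 0 \<longrightarrow>
      \<delta> \<le> gb (mcb j) y (Rm (mcb j) y u v v) u + (hessq (mcb j) (f \<circ> inv_c (ch j)) y v + (Dbl (f \<circ> inv_c (ch j)) y v)\<^sup>2)"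
    by (rule exE[OF uniform_positive[where E = "\<lambda>c y v. hessq (mc c) (f \<circ> inv_c c) y v + (Dbl (f \<circ> inv_c c) y v)\<^sup>2" and L = L,
        OF c2 p]])
       (assumption | blast)+
  show ?thesis
  proof (rule exI[of _ \<delta>], rule conjI[OF \<delta>(1)], rule exI[of _ "max B0 B1"], intro conjI allI impI ballI)
    show "0 \<le> max B0 B1" using B1(2) by simp
    fix K \<gamma> and t :: real assume g: "geo K L \<gamma>" and t: "t \<in> {0..1}"
    obtain j where j: "j \<in> J" "\<gamma> t \<in> dom_c (ch j)" "map_c (ch j) (\<gamma> t) \<in> cball (ce j) (ra j)"
      using geo_in_ball[OF g t] by (elim exE conjE)
    note c = goodD(1)[OF goodJ[OF j(1)]]
    note G = geo_atD[OF geoD[OF g t c j(2)]]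
    note V = fun_along_geo[OF f g t c j(2)]
    show "\<bar>f (\<gamma> t)\<bar> \<le> max B0 B1"
      using B0[rule_format, OF j(1,3) G(3)] by (simp add: inv_map[OF c j(2)])
    show "\<bar>differential f (\<gamma> t) (velocity \<gamma> t)\<bar> \<le> max B0 B1"
      unfolding V(1) using B1(1)[rule_format, OF j(1,3) G(3)] by simp
    obtain u where u: "gb (mcb j) (map_c (ch j) (\<gamma> t)) u u = 1" "gb (mcb j) (map_c (ch j) (\<gamma> t)) u (vel (ch j) \<gamma> t) = 0"
      "gb (mcb j) (map_c (ch j) (\<gamma> t)) (Rm (mcb j) (map_c (ch j) (\<gamma> t)) u (vel (ch j) \<gamma> t) (vel (ch j) \<gamma> t)) u = K t"
      using G(4) by (elim exE conjE)
    have "\<delta> \<le> K t + (hessq (mcb j) (f \<circ> inv_c (ch j)) (map_c (ch j) (\<gamma> t)) (vel (ch j) \<gamma> t) + (differential f (\<gamma> t) (velocity \<gamma> t))\<^sup>2)"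
      using \<delta>(2)[rule_format, OF j(1,3) u(1) G(3) u(2)] unfolding u(3) V(1) .
    then show "\<exists>h2. ((\<lambda>s. differential f (\<gamma> s) (velocity \<gamma> s)) has_vector_derivative h2) (at t within {0..1}) \<and>
      \<delta> \<le> K t + (h2 + (differential f (\<gamma> t) (velocity \<gamma> t))\<^sup>2)"
      using V(3) by (intro exI conjI) simp_all
  qed
qed

lemma fun_along_vd:
  assumes f: "smooth_fun A f" and g: "geo K L \<gamma>" and t: "t \<in> {0..1}"
  shows "((\<lambda>s. f (\<gamma> s)) has_vector_derivative differential f (\<gamma> t) (velocity \<gamma> t)) (at t within {0..1})"
proof -
  obtain c where c: "c \<in> A" "\<gamma> t \<in> dom_c c" using ex_chart[OF geo_top[OF g t]] by (elim exE conjE)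
  show ?thesis by (rule fun_along_geo(2)[OF f g t c])
qed

end

section \<open>Iterates of the loop and the contradiction\<close>

lemma (in manifold_atlas) geodesic_inv_continuous:
  assumes c: "c \<in> A" and x: "geodesic01 (img_c c) G x x'"
  shows "continuous_map (top_of_set {0..1}) T (\<lambda>t. inv_c c (x t))" "t \<in> {0..1} \<Longrightarrow> inv_c c (x t) \<in> dom_c c"
proof -
  have g: "x t \<in> img_c c" "(x has_vector_derivative x' t) (at t within {0..1})" if "t \<in> {0..1}" for t
    using x that unfolding geodesic01_def by blast+
  have "continuous_on {0..1} x" by (rule continuous_on_vd[OF g(2)])
  then have "continuous_map (top_of_set {0..1}) (top_of_set (img_c c)) x"
    using g(1) by (intro continuous_map_into_subtopology) (simp_all add: image_subset_iff Pi_iff)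
  from continuous_map_compose[OF this inv_continuous[OF c]]
  show "continuous_map (top_of_set {0..1}) T (\<lambda>t. inv_c c (x t))" by (simp add: o_def)
  show "t \<in> {0..1} \<Longrightarrow> inv_c c (x t) \<in> dom_c c" by (rule inv_in[OF g(1)])
qed

context covered
begin

lemma geo_iterate:
  assumes "geo K L \<gamma>"
  shows "geo K L (\<lambda>t. (F ^^ n) (\<gamma> t))"
proof (induction n)
  case (Suc n)
  from geo_step[OF F this] show ?case by simp
qed (simp add: assms)

lemma velocity_iterate:
  assumes g: "geo K L \<gamma>" "geo K' L' \<eta>" and st: "s \<in> {0..1}" "t \<in> {0..1}" and eq: "\<gamma> s = \<eta> t" "velocity \<gamma> s = velocity \<eta> t"
  shows "velocity (\<lambda>t. (F ^^ n) (\<gamma> t)) s = velocity (\<lambda>t. (F ^^ n) (\<eta> t)) t"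
proof (induction n)
  case (Suc n)
  have "(F ^^ n) (\<gamma> s) = (F ^^ n) (\<eta> t)" by (simp only: eq)
  from velocity_step[OF F geo_iterate[OF g(1)] geo_iterate[OF g(2)] st this Suc] show ?case by simp
qed (simp add: eq)

text \<open>\<open>\<delta> n i\<close> is the n-th image of segment \<open>i\<close>. The curvature
  function \<open>K i\<close> is the same for every \<open>n\<close>. At the last joint the gluing
  map is \<open>F\<close>, so the n-th image of the loop ends where the image with number n + 1
  begins.\<close>

lemma loop_iterates:
  fixes x x' P :: "nat \<Rightarrow> real \<Rightarrow> real^'n"
  assumes loop: "geodesic_loop m (\<lambda>i. img_c (ch (k i))) (\<lambda>i. mcb (k i)) (\<lambda>i. dom2 (Hm m i) (ch (k (Suc i mod m))) (ch (k i)))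
      (\<lambda>i. rep (Hm m i) (ch (k (Suc i mod m))) (ch (k i))) x x' C"
    and kp: "\<And>i. i < m \<Longrightarrow> k i \<in> J" "\<And>i. i < m \<Longrightarrow> p i \<in> dom_c (ch (k i))" "\<And>i. i < m \<Longrightarrow> nxt m p i \<in> dom_c (ch (k i))"
      "\<And>i. i < m \<Longrightarrow> x i 0 = map_c (ch (k i)) (p i)" "\<And>i. i < m \<Longrightarrow> x i 1 = map_c (ch (k i)) (nxt m p i)"
    and L: "\<And>i t. i < m \<Longrightarrow> t \<in> {0..1} \<Longrightarrow> gb (mcb (k i)) (x i t) (x' i t) (x' i t) = L"
    and P: "\<And>i t. i < m \<Longrightarrow> t \<in> {0..1} \<Longrightarrow> gb (mcb (k i)) (x i t) (P i t) (P i t) = 1"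
      "\<And>i t. i < m \<Longrightarrow> t \<in> {0..1} \<Longrightarrow> gb (mcb (k i)) (x i t) (P i t) (x' i t) = 0"
  defines "K \<equiv> \<lambda>i t. gb (mcb (k i)) (x i t) (Rm (mcb (k i)) (x i t) (P i t) (x' i t) (x' i t)) (P i t)"
    and "\<delta> \<equiv> \<lambda>n i t. (F ^^ n) (inv_c (ch (k i)) (x i t))"
  shows "\<And>n i. i < m \<Longrightarrow> geo (K i) L (\<delta> n i)"
    and "\<And>n i. Suc i < m \<Longrightarrow> \<delta> n i 1 = \<delta> n (Suc i) 0 \<and> velocity (\<delta> n i) 1 = velocity (\<delta> n (Suc i)) 0"
    and "\<And>n. \<delta> n (m - 1) 1 = \<delta> (Suc n) 0 0 \<and> velocity (\<delta> n (m - 1)) 1 = velocity (\<delta> (Suc n) 0) 0"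
proof -
  interpret Lo: geodesic_loop m "\<lambda>i. img_c (ch (k i))" "\<lambda>i. mcb (k i)" "\<lambda>i. dom2 (Hm m i) (ch (k (Suc i mod m))) (ch (k i))"
      "\<lambda>i. rep (Hm m i) (ch (k (Suc i mod m))) (ch (k i))" x x' C by (rule loop)
  note m = Lo.m
  note cA = goodD(1)[OF goodJ[OF kp(1)]]
  define \<gamma> where "\<gamma> i t = inv_c (ch (k i)) (x i t)" for i t
  have geod: "x i t \<in> img_c (ch (k i))" "(x i has_vector_derivative x' i t) (at t within {0..1})"
     "(x' i has_vector_derivative - chr (mcb (k i)) (x i t) (x' i t) (x' i t)) (at t within {0..1})"
    if "i < m" "t \<in> {0..1}" for i t
    using Lo.geod[OF that(1)] that(2) unfolding geodesic01_def by blast+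
  have mg: "map_c (ch (k i)) (\<gamma> i t) = x i t" "\<gamma> i t \<in> dom_c (ch (k i))" if "i < m" "t \<in> {0..1}" for i t
    unfolding \<gamma>_def by (rule map_inv[OF geod(1)[OF that]], rule inv_in[OF geod(1)[OF that]])
  have mvd: "((\<lambda>s. map_c (ch (k i)) (\<gamma> i s)) has_vector_derivative x' i t) (at t within {0..1})" if "i < m" "t \<in> {0..1}" for i t
    by (rule has_vector_derivative_transform[OF that(2) mg(1)[OF that(1)] geod(2)[OF that]])
  have vel: "vel (ch (k i)) (\<gamma> i) t = x' i t" if "i < m" "t \<in> {0..1}" for i t
    by (rule velI[OF that(2) mvd[OF that]])
  have cont: "continuous_map (top_of_set {0..1}) T (\<gamma> i)" if i: "i < m" for i
    using geodesic_inv_continuous(1)[OF cA[OF i] Lo.geod[OF i]] unfolding \<gamma>_def[abs_def] .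
  have ga: "geo_at (K i) L (\<gamma> i) (ch (k i)) t" if i: "i < m" and t: "t \<in> {0..1}" for i t
    unfolding geo_at_def Let_def vel[OF i t] mg(1)[OF i t]
  proof (intro conjI exI[of _ "P i t"])
    show "((\<lambda>s. map_c (ch (k i)) (\<gamma> i s)) has_vector_derivative x' i t) (at t within {0..1})" by (rule mvd[OF i t])
    show "(vel (ch (k i)) (\<gamma> i) has_vector_derivative - chr (mcb (k i)) (x i t) (x' i t) (x' i t)) (at t within {0..1})"
      by (rule has_vector_derivative_transform[OF t vel[OF i] geod(3)[OF i t]])
  qed (simp_all only: L[OF i t] P[OF i t] K_def)
  have g0: "geo (K i) L (\<gamma> i)" if i: "i < m" for i
    unfolding geo_def
  proof (intro conjI cont[OF i] ballI impI)
    fix t d assume t: "t \<in> {0..1}" and d: "d \<in> A" "\<gamma> i t \<in> dom_c d"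
    have "id (\<gamma> i t) \<in> dom_c d" using d(2) by simp
    from geo_at_step(1)[OF isometric_id cont[OF i] cA[OF i] d(1) ga[OF i] t mg(2)[OF i t] this]
    show "geo_at (K i) L (\<gamma> i) d t" by simp
  qed
  have \<delta>: "\<delta> n i = (\<lambda>t. (F ^^ n) (\<gamma> i t))" for n i by (simp add: \<delta>_def \<gamma>_def)
  show gn: "geo (K i) L (\<delta> n i)" if "i < m" for n i unfolding \<delta> by (rule geo_iterate[OF g0[OF that]])
  have p: "\<gamma> i 0 = p i" "\<gamma> i 1 = nxt m p i" if "i < m" for i
    unfolding \<gamma>_def by (simp_all only: kp(4,5)[OF that] inv_map[OF cA[OF that] kp(2)[OF that]] inv_map[OF cA[OF that] kp(3)[OF that]])
  \<comment> \<open>The positions match by the construction of the chain and the velocities by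
    \<open>no_corner\<close>, here translated from charts to tangent vectors.\<close>
  have join: "\<gamma> i 1 = Hm m i (\<gamma> (Lo.sc i) 0) \<and> velocity (\<gamma> i) 1 = velocity (\<lambda>s. Hm m i (\<gamma> (Lo.sc i) s)) 0" if i: "i < m" for i
  proof
    note sc = Lo.sc_less[of i]
    have 01: "0 \<in> {0..1::real}" "1 \<in> {0..1::real}" by simp_all
    show e: "\<gamma> i 1 = Hm m i (\<gamma> (Lo.sc i) 0)" unfolding p(1)[OF sc] p(2)[OF i] by (simp add: nxt_def)
    have h: "Hm m i (\<gamma> (Lo.sc i) 0) \<in> dom_c (ch (k i))" unfolding e[symmetric] by (rule mg(2)[OF i 01(2)])
    have "vel (ch (k i)) (\<lambda>s. Hm m i (\<gamma> (Lo.sc i) s)) 0 =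
        Dbl (rep (Hm m i) (ch (k (Lo.sc i))) (ch (k i))) (map_c (ch (k (Lo.sc i))) (\<gamma> (Lo.sc i) 0)) (vel (ch (k (Lo.sc i))) (\<gamma> (Lo.sc i)) 0)"
      by (rule geo_at_step(2)[OF Hm_isometric cont[OF sc] cA[OF sc] cA[OF i] ga[OF sc] 01(1) mg(2)[OF sc 01(1)] h])
    also have "\<dots> = x' i 1"
      unfolding mg(1)[OF sc 01(1)] vel[OF sc 01(1)] by (rule Lo.no_corner[OF i, symmetric])
    finally have v: "vel (ch (k i)) (\<lambda>s. Hm m i (\<gamma> (Lo.sc i) s)) 0 = x' i 1" .
    have "velocity (\<gamma> i) 1 = vec_at A (ch (k i)) (\<gamma> i 1) (x' i 1)"
      unfolding velocity_vec_at[OF g0[OF i] 01(2) cA[OF i] mg(2)[OF i 01(2)]] vel[OF i 01(2)] ..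
    also have "\<dots> = velocity (\<lambda>s. Hm m i (\<gamma> (Lo.sc i) s)) 0"
      unfolding velocity_vec_at[OF geo_step[OF Hm_isometric g0[OF sc]] 01(1) cA[OF i] h] v e ..
    finally show "velocity (\<gamma> i) 1 = velocity (\<lambda>s. Hm m i (\<gamma> (Lo.sc i) s)) 0" .
  qed
  have join': "\<delta> n i 1 = (F ^^ n) (Hm m i (\<gamma> (Lo.sc i) 0)) \<and> velocity (\<delta> n i) 1 = velocity (\<lambda>s. (F ^^ n) (Hm m i (\<gamma> (Lo.sc i) s))) 0" if i: "i < m" for i n
    unfolding \<delta>
    using velocity_iterate[OF g0[OF i] geo_step[OF Hm_isometric g0[OF Lo.sc_less]] _ _ conjunct1[OF join[OF i]] conjunct2[OF join[OF i]], of n] conjunct1[OF join[OF i]]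
    by simp
  show "\<delta> n i 1 = \<delta> n (Suc i) 0 \<and> velocity (\<delta> n i) 1 = velocity (\<delta> n (Suc i)) 0" if "Suc i < m" for n i
    using join'[of i n] that by (simp add: Hm_def \<delta>)
  show "\<delta> n (m - 1) 1 = \<delta> (Suc n) 0 0 \<and> velocity (\<delta> n (m - 1)) 1 = velocity (\<delta> (Suc n) 0) 0" for n
    using join'[of "m - 1" n] m by (simp add: Hm_def \<delta> funpow_swap1)
qed

text \<open>Both cases use the same joints and the same stability inequality. They differ in the
  scalar function followed along the iterates: the component of \<open>X\<close> along the velocity,
  or the exponential of \<open>f\<close>.\<close>

lemma weighted_loop_contradiction:
  fixes x x' P :: "nat \<Rightarrow> real \<Rightarrow> real^'n"
  assumes pos: "smooth_vector_field T A X \<and> sec_X_positive T A g X \<or> smooth_fun A f \<and> sec_bar_positive T A g f"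
    and loop: "geodesic_loop m (\<lambda>i. img_c (ch (k i))) (\<lambda>i. mcb (k i)) (\<lambda>i. dom2 (Hm m i) (ch (k (Suc i mod m))) (ch (k i)))
      (\<lambda>i. rep (Hm m i) (ch (k (Suc i mod m))) (ch (k i))) x x' C"
    and kp: "\<And>i. i < m \<Longrightarrow> k i \<in> J" "\<And>i. i < m \<Longrightarrow> p i \<in> dom_c (ch (k i))" "\<And>i. i < m \<Longrightarrow> nxt m p i \<in> dom_c (ch (k i))"
      "\<And>i. i < m \<Longrightarrow> x i 0 = map_c (ch (k i)) (p i)" "\<And>i. i < m \<Longrightarrow> x i 1 = map_c (ch (k i)) (nxt m p i)"
    and L: "\<And>i t. i < m \<Longrightarrow> t \<in> {0..1} \<Longrightarrow> gb (mcb (k i)) (x i t) (x' i t) (x' i t) = L" "0 < L"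
    and P: "\<And>i t. i < m \<Longrightarrow> t \<in> {0..1} \<Longrightarrow> gb (mcb (k i)) (x i t) (P i t) (P i t) = 1"
      "\<And>i t. i < m \<Longrightarrow> t \<in> {0..1} \<Longrightarrow> gb (mcb (k i)) (x i t) (P i t) (x' i t) = 0"
      "\<And>i t. i < m \<Longrightarrow> t \<in> {0..1} \<Longrightarrow> (P i has_vector_derivative - chr (mcb (k i)) (x i t) (x' i t) (P i t)) (at t within {0..1})"
      "\<And>i. i < m \<Longrightarrow> P i 1 = Dbl (rep (Hm m i) (ch (k (Suc i mod m))) (ch (k i))) (x (Suc i mod m) 0) (P (Suc i mod m) 0)"
  shows False
proof -
  interpret Lo: geodesic_loop m "\<lambda>i. img_c (ch (k i))" "\<lambda>i. mcb (k i)" "\<lambda>i. dom2 (Hm m i) (ch (k (Suc i mod m))) (ch (k i))"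
      "\<lambda>i. rep (Hm m i) (ch (k (Suc i mod m))) (ch (k i))" x x' C by (rule loop)
  note m = Lo.m
  define K where "K = (\<lambda>i t. gb (mcb (k i)) (x i t) (Rm (mcb (k i)) (x i t) (P i t) (x' i t) (x' i t)) (P i t))"
  define \<delta> where "\<delta> = (\<lambda>n i t. (F ^^ n) (inv_c (ch (k i)) (x i t)))"
  have I1: "geo (K i) L (\<delta> n i)" if "i < m" for n i
    unfolding K_def \<delta>_def by (rule loop_iterates(1)[OF loop, where p = p]; (erule kp | (erule L(1) P(1,2), assumption) | rule that))
  have I2: "\<delta> n i 1 = \<delta> n (Suc i) 0" "velocity (\<delta> n i) 1 = velocity (\<delta> n (Suc i)) 0" if "Suc i < m" for n i
  proof -
    have "\<delta> n i 1 = \<delta> n (Suc i) 0 \<and> velocity (\<delta> n i) 1 = velocity (\<delta> n (Suc i)) 0"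
      unfolding \<delta>_def by (rule loop_iterates(2)[OF loop, where p = p and P = P and L = L]; (erule kp | (erule L(1) P(1,2), assumption) | rule that))
    then show "\<delta> n i 1 = \<delta> n (Suc i) 0" "velocity (\<delta> n i) 1 = velocity (\<delta> n (Suc i)) 0" by blast+
  qed
  have I3: "\<delta> n (m - 1) 1 = \<delta> (Suc n) 0 0" "velocity (\<delta> n (m - 1)) 1 = velocity (\<delta> (Suc n) 0) 0" for n
  proof -
    have "\<delta> n (m - 1) 1 = \<delta> (Suc n) 0 0 \<and> velocity (\<delta> n (m - 1)) 1 = velocity (\<delta> (Suc n) 0) 0"
      unfolding \<delta>_def by (rule loop_iterates(3)[OF loop, where p = p and P = P and L = L]; (erule kp | (erule L(1) P(1,2), assumption)))
    then show "\<delta> n (m - 1) 1 = \<delta> (Suc n) 0 0" "velocity (\<delta> n (m - 1)) 1 = velocity (\<delta> (Suc n) 0) 0" by blast+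
  qed
  have cK: "continuous_on {0..1} (K i)" if i: "i < m" for i
  proof -
    interpret M: lmetric "img_c (ch (k i))" "mcb (k i)" by (rule lmetric_chart[OF goodD(1)[OF goodJ[OF kp(1)[OF i]]]])
    note g = Lo.geod[OF i]
    show ?thesis unfolding K_def
      by (rule M.continuous_on_curvature[OF _ continuous_on_vd continuous_on_vd continuous_on_vd[OF P(3)[OF i]]])
         (use g in \<open>unfold geodesic01_def, blast+\<close>)
  qed
  have stab: "0 \<le> (\<Sum>i<m. integral {0..1} (\<lambda>t. (\<phi>' i t)\<^sup>2 - (\<phi> i t)\<^sup>2 * K i t))"
    if "\<And>i. i < m \<Longrightarrow> C1_curve (\<phi> i) (\<phi>' i)" "\<And>i. i < m \<Longrightarrow> \<phi> i 1 = \<phi> (Suc i mod m) 0" for \<phi> \<phi>'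
    unfolding K_def by (rule Lo.stability[of P \<phi> \<phi>', OF P(3,1,4) that])
  show False using pos
  proof (elim disjE conjE)
    assume X: "smooth_vector_field T A X" "sec_X_positive T A g X"
    define h where "h n i t = g (\<delta> n i t) (X (\<delta> n i t)) (velocity (\<delta> n i) t)" for n i t
    obtain d B where d: "d > 0" and E: "\<forall>K \<gamma>. geo K L \<gamma> \<longrightarrow> (\<forall>t\<in>{0..1}. \<bar>g (\<gamma> t) (X (\<gamma> t)) (velocity \<gamma> t)\<bar> \<le> B \<and>
        (\<exists>h'. ((\<lambda>s. g (\<gamma> s) (X (\<gamma> s)) (velocity \<gamma> s)) has_vector_derivative h') (at t within {0..1}) \<and> d - K t \<le> h'))"
      using vf_estimates[OF X L(2)] by (elim exE conjE)
    have B: "\<And>K \<gamma> t. geo K L \<gamma> \<Longrightarrow> t \<in> {0..1} \<Longrightarrow> \<bar>g (\<gamma> t) (X (\<gamma> t)) (velocity \<gamma> t)\<bar> \<le> B"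
      and h': "\<And>K \<gamma> t. geo K L \<gamma> \<Longrightarrow> t \<in> {0..1} \<Longrightarrow>
        \<exists>h'. ((\<lambda>s. g (\<gamma> s) (X (\<gamma> s)) (velocity \<gamma> s)) has_vector_derivative h') (at t within {0..1}) \<and> d - K t \<le> h'"
      using E by blast+
    have "\<exists>y. (h n i has_vector_derivative y) (at t within {0..1}) \<and> d - K i t \<le> y" if "i < m" "t \<in> {0..1}" for n i t
      using h'[OF I1[OF that(1)] that(2)] unfolding h_def[abs_def] by blast
    note ex = this
    define h' where "h' n i t = (SOME y. (h n i has_vector_derivative y) (at t within {0..1}) \<and> d - K i t \<le> y)" for n i t
    have h': "(h n i has_vector_derivative h' n i t) (at t within {0..1})" "d - K i t \<le> h' n i t" if "i < m" "t \<in> {0..1}" for n i t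
      using someI_ex[OF ex[OF that]] unfolding h'_def by blast+
    \<comment> \<open>The unit parallel field itself is the variation: constants close up, and the
      index form reduces to minus the total curvature term.\<close>
    have "0 \<le> (\<Sum>i<m. integral {0..1} (\<lambda>t. 0\<^sup>2 - 1\<^sup>2 * K i t))"
      by (rule stab[of "\<lambda>_ _. 1" "\<lambda>_ _. 0"]) (simp_all add: C1_curve_def)
    then have sK: "(\<Sum>i<m. integral {0..1} (K i)) \<le> 0" by (simp add: sum_negf)
    show False
      by (rule bounded_slope_contradiction[where h = h and B = B, OF m d cK sK h'])
         (simp_all only: h_def B[OF I1[OF m]] I2 I3 atLeastAtMost_iff zero_le_one order_refl)
  next
    assume f: "smooth_fun A f" "sec_bar_positive T A g f"
    define h where "h n i t = f (\<delta> n i t)" for n i t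
    define h1 where "h1 n i t = differential f (\<delta> n i t) (velocity (\<delta> n i) t)" for n i t
    obtain d B where d: "d > 0" and B0: "B \<ge> 0" and E: "\<forall>K \<gamma>. geo K L \<gamma> \<longrightarrow> (\<forall>t\<in>{0..1}. \<bar>f (\<gamma> t)\<bar> \<le> B \<and> \<bar>differential f (\<gamma> t) (velocity \<gamma> t)\<bar> \<le> B \<and>
    (\<exists>h2. ((\<lambda>s. differential f (\<gamma> s) (velocity \<gamma> s)) has_vector_derivative h2) (at t within {0..1}) \<and>
      d \<le> K t + (h2 + (differential f (\<gamma> t) (velocity \<gamma> t))\<^sup>2)))"
      using fun_estimates[OF f L(2)] by (elim exE conjE)
    have B: "\<And>K \<gamma> t. geo K L \<gamma> \<Longrightarrow> t \<in> {0..1} \<Longrightarrow> \<bar>f (\<gamma> t)\<bar> \<le> B \<and> \<bar>differential f (\<gamma> t) (velocity \<gamma> t)\<bar> \<le> B"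
      and h2: "\<And>K \<gamma> t. geo K L \<gamma> \<Longrightarrow> t \<in> {0..1} \<Longrightarrow>
        \<exists>h2. ((\<lambda>s. differential f (\<gamma> s) (velocity \<gamma> s)) has_vector_derivative h2) (at t within {0..1}) \<and>
        d \<le> K t + (h2 + (differential f (\<gamma> t) (velocity \<gamma> t))\<^sup>2)"
      using E by blast+
    have "\<exists>y. (h1 n i has_vector_derivative y) (at t within {0..1}) \<and> d \<le> K i t + (y + (h1 n i t)\<^sup>2)" if "i < m" "t \<in> {0..1}" for n i t
      using h2[OF I1[OF that(1)] that(2)] unfolding h1_def[abs_def] by blast
    note ex = this
    define h2 where "h2 n i t = (SOME y. (h1 n i has_vector_derivative y) (at t within {0..1}) \<and> d \<le> K i t + (y + (h1 n i t)\<^sup>2))" for n i t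
    have h2: "(h1 n i has_vector_derivative h2 n i t) (at t within {0..1})" "d \<le> K i t + (h2 n i t + (h1 n i t)\<^sup>2)"
      if "i < m" "t \<in> {0..1}" for n i t
      using someI_ex[OF ex[OF that]] unfolding h2_def by blast+
    have hd: "(h n i has_vector_derivative h1 n i t) (at t within {0..1})" if "i < m" "t \<in> {0..1}" for n i t
      using fun_along_vd[OF f(1) I1[OF that(1)] that(2)] unfolding h_def[abs_def] h1_def[abs_def] .
    have hb: "\<bar>h n i t\<bar> \<le> B" "\<bar>h1 n i t\<bar> \<le> B" if "i < m" "t \<in> {0..1}" for n i t
      using B[OF I1[OF that(1)] that(2)] unfolding h_def h1_def by blast+
    define u where "u n i t = exp (h n i t)" for n i t
    define u' where "u' n i t = h1 n i t * exp (h n i t)" for n i t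
    \<comment> \<open>The second derivative of exp h is (h'' + (h')^2) exp h, which is precisely the
      combination of Hessian and squared differential that the curvature hypothesis bounds from
      below.\<close>
    define u'' where "u'' n i t = (h2 n i t + (h1 n i t)\<^sup>2) * exp (h n i t)" for n i t
    have ud: "(u n i has_vector_derivative u' n i t) (at t within {0..1})" if "i < m" "t \<in> {0..1}" for n i t
      using has_vector_derivative_chain[OF DERIV_exp[unfolded has_field_derivative_def] hd[OF that]]
      unfolding u_def[abs_def] u'_def by (simp add: mult.commute)
    have u'd: "(u' n i has_vector_derivative u'' n i t) (at t within {0..1})" if "i < m" "t \<in> {0..1}" for n i t
      using has_vector_derivative_mult[OF h2(1)[OF that] ud[OF that, unfolded u_def[abs_def]]]
      unfolding u'_def u''_def by (simp add: algebra_simps power2_eq_square)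
    show False
    proof (rule index_form_contradiction[OF m d _ _ cK stab ud u'd])
      \<comment> \<open>As \<open>h\<close> lies between \<open>- B\<close> and \<open>B\<close>,
        these constants bound the exponential from both sides; the factor \<open>1 + B\<close> lets
        one upper bound serve the derivative too.\<close>
      show "0 < exp (- B)" by simp
      show "0 < (1 + B) * exp B" using B0 by simp
      show "(d - K i t) * u n i t \<le> u'' n i t" if "i < m" "t \<in> {0..1}" for n i t
        unfolding u_def u''_def using h2(2)[OF that, of n] by (intro mult_right_mono) simp_all
      show "exp (- B) \<le> u n i t \<and> u n i t \<le> (1 + B) * exp B \<and> \<bar>u' n i t\<bar> \<le> (1 + B) * exp B"
        if "i < m" "t \<in> {0..1}" for n i t
      proof (intro conjI)
        note b = hb[OF that, of n]
        have e: "exp (h n i t) \<le> exp B" using b by simp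
        show "exp (- B) \<le> u n i t" using b by (simp add: u_def)
        have "u n i t \<le> 1 * exp B" using e by (simp add: u_def)
        also have "\<dots> \<le> (1 + B) * exp B" using B0 by (intro mult_right_mono) simp_all
        finally show "u n i t \<le> (1 + B) * exp B" .
        have "\<bar>h1 n i t\<bar> * exp (h n i t) \<le> B * exp B" using b(2) e B0 by (intro mult_mono) simp_all
        also have "\<dots> \<le> (1 + B) * exp B" by (intro mult_right_mono) simp_all
        finally show "\<bar>u' n i t\<bar> \<le> (1 + B) * exp B" by (simp add: u'_def abs_mult)
      qed
    qed (simp_all only: u_def u'_def h_def h1_def I2 I3)
  qed
qed

end

section \<open>Orientation\<close>

lemma connected_space_constant:
  assumes S: "connected_space S" and f: "\<And>s. openin S {p \<in> topspace S. f p = s}" and pq: "p \<in> topspace S" "q \<in> topspace S"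
  shows "f p = f q"
proof -
  define R where "R = {r \<in> topspace S. f r = f p}"
  have "topspace S - R = (\<Union>s\<in>- {f p}. {r \<in> topspace S. f r = s})" unfolding R_def by blast
  then have "openin S (topspace S - R)" using f by (simp only:) (rule openin_Union, elim imageE, simp only:)
  moreover have "openin S R" unfolding R_def by (rule f)
  moreover have "p \<in> R" unfolding R_def using pq by simp
  ultimately have "topspace S - R = {}"
    using connected_spaceD[OF S, of R "topspace S - R"] by (auto simp: R_def)
  then have "q \<in> R" using pq(2) by (simp add: Diff_eq_empty_iff subset_iff)
  then show ?thesis unfolding R_def by simp
qed

lemma sgn_eq_of_mult_eq_1: "a * b = 1 \<Longrightarrow> sgn a = sgn b \<and> b \<noteq> (0::real)"
  using zero_less_mult_iff[of a b] by (cases "0 < b"; cases "b < 0") simp_all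

definition jac_det :: "('a \<Rightarrow> 'a) \<Rightarrow> ('a, 'n::finite) chart \<Rightarrow> ('a, 'n) chart \<Rightarrow> 'a \<Rightarrow> real"
  where "jac_det H c d p = det (matrix (blinfun_apply (Dbl (rep H c d) (map_c c p))))"

lemma linear_blinfun_apply: "linear (blinfun_apply f)"
  by (rule bounded_linear.linear[OF blinfun.bounded_linear_right])

lemma det_matrix_comp:
  fixes f g h :: "(real^'n::finite) \<Rightarrow>\<^sub>L (real^'n)"
  assumes "\<And>u. h u = f (g u)"
  shows "det (matrix (blinfun_apply h)) = det (matrix (blinfun_apply f)) * det (matrix (blinfun_apply g))"
proof -
  have "blinfun_apply h = blinfun_apply f \<circ> blinfun_apply g" using assms by (intro ext) simp
  then show ?thesis
    by (simp only: matrix_compose[OF linear_blinfun_apply linear_blinfun_apply] det_mul)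
qed

context manifold_atlas
begin

lemma jac_det_chain:
  assumes "smooth_map T A H1" "smooth_map T A H2" "\<And>p. p \<in> topspace T \<Longrightarrow> H p = H2 (H1 p)" "c \<in> A" "d \<in> A" "e \<in> A"
    "p \<in> dom_c c" "H1 p \<in> dom_c d" "H2 (H1 p) \<in> dom_c e"
  shows "jac_det H c e p = jac_det H2 d e (H1 p) * jac_det H1 c d p"
  unfolding jac_det_def by (rule det_matrix_comp) (rule rep_chain[OF assms])

lemma jac_det_id_chain:
  assumes "c \<in> A" "d \<in> A" "e \<in> A" "p \<in> dom_c c" "p \<in> dom_c d" "p \<in> dom_c e"
  shows "jac_det id c e p = jac_det id d e p * jac_det id c d p"
  using jac_det_chain[OF smooth_map_id smooth_map_id, of id c d e p] assms by simp

lemma jac_det_id_self: "c \<in> A \<Longrightarrow> p \<in> dom_c c \<Longrightarrow> jac_det id c c p = 1"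
proof -
  assume c: "c \<in> A" "p \<in> dom_c c"
  have "blinfun_apply (Dbl (tr c c) (map_c c p)) = id" using Dtr_self[OF c] by (intro ext) simp
  then show ?thesis unfolding jac_det_def by (simp add: matrix_id_mat_1)
qed

lemma jac_det_id_inverse: "c \<in> A \<Longrightarrow> d \<in> A \<Longrightarrow> p \<in> dom_c c \<Longrightarrow> p \<in> dom_c d \<Longrightarrow> jac_det id d c p * jac_det id c d p = 1"
  using jac_det_id_chain[of c d c p] jac_det_id_self[of c p] by simp

lemma sgn_jac_det_id: "c \<in> A \<Longrightarrow> d \<in> A \<Longrightarrow> p \<in> dom_c c \<Longrightarrow> p \<in> dom_c d \<Longrightarrow> sgn (jac_det id d c p) = sgn (jac_det id c d p) \<and> jac_det id c d p \<noteq> 0"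
  by (rule sgn_eq_of_mult_eq_1) (rule jac_det_id_inverse)

text \<open>Later \<open>r\<close> is a sign, so that having that sign becomes an open condition on
  the point.\<close>

lemma jac_det_open:
  assumes H: "smooth_map T A H" and c: "c \<in> A" "d \<in> A"
  shows "openin T {p \<in> dom_c c. H p \<in> dom_c d \<and> 0 < r * jac_det H c d p}"
proof -
  note o = open_dom2[OF smooth_map_continuous[OF H] c]
  define f where "f x = r * det (matrix (blinfun_apply (Dbl (rep H c d) x)))" for x
  have "smooth_on (dom2 H c d) (Dbl (rep H c d))" by (rule smooth_on_Dbl[OF o smooth_rep[OF H c]])
  then have cD: "continuous_on (dom2 H c d) (Dbl (rep H c d))" by (rule smooth_on_continuous)
  have "continuous_on (dom2 H c d) f"
    unfolding f_def det_def matrix_def by (simp, intro continuous_intros cD)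
  then have "open (dom2 H c d \<inter> f -` {0<..})"
    using o by (intro continuous_open_preimage) auto
  from map_preimage_open[OF c(1) this]
  have "openin T {p \<in> dom_c c. map_c c p \<in> dom2 H c d \<inter> f -` {0<..}}" .
  also have "{p \<in> dom_c c. map_c c p \<in> dom2 H c d \<inter> f -` {0<..}} = {p \<in> dom_c c. H p \<in> dom_c d \<and> 0 < r * jac_det H c d p}"
  proof (rule Collect_cong, rule conj_cong[OF refl])
    fix p assume p: "p \<in> dom_c c"
    have "map_c c p \<in> dom2 H c d \<longleftrightarrow> H p \<in> dom_c d"
      unfolding dom2_iff[OF c(1)] inv_map[OF c(1) p] using p by simp
    then show "map_c c p \<in> dom2 H c d \<inter> f -` {0<..} \<longleftrightarrow> H p \<in> dom_c d \<and> 0 < r * jac_det H c d p"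
      by (simp add: f_def jac_det_def)
  qed
  finally show ?thesis .
qed

end

lemma (in riemannian) jac_det_isometric:
  assumes H: "isometric H" and c: "c \<in> A" "d \<in> A" "p \<in> dom_c c" "H p \<in> dom_c d"
  shows "jac_det H c d p \<noteq> 0"
proof -
  interpret lisom "img_c c" "mc c" "img_c d" "mc d" "dom2 H c d" "rep H c d" by (rule isometric_lisom[OF H c(1,2)])
  have "map_c c p \<in> dom2 H c d" by (rule dom2_map[OF c(1), where H = H and d = d, OF c(3,4)])
  from bij_is_inj[OF bij_Dpsi[OF this]] show ?thesis
    unfolding jac_det_def det_nz_iff_inj[OF linear_blinfun_apply] .
qed

locale oriented_cover = covered T A g J F for T :: "'a topology" and A :: "('a, 'n::finite) chart set" and g J F +
  fixes B :: "('a, 'n) chart set"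
  assumes oriented: "oriented_atlas T A B"
begin

text \<open>Charts of \<open>A\<close> and of the oriented atlas can be compared only in a common
  atlas; coordinate changes are smooth there, while \<open>F\<close> is handled in
  \<open>A\<close>.\<close>

sublocale AB: manifold_atlas T "A \<union> B"
  using oriented unfolding oriented_atlas_def by (intro manifold_atlas.intro) blast

lemma ex_B: "p \<in> topspace T \<Longrightarrow> \<exists>b. b \<in> B \<and> p \<in> dom_c b"
  using oriented unfolding oriented_atlas_def smooth_atlas_def by blast

lemma B_pos: "b \<in> B \<Longrightarrow> b' \<in> B \<Longrightarrow> p \<in> dom_c b \<Longrightarrow> p \<in> dom_c b' \<Longrightarrow> 0 < jac_det id b b' p"
proof -
  assume b: "b \<in> B" "b' \<in> B" "p \<in> dom_c b" "p \<in> dom_c b'"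
  have "det (jacobian (map_c b' \<circ> inv_c b) (at (map_c b p))) > 0"
    using oriented b unfolding oriented_atlas_def by blast
  then show ?thesis
    using AB.rep_derivative(2)[OF AB.smooth_map_id, of b b' p] b by (simp add: jacobian_def tr_eq jac_det_def)
qed

text \<open>Signs are computed in charts of \<open>A\<close>, because \<open>F\<close> is only assumed smooth in these.\<close>

definition ori :: "('a, 'n) chart \<Rightarrow> 'a \<Rightarrow> real"
  where "ori c p = sgn (jac_det id c (SOME b. b \<in> B \<and> p \<in> dom_c b) p)"

lemma ori_eq:
  assumes c: "c \<in> A" "p \<in> dom_c c" and b: "b \<in> B" "p \<in> dom_c b"
  shows "ori c p = sgn (jac_det id c b p)"
proof -
  define b' where "b' = (SOME b. b \<in> B \<and> p \<in> dom_c b)"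
  have b': "b' \<in> B \<and> p \<in> dom_c b'" unfolding b'_def by (rule someI_ex[OF ex_B[OF dom_sub[OF c]]])
  note b1 = conjunct1[OF b'] and b2 = conjunct2[OF b']
  have "jac_det id c b' p = jac_det id b b' p * jac_det id c b p"
    using c b b1 b2 by (intro AB.jac_det_id_chain) simp_all
  then show ?thesis unfolding ori_def b'_def[symmetric] using B_pos[OF b(1) b1 b(2) b2] by (simp add: sgn_mult)
qed

lemma ori_sign: "c \<in> A \<Longrightarrow> p \<in> dom_c c \<Longrightarrow> ori c p * ori c p = 1"
proof -
  assume c: "c \<in> A" "p \<in> dom_c c"
  obtain b where b: "b \<in> B" "p \<in> dom_c b" using ex_B[OF dom_sub[OF c]] by (elim exE conjE)
  show ?thesis unfolding ori_eq[OF c b] using AB.sgn_jac_det_id[of c b p] c b by (simp add: sgn_if)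
qed

lemma ori_trans:
  assumes c: "c \<in> A" "p \<in> dom_c c" and d: "d \<in> A" "p \<in> dom_c d"
  shows "ori c p = sgn (jac_det id c d p) * ori d p"
proof -
  obtain b where b: "b \<in> B" "p \<in> dom_c b" using ex_B[OF dom_sub[OF c]] by (elim exE conjE)
  have "jac_det id c b p = jac_det id d b p * jac_det id c d p" using c b d by (intro AB.jac_det_id_chain) simp_all
  then show ?thesis unfolding ori_eq[OF c b] ori_eq[OF d b] by (simp add: sgn_mult)
qed

lemma ori_open: 
  assumes c: "c \<in> A"
  shows "openin T {p \<in> dom_c c. ori c p = s}"
proof (subst openin_subopen, intro ballI)
  fix q assume q: "q \<in> {p \<in> dom_c c. ori c p = s}"
  then have qc: "q \<in> dom_c c" "ori c q = s" by simp_all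
  obtain b where b: "b \<in> B" "q \<in> dom_c b" using ex_B[OF dom_sub[OF c qc(1)]] by (elim exE conjE)
  let ?N = "{p \<in> dom_c c. id p \<in> dom_c b \<and> 0 < s * jac_det id c b p}"
  have s: "s * s = 1" using ori_sign[OF c qc(1)] qc(2) by simp
  have "s = sgn (jac_det id c b q)" using ori_eq[OF c qc(1) b] qc(2) by simp
  then have "0 < s * jac_det id c b q" using s by (auto simp: sgn_if split: if_splits)
  then have "q \<in> ?N" using qc b by simp
  moreover have "?N \<subseteq> {p \<in> dom_c c. ori c p = s}"
  proof
    fix p assume p: "p \<in> ?N"
    then have pc: "p \<in> dom_c c" "p \<in> dom_c b" "0 < s * jac_det id c b p" by simp_all
    from s have "s = 1 \<or> s = - 1" by (simp add: square_eq_1_iff)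
    then have "sgn (jac_det id c b p) = s" using pc(3) by (auto simp: sgn_if)
    then show "p \<in> {p \<in> dom_c c. ori c p = s}" using ori_eq[OF c pc(1) b(1) pc(2)] pc(1) by simp
  qed
  moreover have "openin T ?N" using c b(1) by (intro AB.jac_det_open AB.smooth_map_id) simp_all
  ultimately show "\<exists>S. openin T S \<and> q \<in> S \<and> S \<subseteq> {p \<in> dom_c c. ori c p = s}" by (intro exI[of _ ?N] conjI)
qed

text \<open>A segment of the loop lies in one chart, so the orientation sign of that chart is the
  same at both ends: it is locally constant and the interval is connected.\<close>

lemma ori_curve:
  assumes \<gamma>: "continuous_map (top_of_set {0..1::real}) T \<gamma>" and c: "c \<in> A" "\<And>t. t \<in> {0..1} \<Longrightarrow> \<gamma> t \<in> dom_c c"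
  shows "ori c (\<gamma> 0) = ori c (\<gamma> 1)"
proof (rule connected_space_constant[where f = "\<lambda>t. ori c (\<gamma> t)" and S = "top_of_set {0..1::real}"])
  show "connected_space (top_of_set {0..1::real})" by (simp add: connected_space_subtopology)
  fix s
  have "openin (top_of_set {0..1}) {t \<in> topspace (top_of_set {0..1}). \<gamma> t \<in> {p \<in> dom_c c. ori c p = s}}"
    by (rule openin_continuous_map_preimage[OF \<gamma> ori_open[OF c(1)]])
  also have "{t \<in> topspace (top_of_set {0..1}). \<gamma> t \<in> {p \<in> dom_c c. ori c p = s}} = {t \<in> topspace (top_of_set {0..1}). ori c (\<gamma> t) = s}"
    using c(2) by auto
  finally show "openin (top_of_set {0..1}) {t \<in> topspace (top_of_set {0..1}). ori c (\<gamma> t) = s}" .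
qed simp_all

text \<open>The sign of the Jacobian in arbitrary charts, corrected by their orientation signs at
  source and target: 1 or -1 according to whether \<open>H\<close> keeps or reverses the orientation
  at \<open>p\<close>, for maps with invertible differential.\<close>

definition orientation_sign :: "('a \<Rightarrow> 'a) \<Rightarrow> 'a \<Rightarrow> real"
  where "orientation_sign H p = (let c = (SOME c. c \<in> A \<and> p \<in> dom_c c); d = (SOME d. d \<in> A \<and> H p \<in> dom_c d)
    in ori c p * sgn (jac_det H c d p) * ori d (H p))"

text \<open>A change of chart at source or target multiplies the Jacobian sign and the corresponding
  \<open>ori\<close> by the same sign, so the product is unchanged.\<close>

lemma orientation_sign_eq:
  assumes H: "smooth_map T A H" and c: "c \<in> A" "p \<in> dom_c c" and d: "d \<in> A" "H p \<in> dom_c d"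
  shows "orientation_sign H p = ori c p * sgn (jac_det H c d p) * ori d (H p)"
proof -
  define c' where "c' = (SOME c. c \<in> A \<and> p \<in> dom_c c)"
  define d' where "d' = (SOME d. d \<in> A \<and> H p \<in> dom_c d)"
  have "c' \<in> A \<and> p \<in> dom_c c'" unfolding c'_def by (rule someI_ex[OF ex_chart[OF dom_sub[OF c]]])
  then have c': "c' \<in> A" "p \<in> dom_c c'" by blast+
  have "d' \<in> A \<and> H p \<in> dom_c d'" unfolding d'_def by (rule someI_ex[OF ex_chart[OF dom_sub[OF d]]])
  then have d': "d' \<in> A" "H p \<in> dom_c d'" by blast+
  have i: "id (H p) \<in> dom_c d" "H (id p) \<in> dom_c d'" "id p \<in> dom_c c" using c d d' by simp_all
  have 1: "jac_det H c d p = jac_det id d' d (H p) * jac_det H c d' p"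
    by (rule jac_det_chain[OF H smooth_map_id _ c(1) d'(1) d(1) c(2) d'(2) i(1)]) simp
  have 2: "jac_det H c' d' p = jac_det H c d' p * jac_det id c' c p"
  proof -
    have "jac_det H c' d' p = jac_det H c d' (id p) * jac_det id c' c p"
      by (rule jac_det_chain[OF smooth_map_id H _ c'(1) c(1) d'(1) c'(2) i(3,2)]) simp
    then show ?thesis by (simp only: id_apply)
  qed
  have s: "sgn (jac_det id d' d (H p)) * sgn (jac_det id d' d (H p)) = 1" "sgn (jac_det id c' c p) * sgn (jac_det id c' c p) = 1"
    using conjunct2[OF sgn_jac_det_id[OF d'(1) d(1) d'(2) d(2)]] conjunct2[OF sgn_jac_det_id[OF c'(1) c(1) c'(2) c(2)]] by (simp_all add: sgn_if)
  have "orientation_sign H p = ori c' p * sgn (jac_det H c' d' p) * ori d' (H p)" unfolding orientation_sign_def Let_def c'_def d'_def ..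
  also have "\<dots> = (sgn (jac_det id c' c p) * sgn (jac_det id c' c p)) * ori c p * sgn (jac_det H c d' p) * sgn (jac_det id d' d (H p)) * ori d (H p)"
    unfolding 2 ori_trans[OF c' c] ori_trans[OF d' d] by (simp add: sgn_mult)
  also have "\<dots> = ori c p * sgn (jac_det H c d p) * ori d (H p)" unfolding s 1 by (simp add: sgn_mult)
  finally show ?thesis .
qed

lemma orientation_sign_id: "p \<in> topspace T \<Longrightarrow> orientation_sign id p = 1"
proof -
  assume "p \<in> topspace T"
  then obtain c where c: "c \<in> A" "p \<in> dom_c c" using ex_chart by blast
  have i: "id p \<in> dom_c c" using c by simp
  show ?thesis unfolding orientation_sign_eq[OF smooth_map_id c c(1) i] jac_det_id_self[OF c] using ori_sign[OF c] by simp
qed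

lemma sgn_jac_det_eq:
  assumes H: "smooth_map T A H" and c: "c \<in> A" "p \<in> dom_c c" and d: "d \<in> A" "H p \<in> dom_c d"
  shows "sgn (jac_det H c d p) = orientation_sign H p * ori c p * ori d (H p)"
proof -
  have "orientation_sign H p * ori c p * ori d (H p) = (ori c p * ori c p) * (ori d (H p) * ori d (H p)) * sgn (jac_det H c d p)"
    unfolding orientation_sign_eq[OF assms] by (simp add: mult_ac)
  then show ?thesis unfolding ori_sign[OF c] ori_sign[OF d] by simp
qed

text \<open>In fixed charts all three factors are locally constant, the middle one because an
  isometry has nonzero Jacobian; connectedness does the rest.\<close>

lemma orientation_sign_constant:
  assumes H: "isometric H" and p: "p \<in> topspace T" "q \<in> topspace T"
  shows "orientation_sign H p = orientation_sign H q"
proof (rule connected_space_constant[OF connected _ p])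
  note Hs = isometric_smooth[OF H]
  note Hc = smooth_map_continuous[OF Hs]
  fix s
  show "openin T {p \<in> topspace T. orientation_sign H p = s}"
  proof (subst openin_subopen, intro ballI)
    fix q assume "q \<in> {p \<in> topspace T. orientation_sign H p = s}"
    then have q: "q \<in> topspace T" "orientation_sign H q = s" by simp_all
    have Hq: "H q \<in> topspace T" using Hc q(1) by (auto simp: continuous_map_def)
    obtain c where c: "c \<in> A" "q \<in> dom_c c" using ex_chart[OF q(1)] by (elim exE conjE)
    obtain d where d: "d \<in> A" "H q \<in> dom_c d" using ex_chart[OF Hq] by (elim exE conjE)
    let ?r = "sgn (jac_det H c d q)"
    let ?N1 = "{p \<in> dom_c c. ori c p = ori c q}"
    let ?N2 = "{p \<in> dom_c c. H p \<in> dom_c d \<and> 0 < ?r * jac_det H c d p}"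
    let ?N3 = "{p \<in> topspace T. H p \<in> {p \<in> dom_c d. ori d p = ori d (H q)}}"
    have nz: "jac_det H c d q \<noteq> 0" by (rule jac_det_isometric[OF H c(1) d(1) c(2) d(2)])
    have o: "openin T (?N1 \<inter> ?N2 \<inter> ?N3)"
      by (intro openin_Int ori_open[OF c(1)] jac_det_open[OF Hs c(1) d(1)] openin_continuous_map_preimage[OF Hc ori_open[OF d(1)]])
    have "0 < ?r * jac_det H c d q" using nz by (simp add: sgn_if)
    then have qN: "q \<in> ?N1 \<inter> ?N2 \<inter> ?N3" using c d q(1) by simp
    have sub: "?N1 \<inter> ?N2 \<inter> ?N3 \<subseteq> {p \<in> topspace T. orientation_sign H p = s}"
    proof
      fix p assume "p \<in> ?N1 \<inter> ?N2 \<inter> ?N3"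
      then have p: "p \<in> dom_c c" "ori c p = ori c q" "H p \<in> dom_c d" "0 < ?r * jac_det H c d p" "p \<in> topspace T" "ori d (H p) = ori d (H q)" by simp_all
      have "sgn (jac_det H c d p) = ?r" using p(4) nz by (auto simp: sgn_if split: if_splits)
      then have "orientation_sign H p = orientation_sign H q" unfolding orientation_sign_eq[OF Hs c(1) p(1) d(1) p(3)] orientation_sign_eq[OF Hs c d] p(2,6) by simp
      then show "p \<in> {p \<in> topspace T. orientation_sign H p = s}" using q(2) p(5) by simp
    qed
    show "\<exists>S. openin T S \<and> q \<in> S \<and> S \<subseteq> {p \<in> topspace T. orientation_sign H p = s}" by (intro exI[of _ "?N1 \<inter> ?N2 \<inter> ?N3"] conjI o qN sub)
  qed
qed

text \<open>In oriented charts the map factors locally as a change to charts of \<open>A\<close>,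
  the representative of \<open>H\<close> there, and a change back. The outer Jacobian signs are the
  values of \<open>ori\<close> at source and target.\<close>

lemma jacobian_sign:
  assumes H: "isometric H" and c: "c \<in> B" "p \<in> dom_c c" and d: "d \<in> B" "H p \<in> dom_c d"
  shows "sgn (det (jacobian (map_c d \<circ> H \<circ> inv_c c) (at (map_c c p)))) = orientation_sign H p" and "orientation_sign H p \<noteq> 0"
proof -
  note Hs = isometric_smooth[OF H]
  have cAB: "c \<in> A \<union> B" "d \<in> A \<union> B" using c d by simp_all
  obtain a where a: "a \<in> A" "p \<in> dom_c a" using ex_chart[OF AB.dom_sub[OF cAB(1) c(2)]] by (elim exE conjE)
  obtain b where b: "b \<in> A" "H p \<in> dom_c b" using ex_chart[OF AB.dom_sub[OF cAB(2) d(2)]] by (elim exE conjE)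
  have abAB: "a \<in> A \<union> B" "b \<in> A \<union> B" using a b by simp_all
  have i: "id p \<in> dom_c a" "id (H p) \<in> dom_c d" using a d by simp_all
  let ?x = "map_c c p"
  have x1: "tr c a ?x = map_c a p" using AB.rep_map[OF cAB(1) c(2), of id a] by simp
  have x2: "rep H a b (map_c a p) = map_c b (H p)" by (rule rep_map[OF a])
  note d1 = AB.rep_derivative(1)[OF AB.smooth_map_id cAB(1) abAB(1) c(2) i(1)]
  note d2 = rep_derivative(1)[OF Hs a(1) b(1) a(2) b(2), folded x1]
  note d3 = AB.rep_derivative(1)[OF AB.smooth_map_id abAB(2) cAB(2) b(2) i(2), folded x2, folded x1]
  have comp: "((\<lambda>y. tr b d (rep H a b (tr c a y))) has_derivative
      (\<lambda>v. Dbl (tr b d) (map_c b (H p)) (Dbl (rep H a b) (map_c a p) (Dbl (tr c a) ?x v)))) (at ?x)"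
    using has_derivative_compose[OF has_derivative_compose[OF d1 d2] d3] by (simp only: x1 x2)
  have op: "open {y \<in> img_c c. inv_c c y \<in> dom_c a \<and> H (inv_c c y) \<in> dom_c b}"
  proof -
    have "openin T {q \<in> dom_c c. q \<in> dom_c a \<and> H q \<in> dom_c b}"
    proof -
      have "{q \<in> dom_c c. q \<in> dom_c a \<and> H q \<in> dom_c b} = dom_c c \<inter> dom_c a \<inter> {q \<in> topspace T. H q \<in> dom_c b}"
        using AB.dom_sub[OF cAB(1)] by blast
      then show ?thesis
        using openin_Int[OF openin_Int[OF AB.open_dom[OF cAB(1)] open_dom[OF a(1)]]
            openin_continuous_map_preimage[OF smooth_map_continuous[OF Hs] open_dom[OF b(1)]]] by simp
    qed
    then have "open (map_c c ` {q \<in> dom_c c. q \<in> dom_c a \<and> H q \<in> dom_c b})"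
      by (rule AB.map_open[OF cAB(1)]) blast
    moreover have "map_c c ` {q \<in> dom_c c. q \<in> dom_c a \<and> H q \<in> dom_c b} = {y \<in> img_c c. inv_c c y \<in> dom_c a \<and> H (inv_c c y) \<in> dom_c b}"
      using AB.inv_map[OF cAB(1)] by (force simp: image_iff)
    ultimately show ?thesis by simp
  qed
  have xin: "?x \<in> {y \<in> img_c c. inv_c c y \<in> dom_c a \<and> H (inv_c c y) \<in> dom_c b}"
    using AB.inv_map[OF cAB(1) c(2)] c(2) a(2) b(2) by simp
  have "((map_c d \<circ> H \<circ> inv_c c) has_derivative
      (\<lambda>v. Dbl (tr b d) (map_c b (H p)) (Dbl (rep H a b) (map_c a p) (Dbl (tr c a) ?x v)))) (at ?x)"
  proof (rule has_derivative_transform_within_open[OF comp op xin])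
    fix y assume y: "y \<in> {y \<in> img_c c. inv_c c y \<in> dom_c a \<and> H (inv_c c y) \<in> dom_c b}"
    have "tr c a y = map_c a (inv_c c y)" by (simp add: rep_def)
    then show "tr b d (rep H a b (tr c a y)) = (map_c d \<circ> H \<circ> inv_c c) y"
      using y rep_map[OF a(1), of "inv_c c y" H b] AB.rep_map[OF abAB(2), of "H (inv_c c y)" id d] by simp
  qed
  then have "jacobian (map_c d \<circ> H \<circ> inv_c c) (at ?x) =
      matrix (\<lambda>v. Dbl (tr b d) (map_c b (H p)) (Dbl (rep H a b) (map_c a p) (Dbl (tr c a) ?x v)))"
    unfolding jacobian_def by (simp only: frechet_derivative_at[symmetric])
  also have "(\<lambda>v. Dbl (tr b d) (map_c b (H p)) (Dbl (rep H a b) (map_c a p) (Dbl (tr c a) ?x v))) =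
      blinfun_apply (Dbl (tr b d) (map_c b (H p)) o\<^sub>L (Dbl (rep H a b) (map_c a p) o\<^sub>L Dbl (tr c a) ?x))"
    by (intro ext) simp
  finally have "det (jacobian (map_c d \<circ> H \<circ> inv_c c) (at ?x)) =
      det (matrix (blinfun_apply (Dbl (tr b d) (map_c b (H p)) o\<^sub>L (Dbl (rep H a b) (map_c a p) o\<^sub>L Dbl (tr c a) ?x))))"
    by (simp only:)
  also have "\<dots> = jac_det id b d (H p) * (jac_det H a b p * jac_det id c a p)"
    unfolding jac_det_def
    by (subst det_matrix_comp[OF blinfun_apply_blinfun_compose], subst det_matrix_comp[OF blinfun_apply_blinfun_compose]) (rule refl)
  finally have "sgn (det (jacobian (map_c d \<circ> H \<circ> inv_c c) (at ?x))) = sgn (jac_det id b d (H p)) * sgn (jac_det H a b p) * sgn (jac_det id c a p)"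
    by (simp add: sgn_mult)
  also have "sgn (jac_det id b d (H p)) = ori b (H p)" by (rule ori_eq[OF b d, symmetric])
  also have "sgn (jac_det id c a p) = ori a p"
    unfolding ori_eq[OF a c] using AB.sgn_jac_det_id[OF abAB(1) cAB(1) a(2) c(2)] by simp
  finally show "sgn (det (jacobian (map_c d \<circ> H \<circ> inv_c c) (at ?x))) = orientation_sign H p"
    unfolding orientation_sign_eq[OF Hs a b] by (simp only: mult_ac)
  show "orientation_sign H p \<noteq> 0" unfolding orientation_sign_eq[OF Hs a b]
    using ori_sign[OF a] ori_sign[OF b] jac_det_isometric[OF H a(1) b(1) a(2) b(2)] by (auto simp: sgn_if)
qed

end

section \<open>Holonomy and orientation: assembling the proof\<close>

lemma prod_cyclic:
  fixes e :: "nat \<Rightarrow> real"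
  assumes "0 < m"
  shows "(\<Prod>i<m. e (Suc i mod m)) = (\<Prod>i<m. e i)"
proof -
  obtain n where n: "m = Suc n" using assms gr0_conv_Suc by blast
  have "(\<Prod>i<m. e (Suc i mod m)) = (\<Prod>i<n. e (Suc i)) * e 0" by (simp add: n)
  also have "\<dots> = (\<Prod>i<m. e i)" unfolding n prod.lessThan_Suc_shift by (simp add: mult.commute)
  finally show ?thesis .
qed

lemma (in riemannian) finite_good_cover:
  assumes "compact_space T"
  shows "\<exists>J. finite J \<and> (\<forall>j\<in>J. good j) \<and> (\<forall>p\<in>topspace T. \<exists>j\<in>J. p \<in> half j)"
proof -
  let ?U = "half ` {j. good j}"
  have "\<exists>\<F>. finite \<F> \<and> \<F> \<subseteq> ?U \<and> topspace T \<subseteq> \<Union>\<F>"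
  proof (rule assms[unfolded compact_space_alt, rule_format], rule conjI)
    show "\<forall>U\<in>?U. openin T U" using open_half(1) by blast
    show "topspace T \<subseteq> \<Union>?U" using good_exists by blast
  qed
  then obtain \<F> where F: "finite \<F>" "\<F> \<subseteq> ?U" "topspace T \<subseteq> \<Union>\<F>" by blast
  obtain J where J: "J \<subseteq> {j. good j}" "finite J" "\<F> = half ` J" using finite_subset_image[OF F(1,2)] by blast
  show ?thesis
  proof (intro exI[of _ J] conjI ballI)
    show "finite J" by fact
    show "good j" if "j \<in> J" for j using subsetD[OF J(1) that] by simp
    show "\<exists>j\<in>J. p \<in> half j" if "p \<in> topspace T" for p using subsetD[OF F(3) that] unfolding J(3) by blast
  qed
qed

context oriented_cover
begin

text \<open>Each gluing differential contributes the orientation signs of two neighbouring charts,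
  which do not change along segments. Around the loop every such sign occurs twice and cancels;
  inner joints use the identity, so only the sign of \<open>F\<close> remains.\<close>

lemma holonomy_sign:
  fixes x x' :: "nat \<Rightarrow> real \<Rightarrow> real^'n"
  assumes loop: "geodesic_loop m (\<lambda>i. img_c (ch (k i))) (\<lambda>i. mcb (k i)) (\<lambda>i. dom2 (Hm m i) (ch (k (Suc i mod m))) (ch (k i)))
      (\<lambda>i. rep (Hm m i) (ch (k (Suc i mod m))) (ch (k i))) x x' C"
    and kp: "\<And>i. i < m \<Longrightarrow> k i \<in> J" "\<And>i. i < m \<Longrightarrow> p i \<in> dom_c (ch (k i))" "\<And>i. i < m \<Longrightarrow> nxt m p i \<in> dom_c (ch (k i))"
      "\<And>i. i < m \<Longrightarrow> x i 0 = map_c (ch (k i)) (p i)" "\<And>i. i < m \<Longrightarrow> x i 1 = map_c (ch (k i)) (nxt m p i)"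
  shows "(\<Prod>i<m. sgn (det (matrix (Dbl (rep (Hm m i) (ch (k (Suc i mod m))) (ch (k i))) (x (Suc i mod m) 0))))) = orientation_sign F (p 0)"
proof -
  interpret Lo: geodesic_loop m "\<lambda>i. img_c (ch (k i))" "\<lambda>i. mcb (k i)" "\<lambda>i. dom2 (Hm m i) (ch (k (Suc i mod m))) (ch (k i))"
      "\<lambda>i. rep (Hm m i) (ch (k (Suc i mod m))) (ch (k i))" x x' C by (rule loop)
  note cA = goodD(1)[OF goodJ[OF kp(1)]]
  define e where "e i = ori (ch (k i)) (p i)" for i
  define s where "s i = (if Suc i < m then 1 else orientation_sign F (p 0))" for i
  have e1: "e i * e i = 1" if "i < m" for i unfolding e_def by (rule ori_sign[OF cA[OF that] kp(2)[OF that]])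
  have step: "sgn (det (matrix (Dbl (rep (Hm m i) (ch (k (Lo.sc i))) (ch (k i))) (x (Lo.sc i) 0)))) = s i * (e (Lo.sc i) * e i)" if i: "i < m" for i
  proof -
    note sc = Lo.sc_less[of i]
    note c = geodesic_inv_continuous[OF cA[OF i] Lo.geod[OF i]]
    have "ori (ch (k i)) (inv_c (ch (k i)) (x i 0)) = ori (ch (k i)) (inv_c (ch (k i)) (x i 1))"
      by (rule ori_curve[OF c(1) cA[OF i] c(2)])
    then have en: "ori (ch (k i)) (nxt m p i) = e i"
      unfolding kp(4,5)[OF i] inv_map[OF cA[OF i] kp(2)[OF i]] inv_map[OF cA[OF i] kp(3)[OF i]] e_def by (rule sym)
    have h: "Hm m i (p (Lo.sc i)) \<in> dom_c (ch (k i))" using kp(3)[OF i] unfolding nxt_def .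
    have "sgn (jac_det (Hm m i) (ch (k (Lo.sc i))) (ch (k i)) (p (Lo.sc i))) =
        orientation_sign (Hm m i) (p (Lo.sc i)) * ori (ch (k (Lo.sc i))) (p (Lo.sc i)) * ori (ch (k i)) (Hm m i (p (Lo.sc i)))"
      by (rule sgn_jac_det_eq[OF isometric_smooth[OF Hm_isometric] cA[OF sc] kp(2)[OF sc] cA[OF i] h])
    also have "ori (ch (k i)) (Hm m i (p (Lo.sc i))) = e i" using en unfolding nxt_def .
    also have "orientation_sign (Hm m i) (p (Lo.sc i)) = s i"
    proof (cases "Suc i < m")
      case True
      then show ?thesis unfolding s_def Hm_def using orientation_sign_id[OF dom_sub[OF cA[OF sc] kp(2)[OF sc]]] by simp
    next
      case False
      then have "Suc i = m" using i by simp
      then show ?thesis by (simp add: s_def Hm_def)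
    qed
    finally show ?thesis unfolding jac_det_def kp(4)[OF sc] e_def by (simp add: mult_ac)
  qed
  have "(\<Prod>i<m. sgn (det (matrix (Dbl (rep (Hm m i) (ch (k (Lo.sc i))) (ch (k i))) (x (Lo.sc i) 0))))) = (\<Prod>i<m. s i * (e (Lo.sc i) * e i))"
    by (rule prod.cong[OF refl]) (rule step, simp)
  also have "\<dots> = (\<Prod>i<m. s i) * ((\<Prod>i<m. e (Lo.sc i)) * (\<Prod>i<m. e i))" by (simp only: prod.distrib)
  also have "(\<Prod>i<m. e (Lo.sc i)) * (\<Prod>i<m. e i) = (\<Prod>i<m. e i * e i)" unfolding prod_cyclic[OF Lo.m] by (simp only: prod.distrib)
  also have "\<dots> = 1" by (rule prod.neutral) (simp add: e1)
  also have "(\<Prod>i<m. s i) = orientation_sign F (p 0)"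
  proof -
    obtain n where n: "m = Suc n" using Lo.m gr0_conv_Suc by blast
    have "(\<Prod>i<n. s i) = 1" by (rule prod.neutral) (simp add: s_def n)
    then show ?thesis by (simp add: n s_def)
  qed
  finally show ?thesis by simp
qed

text \<open>With the other sign, the holonomy of a minimal loop would satisfy the hypothesis of
  \<open>parallel_field\<close>, and the resulting normal field would contradict the curvature
  assumption.\<close>

lemma orientation_sign_weighted:
  assumes nofix: "\<forall>p\<in>topspace T. F p \<noteq> p"
    and pos: "smooth_vector_field T A X \<and> sec_X_positive T A g X \<or> smooth_fun A f \<and> sec_bar_positive T A g f"
    and q: "q \<in> topspace T"
  shows "orientation_sign F q = - ((-1) ^ CARD('n))"
proof (rule ccontr)
  assume neq: "orientation_sign F q \<noteq> - ((-1) ^ CARD('n))"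
  have ne: "topspace T \<noteq> {}" using q by blast
  obtain m k p x x' where loop: "geodesic_loop m (\<lambda>i. img_c (ch (k i))) (\<lambda>i. mcb (k i)) (\<lambda>i. dom2 (Hm m i) (ch (k (Suc i mod m))) (ch (k i)))
      (\<lambda>i. rep (Hm m i) (ch (k (Suc i mod m))) (ch (k i))) x x' (\<lambda>i. ball (ce (k i)) (6 * ra (k i)))"
    and kp: "\<forall>i<m. k i \<in> J \<and> p i \<in> dom_c (ch (k i)) \<and> nxt m p i \<in> dom_c (ch (k i)) \<and> x i 0 = map_c (ch (k i)) (p i) \<and> x i 1 = map_c (ch (k i)) (nxt m p i)"
    and nz: "x' 0 0 \<noteq> 0"
    using loop_exists[OF nofix ne] by (elim exE conjE)
  have kp: "\<And>i. i < m \<Longrightarrow> k i \<in> J" "\<And>i. i < m \<Longrightarrow> p i \<in> dom_c (ch (k i))" "\<And>i. i < m \<Longrightarrow> nxt m p i \<in> dom_c (ch (k i))"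
      "\<And>i. i < m \<Longrightarrow> x i 0 = map_c (ch (k i)) (p i)" "\<And>i. i < m \<Longrightarrow> x i 1 = map_c (ch (k i)) (nxt m p i)"
    using kp by blast+
  interpret Lo: geodesic_loop m "\<lambda>i. img_c (ch (k i))" "\<lambda>i. mcb (k i)" "\<lambda>i. dom2 (Hm m i) (ch (k (Suc i mod m))) (ch (k i))"
      "\<lambda>i. rep (Hm m i) (ch (k (Suc i mod m))) (ch (k i))" x x' "\<lambda>i. ball (ce (k i)) (6 * ra (k i))" by (rule loop)
  have p0: "p 0 \<in> topspace T" by (rule dom_sub[OF goodD(1)[OF goodJ[OF kp(1)[OF Lo.m]]] kp(2)[OF Lo.m]])
  have "(\<Prod>i<m. sgn (det (matrix (Dbl (rep (Hm m i) (ch (k (Lo.sc i))) (ch (k i))) (x (Lo.sc i) 0))))) = orientation_sign F (p 0)"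
    by (rule holonomy_sign[OF loop kp])
  also have "\<dots> = orientation_sign F q" by (rule orientation_sign_constant[OF F p0 q])
  finally have sgn: "(\<Prod>i<m. sgn (det (Lo.Theta i))) \<noteq> - ((-1) ^ CARD('n))" using neq by (simp only: Lo.Theta_def not_False_eq_True)
  note pf = Lo.parallel_field[OF nz sgn]
  obtain P where P: "\<forall>i<m. \<forall>t\<in>{0..1}. (P i has_vector_derivative - chr (mcb (k i)) (x i t) (x' i t) (P i t)) (at t within {0..1})"
      "\<forall>i<m. \<forall>t\<in>{0..1}. gb (mcb (k i)) (x i t) (P i t) (P i t) = 1 \<and> gb (mcb (k i)) (x i t) (P i t) (x' i t) = 0"
      "\<forall>i<m. P i 1 = Dbl (rep (Hm m i) (ch (k (Lo.sc i))) (ch (k i))) (x (Lo.sc i) 0) (P (Lo.sc i) 0)"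
    using pf(1) by (elim exE conjE)
  have L: "0 < gb (mcb (k 0)) (x 0 0) (x' 0 0) (x' 0 0)"
    by (rule lmetric.pos[OF Lo.met[OF Lo.m] _ nz]) (use Lo.C_sub[OF Lo.m] Lo.x_in[OF Lo.m, of 0] in auto)
  show False
  proof (rule weighted_loop_contradiction[OF pos loop, where p = p and P = P])
    show "\<And>i. i < m \<Longrightarrow> k i \<in> J" "\<And>i. i < m \<Longrightarrow> p i \<in> dom_c (ch (k i))" "\<And>i. i < m \<Longrightarrow> nxt m p i \<in> dom_c (ch (k i))"
      "\<And>i. i < m \<Longrightarrow> x i 0 = map_c (ch (k i)) (p i)" "\<And>i. i < m \<Longrightarrow> x i 1 = map_c (ch (k i)) (nxt m p i)" by (fact kp)+
    show "\<And>i t. i < m \<Longrightarrow> t \<in> {0..1} \<Longrightarrow> gb (mcb (k i)) (x i t) (x' i t) (x' i t) = gb (mcb (k 0)) (x 0 0) (x' 0 0) (x' 0 0)" by (rule pf(2))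
    show "0 < gb (mcb (k 0)) (x 0 0) (x' 0 0) (x' 0 0)" by (rule L)
  qed (use P in blast)+
qed

end

theorem theorem5p1:
  fixes T :: "'a topology"
    and A :: "('a, 'n::finite) chart set"
    and g :: "('a, 'n) metric"
    and X :: "'a \<Rightarrow> ('a, 'n) tvec"
    and F :: "'a \<Rightarrow> 'a"
  assumes "closed_manifold T A"
    and "orientable T A"
    and "riemannian_metric T A g"
    and "smooth_vector_field T A X"
    and "positive_weighted_sec T A g X"
    and "riem_isometry T A g F"
    and "\<forall>p\<in>topspace T. F p \<noteq> p"
  shows "(even CARD('n) \<longrightarrow> reverses_orientation T A F) \<and>
         (odd CARD('n) \<longrightarrow> preserves_orientation T A F)"
proof -
  have mf: "connected_space T" "Hausdorff_space T" "compact_space T" "smooth_atlas T A"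
    using assms(1) unfolding closed_manifold_def smooth_manifold_def by blast+
  interpret riemannian T A g using mf(4) assms(3) by unfold_locales
  obtain J where J: "finite J" "\<forall>j\<in>J. good j" "\<forall>p\<in>topspace T. \<exists>j\<in>J. p \<in> half j"
    using finite_good_cover[OF mf(3)] by (elim exE conjE)
  have iso: "isometric F" by (rule isometric_riem_isometry[OF assms(6)])
  have cov: "covered T A g J F"
    by (intro covered.intro riemannian_axioms covered_axioms.intro mf iso J(1) bspec[OF J(2)] bspec[OF J(3)])
  obtain f where pos: "smooth_vector_field T A X \<and> sec_X_positive T A g X \<or> smooth_fun A f \<and> sec_bar_positive T A g f"
    using assms(4,5) unfolding positive_weighted_sec_def by blast
  have sign: "sgn (det (jacobian (map_c d \<circ> F \<circ> inv_c c) (at (map_c c p)))) = - ((-1) ^ CARD('n))"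
    if B: "oriented_atlas T A B" and c: "c \<in> B" "p \<in> dom_c c" and d: "d \<in> B" "F p \<in> dom_c d" for B c d p
  proof -
    interpret oriented_cover T A g J F B
      by (intro oriented_cover.intro cov oriented_cover_axioms.intro B)
    have p: "p \<in> topspace T" by (rule AB.dom_sub[OF UnI2[OF c(1)] c(2)])
    show ?thesis unfolding jacobian_sign(1)[OF iso c d]
      by (rule orientation_sign_weighted[OF assms(7) pos p])
  qed
  show ?thesis
  proof (intro conjI impI)
    assume "even CARD('n)"
    then have "det (jacobian (map_c d \<circ> F \<circ> inv_c c) (at (map_c c p))) < 0"
      if "oriented_atlas T A B" "c \<in> B" "p \<in> dom_c c" "d \<in> B" "F p \<in> dom_c d" for B c d p
      using sign[OF that] by (simp add: sgn_if split: if_splits)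
    then show "reverses_orientation T A F"
      unfolding reverses_orientation_def by blast
  next
    assume "odd CARD('n)"
    then have "det (jacobian (map_c d \<circ> F \<circ> inv_c c) (at (map_c c p))) > 0"
      if "oriented_atlas T A B" "c \<in> B" "p \<in> dom_c c" "d \<in> B" "F p \<in> dom_c d" for B c d p
      using sign[OF that] by (simp add: sgn_if split: if_splits)
    then show "preserves_orientation T A F"
      unfolding preserves_orientation_def by blast
  qed
qed

end
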